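(* In the word RAM model, there exists a data structure using $O(n)$ words of space that maintains a set $S$ of $n$ one-dimensional intervals and answers stabbing-sum queries (given a point $q$, report the number of intervals in $S$ that contain $q$) in $O(\log n/\log\log n)$ time. Insertions and deletions are supported in $O(\log n)$ and $O(\log n/\log\log n)$ amortized time respectively.
   Context: Model: word RAM with words of $\Theta(\log n)$ bits. *)

theory Defs
  imports Complex_Main "HOL-Library.Landau_Symbols"
begin

section \<open>Word RAM\<close>

text \<open>
  Registers and memory cells hold \<open>w\<close>-bit words, represented as natural numbers below \<open>2 ^ w\<close>.
  The word length is a parameter of the semantics and not of the programs: one finite program
  (hence finitely many registers and literals) serves all word lengths. Cells are addressed by
  words, so only the cells \<open>0, \<dots>, 2 ^ w - 1\<close> can be reached. Each instruction costs one unit.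
\<close>

datatype binop = Add | Sub | Mul | Div | Mod | And | Or | Xor | Shl | Shr

datatype instr =
    Const nat nat              \<comment> \<open>\<open>Const r k\<close>: register \<open>r\<close> := \<open>k\<close> (reduced to a word)\<close>
  | Op binop nat nat nat       \<comment> \<open>\<open>Op f r x y\<close>: register \<open>r\<close> := \<open>f\<close> (register \<open>x\<close>) (register \<open>y\<close>)\<close>
  | Load nat nat               \<comment> \<open>\<open>Load r x\<close>: register \<open>r\<close> := cell addressed by register \<open>x\<close>\<close>
  | Store nat nat              \<comment> \<open>\<open>Store x r\<close>: cell addressed by register \<open>x\<close> := register \<open>r\<close>\<close>
  | JumpLess nat nat nat       \<comment> \<open>\<open>JumpLess x y l\<close>: go to \<open>l\<close> if register \<open>x\<close> < register \<open>y\<close>\<close>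
  | JumpEq nat nat nat

type_synonym memory = "nat \<Rightarrow> nat"

record config =
  pc :: nat
  regs :: "nat \<Rightarrow> nat"
  mem :: memory

fun binop_val :: "nat \<Rightarrow> binop \<Rightarrow> nat \<Rightarrow> nat \<Rightarrow> nat" where
  "binop_val w Add x y = (x + y) mod 2 ^ w"
| "binop_val w Sub x y = (x + (2 ^ w - y)) mod 2 ^ w"
| "binop_val w Mul x y = (x * y) mod 2 ^ w"
| "binop_val w Div x y = x div y"
| "binop_val w Mod x y = x mod y"
| "binop_val w And x y = and x y"
| "binop_val w Or x y = or x y"
| "binop_val w Xor x y = xor x y"
| "binop_val w Shl x y = push_bit y x mod 2 ^ w"
| "binop_val w Shr x y = drop_bit y x"

fun exec_instr :: "nat \<Rightarrow> instr \<Rightarrow> config \<Rightarrow> config" where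
  "exec_instr w (Const r k) s =
     s\<lparr>pc := Suc (pc s), regs := (regs s)(r := k mod 2 ^ w)\<rparr>"
| "exec_instr w (Op f r x y) s =
     s\<lparr>pc := Suc (pc s), regs := (regs s)(r := binop_val w f (regs s x) (regs s y))\<rparr>"
| "exec_instr w (Load r x) s =
     s\<lparr>pc := Suc (pc s), regs := (regs s)(r := mem s (regs s x))\<rparr>"
| "exec_instr w (Store x r) s =
     s\<lparr>pc := Suc (pc s), mem := (mem s)(regs s x := regs s r)\<rparr>"
| "exec_instr w (JumpLess x y l) s =
     s\<lparr>pc := (if regs s x < regs s y then l else Suc (pc s))\<rparr>"
| "exec_instr w (JumpEq x y l) s =
     s\<lparr>pc := (if regs s x = regs s y then l else Suc (pc s))\<rparr>"

definition halted :: "instr list \<Rightarrow> config \<Rightarrow> bool" where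
  "halted P s \<longleftrightarrow> length P \<le> pc s"

definition step :: "nat \<Rightarrow> instr list \<Rightarrow> config \<Rightarrow> config" where
  "step w P s = (if halted P s then s else exec_instr w (P ! pc s) s)"

text \<open>
  A call receives its arguments in registers 0 and 1 and returns its result in register 0.
  Only the memory survives from one call to the next.
\<close>

definition start :: "nat \<times> nat \<Rightarrow> memory \<Rightarrow> config" where
  "start args M = \<lparr>pc = 0, regs = (\<lambda>_. 0)(0 := fst args, 1 := snd args), mem = M\<rparr>"

definition config_at :: "nat \<Rightarrow> instr list \<Rightarrow> nat \<times> nat \<Rightarrow> memory \<Rightarrow> nat \<Rightarrow> config" where
  "config_at w P args M t = (step w P ^^ t) (start args M)"

definition halts :: "nat \<Rightarrow> instr list \<Rightarrow> nat \<times> nat \<Rightarrow> memory \<Rightarrow> bool" where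
  "halts w P args M \<longleftrightarrow> (\<exists>t. halted P (config_at w P args M t))"

definition run_time :: "nat \<Rightarrow> instr list \<Rightarrow> nat \<times> nat \<Rightarrow> memory \<Rightarrow> nat" where
  "run_time w P args M = (LEAST t. halted P (config_at w P args M t))"

definition final :: "nat \<Rightarrow> instr list \<Rightarrow> nat \<times> nat \<Rightarrow> memory \<Rightarrow> config" where
  "final w P args M = config_at w P args M (run_time w P args M)"


section \<open>Dynamic interval sets\<close>

text \<open>The pair \<open>(l, r)\<close> stands for the closed interval \<open>[l, r]\<close>, whose endpoints are words.\<close>

datatype operation = Insert nat nat | Delete nat nat | Query nat

type_synonym intervals = "(nat \<times> nat) set"

definition stabbing_sum :: "intervals \<Rightarrow> nat \<Rightarrow> nat" where
  "stabbing_sum S q = card {(l, r) \<in> S. l \<le> q \<and> q \<le> r}"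

fun apply_op :: "operation \<Rightarrow> intervals \<Rightarrow> intervals" where
  "apply_op (Insert l r) S = insert (l, r) S"
| "apply_op (Delete l r) S = S - {(l, r)}"
| "apply_op (Query q) S = S"

fun legal :: "nat \<Rightarrow> intervals \<Rightarrow> operation \<Rightarrow> bool" where
  "legal w S (Insert l r) \<longleftrightarrow> l \<le> r \<and> r < 2 ^ w \<and> (l, r) \<notin> S"
| "legal w S (Delete l r) \<longleftrightarrow> (l, r) \<in> S"
| "legal w S (Query q) \<longleftrightarrow> q < 2 ^ w"

text \<open>A history is a list of operations, performed on an initially empty set.\<close>

definition set_before :: "operation list \<Rightarrow> nat \<Rightarrow> intervals" where
  "set_before ops i = fold apply_op (take i ops) {}"

definition size_before :: "operation list \<Rightarrow> nat \<Rightarrow> nat" where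
  "size_before ops i = card (set_before ops i)"

definition legal_history :: "nat \<Rightarrow> operation list \<Rightarrow> bool" where
  "legal_history w ops \<longleftrightarrow> (\<forall>i < length ops. legal w (set_before ops i) (ops ! i))"


section \<open>Data structures on the word RAM\<close>

record data_structure =
  insert_prog :: "instr list"
  delete_prog :: "instr list"
  query_prog :: "instr list"

fun op_prog :: "data_structure \<Rightarrow> operation \<Rightarrow> instr list" where
  "op_prog D (Insert l r) = insert_prog D"
| "op_prog D (Delete l r) = delete_prog D"
| "op_prog D (Query q) = query_prog D"

fun op_args :: "operation \<Rightarrow> nat \<times> nat" where
  "op_args (Insert l r) = (l, r)"
| "op_args (Delete l r) = (l, r)"
| "op_args (Query q) = (q, 0)"

definition op_final :: "nat \<Rightarrow> data_structure \<Rightarrow> operation \<Rightarrow> memory \<Rightarrow> config" where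
  "op_final w D p M = final w (op_prog D p) (op_args p) M"

definition memory_before :: "nat \<Rightarrow> data_structure \<Rightarrow> operation list \<Rightarrow> nat \<Rightarrow> memory" where
  "memory_before w D ops i = fold (\<lambda>p M. mem (op_final w D p M)) (take i ops) (\<lambda>_. 0)"

definition op_halts :: "nat \<Rightarrow> data_structure \<Rightarrow> operation list \<Rightarrow> nat \<Rightarrow> bool" where
  "op_halts w D ops i \<longleftrightarrow>
     halts w (op_prog D (ops ! i)) (op_args (ops ! i)) (memory_before w D ops i)"

definition op_time :: "nat \<Rightarrow> data_structure \<Rightarrow> operation list \<Rightarrow> nat \<Rightarrow> nat" where
  "op_time w D ops i =
     run_time w (op_prog D (ops ! i)) (op_args (ops ! i)) (memory_before w D ops i)"

definition op_result :: "nat \<Rightarrow> data_structure \<Rightarrow> operation list \<Rightarrow> nat \<Rightarrow> nat" where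
  "op_result w D ops i = regs (op_final w D (ops ! i) (memory_before w D ops i)) 0"

text \<open>
  Space is measured by the largest address in use, at any moment of an operation. A cell outside
  the occupied prefix holds its initial value 0, so it carries no information; memory that is
  given back when the set shrinks has to be cleared.
\<close>

definition op_space_le :: "nat \<Rightarrow> data_structure \<Rightarrow> operation list \<Rightarrow> nat \<Rightarrow> real \<Rightarrow> bool" where
  "op_space_le w D ops i s \<longleftrightarrow>
     (\<forall>t a. mem (config_at w (op_prog D (ops ! i)) (op_args (ops ! i))
                  (memory_before w D ops i) t) a \<noteq> 0 \<longrightarrow> real a < s)"

definition update_time :: "nat \<Rightarrow> data_structure \<Rightarrow> operation list \<Rightarrow> nat" where
  "update_time w D ops =
     (\<Sum>i<length ops. case ops ! i of Query q \<Rightarrow> 0 | _ \<Rightarrow> op_time w D ops i)"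

definition update_budget :: "(nat \<Rightarrow> real) \<Rightarrow> (nat \<Rightarrow> real) \<Rightarrow> operation list \<Rightarrow> real" where
  "update_budget ti td ops =
     (\<Sum>i<length ops. case ops ! i of
        Insert l r \<Rightarrow> ti (size_before ops i)
      | Delete l r \<Rightarrow> td (size_before ops i)
      | Query q \<Rightarrow> 0)"


section \<open>Words of logarithmic length\<close>

text \<open>
  \<open>w = \<Theta>(log n)\<close> with explicit constants. The lower bound has the form \<open>2 ^ b * n \<le> 2 ^ w\<close>:
  words must be able to address a memory of linearly many cells.
\<close>

definition log_word_length :: "real \<Rightarrow> real \<Rightarrow> nat \<Rightarrow> nat \<Rightarrow> bool" where
  "log_word_length b c n w \<longleftrightarrow> log 2 (real n) + b \<le> real w \<and> real w \<le> c * log 2 (real n)"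

text \<open>
  The word length is fixed while \<open>n\<close> varies, and it cannot be logarithmic in \<open>n\<close> when the set is
  (nearly) empty. Hence the first \<open>k\<close> operations insert the elements of an initial set; from then
  on the word length is logarithmic in the current number of intervals at all times.
\<close>

definition admissible :: "real \<Rightarrow> real \<Rightarrow> nat \<Rightarrow> nat \<Rightarrow> operation list \<Rightarrow> bool" where
  "admissible b c w k ops \<longleftrightarrow>
     legal_history w ops \<and> k \<le> length ops \<and>
     (\<forall>i<k. \<exists>l r. ops ! i = Insert l r) \<and>
     (\<forall>i\<in>{k..length ops}. log_word_length b c (size_before ops i) w)"

end

theory Submission
  imports Defs "HOL-Library.Multiset" "HOL-Real_Asymp.Real_Asymp"
begin

text \<open>
  The number of intervals containing \<open>q\<close> is \<open>n\<close> minus the number of left endpoints above \<open>q\<close> minus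
  the number of right endpoints below \<open>q\<close>. Both are rank queries; reversing the left endpoints
  (\<open>l\<close> becomes \<open>2 ^ w - 1 - l\<close>) and shifting the right endpoints past them makes them ranks in one set of keys.
  The keys live in a trie of branching factor \<open>B\<close>, about the square root of \<open>w\<close>, hence of height
  \<open>O(w / log w)\<close>. A node keeps \<open>B\<close> prefix counts together with two words in which
  pending corrections are packed as \<open>B\<close> small counters: an update adds a mask and folds a single
  correction, chosen cyclically, into its count, and a query unpacks one counter; both take constant time.
  A slot stores up to \<open>B\<close> keys in a sorted list before it gets a child, so that there are
  only \<open>O(n / B)\<close> nodes of \<open>O(B)\<close> words. Dead cells are removed by rebuilding when they outnumber the
  live ones, and deletions are charged to the preceding insertions.
\<close>

section \<open>A structured language compiled to the word RAM\<close>

text \<open>A query may pay \<open>H + B\<close> but not \<open>H * B\<close>, so it must not scan a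
  list on every level. Therefore each slot holds the smallest keys of its subtree, in decreasing
  order: if there is a child and the list is empty or its head is below the searched key, the stored
  length counts the whole list and the search goes down; otherwise nothing deeper is smaller, and
  only this one list is scanned. An overfull slot passes its head, its maximum, to the end of a list
  of the child, in constant time per level. Deletions leave holes that are never refilled from
  below. Since \<open>B ^ H\<close> may exceed a word, the two kinds of keys are told apart by a
  tag, which serves as the digit at the root; comparisons occur only within a slot, where the tags
  agree. Cells own the fields 0 to 2 and nodes the fields 3 to 10 of the same units, so that both
  arrays grow from the same start without colliding. A program must not depend on \<open>w\<close>:
  the first insertion computes \<open>w\<close>, \<open>B\<close>, \<open>B ^ (H - 1)\<close> and
  the masks in time linear in \<open>w\<close>.\<close>

datatype cond = Lt nat nat | Eq nat nat

text \<open>\<open>MaxW\<close> is there because programs do not know the word length: it yields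
  \<open>2 ^ w - 1\<close>. In \<open>Ld r x f\<close> and \<open>St x f r\<close> the register
  \<open>x\<close> holds a unit number and \<open>f\<close> is a fixed field of that unit.\<close>

datatype com =
    Skip
  | Imm nat nat
  | Bin binop nat nat nat
  | MaxW nat
  | Ld nat nat nat
  | St nat nat nat
  | Seq com com  (infixr ";;" 60)
  | If cond com com
  | Until cond com

type_synonym regs = "nat \<Rightarrow> nat"
type_synonym umem = "nat \<Rightarrow> nat \<Rightarrow> nat"

text \<open>Memory is seen as an array of units of 16 words; pointers are unit numbers.\<close>

definition flat :: "umem \<Rightarrow> memory" where
  "flat m a = m (a div 16) (a mod 16)"

fun bval :: "cond \<Rightarrow> regs \<Rightarrow> bool" where
  "bval (Lt x y) R \<longleftrightarrow> R x < R y"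
| "bval (Eq x y) R \<longleftrightarrow> R x = R y"

fun jump :: "cond \<Rightarrow> nat \<Rightarrow> instr" where
  "jump (Lt x y) l = JumpLess x y l"
| "jump (Eq x y) l = JumpEq x y l"

text \<open>Registers 2 and 3 are scratch registers of the compiler.\<close>

fun len :: "com \<Rightarrow> nat" where
  "len Skip = 0"
| "len (Imm r k) = 1"
| "len (Bin f r x y) = 1"
| "len (MaxW r) = 3"
| "len (Ld r x f) = 5"
| "len (St x f r) = 5"
| "len (c1 ;; c2) = len c1 + len c2"
| "len (If b c1 c2) = 2 + len c1 + len c2"
| "len (Until b c) = 2 + len c"

text \<open>The argument \<open>p\<close> is the absolute address of the block, as jump targets are
  absolute. \<open>JumpEq 0 0\<close> is the unconditional jump. The true branch of
  \<open>If\<close> is laid out last, so only the false branch pays for a second jump.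
  \<open>MaxW\<close> relies on the wrap-around of 0 - 1.\<close>

fun comp :: "nat \<Rightarrow> com \<Rightarrow> instr list" where
  "comp p Skip = []"
| "comp p (Imm r k) = [Const r k]"
| "comp p (Bin f r x y) = [Op f r x y]"
| "comp p (MaxW r) = [Const 2 0, Const 3 1, Op Sub r 2 3]"
| "comp p (Ld r x f) = [Const 2 16, Op Mul 2 2 x, Const 3 f, Op Add 2 2 3, Load r 2]"
| "comp p (St x f r) = [Const 2 16, Op Mul 2 2 x, Const 3 f, Op Add 2 2 3, Store 2 r]"
| "comp p (c1 ;; c2) = comp p c1 @ comp (p + len c1) c2"
| "comp p (If b c1 c2) = jump b (p + 2 + len c2) # comp (p + 1) c2 @
     [JumpEq 0 0 (p + 2 + len c2 + len c1)] @ comp (p + 2 + len c2) c1"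
| "comp p (Until b c) = jump b (p + 2 + len c) # comp (p + 1) c @ [JumpEq 0 0 p]"

lemma length_comp [simp]: "length (comp p c) = len c"
  by (induction c arbitrary: p) auto

abbreviation usable :: "nat \<Rightarrow> bool" where
  "usable r \<equiv> r \<noteq> 2 \<and> r \<noteq> 3"

fun wfcond :: "cond \<Rightarrow> bool" where
  "wfcond (Lt x y) \<longleftrightarrow> usable x \<and> usable y"
| "wfcond (Eq x y) \<longleftrightarrow> usable x \<and> usable y"

text \<open>The bit operations are excluded because \<open>exact\<close> gives them a dummy
  value.\<close>

fun wf :: "com \<Rightarrow> bool" where
  "wf Skip \<longleftrightarrow> True"
| "wf (Imm r k) \<longleftrightarrow> usable r"
| "wf (Bin f r x y) \<longleftrightarrow> usable r \<and> usable x \<and> usable y \<and> f \<in> {Add, Sub, Mul, Div, Mod}"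
| "wf (MaxW r) \<longleftrightarrow> usable r"
| "wf (Ld r x f) \<longleftrightarrow> usable r \<and> usable x"
| "wf (St x f r) \<longleftrightarrow> usable x \<and> usable r"
| "wf (c1 ;; c2) \<longleftrightarrow> wf c1 \<and> wf c2"
| "wf (If b c1 c2) \<longleftrightarrow> wfcond b \<and> wf c1 \<and> wf c2"
| "wf (Until b c) \<longleftrightarrow> wfcond b \<and> wf c"

text \<open>
  The semantics works with exact natural numbers: \<open>safe\<close> demands that no operation wraps around.
\<close>

fun safe :: "nat \<Rightarrow> binop \<Rightarrow> nat \<Rightarrow> nat \<Rightarrow> bool" where
  "safe w Add x y \<longleftrightarrow> x + y < 2 ^ w"
| "safe w Sub x y \<longleftrightarrow> y \<le> x \<and> x < 2 ^ w"
| "safe w Mul x y \<longleftrightarrow> x * y < 2 ^ w"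
| "safe w f x y \<longleftrightarrow> True"

fun exact :: "binop \<Rightarrow> nat \<Rightarrow> nat \<Rightarrow> nat" where
  "exact Add x y = x + y"
| "exact Sub x y = x - y"
| "exact Mul x y = x * y"
| "exact Div x y = x div y"
| "exact Mod x y = x mod y"
| "exact f x y = 0"

text \<open>
  \<open>ex w L c (t, R, m) (t', R', m')\<close>: big-step execution from time \<open>t\<close> to time \<open>t'\<close> which only
  accesses units below \<open>L\<close>.
\<close>

inductive ex :: "nat \<Rightarrow> nat \<Rightarrow> com \<Rightarrow> nat \<times> regs \<times> umem \<Rightarrow> nat \<times> regs \<times> umem \<Rightarrow> bool"
  for w L where
  Skip: "ex w L Skip s s"
| Imm: "k < 2 ^ w \<Longrightarrow> ex w L (Imm r k) (t, R, m) (t + 1, R(r := k), m)"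
| Bin: "safe w f (R x) (R y) \<Longrightarrow>
    ex w L (Bin f r x y) (t, R, m) (t + 1, R(r := exact f (R x) (R y)), m)"
| MaxW: "ex w L (MaxW r) (t, R, m) (t + 3, R(r := 2 ^ w - 1), m)"
| Ld: "R x < L \<Longrightarrow> f < 16 \<Longrightarrow> ex w L (Ld r x f) (t, R, m) (t + 5, R(r := m (R x) f), m)"
| St: "R x < L \<Longrightarrow> f < 16 \<Longrightarrow>
    ex w L (St x f r) (t, R, m) (t + 5, R, m(R x := (m (R x))(f := R r)))"
| Seq: "ex w L c1 s s1 \<Longrightarrow> ex w L c2 s1 s2 \<Longrightarrow> ex w L (c1 ;; c2) s s2"
| IfT: "bval b R \<Longrightarrow> ex w L c1 (t + 1, R, m) s \<Longrightarrow> ex w L (If b c1 c2) (t, R, m) s"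
| IfF: "\<not> bval b R \<Longrightarrow> ex w L c2 (t + 1, R, m) (t1, R1, m1) \<Longrightarrow>
    ex w L (If b c1 c2) (t, R, m) (t1 + 1, R1, m1)"
| UntilT: "bval b R \<Longrightarrow> ex w L (Until b c) (t, R, m) (t + 1, R, m)"
| UntilF: "\<not> bval b R \<Longrightarrow> ex w L c (t + 1, R, m) (t1, R1, m1) \<Longrightarrow>
    ex w L (Until b c) (t1 + 1, R1, m1) s \<Longrightarrow> ex w L (Until b c) (t, R, m) s"

subsection \<open>Correctness of the compiler\<close>

text \<open>Staying inside the block before step \<open>n\<close> means not halting early, which
  makes \<open>n\<close> the exact running time. The last conjunct speaks about every intermediate
  memory, because the space bound does so too.\<close>

definition reach :: "nat \<Rightarrow> instr list \<Rightarrow> nat \<Rightarrow> nat \<Rightarrow> nat \<Rightarrow> nat \<Rightarrow> config \<Rightarrow> config \<Rightarrow> bool" where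
  "reach w P A lo hi n s s' \<longleftrightarrow> (step w P ^^ n) s = s' \<and>
     (\<forall>i<n. lo \<le> pc ((step w P ^^ i) s) \<and> pc ((step w P ^^ i) s) < hi) \<and>
     (\<forall>i\<le>n. \<forall>a\<ge>A. mem ((step w P ^^ i) s) a = mem s a)"

lemma reach_0: "reach w P A lo hi 0 s s"
  by (simp add: reach_def)

lemma reach_trans:
  assumes 1: "reach w P A lo1 hi1 n1 s s1" and 2: "reach w P A lo2 hi2 n2 s1 s2"
    and "lo \<le> lo1" "hi1 \<le> hi" "lo \<le> lo2" "hi2 \<le> hi"
  shows "reach w P A lo hi (n1 + n2) s s2"
proof -
  have split: "(step w P ^^ (i + n1)) s = (step w P ^^ i) s1" for i
    using 1 by (simp add: reach_def funpow_add)
  have late: "(step w P ^^ i) s = (step w P ^^ (i - n1)) s1" if "n1 \<le> i" for i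
    using split[of "i - n1"] that by simp
  show ?thesis unfolding reach_def
  proof (intro conjI allI impI)
    show "(step w P ^^ (n1 + n2)) s = s2"
      using split[of n2] 2 by (simp add: reach_def add.commute)
  next
    fix i assume i: "i < n1 + n2"
    have "lo \<le> pc ((step w P ^^ i) s) \<and> pc ((step w P ^^ i) s) < hi"
    proof (cases "i < n1")
      case True
      then have "lo1 \<le> pc ((step w P ^^ i) s)" "pc ((step w P ^^ i) s) < hi1"
        using 1 by (auto simp: reach_def)
      then show ?thesis using assms(3,4) by linarith
    next
      case False
      then have "lo2 \<le> pc ((step w P ^^ (i - n1)) s1)" "pc ((step w P ^^ (i - n1)) s1) < hi2"
        using 2 i by (auto simp: reach_def)
      then show ?thesis using assms(5,6) late[of i] False by simp
    qed
    then show "lo \<le> pc ((step w P ^^ i) s)" "pc ((step w P ^^ i) s) < hi" by auto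
  next
    fix i a assume i: "i \<le> n1 + n2" "A \<le> a"
    have s1: "mem s1 a = mem s a" using 1 \<open>A \<le> a\<close> by (auto simp: reach_def)
    show "mem ((step w P ^^ i) s) a = mem s a"
    proof (cases "i < n1")
      case True
      then show ?thesis using 1 i by (auto simp: reach_def)
    next
      case False
      then show ?thesis using 2 i s1 late[of i] by (auto simp: reach_def)
    qed
  qed
qed

lemma reach_step:
  assumes "pc s < length P" "s' = exec_instr w (P ! pc s) s" "lo \<le> pc s" "pc s < hi"
    and "\<forall>a\<ge>A. mem s' a = mem s a"
  shows "reach w P A lo hi 1 s s'"
  using assms by (auto simp: reach_def step_def halted_def le_Suc_eq)

fun local :: "instr \<Rightarrow> bool" where
  "local (Const r k) = True"
| "local (Op f r x y) = True"
| "local (Load r x) = True"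
| "local _ = False"

text \<open>Instructions that neither jump nor store act as a fold; this covers the address
  computations emitted by the compiler.\<close>

lemma reach_local:
  assumes "P = pre @ is @ post" "pc s = length pre" "\<forall>i\<in>set is. local i" "n = length is"
  shows "reach w P A (length pre) (length pre + n) n s (fold (exec_instr w) is s) \<and>
    pc (fold (exec_instr w) is s) = length pre + n"
  unfolding assms(4) using assms(1-3)
proof (induction "is" arbitrary: pre s)
  case Nil
  then show ?case by (simp add: reach_0)
next
  case (Cons i "is")
  let ?s = "exec_instr w i s"
  have i: "pc ?s = length (pre @ [i])" "mem ?s = mem s"
    using Cons.prems by (cases i; auto)+
  have 1: "reach w P A (length pre) (length pre + length (i # is)) 1 s ?s"
    using Cons.prems i by (intro reach_step) auto
  have 2: "reach w P A (length (pre @ [i])) (length (pre @ [i]) + length is) (length is) ?s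
     (fold (exec_instr w) is ?s) \<and>
    pc (fold (exec_instr w) is ?s) = length (pre @ [i]) + length is"
    using Cons.prems i by (intro Cons.IH) auto
  show ?case
    using reach_trans[OF 1 conjunct1[OF 2], of "length pre" "length pre + length (i # is)"] 2 by auto
qed

text \<open>Registers 2 and 3 are exempt, since address computations overwrite them.\<close>

definition agree :: "regs \<Rightarrow> umem \<Rightarrow> config \<Rightarrow> bool" where
  "agree R m s \<longleftrightarrow> (\<forall>r. usable r \<longrightarrow> regs s r = R r) \<and> mem s = flat m"

lemma flat_upd:
  assumes "f < 16"
  shows "(flat m)(16 * u + f := v) = flat (m(u := (m u)(f := v)))"
proof
  fix a
  show "((flat m)(16 * u + f := v)) a = flat (m(u := (m u)(f := v))) a"
    using assms by (auto simp: flat_def)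
qed

lemma exec_jump:
  "wfcond b \<Longrightarrow> agree R m s \<Longrightarrow>
   exec_instr w (jump b l) s = s\<lparr>pc := (if bval b R then l else Suc (pc s))\<rparr>"
  by (cases b) (auto simp: agree_def)

text \<open>Induction on the big-step derivation, for arbitrary code around the block. The bound on
  \<open>16 * L\<close> keeps the addresses \<open>16 * u + f\<close> from wrapping around; together
  with \<open>2 \<le> L\<close> it also makes the literals 1 and 16 fit into a word.\<close>

lemma comp_correct:
  assumes "ex w L c (t, R, m) (t', R', m')"
    and "wf c" "16 * L \<le> 2 ^ w" "2 \<le> L"
    and "P = pre @ comp (length pre) c @ post" "pc s = length pre" "agree R m s"
  shows "\<exists>n s'. t' = t + n \<and> reach w P (16 * L) (length pre) (length pre + len c) n s s' \<and>
    pc s' = length pre + len c \<and> agree R' m' s'"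
  using assms
proof (induction c "(t, R, m)" "(t', R', m')" arbitrary: t R m t' R' m' pre post s rule: ex.induct)
  case Skip
  then show ?case by (intro exI[of _ 0] exI[of _ s]) (auto simp: reach_0)
next
  case (Imm k r t R m)
  let ?s = "exec_instr w (Const r k) s"
  have "reach w P (16 * L) (length pre) (length pre + 1) 1 s ?s"
    using Imm by (intro reach_step) auto
  then show ?case using Imm by (intro exI[of _ 1] exI[of _ ?s]) (auto simp: agree_def)
next
  case (Bin f R x y r t m)
  let ?s = "exec_instr w (Op f r x y) s"
  have "reach w P (16 * L) (length pre) (length pre + 1) 1 s ?s"
    using Bin by (intro reach_step) auto
  moreover have "binop_val w f (R x) (R y) = exact f (R x) (R y)"
  proof (cases f)
    case Sub
    then show ?thesis using Bin
      by (auto simp: le_mod_geq)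
  qed (use Bin in auto)
  ultimately show ?case using Bin by (intro exI[of _ 1] exI[of _ ?s]) (auto simp: agree_def)
next
  case (MaxW r t R m)
  let ?c = "[Const 2 0, Const 3 1, Op Sub r 2 3]"
  define s3 where "s3 = fold (exec_instr w) ?c s"
  have P: "P = pre @ ?c @ post" and p: "pc s = length pre" using MaxW.prems by simp_all
  have q: "\<forall>i\<in>set ?c. local i" and n: "3 = length ?c" by simp_all
  have r: "reach w P (16 * L) (length pre) (length pre + 3) 3 s s3 \<and> pc s3 = length pre + 3"
    unfolding s3_def using reach_local[OF P p q n] by blast
  have "1 < (2::nat) ^ w" using MaxW.prems by - (rule less_le_trans[of 1 "16 * L"], auto)
  then have "agree (R(r := 2 ^ w - 1)) m s3"
    using MaxW.prems by (simp add: agree_def s3_def)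
  then show ?case using r by (intro exI[of _ 3] exI[of _ s3]) simp
next
  case (Ld R x f r t m)
  let ?c = "[Const 2 16, Op Mul 2 2 x, Const 3 f, Op Add 2 2 3, Load r 2]"
  define s5 where "s5 = fold (exec_instr w) ?c s"
  have P: "P = pre @ ?c @ post" and p: "pc s = length pre" using Ld.prems by simp_all
  have q: "\<forall>i\<in>set ?c. local i" and n: "5 = length ?c" by simp_all
  have r: "reach w P (16 * L) (length pre) (length pre + 5) 5 s s5 \<and> pc s5 = length pre + 5"
    unfolding s5_def using reach_local[OF P p q n] by blast
  have "16 < (2::nat) ^ w" using Ld by - (rule less_le_trans[of 16 "16 * L"], auto)
  moreover have "16 * R x + f < 2 ^ w" using Ld by - (rule less_le_trans[of _ "16 * L"], auto)
  ultimately have "agree (R(r := m (R x) f)) m s5"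
    using Ld by (auto simp: agree_def s5_def flat_def)
  then show ?case using r by (intro exI[of _ 5] exI[of _ s5]) auto
next
  case (St R x f r t m)
  let ?c = "[Const 2 16, Op Mul 2 2 x, Const 3 f, Op Add 2 2 3]"
  define s4 where "s4 = fold (exec_instr w) ?c s"
  define s5 where "s5 = exec_instr w (Store 2 r) s4"
  have P: "P = pre @ ?c @ Store 2 r # post" and p: "pc s = length pre" using St.prems by simp_all
  have q: "\<forall>i\<in>set ?c. local i" and n: "4 = length ?c" by simp_all
  have r: "reach w P (16 * L) (length pre) (length pre + 4) 4 s s4" "pc s4 = length pre + 4"
    unfolding s4_def using reach_local[OF P p q n] by blast+
  have a: "16 < (2::nat) ^ w" using St by - (rule less_le_trans[of 16 "16 * L"], auto)
  have b: "16 * R x + f < 2 ^ w" using St by - (rule less_le_trans[of _ "16 * L"], auto)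
  have s4: "agree R m s4" "regs s4 2 = 16 * R x + f"
    using St a b by (auto simp: agree_def s4_def)
  have m4: "mem s4 = flat m" and r4: "regs s4 r = R r" using s4 St by (auto simp: agree_def)
  have s5: "s5 = s4\<lparr>pc := length pre + 5, mem := (flat m)(16 * R x + f := R r)\<rparr>"
    by (simp add: s5_def s4(2) m4 r4 r(2))
  have P: "P ! pc s4 = Store 2 r" "pc s4 < length P"
    using St r(2) by (auto simp: nth_append)
  have "reach w P (16 * L) (length pre) (length pre + 5) 1 s4 s5"
  proof (rule reach_step[OF P(2)])
    show "s5 = exec_instr w (P ! pc s4) s4" by (simp add: P s5_def)
    have "16 * R x + f < 16 * L" using St by auto
    then show "\<forall>a\<ge>16 * L. mem s5 a = mem s4 a" by (auto simp: s5 m4)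
  qed (use r in auto)
  then have r5: "reach w P (16 * L) (length pre) (length pre + 5) 5 s s5"
    using reach_trans[OF r(1), of "length pre" "length pre + 5" 1 s5] by auto
  have "agree R (m(R x := (m (R x))(f := R r))) s5"
    using s4(1) flat_upd[OF \<open>f < 16\<close>, of m "R x" "R r"] by (simp add: agree_def s5)
  then show ?case using r5 by (intro exI[of _ 5] exI[of _ s5]) (auto simp: s5)
next
  case (Seq c1 s1 c2 t R m t' R' m')
  obtain t1 R1 m1 where s1: "s1 = (t1, R1, m1)" by (cases s1)
  have P1: "P = pre @ comp (length pre) c1 @ (comp (length pre + len c1) c2 @ post)"
    using Seq by simp
  obtain n1 s' where 1: "t1 = t + n1" "reach w P (16 * L) (length pre) (length pre + len c1) n1 s s'"
    "pc s' = length pre + len c1" "agree R1 m1 s'"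
    using Seq.hyps(2)[OF s1 _ Seq.prems(2,3) P1 Seq.prems(5,6)] Seq.prems(1) by auto
  have P2: "P = (pre @ comp (length pre) c1) @
     comp (length (pre @ comp (length pre) c1)) c2 @ post"
    using Seq by simp
  obtain n2 s2 where 2: "t' = t1 + n2"
    "reach w P (16 * L) (length pre + len c1) (length pre + len c1 + len c2) n2 s' s2"
    "pc s2 = length pre + len c1 + len c2" "agree R' m' s2"
    using Seq.hyps(4)[OF s1 _ Seq.prems(2,3) P2 _ 1(4)] Seq.prems(1) 1 by auto
  show ?case
    using reach_trans[OF 1(2) 2(2), of "length pre" "length pre + len (c1;;c2)"] 1 2
    by (intro exI[of _ "n1 + n2"] exI[of _ s2]) (auto simp: algebra_simps)
next
  case (IfT b R c1 t m c2 t' R' m')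
  let ?s1 = "s\<lparr>pc := length pre + 2 + len c2\<rparr>"
  have b: "exec_instr w (P ! pc s) s = ?s1"
    using exec_jump[of b R m s w] IfT by auto
  have r1: "reach w P (16 * L) (length pre) (length pre + len (If b c1 c2)) 1 s ?s1"
    using IfT.prems b by (intro reach_step) auto
  let ?pre = "pre @ jump b (length pre + 2 + len c2) # comp (length pre + 1) c2 @
     [JumpEq 0 0 (length pre + 2 + len c2 + len c1)]"
  have P2: "P = ?pre @ comp (length ?pre) c1 @ post"
    using IfT by simp
  have 2: "\<exists>n s'. t' = t + 1 + n \<and> reach w P (16 * L) (length ?pre) (length ?pre + len c1) n ?s1 s' \<and>
    pc s' = length ?pre + len c1 \<and> agree R' m' s'"
    using IfT.hyps(3)[OF _ IfT.prems(2,3) P2, of ?s1] IfT.prems by (auto simp: agree_def)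
  then obtain n s' where 3: "t' = t + 1 + n"
    "reach w P (16 * L) (length ?pre) (length ?pre + len c1) n ?s1 s'"
    "pc s' = length ?pre + len c1" "agree R' m' s'" by blast
  show ?case
    using reach_trans[OF r1 3(2), of "length pre" "length pre + len (If b c1 c2)"] 3
    by (intro exI[of _ "1 + n"] exI[of _ s']) auto
next
  case (IfF b R c2 t m t1 R1 m1 c1)
  let ?s1 = "s\<lparr>pc := length pre + 1\<rparr>"
  have b: "exec_instr w (P ! pc s) s = ?s1"
    using exec_jump[of b R m s w] IfF by auto
  have r1: "reach w P (16 * L) (length pre) (length pre + len (If b c1 c2)) 1 s ?s1"
    using IfF.prems b by (intro reach_step) auto
  let ?pre = "pre @ [jump b (length pre + 2 + len c2)]"
  let ?post = "[JumpEq 0 0 (length pre + 2 + len c2 + len c1)] @ comp (length pre + 2 + len c2) c1 @ post"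
  have P2: "P = ?pre @ comp (length ?pre) c2 @ ?post"
    using IfF by simp
  have 2: "\<exists>n s'. t1 = t + 1 + n \<and> reach w P (16 * L) (length ?pre) (length ?pre + len c2) n ?s1 s' \<and>
    pc s' = length ?pre + len c2 \<and> agree R1 m1 s'"
    using IfF.hyps(3)[OF _ IfF.prems(2,3) P2, of ?s1] IfF.prems by (auto simp: agree_def)
  then obtain n s' where 3: "t1 = t + 1 + n"
    "reach w P (16 * L) (length ?pre) (length ?pre + len c2) n ?s1 s'"
    "pc s' = length ?pre + len c2" "agree R1 m1 s'" by blast
  let ?s2 = "s'\<lparr>pc := length pre + len (If b c1 c2)\<rparr>"
  have "P ! pc s' = JumpEq 0 0 (length pre + 2 + len c2 + len c1)"
    using 3(3) IfF.prems by (simp add: nth_append)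
  then have r3: "reach w P (16 * L) (length pre) (length pre + len (If b c1 c2)) 1 s' ?s2"
    using IfF.prems 3(3) by (intro reach_step) auto
  have r2: "reach w P (16 * L) (length pre) (length pre + len (If b c1 c2)) (1 + n) s s'"
    using reach_trans[OF r1 3(2), of "length pre" "length pre + len (If b c1 c2)"] by auto
  show ?case
    using reach_trans[OF r2 r3] 3(1,4)
    by (intro exI[of _ "1 + n + 1"] exI[of _ ?s2]) (auto simp: agree_def)
next
  case (UntilT b R c t m)
  let ?s1 = "s\<lparr>pc := length pre + 2 + len c\<rparr>"
  have b: "exec_instr w (P ! pc s) s = ?s1"
    using exec_jump[of b R m s w] UntilT by auto
  have r1: "reach w P (16 * L) (length pre) (length pre + len (Until b c)) 1 s ?s1"
    using UntilT.prems b by (intro reach_step) auto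
  then show ?case using UntilT
    by (intro exI[of _ 1] exI[of _ ?s1]) (auto simp: agree_def)
next
  case (UntilF b R c t m t1 R1 m1 t' R' m')
  let ?s1 = "s\<lparr>pc := length pre + 1\<rparr>"
  have b: "exec_instr w (P ! pc s) s = ?s1"
    using exec_jump[of b R m s w] UntilF by auto
  have r1: "reach w P (16 * L) (length pre) (length pre + len (Until b c)) 1 s ?s1"
    using UntilF.prems b by (intro reach_step) auto
  let ?pre = "pre @ [jump b (length pre + 2 + len c)]"
  have P2: "P = ?pre @ comp (length ?pre) c @ ([JumpEq 0 0 (length pre)] @ post)"
    using UntilF by simp
  have 2: "\<exists>n s'. t1 = t + 1 + n \<and> reach w P (16 * L) (length ?pre) (length ?pre + len c) n ?s1 s' \<and>
    pc s' = length ?pre + len c \<and> agree R1 m1 s'"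
    using UntilF.hyps(3)[OF _ UntilF.prems(2,3) P2, of ?s1] UntilF.prems by (auto simp: agree_def)
  then obtain n s' where 3: "t1 = t + 1 + n"
    "reach w P (16 * L) (length ?pre) (length ?pre + len c) n ?s1 s'"
    "pc s' = length ?pre + len c" "agree R1 m1 s'" by blast
  \<comment> \<open>The backward jump returns to the test, where the induction hypothesis for the
    remaining rounds takes over.\<close>
  let ?s2 = "s'\<lparr>pc := length pre\<rparr>"
  have "P ! pc s' = JumpEq 0 0 (length pre)"
    using 3(3) UntilF.prems by (simp add: nth_append)
  then have r3: "reach w P (16 * L) (length pre) (length pre + len (Until b c)) 1 s' ?s2"
    using UntilF.prems 3(3) by (intro reach_step) auto
  have r2: "reach w P (16 * L) (length pre) (length pre + len (Until b c)) (1 + n) s s'"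
    using reach_trans[OF r1 3(2), of "length pre" "length pre + len (Until b c)"] by auto
  have r4: "reach w P (16 * L) (length pre) (length pre + len (Until b c)) (1 + n + 1) s ?s2"
    using reach_trans[OF r2 r3] by auto
  obtain n2 s3 where 4: "t' = t1 + 1 + n2"
    "reach w P (16 * L) (length pre) (length pre + len (Until b c)) n2 ?s2 s3"
    "pc s3 = length pre + len (Until b c)" "agree R' m' s3"
    using UntilF.hyps(5)[OF UntilF.prems(1-4), of ?s2] 3(4) by (auto simp: agree_def)
  show ?case
    using reach_trans[OF r4 4(2)] 3(1) 4
    by (intro exI[of _ "1 + n + 1 + n2"] exI[of _ s3]) auto
qed

subsection \<open>Weakest preconditions\<close>

text \<open>Total correctness: \<open>ex\<close> is inductive, so a derivation includes termination.
  Elapsed time is part of the state, so time bounds become ordinary postconditions.\<close>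

definition wp :: "nat \<Rightarrow> nat \<Rightarrow> com \<Rightarrow> (nat \<Rightarrow> regs \<Rightarrow> umem \<Rightarrow> bool) \<Rightarrow> nat \<Rightarrow> regs \<Rightarrow> umem \<Rightarrow> bool" where
  "wp w L c Q t R m \<longleftrightarrow> (\<exists>t' R' m'. ex w L c (t, R, m) (t', R', m') \<and> Q t' R' m')"

inductive_cases ex_cases:
  "ex w L Skip s s'" "ex w L (Imm r k) s s'" "ex w L (Bin f r x y) s s'" "ex w L (MaxW r) s s'"
  "ex w L (Ld r x f) s s'" "ex w L (St x f r) s s'" "ex w L (c1 ;; c2) s s'"
  "ex w L (If b c1 c2) s s'"

lemma ex_basic:
  "ex w L Skip s s' \<longleftrightarrow> s' = s"
  "ex w L (Imm r k) (t, R, m) s' \<longleftrightarrow> k < 2 ^ w \<and> s' = (t + 1, R(r := k), m)"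
  "ex w L (Bin g r x y) (t, R, m) s' \<longleftrightarrow>
     safe w g (R x) (R y) \<and> s' = (t + 1, R(r := exact g (R x) (R y)), m)"
  "ex w L (MaxW r) (t, R, m) s' \<longleftrightarrow> s' = (t + 3, R(r := 2 ^ w - 1), m)"
  "ex w L (Ld r x f) (t, R, m) s' \<longleftrightarrow> R x < L \<and> f < 16 \<and> s' = (t + 5, R(r := m (R x) f), m)"
  "ex w L (St x f r) (t, R, m) s' \<longleftrightarrow>
     R x < L \<and> f < 16 \<and> s' = (t + 5, R, m(R x := (m (R x))(f := R r)))"
  by (auto elim!: ex_cases intro: ex.intros ex.intros[simplified])

lemma ex_If: "ex w L (If b c1 c2) (t, R, m) s \<longleftrightarrow>
  (if bval b R then ex w L c1 (t + 1, R, m) s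
   else \<exists>t1 R1 m1. s = (t1 + 1, R1, m1) \<and> ex w L c2 (t + 1, R, m) (t1, R1, m1))"
  by (auto elim!: ex_cases intro: ex.intros ex.intros[simplified])

lemma ex_Seq: "ex w L (c1 ;; c2) s s' \<longleftrightarrow> (\<exists>s1. ex w L c1 s s1 \<and> ex w L c2 s1 s')"
  by (auto elim!: ex_cases intro: ex.intros ex.intros[simplified])

lemma wp_basic [simp]:
  "wp w L Skip Q t R m \<longleftrightarrow> Q t R m"
  "wp w L (Imm r k) Q t R m \<longleftrightarrow> k < 2 ^ w \<and> Q (t + 1) (R(r := k)) m"
  "wp w L (Bin g r x y) Q t R m \<longleftrightarrow>
     safe w g (R x) (R y) \<and> Q (t + 1) (R(r := exact g (R x) (R y))) m"
  "wp w L (MaxW r) Q t R m \<longleftrightarrow> Q (t + 3) (R(r := 2 ^ w - 1)) m"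
  "wp w L (Ld r x f) Q t R m \<longleftrightarrow> R x < L \<and> f < 16 \<and> Q (t + 5) (R(r := m (R x) f)) m"
  "wp w L (St x f r) Q t R m \<longleftrightarrow>
     R x < L \<and> f < 16 \<and> Q (t + 5) R (m(R x := (m (R x))(f := R r)))"
  by (simp_all add: wp_def ex_basic)

lemma wp_Seq [simp]: "wp w L (c1 ;; c2) Q t R m \<longleftrightarrow> wp w L c1 (wp w L c2 Q) t R m"
  by (simp add: wp_def ex_Seq) blast

lemma wp_If [simp]: "wp w L (If b c1 c2) Q t R m \<longleftrightarrow>
  (if bval b R then wp w L c1 Q (t + 1) R m else wp w L c2 (\<lambda>t. Q (t + 1)) (t + 1) R m)"
  by (auto simp: wp_def ex_If)

lemma wp_mono:
  "wp w L c Q t R m \<Longrightarrow> (\<And>t R m. Q t R m \<Longrightarrow> Q' t R m) \<Longrightarrow> wp w L c Q' t R m"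
  unfolding wp_def by blast

text \<open>The index of the invariant is a variant that every round decreases. The two additional
  time units of a round are the test and the jump back.\<close>

lemma wp_Until:
  fixes I :: "nat \<Rightarrow> nat \<Rightarrow> regs \<Rightarrow> umem \<Rightarrow> bool"
  assumes "I n t R m"
    and body: "\<And>n t R m. I n t R m \<Longrightarrow> \<not> bval b R \<Longrightarrow>
      wp w L c (\<lambda>t R m. \<exists>n'<n. I n' (t + 1) R m) (t + 1) R m"
    and exit: "\<And>n t R m. I n t R m \<Longrightarrow> bval b R \<Longrightarrow> Q (t + 1) R m"
  shows "wp w L (Until b c) Q t R m"
  using assms(1)
proof (induction n arbitrary: t R m rule: less_induct)
  case (less n)
  show ?case
  proof (cases "bval b R")
    case True
    then show ?thesis using exit[OF less.prems] unfolding wp_def by (blast intro: ex.intros)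
  next
    case False
    then obtain t1 R1 m1 n' where 1: "ex w L c (t + 1, R, m) (t1, R1, m1)" "n' < n" "I n' (t1 + 1) R1 m1"
      using body[OF less.prems] unfolding wp_def by blast
    then show ?thesis using less.IH[OF 1(2,3)] False unfolding wp_def by (blast intro: ex.intros)
  qed
qed

text \<open>The bridge to the machine model: \<open>Q\<close> is evaluated at the exact running
  time, and the memory beyond \<open>16 * L\<close> is controlled at all times, also after
  halting.\<close>

lemma wp_run:
  assumes "wp w L c Q 0 ((\<lambda>_. 0)(0 := fst args, 1 := snd args)) m" "wf c" "16 * L \<le> 2 ^ w" "2 \<le> L"
  shows "\<exists>R m'. halts w (comp 0 c) args (flat m) \<and>
    Q (run_time w (comp 0 c) args (flat m)) R m' \<and>
    regs (final w (comp 0 c) args (flat m)) 0 = R 0 \<and>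
    mem (final w (comp 0 c) args (flat m)) = flat m' \<and>
    (\<forall>t. \<forall>a\<ge>16 * L. mem (config_at w (comp 0 c) args (flat m) t) a = flat m a)"
proof -
  let ?P = "comp 0 c" and ?s = "start args (flat m)"
  obtain t R m' where 1: "ex w L c (0, (\<lambda>_. 0)(0 := fst args, 1 := snd args), m) (t, R, m')" "Q t R m'"
    using assms(1) unfolding wp_def by blast
  have s: "agree ((\<lambda>_. 0)(0 := fst args, 1 := snd args)) m ?s" "pc ?s = 0" "mem ?s = flat m"
    by (auto simp: start_def agree_def)
  obtain s' where 2: "reach w ?P (16 * L) 0 (len c) t ?s s'" "pc s' = len c" "agree R m' s'"
    using comp_correct[OF 1(1) assms(2-4), of ?P "[]" "[]" ?s] s by auto
  have at: "config_at w ?P args (flat m) i = (step w ?P ^^ i) ?s" for i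
    by (simp add: config_at_def)
  have h: "halted ?P (config_at w ?P args (flat m) t)"
    using 2 by (simp add: at reach_def halted_def)
  have nh: "\<not> halted ?P (config_at w ?P args (flat m) i)" if "i < t" for i
    using 2 that by (auto simp: at reach_def halted_def)
  have rt: "run_time w ?P args (flat m) = t"
    unfolding run_time_def by (rule Least_equality) (use h nh not_le in blast)+
  \<comment> \<open>A halted configuration is a fixed point of \<open>step\<close>, which settles
    all times after \<open>t\<close>.\<close>
  have later: "(step w ?P ^^ (t + i)) ?s = s'" for i
  proof (induction i)
    case (Suc i)
    have "step w ?P s' = s'" using 2(2) by (simp add: step_def halted_def)
    then show ?case using Suc by simp
  qed (use 2 in \<open>simp add: reach_def\<close>)
  have "mem (config_at w ?P args (flat m) i) a = flat m a" if "a \<ge> 16 * L" for i a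
  proof (cases "i \<le> t")
    case True
    then show ?thesis using 2 that s(3) by (auto simp: at reach_def)
  next
    case False
    then have "(step w ?P ^^ i) ?s = (step w ?P ^^ t) ?s"
      using later[of "i - t"] later[of 0] by simp
    moreover have "mem s' a = flat m a" using 2(1) that s(3) unfolding reach_def by (metis order_refl)
    ultimately show ?thesis using 2(1) by (simp add: at reach_def)
  qed
  moreover have "final w ?P args (flat m) = s'"
    unfolding final_def rt at using 2 by (simp add: reach_def)
  ultimately show ?thesis
    using h 1(2) 2(3) unfolding halts_def rt agree_def by (intro exI[of _ R] exI[of _ m']) auto
qed

section \<open>Packed counters\<close>

text \<open>Base \<open>Suc B\<close> lets each of the \<open>B\<close> digits take the values 0 to
  \<open>B\<close>.\<close>

definition enc :: "nat \<Rightarrow> (nat \<Rightarrow> nat) \<Rightarrow> nat" where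
  "enc B U = (\<Sum>i<B. U i * Suc B ^ i)"

lemma enc_less_aux: "\<forall>i<n. U i \<le> B \<Longrightarrow> (\<Sum>i<n. U i * Suc B ^ i) < Suc B ^ n"
proof (induction n)
  case (Suc n)
  have "U n * Suc B ^ n \<le> B * Suc B ^ n" using Suc.prems by (intro mult_right_mono) auto
  moreover have "(\<Sum>i<n. U i * Suc B ^ i) < Suc B ^ n" using Suc by simp
  moreover have "Suc B ^ Suc n = B * Suc B ^ n + Suc B ^ n" by simp
  ultimately show ?case by (simp only: sum.lessThan_Suc)
qed simp

lemma enc_less: "\<forall>i<B. U i \<le> B \<Longrightarrow> enc B U < Suc B ^ B"
  using enc_less_aux by (simp add: enc_def)

text \<open>Split the sum at \<open>r\<close>: the lower part is less than \<open>Suc B ^ r\<close>,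
  and the upper part is still a multiple of \<open>Suc B\<close> after the division.\<close>

lemma enc_digit:
  assumes "\<forall>i<B. U i \<le> B" "r < B"
  shows "enc B U div Suc B ^ r mod Suc B = U r"
proof -
  let ?G = "Suc B"
  have "(\<Sum>i<B. U i * ?G ^ i) =
      (\<Sum>i<r. U i * ?G ^ i) + U r * ?G ^ r + (\<Sum>i\<in>{Suc r..<B}. U i * ?G ^ i)"
    using sum.atLeastLessThan_concat[of 0 r B "\<lambda>i. U i * ?G ^ i"] assms(2)
      sum.atLeast_Suc_lessThan[of r B "\<lambda>i. U i * ?G ^ i"]
    by (simp add: lessThan_atLeast0)
  moreover have "(\<Sum>i\<in>{Suc r..<B}. U i * ?G ^ i) = ?G * (\<Sum>i\<in>{Suc r..<B}. U i * ?G ^ (i - Suc r)) * ?G ^ r"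
    unfolding sum_distrib_left sum_distrib_right
  proof (rule sum.cong)
    fix i assume "i \<in> {Suc r..<B}"
    then have "?G ^ i = ?G * ?G ^ (i - Suc r) * ?G ^ r"
      by (metis Suc_le_eq add_Suc_shift atLeastLessThan_iff le_add_diff_inverse2 power_Suc power_add Suc_leD)
    then show "U i * ?G ^ i = ?G * (U i * ?G ^ (i - Suc r)) * ?G ^ r" by (simp only: ac_simps)
  qed simp
  ultimately have "enc B U = (\<Sum>i<r. U i * ?G ^ i) +
      (U r + ?G * (\<Sum>i\<in>{Suc r..<B}. U i * ?G ^ (i - Suc r))) * ?G ^ r"
    unfolding enc_def by (simp only: algebra_simps)
  moreover have "(\<Sum>i<r. U i * ?G ^ i) < ?G ^ r" using assms by (intro enc_less_aux) auto
  ultimately have "enc B U div ?G ^ r = U r + ?G * (\<Sum>i\<in>{Suc r..<B}. U i * ?G ^ (i - Suc r))"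
    by (simp only: div_mult_self3 div_less) (simp add: div_less)
  then show ?thesis using assms by (simp only: mod_mult_self2) (simp add: le_imp_less_Suc)
qed

lemma enc_clear:
  assumes "r < B"
  shows "enc B U - U r * Suc B ^ r = enc B (U(r := 0))" "U r * Suc B ^ r \<le> enc B U"
proof -
  have *: "enc B U = U r * Suc B ^ r + (\<Sum>i\<in>{..<B} - {r}. U i * Suc B ^ i)" for U
    unfolding enc_def using assms by (subst sum.remove[of _ r]) auto
  have "enc B (U(r := 0)) = (\<Sum>i\<in>{..<B} - {r}. U i * Suc B ^ i)"
    by (subst *) (auto intro: sum.cong)
  then show "enc B U - U r * Suc B ^ r = enc B (U(r := 0))" by (subst *) simp
  show "U r * Suc B ^ r \<le> enc B U" using *[of U] by simp
qed

text \<open>\<open>enc\<close> is linear whatever the digits are; only reading digits back needs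
  their bound.\<close>

lemma enc_add: "enc B U + enc B V = enc B (\<lambda>i. U i + V i)"
  by (simp add: enc_def sum.distrib algebra_simps)

text \<open>A key with digit \<open>j\<close> contributes to the strict prefix counts of all digits
  beyond \<open>j\<close>; \<open>enc B (above j)\<close> is the mask that an update adds.\<close>

abbreviation above :: "nat \<Rightarrow> nat \<Rightarrow> nat" where
  "above j i \<equiv> (if j < i then 1 else 0)"

text \<open>
  The counters are cleared in a cyclic order; \<open>slack B r i\<close> bounds counter \<open>i\<close> when \<open>r\<close> is the
  next counter to be cleared.
\<close>

definition slack :: "nat \<Rightarrow> nat \<Rightarrow> nat \<Rightarrow> nat" where
  "slack B r i = (if i < r then r - 1 - i else B + r - 1 - i)"

definition next_idx :: "nat \<Rightarrow> nat \<Rightarrow> nat" where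
  "next_idx B r = (if Suc r = B then 0 else Suc r)"

lemma slack_less: "r < B \<Longrightarrow> i < B \<Longrightarrow> slack B r i < B"
  by (auto simp: slack_def)

text \<open>An update raises a counter by at most 1, and advancing the cyclic index raises its
  allowance just as much. Only the counter that is being cleared is left out.\<close>

lemma slack_next: "r < B \<Longrightarrow> i < B \<Longrightarrow> i \<noteq> r \<Longrightarrow> slack B r i + 1 \<le> slack B (next_idx B r) i"
  by (auto simp: slack_def next_idx_def)

text \<open>\<open>Suc B < 2 ^ B\<close> from \<open>B = 2\<close> on, so \<open>B\<close> digits
  take fewer than \<open>B * B\<close> bits. This is what confines \<open>B\<close> to the square
  root of \<open>w\<close>.\<close>

lemma power_Suc_less_two_power: "2 \<le> B \<Longrightarrow> B * B \<le> w \<Longrightarrow> Suc B ^ B < 2 ^ w" for B w :: nat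
proof -
  assume B: "2 \<le> B" "B * B \<le> w"
  have "Suc B \<le> 2 ^ B" by (simp add: Suc_leI)
  moreover have "Suc B \<noteq> 2 ^ B"
  proof
    assume *: "Suc B = 2 ^ B"
    have "Suc (Suc n) < 2 ^ n" if "3 \<le> n" for n :: nat
      using that by (induction n rule: dec_induct) auto
    moreover have "B = 2 \<or> 3 \<le> B" using B by auto
    ultimately show False using * by (metis Suc_lessD eval_nat_numeral(2) less_irrefl numeral_eq_iff power2_eq_square semiring_norm(88) numeral_times_numeral semiring_norm(13) semiring_norm(11) numeral_3_eq_3 numeral_2_eq_2)
  qed
  ultimately have "Suc B < 2 ^ B" by simp
  then have "Suc B ^ B < (2 ^ B) ^ B" using B by (intro power_strict_mono) auto
  also have "\<dots> = 2 ^ (B * B)" by (simp add: power_mult)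
  also have "\<dots> \<le> 2 ^ w" using B by (intro power_increasing) auto
  finally show ?thesis .
qed

section \<open>The trie\<close>

text \<open>
  Fields of a unit: 0 key, 1 next cell, 2 tag (0 for a dead cell); 3 head, 4 tail, 5 length,
  6 child and 7 prefix count of a slot; 8, 9 packed corrections and 10 cyclic index of a node
  header. The slot of digit \<open>j\<close> of the node at \<open>p\<close> is the unit \<open>p + 1 + j\<close>. Unit 0 holds global
  variables, unit \<open>1 + j\<close> the constants belonging to digit \<open>j\<close>.

  Registers 4, 5, 6 hold \<open>0\<close>, \<open>1\<close>, \<open>B\<close>; 7 is the current node, 8 the current digit, 9 the key,
  11 the current slot. At height \<open>h\<close>, register 10 holds \<open>B ^ h div B\<close>, which is \<open>0\<close> exactly at the
  bottom.
\<close>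

locale trie =
  fixes w B H L :: nat
  assumes B2: "2 \<le> B" and BB: "B * B \<le> w" and H1: "1 \<le> H" and BH: "2 ^ w \<le> B ^ H"
    and BH1: "B ^ (H - 1) < 2 ^ w" and L1: "B + 1 < L" and L2: "16 * L \<le> 2 ^ w"
begin

section \<open>Constants in memory and the buffered prefix counts of a node\<close>

definition cregs :: "regs \<Rightarrow> bool" where
  "cregs R \<longleftrightarrow> R 4 = 0 \<and> R 5 = 1 \<and> R 6 = B"

text \<open>\<open>B ^ (H - 1)\<close> fits into a word whereas \<open>B ^ H\<close> need not, so
  the former is stored. Field 5 of unit 0 serves both as the unit of the root and as the first unit
  for cells. Each digit owns its mask and the power by which its counter is unpacked.\<close>

definition table :: "umem \<Rightarrow> bool" where
  "table m \<longleftrightarrow> m 0 0 = B \<and> m 0 1 = B ^ (H - 1) \<and> m 0 5 = B + 1 \<and>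
     (\<forall>j<B. m (Suc j) 0 = enc B (above j) \<and> m (Suc j) 1 = Suc B ^ j)"

text \<open>The true count \<open>F i\<close> is the stored count plus pending additions
  \<open>U i\<close> minus pending removals \<open>V i\<close>, written without subtraction. Two
  packed words are kept because digits cannot be negative.\<close>

definition counts :: "umem \<Rightarrow> nat \<Rightarrow> (nat \<Rightarrow> nat) \<Rightarrow> bool" where
  "counts m p F \<longleftrightarrow> (\<exists>U V. m p 8 = enc B U \<and> m p 9 = enc B V \<and> m p 10 < B \<and>
     (\<forall>i<B. U i \<le> slack B (m p 10) i \<and> V i \<le> slack B (m p 10) i \<and>
        m (p + 1 + i) 7 + U i = V i + F i))"

text \<open>The additions are applied before the removals, so the intermediate value stays a natural
  number.\<close>

definition norm_com :: com where
  "norm_com =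
     Ld 12 7 10 ;; Bin Add 15 12 5 ;; Ld 13 15 1 ;; Bin Add 16 6 5 ;;
     Ld 14 7 8 ;; Bin Div 17 14 13 ;; Bin Mod 17 17 16 ;; Bin Mul 18 17 13 ;; Bin Sub 14 14 18 ;;
     St 7 8 14 ;;
     Ld 14 7 9 ;; Bin Div 19 14 13 ;; Bin Mod 19 19 16 ;; Bin Mul 18 19 13 ;; Bin Sub 14 14 18 ;;
     St 7 9 14 ;;
     Bin Add 18 7 15 ;; Ld 14 18 7 ;; Bin Add 14 14 17 ;; Bin Sub 14 14 19 ;; St 18 7 14 ;;
     If (Eq 15 6) (Imm 15 0) Skip ;; St 7 10 15"

definition count_com :: "nat \<Rightarrow> com" where
  "count_com f = Bin Add 12 8 5 ;; Ld 13 12 0 ;; Ld 14 7 f ;; Bin Add 14 14 13 ;; St 7 f 14 ;; norm_com"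

definition node_frame :: "nat \<Rightarrow> umem \<Rightarrow> umem \<Rightarrow> bool" where
  "node_frame p m m' \<longleftrightarrow> (\<forall>u f. m' u f \<noteq> m u f \<longrightarrow>
     (u = p \<and> f \<in> {8, 9, 10}) \<or> (p < u \<and> u \<le> p + B \<and> f = 7))"

definition same_regs :: "nat set \<Rightarrow> regs \<Rightarrow> regs \<Rightarrow> bool" where
  "same_regs X R R' \<longleftrightarrow> (\<forall>x. x \<notin> X \<longrightarrow> R' x = R x)"

lemma small: "L < 2 ^ w" "Suc B ^ B < 2 ^ w" "B < w"
proof -
  show "L < 2 ^ w" using L1 L2 by simp
  show "Suc B ^ B < 2 ^ w" using power_Suc_less_two_power B2 BB by blast
  have "B < B * B" using B2 by simp
  then show "B < w" using BB by (rule less_le_trans)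
qed

text \<open>Entered right after a mask was added, hence the allowance \<open>slack + 1\<close>. The
  digit being cleared is the one with the largest slack, and for all others the slack of the next
  index absorbs the increase.\<close>

lemma wp_norm:
  assumes R: "cregs R" "R 7 = p" and p: "B < p" "p + B < L" and tab: "table m"
    and m: "m p 8 = enc B U" "m p 9 = enc B V" "m p 10 < B"
    and UV: "\<forall>i<B. U i \<le> slack B (m p 10) i + 1 \<and> V i \<le> slack B (m p 10) i + 1 \<and>
        m (p + 1 + i) 7 + U i = V i + F i"
    and F: "\<forall>i<B. F i + B < 2 ^ w"
    and Q: "\<And>t' R' m'. t' \<le> t + 80 \<Longrightarrow> same_regs {12..19} R R' \<Longrightarrow> node_frame p m m' \<Longrightarrow>
      counts m' p F \<Longrightarrow> Q t' R' m'"
  shows "wp w L norm_com Q t R m"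
proof -
  define r where "r = m p 10"
  have r: "r < B" using m by (simp add: r_def)
  \<comment> \<open>The slack is less than \<open>B\<close>, so a digit is at most \<open>B\<close>
    even after the increment, and decoding is still valid.\<close>
  have UB: "\<forall>i<B. U i \<le> B" "\<forall>i<B. V i \<le> B"
    using UV slack_less[OF r] by (fastforce simp: r_def Suc_le_eq)+
  have dig: "enc B U div Suc B ^ r mod Suc B = U r" "enc B V div Suc B ^ r mod Suc B = V r"
    using enc_digit r UB by auto
  have lt: "enc B U < 2 ^ w" "enc B V < 2 ^ w"
    using enc_less[OF UB(1)] enc_less[OF UB(2)] small(2) by auto
  have clr: "U r * Suc B ^ r < 2 ^ w" "V r * Suc B ^ r < 2 ^ w"
    "U r * Suc B ^ r \<le> enc B U" "V r * Suc B ^ r \<le> enc B V"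
    "enc B U - U r * Suc B ^ r = enc B (U(r := 0))" "enc B V - V r * Suc B ^ r = enc B (V(r := 0))"
    using enc_clear[OF r, of U] enc_clear[OF r, of V] lt by auto
  have A: "m (Suc (p + r)) 7 + U r = V r + F r" using UV r by simp
  have Al: "V r + F r < 2 ^ w" using F UB r by (fastforce intro: le_less_trans add_le_mono)
  have tb: "m (Suc r) 1 = Suc B ^ r" using tab r by (simp add: table_def)
  have tb': "m (Suc r) (Suc 0) = Suc B ^ r" using tb by simp
  define m' where "m' = (m(p := (m p)(8 := enc B (U(r := 0)), 9 := enc B (V(r := 0)), 10 := next_idx B r)))
      (p + Suc r := (m (p + Suc r))(7 := F r))"
  have fr: "node_frame p m m'"
    using r by (auto simp: node_frame_def m'_def)
  have cn: "counts m' p F"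
    unfolding counts_def
  proof (intro exI conjI)
    show "m' p 8 = enc B (U(r := 0))" "m' p 9 = enc B (V(r := 0))"
      by (auto simp: m'_def)
    show "m' p 10 < B" using r by (auto simp: m'_def next_idx_def)
    have 10: "m' p 10 = next_idx B r" by (auto simp: m'_def)
    show "\<forall>i<B. (U(r := 0)) i \<le> slack B (m' p 10) i \<and> (V(r := 0)) i \<le> slack B (m' p 10) i \<and>
        m' (p + 1 + i) 7 + (U(r := 0)) i = (V(r := 0)) i + F i"
    proof (intro allI impI)
      fix i assume i: "i < B"
      show "(U(r := 0)) i \<le> slack B (m' p 10) i \<and> (V(r := 0)) i \<le> slack B (m' p 10) i \<and>
        m' (p + 1 + i) 7 + (U(r := 0)) i = (V(r := 0)) i + F i"
        using UV i slack_next[OF r i] unfolding 10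
        by (cases "i = r") (fastforce simp: m'_def r_def)+
    qed
  qed
  have bnd: "p + Suc r < L" "Suc r < L" "p < L" "p + Suc r < 2 ^ w" "Suc r < 2 ^ w" "Suc B < 2 ^ w"
    using r p L1 small(1) by auto
  have ne: "p + Suc r \<noteq> p" "p \<noteq> p + Suc r" "p \<noteq> Suc r" using p r by auto
  have w0: "(0::nat) < 2 ^ w" by simp
  have mm: "m(Suc (p + r) := (m (Suc (p + r)))(7 := F r),
       p := (m p)(8 := enc B (U(r := 0)), 9 := enc B (V(r := 0)), 10 := next_idx B r)) = m'"
    using ne by (auto simp: m'_def fun_eq_iff)
  have Q': "Q t' R' m'" if "t' \<le> t + 80" "same_regs {12..19} R R'" for t' R'
    using Q that fr cn by blast
  have goal: "Q t' R' (m(Suc (p + r) := (m (Suc (p + r)))(7 := F r),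
       p := (m p)(8 := enc B (U(r := 0)), 9 := enc B (V(r := 0)), 10 := k)))"
    if "k = next_idx B r" "t' \<le> t + 80" "same_regs {12..19} R R'" for t' R' k
    using Q'[OF that(2,3)] unfolding that(1) mm .
  show ?thesis
    unfolding norm_com_def using R bnd ne
    by (simp add: cregs_def r_def[symmetric] m tb' dig clr A Al lt)
      (intro conjI impI goal; simp add: same_regs_def next_idx_def)
qed

text \<open>Field 8 counts additions and field 9 counts removals.\<close>

lemma wp_count:
  assumes R: "cregs R" "R 7 = p" "R 8 = j" "j < B" and p: "B < p" "p + B < L" and tab: "table m"
    and m: "counts m p F"
    and f: "f = 8 \<and> (\<forall>i<B. F' i = F i + above j i) \<or> f = 9 \<and> (\<forall>i<B. F' i + above j i = F i)"
    and F: "\<forall>i<B. F' i + B < 2 ^ w"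
    and Q: "\<And>t' R' m'. t' \<le> t + 100 \<Longrightarrow> same_regs {12..19} R R' \<Longrightarrow> node_frame p m m' \<Longrightarrow>
      counts m' p F' \<Longrightarrow> Q t' R' m'"
  shows "wp w L (count_com f) Q t R m"
proof -
  obtain U V where UV: "m p 8 = enc B U" "m p 9 = enc B V" "m p 10 < B"
     "\<forall>i<B. U i \<le> slack B (m p 10) i \<and> V i \<le> slack B (m p 10) i \<and>
        m (p + 1 + i) 7 + U i = V i + F i"
    using m unfolding counts_def by blast
  have sl: "\<forall>i<B. slack B (m p 10) i < B" using slack_less UV(3) by blast
  define U' where "U' = (if f = 8 then (\<lambda>i. U i + above j i) else U)"
  define V' where "V' = (if f = 8 then V else (\<lambda>i. V i + above j i))"
  define W where "W = (if f = 8 then U' else V')"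
  have le: "\<forall>i<B. W i \<le> B"
    using UV(4) sl by (auto simp: W_def U'_def V'_def Suc_le_eq intro: le_less_trans less_imp_le)
  have W: "enc B W < 2 ^ w" using enc_less[OF le] small(2) by simp
  define m1 where "m1 = m(p := (m p)(f := enc B W))"
  have e: "m p f + enc B (above j) = enc B W"
    using f UV by (auto simp: W_def U'_def V'_def enc_add)
  have tb: "m (Suc j) 0 = enc B (above j)" using tab \<open>j < B\<close> by (simp add: table_def)
  have n: "wp w L norm_com Q t' R' m1" if R': "same_regs {12..19} R R'" and t': "t' \<le> t + 20" for t' R'
  proof (rule wp_norm[where U = U' and V = V' and F = F' and p = p])
    show "cregs R'" "R' 7 = p" using R R' by (auto simp: cregs_def same_regs_def)
    show "B < p" "p + B < L" by fact+
    show "table m1" using tab p by (auto simp: table_def m1_def)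
    show "m1 p 8 = enc B U'" "m1 p 9 = enc B V'" "m1 p 10 < B"
      using f UV(1-3) by (auto simp: m1_def W_def U'_def V'_def)
    have 10: "m1 p 10 = m p 10" using f by (auto simp: m1_def)
    show "\<forall>i<B. U' i \<le> slack B (m1 p 10) i + 1 \<and> V' i \<le> slack B (m1 p 10) i + 1 \<and>
        m1 (p + 1 + i) 7 + U' i = V' i + F' i"
    proof (intro allI impI)
      fix i assume i: "i < B"
      note u = UV(4)[rule_format, OF i]
      have 7: "m1 (p + 1 + i) 7 = m (p + 1 + i) 7" by (simp add: m1_def)
      have "U' i \<le> U i + 1" "V' i \<le> V i + 1" by (simp_all add: U'_def V'_def)
      moreover have "m (p + 1 + i) 7 + U' i = V' i + F' i"
        using f
      proof
        assume "f = 8 \<and> (\<forall>i<B. F' i = F i + above j i)"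
        then show ?thesis using u i by (simp add: U'_def V'_def)
      next
        assume "f = 9 \<and> (\<forall>i<B. F' i + above j i = F i)"
        then have "f = 9" "F i = F' i + above j i" using i by auto
        then show ?thesis using u by (simp add: U'_def V'_def)
      qed
      ultimately show "U' i \<le> slack B (m1 p 10) i + 1 \<and> V' i \<le> slack B (m1 p 10) i + 1 \<and>
        m1 (p + 1 + i) 7 + U' i = V' i + F' i"
        unfolding 10 7 using u by linarith
    qed
    show "\<forall>i<B. F' i + B < 2 ^ w" by fact
    fix t2 R2 m2
    assume 2: "t2 \<le> t' + 80" "same_regs {12..19} R' R2" "node_frame p m1 m2" "counts m2 p F'"
    have "node_frame p m m2"
      unfolding node_frame_def
    proof (intro allI impI)
      fix u g assume ne: "m2 u g \<noteq> m u g"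
      show "u = p \<and> g \<in> {8, 9, 10} \<or> p < u \<and> u \<le> p + B \<and> g = 7"
      proof (cases "u = p \<and> g = f")
        case False
        then have "m1 u g = m u g" by (auto simp: m1_def)
        then show ?thesis using ne 2(3) unfolding node_frame_def by metis
      qed (use f in auto)
    qed
    then show "Q t2 R2 m2" using Q 2 R' t' by (auto simp: same_regs_def)
  qed
  have bnd: "Suc j < L" "p < L" "Suc j < 2 ^ w" "f < 16"
    using \<open>j < B\<close> p L1 small(1) f by auto
  show ?thesis
    unfolding count_com_def using R bnd W
    by (simp add: cregs_def tb e m1_def[symmetric]) (rule n; simp add: same_regs_def)
qed

definition pre_com :: com where
  "pre_com = Bin Add 11 7 8 ;; Bin Add 11 11 5 ;;
     Bin Add 12 8 5 ;; Ld 13 12 1 ;; Bin Add 16 6 5 ;;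
     Ld 14 7 8 ;; Bin Div 14 14 13 ;; Bin Mod 14 14 16 ;;
     Ld 15 7 9 ;; Bin Div 15 15 13 ;; Bin Mod 15 15 16 ;;
     Ld 17 11 7 ;; Bin Add 17 17 14 ;; Bin Sub 17 17 15 ;; Bin Add 26 26 17"

text \<open>A query leaves the node unchanged: it corrects the stored count by the two digits
  belonging to \<open>j\<close> and accumulates the result in register 26.\<close>

lemma wp_pre:
  assumes R: "cregs R" "R 7 = p" "R 8 = j" "j < B" and p: "B < p" "p + B < L" and tab: "table m"
    and m: "counts m p F" and F: "F j + B < 2 ^ w" "R 26 + F j < 2 ^ w"
    and Q: "\<And>t' R'. t' \<le> t + 40 \<Longrightarrow> same_regs ({11..19} \<union> {26}) R R' \<Longrightarrow> R' 26 = R 26 + F j \<Longrightarrow>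
      Q t' R' m"
  shows "wp w L pre_com Q t R m"
proof -
  obtain U V where UV: "m p 8 = enc B U" "m p 9 = enc B V" "m p 10 < B"
     "\<forall>i<B. U i \<le> slack B (m p 10) i \<and> V i \<le> slack B (m p 10) i \<and>
        m (p + 1 + i) 7 + U i = V i + F i"
    using m unfolding counts_def by blast
  have le: "\<forall>i<B. U i \<le> B" "\<forall>i<B. V i \<le> B"
    using UV(4) slack_less[OF UV(3)] by (meson le_trans less_imp_le)+
  have dig: "enc B U div Suc B ^ j mod Suc B = U j" "enc B V div Suc B ^ j mod Suc B = V j"
    using enc_digit \<open>j < B\<close> le by auto
  have A: "m (Suc (p + j)) 7 + U j = V j + F j" using UV \<open>j < B\<close> by simp
  have "V j \<le> B" using le \<open>j < B\<close> by simp
  then have Al: "V j + F j < 2 ^ w" using F by linarith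
  have tb: "m (Suc j) (Suc 0) = Suc B ^ j" using tab \<open>j < B\<close> by (simp add: table_def)
  have bnd: "Suc (p + j) < L" "Suc j < L" "p < L" "Suc (p + j) < 2 ^ w" "Suc j < 2 ^ w" "Suc B < 2 ^ w"
    "p + j < 2 ^ w"
    using \<open>j < B\<close> p L1 small(1) by auto
  show ?thesis
    unfolding pre_com_def using R bnd F(2)
    by (simp add: cregs_def tb UV(1,2) dig A Al) (rule Q; simp add: same_regs_def)
qed

end

subsection \<open>The invariant\<close>

text \<open>
  Ghost state. Virtual keys \<open>t * B ^ H + x\<close> combine the tag \<open>t\<close> and the word \<open>x\<close>. Cell \<open>c\<close> sits in
  the slot \<open>(gh c, gK c div B ^ gh c)\<close>; the slot \<open>(h, P)\<close> belongs to the node \<open>(h, P div B)\<close> and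
  its child is the node \<open>(h - 1, P)\<close>. \<open>gT\<close> are the cells with a nonzero tag, \<open>gC\<close> those that are
  linked into the trie and \<open>gP\<close> those that ever were since the last rebuilding: a removed cell keeps
  its place in the ghost state, which pays for the nodes.
\<close>

record ghost =
  gC :: "nat set"
  gT :: "nat set"
  gP :: "nat set"
  gK :: "nat \<Rightarrow> nat"
  gh :: "nat \<Rightarrow> nat"
  nd :: "nat \<Rightarrow> nat \<Rightarrow> nat"
  ls :: "nat \<Rightarrow> nat \<Rightarrow> nat list"
  ce :: nat
  ne :: nat

text \<open>0 is the null pointer: unit 0 holds global variables and is never a cell.\<close>

definition hd0 :: "nat list \<Rightarrow> nat" where "hd0 xs = (case xs of [] \<Rightarrow> 0 | x # _ \<Rightarrow> x)"
definition last0 :: "nat list \<Rightarrow> nat" where "last0 xs = (if xs = [] then 0 else last xs)"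

lemma hd0_simps [simp]: "hd0 [] = 0" "hd0 (x # xs) = x"
  by (simp_all add: hd0_def)

lemma last0_simps [simp]: "last0 [] = 0" "last0 (xs @ [x]) = x"
  by (simp_all add: last0_def)

fun chain :: "umem \<Rightarrow> nat list \<Rightarrow> bool" where
  "chain m [] = True"
| "chain m (x # xs) = (m x 1 = hd0 xs \<and> chain m xs)"

text \<open>The tail pointer allows appending in constant time, which is how keys arrive from the
  parent slot; the length replaces a scan whenever the whole list counts.\<close>

definition lst :: "umem \<Rightarrow> nat \<Rightarrow> nat list \<Rightarrow> bool" where
  "lst m q xs \<longleftrightarrow> m q 3 = hd0 xs \<and> m q 4 = last0 xs \<and> m q 5 = length xs \<and> chain m xs"

text \<open>These are the keys that nodes at height \<open>h\<close> count: those in slots of that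
  height or below. Keys kept in slots further up are missing from them.\<close>

definition KMr :: "ghost \<Rightarrow> nat \<Rightarrow> nat multiset" where
  "KMr g h = image_mset (gK g) (mset_set {c \<in> gC g. gh g c \<le> h})"

definition keys :: "ghost \<Rightarrow> nat multiset" where
  "keys g = image_mset (gK g) (mset_set (gC g))"

lemma size_filter_image: "finite A \<Longrightarrow>
  size {#v \<in># image_mset f (mset_set A). p v#} = card {c \<in> A. p (f c)}"
  by (simp add: filter_mset_image_mset filter_mset_mset_set)

context trie begin

definition su :: "ghost \<Rightarrow> nat \<Rightarrow> nat \<Rightarrow> nat" where
  "su g h P = nd g h (P div B) + 1 + P mod B"

definition memI :: "ghost \<Rightarrow> umem \<Rightarrow> bool" where
  "memI g m \<longleftrightarrow> table m \<and> m 0 2 = ce g \<and> m 0 3 = ne g"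

text \<open>The node fields are clean from \<open>ne\<close> on, so a fresh node needs no
  initialisation. The first \<open>B + 1\<close> units are reserved, hence the \<open>+ 1\<close> in
  the formula for \<open>ne\<close>. The last conjunct charges each node below the root to
  \<open>B\<close> cells placed in its parent slot; it uses \<open>gP\<close> instead of
  \<open>gC\<close> so that deletions do not destroy the payment.\<close>

definition nodeI :: "ghost \<Rightarrow> umem \<Rightarrow> bool" where
  "nodeI g m \<longleftrightarrow>
     nd g H 0 = B + 1 \<and>
     (\<forall>h p. nd g h p \<noteq> 0 \<longrightarrow>
        h \<le> H \<and> (h = H \<longrightarrow> p = 0) \<and> B + 1 \<le> nd g h p \<and> nd g h p + B < ne g) \<and>
     (\<forall>h p h' p'. nd g h p \<noteq> 0 \<longrightarrow> nd g h' p' \<noteq> 0 \<longrightarrow> (h, p) \<noteq> (h', p') \<longrightarrow>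
        nd g h p + B < nd g h' p' \<or> nd g h' p' + B < nd g h p) \<and>
     (\<forall>h P. nd g h (P div B) \<noteq> 0 \<longrightarrow> m (su g h P) 6 = (if h = 0 then 0 else nd g (h - 1) P)) \<and>
     (\<forall>h p. nd g h p \<noteq> 0 \<longrightarrow> h < H \<longrightarrow> nd g (Suc h) (p div B) \<noteq> 0) \<and>
     (\<forall>u f. ne g \<le> u \<longrightarrow> 3 \<le> f \<longrightarrow> m u f = 0) \<and>
     finite {(h, p). nd g h p \<noteq> 0} \<and> ne g = (B + 1) * (card {(h, p). nd g h p \<noteq> 0} + 1) \<and>
     (\<forall>h p. nd g h p \<noteq> 0 \<longrightarrow> h < H \<longrightarrow>
        B \<le> card {c \<in> gP g. gh g c = Suc h \<and> gK g c div B ^ Suc h = p})"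

text \<open>The last conjunct is a heap order: on a common path, the cell further up has the smaller
  or equal key. \<open>ov\<close> names the one slot that may hold \<open>B + 1\<close> cells during
  an insertion. Slots at height 0 have no length limit, as they contain copies of a single
  key.\<close>

definition listI :: "ghost \<Rightarrow> umem \<Rightarrow> (nat \<times> nat) option \<Rightarrow> bool" where
  "listI g m ov \<longleftrightarrow>
     (\<forall>h P. nd g h (P div B) \<noteq> 0 \<longrightarrow> lst m (su g h P) (ls g h P) \<and>
        set (ls g h P) = {c \<in> gC g. gh g c = h \<and> gK g c div B ^ h = P} \<and>
        distinct (ls g h P) \<and> sorted_wrt (\<lambda>a b. gK g b \<le> gK g a) (ls g h P)) \<and>
     (\<forall>h P. 0 < h \<longrightarrow> nd g h (P div B) \<noteq> 0 \<longrightarrow>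
        length (ls g h P) \<le> B + (if ov = Some (h, P) then 1 else 0)) \<and>
     (\<forall>c \<in> gC g. gh g c \<le> H \<and>
        (\<forall>h. gh g c \<le> h \<longrightarrow> h \<le> H \<longrightarrow> nd g h (gK g c div B ^ Suc h) \<noteq> 0)) \<and>
     (\<forall>c \<in> gC g. \<forall>c' \<in> gC g. gh g c' < gh g c \<longrightarrow>
        gK g c div B ^ gh g c = gK g c' div B ^ gh g c \<longrightarrow> gK g c \<le> gK g c')"

text \<open>A cell can be live without being linked, as happens during insertion and rebuilding. A
  dead cell keeps its unit, with tag 0, until the next rebuilding.\<close>

definition cellI :: "ghost \<Rightarrow> umem \<Rightarrow> bool" where
  "cellI g m \<longleftrightarrow> gC g \<subseteq> gT g \<and> gC g \<subseteq> gP g \<and> gT g \<subseteq> {B+1..<ce g} \<and> gP g \<subseteq> {B+1..<ce g} \<and>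
     B + 1 \<le> ce g \<and>
     (\<forall>c \<in> {B+1..<ce g}. m c 2 = (if c \<in> gT g then 1 + gK g c div B ^ H else 0)) \<and>
     (\<forall>c \<in> gT g. m c 0 = gK g c mod B ^ H \<and> gK g c < 2 * B ^ H \<and> gK g c mod B ^ H < 2 ^ w) \<and>
     (\<forall>u f. ce g \<le> u \<longrightarrow> f < 3 \<longrightarrow> m u f = 0)"

text \<open>The strict prefix count of the node \<open>(h, p)\<close> for digit \<open>j\<close>,
  expressed through an interval of prefixes.\<close>

definition cntF :: "nat multiset \<Rightarrow> nat \<Rightarrow> nat \<Rightarrow> nat \<Rightarrow> nat" where
  "cntF M h p j = size {#v \<in># M. p * B \<le> v div B ^ h \<and> v div B ^ h < p * B + j#}"

definition countI :: "ghost \<Rightarrow> umem \<Rightarrow> (nat \<Rightarrow> nat multiset) \<Rightarrow> bool" where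
  "countI g m KM \<longleftrightarrow> (\<forall>h p. nd g h p \<noteq> 0 \<longrightarrow> counts m (nd g h p) (cntF (KM h) h p))"

text \<open>The counted multisets \<open>KM\<close> are a separate argument because an update
  adjusts the counts along the path before it links or unlinks the cell.\<close>

definition inv :: "ghost \<Rightarrow> umem \<Rightarrow> (nat \<times> nat) option \<Rightarrow> (nat \<Rightarrow> nat multiset) \<Rightarrow> bool" where
  "inv g m ov KM \<longleftrightarrow> memI g m \<and> nodeI g m \<and> listI g m ov \<and> cellI g m \<and> countI g m KM"

text \<open>\<open>pos g h k R\<close>: the registers describe the node at height \<open>h\<close> on the search path of \<open>k\<close>.\<close>

definition pos :: "ghost \<Rightarrow> nat \<Rightarrow> nat \<Rightarrow> regs \<Rightarrow> bool" where
  "pos g h k R \<longleftrightarrow> cregs R \<and> R 7 = nd g h (k div B ^ Suc h) \<and> R 8 = k div B ^ h mod B \<and>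
     R 9 = k mod B ^ H \<and> R 10 = B ^ h div B"

section \<open>Digits and prefixes of keys, and the layout of slots\<close>

lemma B_pos: "0 < B" using B2 by simp

lemma div_Suc: "k div B ^ h div B = k div B ^ Suc h"
  by (metis div_mult2_eq power_Suc2)

lemma su_key: "su g h (k div B ^ h) = nd g h (k div B ^ Suc h) + 1 + k div B ^ h mod B"
  by (simp add: su_def div_Suc)

text \<open>Below height \<open>H\<close> the digits depend on the stored word alone; the tag only
  supplies the digit at height \<open>H\<close>.\<close>

lemma digit_low:
  assumes "h < H"
  shows "(k mod B ^ H) div B ^ h mod B = k div B ^ h mod B"
proof -
  define b where "b = B * B ^ (H - Suc h)"
  have BH: "B ^ H = B ^ h * b"
    using assms unfolding b_def by (simp flip: power_add power_Suc)
  have "(k mod B ^ H) div B ^ h = k div B ^ h mod b"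
    using B_pos by (simp add: BH mod_mult2_eq)
  then show ?thesis by (simp add: b_def mod_mod_cancel)
qed

lemma div_top:
  assumes "h \<le> H" "k div B ^ h = k' div B ^ h"
  shows "k div B ^ H = k' div B ^ H"
proof -
  have "B ^ H = B ^ h * B ^ (H - h)" using assms(1) by (simp flip: power_add)
  then show ?thesis using assms(2) by (simp add: div_mult2_eq)
qed

text \<open>Keys with a common prefix share their tag, so comparing words amounts to comparing
  virtual keys, although the latter may not fit into a word.\<close>

lemma less_low:
  assumes "h \<le> H" "k div B ^ h = k' div B ^ h"
  shows "k mod B ^ H < k' mod B ^ H \<longleftrightarrow> k < k'"
proof -
  have "k = B ^ H * (k div B ^ H) + k mod B ^ H" "k' = B ^ H * (k div B ^ H) + k' mod B ^ H"
    unfolding div_top[OF assms] by simp_all (metis assms div_top mult_div_mod_eq)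
  then show ?thesis by (metis nat_add_left_cancel_less)
qed

lemma inj_low:
  assumes "h \<le> H" "k div B ^ h = k' div B ^ h"
  shows "k mod B ^ H = k' mod B ^ H \<longleftrightarrow> k = k'"
  using less_low[OF assms] less_low[OF assms(1) assms(2)[symmetric]] by (metis nat_neq_iff)

lemma nodeD:
  assumes "nodeI g m" "nd g h p \<noteq> 0"
  shows "h \<le> H" "B + 1 \<le> nd g h p" "nd g h p + B < ne g"
  using assms unfolding nodeI_def by blast+

lemma su_range:
  assumes "nodeI g m" "nd g h (P div B) \<noteq> 0"
  shows "B + 1 < su g h P" "su g h P < ne g"
proof -
  have "P mod B < B" using B_pos by simp
  then show "B + 1 < su g h P" "su g h P < ne g"
    using nodeD[OF assms] unfolding su_def by linarith+
qed

lemma su_inj: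
  assumes "nodeI g m" "nd g h (P div B) \<noteq> 0" "nd g h' (P' div B) \<noteq> 0" "su g h P = su g h' P'"
  shows "h = h' \<and> P = P'"
proof -
  have lt: "P mod B < B" "P' mod B < B" using B_pos by auto
  have "(h, P div B) = (h', P' div B)"
  proof (rule ccontr)
    assume "\<not> ?thesis"
    then have "nd g h (P div B) + B < nd g h' (P' div B) \<or> nd g h' (P' div B) + B < nd g h (P div B)"
      using assms(1-3) unfolding nodeI_def by meson
    then show False using assms(4) lt unfolding su_def by linarith
  qed
  moreover then have "P mod B = P' mod B" using assms(4) by (simp add: su_def)
  ultimately show ?thesis by (metis div_mult_mod_eq prod.inject)
qed

lemma cellD:
  assumes "cellI g m" "c \<in> gC g"
  shows "m c 0 = gK g c mod B ^ H" "B + 1 \<le> c" "c < ce g" "gK g c < 2 * B ^ H" "c \<in> gT g" "c \<in> gP g"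
    "m c 2 = 1 + gK g c div B ^ H"
proof -
  have c: "c \<in> gT g" "c \<in> gP g" "c \<in> {B+1..<ce g}" using assms unfolding cellI_def by blast+
  then show "c \<in> gT g" "c \<in> gP g" "B + 1 \<le> c" "c < ce g" by auto
  show "m c 0 = gK g c mod B ^ H" "gK g c < 2 * B ^ H"
    using c(1) assms(1) unfolding cellI_def by blast+
  have "m c 2 = (if c \<in> gT g then 1 + gK g c div B ^ H else 0)"
    using c(3) assms(1) unfolding cellI_def by blast
  then show "m c 2 = 1 + gK g c div B ^ H" using c(1) by simp
qed

lemma listD:
  assumes "listI g m ov" "nd g h (P div B) \<noteq> 0"
  shows "lst m (su g h P) (ls g h P)"
    "set (ls g h P) = {c \<in> gC g. gh g c = h \<and> gK g c div B ^ h = P}"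
    "distinct (ls g h P)" "sorted_wrt (\<lambda>a b. gK g b \<le> gK g a) (ls g h P)"
  using assms unfolding listI_def by blast+

lemma listI_path:
  assumes "listI g m ov" "c \<in> gC g" "gh g c \<le> h" "h \<le> H"
  shows "nd g h (gK g c div B ^ Suc h) \<noteq> 0"
  using assms unfolding listI_def by blast

lemma listI_order:
  assumes "listI g m ov" "c \<in> gC g" "c' \<in> gC g" "gh g c' < gh g c"
    "gK g c div B ^ gh g c = gK g c' div B ^ gh g c"
  shows "gK g c \<le> gK g c'"
  using assms unfolding listI_def by blast

lemma finite_cells: "cellI g m \<Longrightarrow> finite (gC g)"
  unfolding cellI_def by (meson finite_atLeastLessThan finite_subset)

section \<open>One step of a search\<close>

definition visit :: com where
  "visit = Bin Add 11 7 8 ;; Bin Add 11 11 5 ;; Ld 21 11 6 ;; Ld 22 11 3 ;; Imm 23 0 ;;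
     If (Eq 21 4) Skip
      (If (Eq 22 4) (Imm 23 1) (Ld 24 22 0 ;; If (Lt 24 9) (Imm 23 1) Skip))"

text \<open>At positive height register 10 is \<open>B ^ (h - 1)\<close>, exactly the divisor that
  exposes the next digit; it is divided by \<open>B\<close> only afterwards.\<close>

definition descend :: com where
  "descend = Bin Add 7 21 4 ;; Bin Div 24 9 10 ;; Bin Mod 8 24 6 ;; Bin Div 10 10 6"

definition child :: "ghost \<Rightarrow> nat \<Rightarrow> nat \<Rightarrow> nat" where
  "child g h P = (if h = 0 then 0 else nd g (h - 1) P)"

text \<open>By the heap order nothing below the slot is smaller than the head of its list, so a head
  not below \<open>k\<close> ends the search. A head below \<open>k\<close> means that the entire
  list is below \<open>k\<close>.\<close>

definition goes_down :: "ghost \<Rightarrow> nat \<Rightarrow> nat \<Rightarrow> bool" where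
  "goes_down g h k \<longleftrightarrow> child g h (k div B ^ h) \<noteq> 0 \<and>
     (ls g h (k div B ^ h) = [] \<or> gK g (hd (ls g h (k div B ^ h))) < k)"

lemma wp_visit:
  assumes I: "nodeI g m" "listI g m ov" "cellI g m" and a: "pos g h k R"
    and n: "nd g h (k div B ^ Suc h) \<noteq> 0" and b: "ne g \<le> L" "ce g \<le> L"
    and Q: "\<And>t' R'. t' \<le> t + 40 \<Longrightarrow> same_regs {11, 21, 22, 23, 24} R R' \<Longrightarrow>
      R' 11 = su g h (k div B ^ h) \<Longrightarrow> R' 21 = child g h (k div B ^ h) \<Longrightarrow>
      R' 22 = hd0 (ls g h (k div B ^ h)) \<Longrightarrow> R' 23 = (if goes_down g h k then 1 else 0) \<Longrightarrow>
      Q t' R' m"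
  shows "wp w L visit Q t R m"
proof -
  let ?P = "k div B ^ h" and ?q = "su g h (k div B ^ h)" and ?xs = "ls g h (k div B ^ h)"
  have n': "nd g h (?P div B) \<noteq> 0" using n by (simp add: div_Suc)
  have q: "?q = Suc (R 7 + R 8)" using a by (simp add: su_key pos_def)
  have qL: "?q < L" "?q < 2 ^ w" "R 7 + R 8 < 2 ^ w"
    using su_range(2)[OF I(1) n'] b small(1) q by auto
  have 6: "m ?q 6 = child g h ?P" using I(1) n' by (simp add: nodeI_def child_def)
  have 3: "m ?q 3 = hd0 ?xs" using listD(1)[OF I(2) n'] by (simp add: lst_def)
  have cs: "set ?xs = {c \<in> gC g. gh g c = h \<and> gK g c div B ^ h = ?P}"
    using listD(2)[OF I(2) n'] .
  have c: "R 4 = 0" "R 5 = 1" "R 6 = B" "R 9 = k mod B ^ H" using a by (auto simp: pos_def cregs_def)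
  have hd: "0 < hd ?xs \<and> hd ?xs < L \<and> (m (hd ?xs) 0 < R 9 \<longleftrightarrow> gK g (hd ?xs) < k)" if "?xs \<noteq> []"
  proof -
    have "hd ?xs \<in> set ?xs" using that by simp
    then have h: "hd ?xs \<in> gC g" "gK g (hd ?xs) div B ^ h = ?P" using cs by auto
    show ?thesis
      using cellD(1-3)[OF I(3) h(1)] less_low[OF nodeD(1)[OF I(1) n] h(2)] b c by auto
  qed
  have w1: "1 < (2::nat) ^ w" using small(1) L1 by linarith
  show ?thesis
  proof (cases "child g h ?P = 0")
    case True
    then show ?thesis
      unfolding visit_def using qL w1 q[symmetric]
      by (simp add: c 6 3 q[symmetric] qL) (rule Q; simp add: same_regs_def goes_down_def q)
  next
    case ch: False
    show ?thesis
    proof (cases "?xs")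
      case Nil
      then show ?thesis
        unfolding visit_def using qL w1 q[symmetric] ch
        by (simp add: c 6 3 q[symmetric] qL) (rule Q; simp add: same_regs_def goes_down_def q)
    next
      case (Cons x xs)
      then show ?thesis
        unfolding visit_def using qL w1 q[symmetric] ch hd
        by (simp add: c 6 3 q[symmetric] qL) (intro conjI impI Q; simp add: same_regs_def goes_down_def q)
    qed
  qed
qed

lemma wp_descend:
  assumes a: "pos g h k R" and h: "0 < h" "h \<le> H" and c: "R 21 = nd g (h - 1) (k div B ^ h)"
    and b: "R 21 < L"
    and Q: "\<And>t' R'. t' \<le> t + 4 \<Longrightarrow> same_regs {7, 8, 10, 24} R R' \<Longrightarrow> pos g (h - 1) k R' \<Longrightarrow> Q t' R' m"
  shows "wp w L descend Q t R m"
proof -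
  have "R 21 < 2 ^ w" using b small(1) by simp
  moreover have "B ^ h div B = B ^ (h - 1)" using h B_pos by (cases h) auto
  moreover have "(k mod B ^ H) div B ^ (h - 1) mod B = k div B ^ (h - 1) mod B"
    using h by (intro digit_low) auto
  ultimately show ?thesis
    unfolding descend_def using a c h
    by (simp add: pos_def cregs_def) (rule Q; simp add: same_regs_def pos_def cregs_def)
qed


subsection \<open>Rank queries\<close>

definition scan_com :: com where
  "scan_com = Until (Eq 22 4) (Ld 24 22 0 ;; If (Lt 24 9) (Bin Add 26 26 5) Skip ;; Ld 22 22 1)"

definition rank_com :: com where
  "rank_com = Ld 7 4 5 ;; Ld 10 4 1 ;; Imm 23 1 ;;
     Until (Eq 23 4)
       (pre_com ;; visit ;; If (Eq 23 4) Skip (Ld 25 11 5 ;; Bin Add 26 26 25 ;; descend)) ;;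
     If (Eq 10 4) Skip scan_com"

lemma size_KMr: "finite (gC g) \<Longrightarrow>
    size {#v \<in># KMr g h. p v#} = card {c \<in> gC g. gh g c \<le> h \<and> p (gK g c)}"
  unfolding KMr_def by (subst size_filter_image) auto

lemma prefix_less_iff: "v div B ^ h \<noteq> k div B ^ h \<Longrightarrow> v < k \<longleftrightarrow> v div B ^ h < k div B ^ h"
  by (metis div_le_mono le_less not_le order.strict_iff_order)

text \<open>Inside one node the order is decided by the digit at height \<open>h\<close>, unless the
  digits agree.\<close>

lemma node_less:
  "v div B ^ Suc h = k div B ^ Suc h \<and> v < k \<longleftrightarrow>
    (k div B ^ Suc h * B \<le> v div B ^ h \<and> v div B ^ h < k div B ^ Suc h * B + k div B ^ h mod B) \<or>
    (v div B ^ h = k div B ^ h \<and> v < k)"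
proof -
  have e: "k div B ^ Suc h * B + k div B ^ h mod B = k div B ^ h"
    by (metis div_Suc div_mult_mod_eq)
  have s: "v div B ^ Suc h = k div B ^ Suc h \<longleftrightarrow>
      k div B ^ Suc h * B \<le> v div B ^ h \<and> v div B ^ h < k div B ^ Suc h * B + B"
  proof -
    have "k div B ^ Suc h * B \<le> v div B ^ h \<longleftrightarrow> k div B ^ Suc h \<le> v div B ^ h div B"
      using B_pos by (simp add: less_eq_div_iff_mult_less_eq)
    moreover have "v div B ^ h < k div B ^ Suc h * B + B \<longleftrightarrow> v div B ^ h div B < Suc (k div B ^ Suc h)"
      using B_pos by (subst div_less_iff_less_mult) (auto simp: algebra_simps)
    ultimately show ?thesis unfolding div_Suc by auto
  qed
  have l: "k div B ^ h < k div B ^ Suc h * B + B"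
    using e mod_less_divisor[OF B_pos, of "k div B ^ h"] by linarith
  have g: "k div B ^ Suc h * B \<le> k div B ^ h" using e by linarith
  show ?thesis
  proof (cases "v div B ^ h = k div B ^ h")
    case True
    then show ?thesis unfolding e s using l g by auto
  next
    case False
    then show ?thesis unfolding e s using l prefix_less_iff[OF False] by auto
  qed
qed

text \<open>The first summand is what the node stores for the digit of \<open>k\<close>; the second
  is left to the slot on the path.\<close>

lemma rank_split:
  assumes fin: "finite (gC g)"
  shows "size {#v \<in># KMr g h. v div B ^ Suc h = k div B ^ Suc h \<and> v < k#} =
    cntF (KMr g h) h (k div B ^ Suc h) (k div B ^ h mod B) +
    size {#v \<in># KMr g h. v div B ^ h = k div B ^ h \<and> v < k#}"
proof -
  have e: "k div B ^ Suc h * B + k div B ^ h mod B = k div B ^ h"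
    by (metis div_Suc div_mult_mod_eq)
  have "{c \<in> gC g. gh g c \<le> h \<and> gK g c div B ^ Suc h = k div B ^ Suc h \<and> gK g c < k} =
     {c \<in> gC g. gh g c \<le> h \<and> k div B ^ Suc h * B \<le> gK g c div B ^ h \<and>
        gK g c div B ^ h < k div B ^ Suc h * B + k div B ^ h mod B} \<union>
     {c \<in> gC g. gh g c \<le> h \<and> gK g c div B ^ h = k div B ^ h \<and> gK g c < k}"
    using node_less by blast
  then show ?thesis
    unfolding cntF_def size_KMr[OF fin]
    by (simp only:) (rule card_Un_disjoint; use fin e in auto)
qed

text \<open>When the search stops here, deeper cells are at least the head of the list, and the head
  is at least \<open>k\<close>; only the list can contribute.\<close>

lemma rank_slot:
  assumes I: "nodeI g m" "listI g m ov" "cellI g m" and n: "nd g h (k div B ^ Suc h) \<noteq> 0"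
  shows "size {#v \<in># KMr g h. v div B ^ h = k div B ^ h \<and> v < k#} =
    length (filter (\<lambda>c. gK g c < k) (ls g h (k div B ^ h))) +
    (if goes_down g h k then
       size {#v \<in># KMr g (h - 1). v div B ^ h = k div B ^ h \<and> v < k#} else 0)"
proof -
  let ?P = "k div B ^ h"
  let ?xs = "ls g h ?P"
  let ?D = "{c \<in> gC g. gh g c < h \<and> gK g c div B ^ h = ?P \<and> gK g c < k}"
  have fin: "finite (gC g)" using finite_cells I by blast
  have n': "nd g h (?P div B) \<noteq> 0" using n by (simp add: div_Suc)
  have cs: "set ?xs = {c \<in> gC g. gh g c = h \<and> gK g c div B ^ h = ?P}" and d: "distinct ?xs"
    and srt: "sorted_wrt (\<lambda>a b. gK g b \<le> gK g a) ?xs"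
    using listD[OF I(2) n'] by blast+
  have "length (filter (\<lambda>c. gK g c < k) ?xs) = card {c \<in> set ?xs. gK g c < k}"
    using d distinct_card[of "filter (\<lambda>c. gK g c < k) ?xs"] by simp
  also have "\<dots> = card {c \<in> gC g. gh g c = h \<and> gK g c div B ^ h = ?P \<and> gK g c < k}"
    unfolding cs by (rule arg_cong[of _ _ card]) auto
  finally have len: "length (filter (\<lambda>c. gK g c < k) ?xs) =
      card {c \<in> gC g. gh g c = h \<and> gK g c div B ^ h = ?P \<and> gK g c < k}" .
  have "{c \<in> gC g. gh g c \<le> h \<and> gK g c div B ^ h = ?P \<and> gK g c < k} =
      {c \<in> gC g. gh g c = h \<and> gK g c div B ^ h = ?P \<and> gK g c < k} \<union> ?D" by auto
  then have 1: "size {#v \<in># KMr g h. v div B ^ h = ?P \<and> v < k#} =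
      length (filter (\<lambda>c. gK g c < k) ?xs) + card ?D"
    unfolding size_KMr[OF fin] len by (simp only:) (rule card_Un_disjoint; use fin in auto)
  have "card ?D = (if goes_down g h k then
       size {#v \<in># KMr g (h - 1). v div B ^ h = k div B ^ h \<and> v < k#} else 0)"
  proof (cases "goes_down g h k")
    case True
    then have "0 < h" by (cases h) (auto simp: goes_down_def child_def)
    then have "gh g c < h \<longleftrightarrow> gh g c \<le> h - 1" for c by auto
    then show ?thesis using True by (simp add: size_KMr[OF fin])
  next
    case False
    \<comment> \<open>A smaller cell further down would force a child to exist and, by the heap
      order, a head below \<open>k\<close>.\<close>
    have "?D = {}"
    proof (rule ccontr)
      assume "?D \<noteq> {}"
      then obtain c where c: "c \<in> gC g" "gh g c < h" "gK g c div B ^ h = ?P" "gK g c < k" by blast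
      have "nd g (h - 1) (gK g c div B ^ Suc (h - 1)) \<noteq> 0"
        using listI_path[OF I(2) c(1), of "h - 1"] c(2) nodeD(1)[OF I(1) n] by simp
      then have ch: "child g h ?P \<noteq> 0" using c(2,3) by (cases h) (auto simp: child_def)
      then have xs: "?xs \<noteq> []" "k \<le> gK g (hd ?xs)" using False by (auto simp: goes_down_def)
      then have "hd ?xs \<in> set ?xs" by simp
      then have "hd ?xs \<in> gC g" "gh g (hd ?xs) = h" "gK g (hd ?xs) div B ^ h = ?P" using cs by auto
      then have "gK g (hd ?xs) \<le> gK g c" using listI_order[OF I(2) _ c(1)] c by simp
      then show False using xs c by simp
    qed
    then show ?thesis using False by (simp only: card.empty if_False)
  qed
  then show ?thesis using 1 by simp
qed

lemma chain_append: "chain m (xs @ ys) \<Longrightarrow> chain m ys"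
  by (induction xs) auto

lemma sorted_hd_less:
  assumes "sorted_wrt (\<lambda>a b. gK g b \<le> gK g a) xs" "xs = [] \<or> gK g (hd xs) < k"
  shows "filter (\<lambda>c. gK g c < k) xs = xs"
  using assms by (cases xs) (auto simp: filter_id_conv)

text \<open>The predicate \<open>P\<close> hides the comparison of words, so the loop is verified
  without virtual keys.\<close>

lemma wp_scan:
  assumes xs: "chain m xs" "\<forall>c\<in>set xs. 0 < c \<and> c < L \<and> (m c 0 < R 9 \<longleftrightarrow> P c)"
    and R: "R 22 = hd0 xs" "R 4 = 0" "R 5 = 1" and b: "R 26 + length xs < 2 ^ w"
    and Q: "\<And>t' R'. t' \<le> t + 20 * length xs + 1 \<Longrightarrow> same_regs {22, 24, 26} R R' \<Longrightarrow>
      R' 26 = R 26 + length (filter P xs) \<Longrightarrow> Q t' R' m"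
  shows "wp w L scan_com Q t R m"
proof -
  define I where "I = (\<lambda>n t' R' m'. m' = m \<and> same_regs {22, 24, 26} R R' \<and>
      (\<exists>ys zs. xs = zs @ ys \<and> n = length ys \<and>
      R' 22 = hd0 ys \<and> t' \<le> t + 20 * length zs \<and> R' 26 = R 26 + length (filter P zs)))"
  have Il: "I n t' R' m' \<Longrightarrow> m' = m \<and> same_regs {22, 24, 26} R R' \<and>
      (\<exists>ys zs. xs = zs @ ys \<and> n = length ys \<and>
      R' 22 = hd0 ys \<and> t' \<le> t + 20 * length zs \<and> R' 26 = R 26 + length (filter P zs))" for n t' R' m'
    by (simp add: I_def)
  show ?thesis
    unfolding scan_com_def
  proof (rule wp_Until[where I = I and n = "length xs"])
    show "I (length xs) t R m"
      unfolding I_def using R by (intro conjI exI[of _ xs] exI[of _ "[]"]) (auto simp: same_regs_def)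
  next
    fix n t1 R1 m1
    assume I: "I n t1 R1 m1" and nb: "\<not> bval (Eq 22 4) R1"
    obtain ys zs where 1: "xs = zs @ ys" "n = length ys" "R1 22 = hd0 ys" "t1 \<le> t + 20 * length zs"
      "R1 26 = R 26 + length (filter P zs)" "m1 = m" and s: "same_regs {22, 24, 26} R R1"
      using Il[OF I] by blast
    have r: "R1 4 = 0" "R1 5 = 1" "R1 9 = R 9" using s R by (auto simp: same_regs_def)
    obtain c cs where ys: "ys = c # cs" using 1(3) nb r by (cases ys) auto
    have c: "0 < c" "c < L" "m c 0 < R 9 \<longleftrightarrow> P c" using xs(2) 1(1) ys by auto
    have n: "m c (Suc 0) = hd0 cs" using chain_append[of m zs ys] xs(1) 1(1) ys by simp
    have "length xs = length zs + length cs + 1" using 1(1) ys by simp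
    then have l: "R1 26 + 1 < 2 ^ w"
      using 1(5) b length_filter_le[of P zs] by linarith
    have ind: "\<exists>n'<n. I n' t' R' m" if "t' \<le> t1 + 19" "same_regs {22, 24, 26} R1 R'"
      "R' 22 = hd0 cs" "R' 26 = R1 26 + (if P c then 1 else 0)" for t' R'
      unfolding I_def using that 1 ys s
      by (intro exI[of _ "length cs"] conjI exI[of _ cs] exI[of _ "zs @ [c]"]) (auto simp: same_regs_def)
    have c22: "R1 22 = c" using 1(3) ys by simp
    show "wp w L (Ld 24 22 0 ;; If (Lt 24 9) (Bin Add 26 26 5) Skip ;; Ld 22 22 1)
      (\<lambda>t' R' m'. \<exists>n'<n. I n' (t' + 1) R' m') (t1 + 1) R1 m1"
      using l c(2)
      by (simp add: c22 r 1(6) c(3) n) (intro conjI impI ind; simp add: same_regs_def)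
  next
    fix n t1 R1 m1
    assume I: "I n t1 R1 m1" and nb: "bval (Eq 22 4) R1"
    obtain ys zs where 1: "xs = zs @ ys" "R1 22 = hd0 ys" "t1 \<le> t + 20 * length zs"
      "R1 26 = R 26 + length (filter P zs)" "m1 = m" and s: "same_regs {22, 24, 26} R R1"
      using Il[OF I] by blast
    have "R1 4 = 0" using s R by (auto simp: same_regs_def)
    then have "ys = []" using 1(1,2) nb xs(2) by (cases ys) auto
    then show "Q (t1 + 1) R1 m1" using Q[of "t1 + 1" R1] 1 s by auto
  qed
qed

text \<open>At the root the digit is the tag, which is below \<open>B\<close> because there are two
  tags and \<open>2 \<le> B\<close>; the prefix above it is 0.\<close>

lemma pos_start:
  assumes "table m" "cregs R" "R 8 = k div B ^ H" "R 9 = k mod B ^ H" "k < 2 * B ^ H" "nd g H 0 = B + 1"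
    "R' = R(7 := m 0 5, 10 := m 0 1) \<or> same_regs {7, 10} R R' \<and> R' 7 = m 0 5 \<and> R' 10 = m 0 1"
  shows "pos g H k R'" "k div B ^ Suc H = 0"
proof -
  have "k div B ^ H < 2" using assms(5) by (simp add: less_mult_imp_div_less mult.commute)
  then have d: "k div B ^ H mod B = k div B ^ H" "k div B ^ Suc H = 0"
    using B2 unfolding div_Suc[symmetric] by simp_all
  have "B ^ H div B = B ^ (H - 1)" using H1 B_pos by (cases H) auto
  then show "pos g H k R'"
    using assms d by (auto simp: pos_def cregs_def table_def same_regs_def)
  show "k div B ^ Suc H = 0" by (rule d)
qed

lemma card_gC_less: "cellI g m \<Longrightarrow> card (gC g) < ce g"
proof -
  assume I: "cellI g m"
  then have "card (gC g) \<le> card {B+1..<ce g}" unfolding cellI_def by (intro card_mono) auto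
  then show ?thesis using I by (auto simp: cellI_def)
qed

lemma card_le_gC: "cellI g m \<Longrightarrow> card {c \<in> gC g. p c} < ce g"
  using card_gC_less card_mono[OF finite_cells, of g m "{c \<in> gC g. p c}"] by fastforce

lemma cntF_less: "cellI g m \<Longrightarrow> cntF (KMr g h) h' p j < ce g"
  unfolding cntF_def by (subst size_KMr) (auto intro: finite_cells card_le_gC)

text \<open>A constant amount of work per level and one scan of a list of at most \<open>B\<close>
  cells.\<close>

lemma wp_rank:
  assumes inv: "inv g m None (KMr g)" and R: "cregs R" "R 8 = k div B ^ H" "R 9 = k mod B ^ H"
    and k: "k < 2 * B ^ H" and b: "ne g \<le> L" "ce g \<le> L" "R 26 + 2 * L < 2 ^ w"
    and Q: "\<And>t' R'. t' \<le> t + 200 * (H + B + 1) \<Longrightarrow> same_regs {7..26} R R' \<Longrightarrow> R' 9 = R 9 \<Longrightarrow>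
      R' 26 = R 26 + size {#v \<in># keys g. v < k#} \<Longrightarrow> Q t' R' m"
  shows "wp w L rank_com Q t R m"
proof -
  have I: "nodeI g m" "listI g m None" "cellI g m" and tab: "table m" and cI: "countI g m (KMr g)"
    using inv by (auto simp: inv_def memI_def)
  have fin: "finite (gC g)" using finite_cells I by blast
  define rk where "rk = size {#v \<in># keys g. v < k#}"
  define a where "a = R 26"
  have rkL: "rk < L" unfolding rk_def keys_def
    using card_le_gC[OF I(3), of "\<lambda>c. gK g c < k"] b(2) by (simp add: size_filter_image[OF fin])
  \<comment> \<open>The accumulator plus the number of smaller keys counted at the current node
    equals the final rank.\<close>
  define J1 where "J1 = (\<lambda>n t' (R' :: regs). R' 23 = 1 \<and> (\<exists>h\<le>H. n = Suc h \<and> pos g h k R' \<and>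
      nd g h (k div B ^ Suc h) \<noteq> 0 \<and> t' \<le> t + 20 + 150 * (H - h) \<and>
      R' 26 + size {#v \<in># KMr g h. v div B ^ Suc h = k div B ^ Suc h \<and> v < k#} = a + rk))"
  \<comment> \<open>The search has ended: only the list of the last slot remains to be
    counted.\<close>
  define J2 where "J2 = (\<lambda>(n::nat) t' (R' :: regs). R' 23 = 0 \<and> n = 0 \<and> (\<exists>h\<le>H. nd g h (k div B ^ Suc h) \<noteq> 0 \<and>
      R' 10 = B ^ h div B \<and> R' 22 = hd0 (ls g h (k div B ^ h)) \<and> t' \<le> t + 20 + 150 * (H + 1) \<and>
      R' 26 + length (filter (\<lambda>c. gK g c < k) (ls g h (k div B ^ h))) = a + rk))"
  let ?X = "{7, 8} \<union> {10..26}"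
  define J where "J = (\<lambda>n t' R' m'. m' = m \<and> same_regs ?X R R' \<and> (J1 n t' R' \<or> J2 n t' R'))"
  have scan: "wp w L (If (Eq 10 4) Skip scan_com) Q (t' + 1) R' m"
    if S: "same_regs ?X R R'" and J: "J2 n t' R'" for n t' R'
  proof -
    obtain h where h: "h \<le> H" "nd g h (k div B ^ Suc h) \<noteq> 0" "R' 10 = B ^ h div B"
       "R' 22 = hd0 (ls g h (k div B ^ h))" "t' \<le> t + 20 + 150 * (H + 1)"
       "R' 26 + length (filter (\<lambda>c. gK g c < k) (ls g h (k div B ^ h))) = a + rk"
      using J unfolding J2_def by blast
    let ?xs = "ls g h (k div B ^ h)"
    have n': "nd g h (k div B ^ h div B) \<noteq> 0" using h by (simp add: div_Suc)
    have c: "R' 4 = 0" "R' 5 = 1" "R' 9 = k mod B ^ H" using S R by (auto simp: same_regs_def cregs_def)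
    have cs: "set ?xs = {c \<in> gC g. gh g c = h \<and> gK g c div B ^ h = k div B ^ h}"
      using listD(2)[OF I(2) n'] .
    have S': "same_regs {7..26} R R' \<and> R' 9 = R 9" using S by (auto simp: same_regs_def)
    show ?thesis
    \<comment> \<open>At the bottom every key of the slot equals \<open>k\<close>, so nothing is
      left to count; skipping the scan matters, as this list may be long.\<close>
    proof (cases "h = 0")
      case True
      then have "filter (\<lambda>c. gK g c < k) ?xs = []" using cs by (auto simp: filter_empty_conv)
      then have "R' 26 = a + rk" using h(6) by simp
      then have "Q (t' + 1 + 1) R' m" using h(5) S' by (intro Q) (auto simp: a_def rk_def)
      then show ?thesis using True h(3) B2 c by simp
    next
      case False
      then have ne0: "R' 10 \<noteq> 0" using h(3) B_pos by (cases h) auto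
      have len: "length ?xs \<le> B" using I(2) n' False unfolding listI_def by fastforce
      have chn: "chain m ?xs" using listD(1)[OF I(2) n'] by (simp add: lst_def)
      have el: "\<forall>c\<in>set ?xs. 0 < c \<and> c < L \<and> (m c 0 < R' 9 \<longleftrightarrow> gK g c < k)"
      proof
        fix x assume "x \<in> set ?xs"
        then have x: "x \<in> gC g" "gK g x div B ^ h = k div B ^ h" using cs by auto
        show "0 < x \<and> x < L \<and> (m x 0 < R' 9 \<longleftrightarrow> gK g x < k)"
          using cellD(1-3)[OF I(3) x(1)] less_low[OF h(1) x(2)] b(2) c by auto
      qed
      have bb: "R' 26 + length ?xs < 2 ^ w" using h(6) len rkL b(3) L1 L2 by (simp add: a_def)
      have Q2: "Q (t2 + 1) R2 m" if "t2 \<le> t' + 1 + 1 + 20 * length ?xs + 1" "same_regs {22, 24, 26} R' R2"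
        "R2 26 = R' 26 + length (filter (\<lambda>c. gK g c < k) ?xs)" for t2 R2
        using that len h(5,6) S' by (intro Q) (auto simp: a_def rk_def same_regs_def)
      have "wp w L scan_com (\<lambda>t. Q (t + 1)) (t' + 1 + 1) R' m"
        by (rule wp_scan[OF chn el h(4) c(1,2) bb]) (rule Q2)
      then show ?thesis using ne0 c(1) by simp
    qed
  qed
  have loop: "wp w L (Until (Eq 23 4)
       (pre_com ;; visit ;; If (Eq 23 4) Skip (Ld 25 11 5 ;; Bin Add 26 26 25 ;; descend)))
      (wp w L (If (Eq 10 4) Skip scan_com) Q) t' R' m"
    if J0: "J (Suc H) t' R' m" for t' R'
  proof (rule wp_Until[where I = J, OF J0])
    fix n t1 R1 m1
    assume J: "J n t1 R1 m1" and nb: "\<not> bval (Eq 23 4) R1"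
    have S1: "same_regs ?X R R1" and m1: "m1 = m" using J by (auto simp: J_def)
    have c1: "R1 4 = 0" "R1 5 = 1" "R1 6 = B" using S1 R(1) by (auto simp: same_regs_def cregs_def)
    have "J1 n t1 R1" using J nb c1 by (auto simp: J_def J2_def)
    then obtain h where h: "h \<le> H" "n = Suc h" "pos g h k R1" "nd g h (k div B ^ Suc h) \<noteq> 0"
       "t1 \<le> t + 20 + 150 * (H - h)"
       "R1 26 + size {#v \<in># KMr g h. v div B ^ Suc h = k div B ^ Suc h \<and> v < k#} = a + rk"
      unfolding J1_def by blast
    let ?P = "k div B ^ h" and ?p = "k div B ^ Suc h"
    let ?xs = "ls g h ?P"
    define F where "F = cntF (KMr g h) h ?p"
    have cn: "counts m (nd g h ?p) F" using cI h(4) by (simp add: countI_def F_def)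
    have sp: "R1 26 + (F (?P mod B) + (length (filter (\<lambda>c. gK g c < k) ?xs) +
       (if goes_down g h k then size {#v \<in># KMr g (h - 1). v div B ^ h = ?P \<and> v < k#} else 0))) = a + rk"
      using h(6) rank_split[OF fin, of h k] rank_slot[OF I h(4)] by (simp only: F_def)
    have Fb: "F j + B < 2 ^ w" for j
      using cntF_less[OF I(3), of h h ?p j] b(2) L1 L2 by (simp add: F_def)
    have nb': "B < nd g h ?p" "nd g h ?p + B < L" using nodeD[OF I(1) h(4)] b(1) by auto
    show "wp w L (pre_com ;; visit ;; If (Eq 23 4) Skip (Ld 25 11 5 ;; Bin Add 26 26 25 ;; descend))
      (\<lambda>t R m. \<exists>n'<n. J n' (t + 1) R m) (t1 + 1) R1 m1"
      unfolding wp_Seq m1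
    proof (rule wp_pre[where p = "nd g h ?p" and j = "?P mod B", OF _ _ _ _ nb' tab cn Fb])
      show "cregs R1" "R1 7 = nd g h ?p" "R1 8 = ?P mod B" using h(3) by (auto simp: pos_def)
      show "?P mod B < B" using B_pos by simp
      show "R1 26 + F (?P mod B) < 2 ^ w" using sp rkL b(3) by (simp add: a_def)
    next
      fix t2 R2
      assume 2: "t2 \<le> t1 + 1 + 40" "same_regs ({11..19} \<union> {26}) R1 R2" "R2 26 = R1 26 + F (?P mod B)"
      have p2: "pos g h k R2" using h(3) 2(2) by (auto simp: pos_def cregs_def same_regs_def)
      show "wp w L visit (wp w L (If (Eq 23 4) Skip (Ld 25 11 5 ;; Bin Add 26 26 25 ;; descend))
         (\<lambda>t R m. \<exists>n'<n. J n' (t + 1) R m)) t2 R2 m"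
      proof (rule wp_visit[OF I p2 h(4) b(1,2)])
        fix t3 R3
        assume 3: "t3 \<le> t2 + 40" "same_regs {11, 21, 22, 23, 24} R2 R3" "R3 11 = su g h ?P"
          "R3 21 = child g h ?P" "R3 22 = hd0 ?xs" "R3 23 = (if goes_down g h k then 1 else 0)"
        have p3: "pos g h k R3" using p2 3(2) by (auto simp: pos_def cregs_def same_regs_def)
        have S3: "same_regs ?X R R3" using S1 2(2) 3(2) by (auto simp: same_regs_def)
        have 26: "R3 26 = R1 26 + F (?P mod B)" using 2 3 by (simp add: same_regs_def)
        have c3: "R3 4 = 0" using p3 by (simp add: pos_def cregs_def)
        have n': "nd g h (?P div B) \<noteq> 0" using h by (simp add: div_Suc)
        show "wp w L (If (Eq 23 4) Skip (Ld 25 11 5 ;; Bin Add 26 26 25 ;; descend))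
          (\<lambda>t R m. \<exists>n'<n. J n' (t + 1) R m) t3 R3 m"
        proof (cases "goes_down g h k")
          case False
          have "J2 0 (t3 + 2) R3"
            unfolding J2_def using False 3 h p3 26 sp 2(1) by (auto simp: pos_def intro!: exI[of _ h])
          then have "\<exists>n'<n. J n' (t3 + 2) R3 m" using S3 h(2) by (auto simp: J_def)
          then show ?thesis using False 3(6) c3 by simp
        next
          case True
          have h0: "0 < h" using True by (cases h) (auto simp: goes_down_def child_def)
          have ch: "R3 21 = nd g (h - 1) ?P" "nd g (h - 1) ?P \<noteq> 0"
            using 3(4) h0 True by (auto simp: child_def goes_down_def)
          have len: "m (su g h ?P) 5 = length ?xs" using listD(1)[OF I(2) n'] by (simp add: lst_def)
          \<comment> \<open>The head is the maximum of the list and lies below \<open>k\<close>, so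
            the stored length counts every cell.\<close>
          have "filter (\<lambda>c. gK g c < k) ?xs = ?xs"
            using listD(4)[OF I(2) n'] True by (intro sorted_hd_less) (auto simp: goes_down_def)
          then have sp': "R3 26 + length ?xs + size {#v \<in># KMr g (h - 1). v div B ^ h = ?P \<and> v < k#} = a + rk"
            using sp True 26 by simp
          have suL: "su g h ?P < L" using su_range[OF I(1) n'] b(1) by simp
          let ?R = "R3(25 := length ?xs, 26 := R3 26 + length ?xs)"
          have p4: "pos g h k ?R" using p3 by (auto simp: pos_def cregs_def)
          have fin2: "wp w L descend (\<lambda>t R m. \<exists>n'<n. J n' (t + 1 + 1) R m) (t3 + 1 + 5 + 1) ?R m"
          proof (rule wp_descend[OF p4 h0 h(1)])
            show "?R 21 = nd g (h - 1) ?P" using ch by simp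
            show "?R 21 < L" using ch nodeD(3)[OF I(1) ch(2)] b(1) by simp
            fix t5 R5
            assume 5: "t5 \<le> t3 + 1 + 5 + 1 + 4" "same_regs {7, 8, 10, 24} ?R R5" "pos g (h - 1) k R5"
            have "J1 h (t5 + 1 + 1) R5"
              unfolding J1_def
            proof (intro conjI exI[of _ "h - 1"])
              show "R5 23 = 1" using 5(2) 3(6) True by (simp add: same_regs_def)
              show "t5 + 1 + 1 \<le> t + 20 + 150 * (H - (h - 1))"
                using 5(1) 3(1) 2(1) h(1,5) h0 by simp
              show "R5 26 + size {#v \<in># KMr g (h - 1). v div B ^ Suc (h - 1) = k div B ^ Suc (h - 1) \<and> v < k#} = a + rk"
                using 5(2) sp' h0 by (simp add: same_regs_def)
            qed (use h h0 ch 5(3) in auto)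
            moreover have "same_regs ?X R R5" using S3 5(2) by (auto simp: same_regs_def)
            ultimately show "\<exists>n'<n. J n' (t5 + 1 + 1) R5 m" using h(2) by (auto simp: J_def)
          qed
          have "R3 26 + length ?xs < 2 ^ w" using sp' rkL b(3) by (simp add: a_def)
          then show ?thesis using 3(3,6) True c3 suL len fin2 by simp
        qed
      qed
    qed
  next
    fix n t1 R1 m1
    assume J: "J n t1 R1 m1" and nb: "bval (Eq 23 4) R1"
    have S1: "same_regs ?X R R1" and m1: "m1 = m" using J by (auto simp: J_def)
    have "R1 4 = 0" using S1 R(1) by (auto simp: same_regs_def cregs_def)
    then have "J2 n t1 R1" using J nb by (auto simp: J_def J1_def)
    then show "wp w L (If (Eq 10 4) Skip scan_com) Q (t1 + 1) R1 m1"
      using scan[OF S1] m1 by blast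
  qed
  have st: "J (Suc H) (11 + t) (R(7 := m 0 5, 10 := m 0 1, 23 := 1)) m"
  proof -
    let ?R = "R(7 := m 0 5, 10 := m 0 1, 23 := 1)"
    have p: "pos g H k ?R" and z: "k div B ^ Suc H = 0"
      using pos_start[OF tab R k, of g "R(7 := m 0 5, 10 := m 0 1)"] I(1)
      by (auto simp: nodeI_def pos_def cregs_def)
    have "{c \<in> gC g. gh g c \<le> H} = gC g" using I(2) by (auto simp: listI_def)
    then have K: "KMr g H = keys g" by (simp add: KMr_def keys_def)
    have z': "v div B ^ Suc H = 0" if "v \<in># keys g" for v
    proof -
      have "v < 2 * B ^ H" using that cellD(4)[OF I(3)] fin by (auto simp: keys_def)
      then show ?thesis using pos_start(2)[OF tab _ _ _ _ _ disjI1[OF refl], of "R(8 := v div B ^ H, 9 := v mod B ^ H)" v g] R(1) I(1)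
        by (auto simp: nodeI_def cregs_def)
    qed
    have "size {#v \<in># KMr g H. v div B ^ Suc H = k div B ^ Suc H \<and> v < k#} = rk"
      unfolding K rk_def z using z' by (intro arg_cong[of _ _ size] filter_mset_cong) auto
    then have "J1 (Suc H) (11 + t) ?R"
      unfolding J1_def using p z I(1) by (auto simp: nodeI_def a_def)
    then show ?thesis by (auto simp: J_def same_regs_def)
  qed
  have "(1::nat) < 2 ^ w" using small(1) L1 by linarith
  then show ?thesis
    unfolding rank_com_def wp_Seq using L1 R(1) loop[OF st] by (simp add: cregs_def del: wp_If)
qed

end

subsection \<open>Preservation of the invariant\<close>

lemma chain_cong: "\<forall>x\<in>set xs. m' x 1 = m x 1 \<Longrightarrow> chain m' xs = chain m xs"
  by (induction xs) auto

lemma chain_insert: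
  assumes "chain m (as @ bs)" "y \<notin> set (as @ bs)" "distinct (as @ bs)" "m' y 1 = hd0 bs"
    "as \<noteq> [] \<longrightarrow> m' (last as) 1 = y"
    "\<forall>x\<in>set (as @ bs). as = [] \<or> x \<noteq> last as \<longrightarrow> m' x 1 = m x 1"
  shows "chain m' (as @ y # bs)"
  using assms
proof (induction as)
  case Nil
  then show ?case using chain_cong[of bs m' m] by simp
next
  case (Cons a as)
  have "chain m' (as @ y # bs)"
    using Cons.prems by (intro Cons.IH) (auto split: if_splits)
  moreover have "m' a 1 = hd0 (as @ y # bs)"
    using Cons.prems by (cases as) (auto split: if_splits)
  ultimately show ?case by simp
qed

lemma chain_remove:
  assumes "chain m (as @ y # bs)" "distinct (as @ y # bs)"
    "as \<noteq> [] \<longrightarrow> m' (last as) 1 = hd0 bs"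
    "\<forall>x\<in>set (as @ bs). as = [] \<or> x \<noteq> last as \<longrightarrow> m' x 1 = m x 1"
  shows "chain m' (as @ bs)"
  using assms
proof (induction as)
  case Nil
  then show ?case using chain_cong[of bs m' m] by simp
next
  case (Cons a as)
  have "chain m' (as @ bs)"
    using Cons.prems by (intro Cons.IH) (auto split: if_splits)
  moreover have "m' a 1 = hd0 (as @ bs)"
    using Cons.prems by (cases as) (auto split: if_splits)
  ultimately show ?case by simp
qed

lemma KMr_insert:
  assumes "finite (gC g)" "y \<notin> gC g"
    "gC g' = insert y (gC g)" "gh g' = (gh g)(y := h)" "gK g' = gK g"
  shows "KMr g' h' = (if h \<le> h' then add_mset (gK g y) (KMr g h') else KMr g h')"
proof -
  have "{c \<in> gC g'. gh g' c \<le> h'} =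
      (if h \<le> h' then insert y {c \<in> gC g. gh g c \<le> h'} else {c \<in> gC g. gh g c \<le> h'})"
    using assms by auto
  then show ?thesis unfolding KMr_def using assms by auto
qed

lemma KMr_remove:
  assumes "finite (gC g)" "y \<in> gC g"
    "gC g' = gC g - {y}" "gh g' = gh g" "gK g' = gK g"
  shows "KMr g h' = (if gh g y \<le> h' then add_mset (gK g y) (KMr g' h') else KMr g' h')"
proof -
  have "{c \<in> gC g. gh g c \<le> h'} =
      (if gh g y \<le> h' then insert y {c \<in> gC g'. gh g c \<le> h'} else {c \<in> gC g'. gh g c \<le> h'})"
    using assms by auto
  then show ?thesis unfolding KMr_def using assms by auto
qed

context trie begin

lemma memI_cong: "memI g m \<Longrightarrow> (\<forall>u\<le>B. \<forall>f. m' u f = m u f) \<Longrightarrow> memI g m'"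
  unfolding memI_def table_def by auto

lemma node_frame_mem:
  assumes "nodeI g m" "nd g h p \<noteq> 0" "node_frame (nd g h p) m m'"
  shows "\<forall>u\<le>B. \<forall>f. m' u f = m u f" "\<forall>u f. f < 7 \<longrightarrow> m' u f = m u f"
    "\<forall>u f. ne g \<le> u \<longrightarrow> m' u f = m u f"
  using nodeD[OF assms(1,2)] assms(3) unfolding node_frame_def by fastforce+

lemma nodeI_cong:
  assumes "nodeI g m" "\<forall>u. m' u 6 = m u 6" "\<forall>u f. ne g \<le> u \<longrightarrow> 3 \<le> f \<longrightarrow> m' u f = m u f"
  shows "nodeI g m'"
  using assms unfolding nodeI_def by auto

lemma nodeI_ghost:
  assumes "nodeI g m" and eq: "nd g' = nd g" "ne g' = ne g"
    and "\<forall>h p. nd g h p \<noteq> 0 \<longrightarrow> h < H \<longrightarrow>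
        B \<le> card {c \<in> gP g'. gh g' c = Suc h \<and> gK g' c div B ^ Suc h = p}"
  shows "nodeI g' m"
proof -
  have su: "su g' h P = su g h P" for h P by (simp add: su_def eq)
  show ?thesis using assms(1,4) unfolding nodeI_def su eq by blast
qed

lemma lst_cong: "\<forall>f\<in>{3,4,5}. m' q f = m q f \<Longrightarrow> \<forall>c\<in>set xs. m' c 1 = m c 1 \<Longrightarrow> lst m' q xs = lst m q xs"
  unfolding lst_def using chain_cong[of xs m' m] by auto

lemma listI_cong:
  assumes "listI g m ov" "\<forall>u f. f \<in> {1, 3, 4, 5} \<longrightarrow> m' u f = m u f"
  shows "listI g m' ov"
  using assms lst_cong[of m' _ m] unfolding listI_def by auto

lemma cellI_cong:
  assumes "cellI g m" "\<forall>u f. f < 3 \<longrightarrow> m' u f = m u f"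
  shows "cellI g m'"
  using assms unfolding cellI_def by auto

lemma counts_cong:
  assumes "counts m p F" "\<forall>u f. p \<le> u \<longrightarrow> u \<le> p + B \<longrightarrow> 7 \<le> f \<longrightarrow> m' u f = m u f"
    "\<forall>j<B. F' j = F j"
  shows "counts m' p F'"
proof -
  have "m' p 8 = m p 8" "m' p 9 = m p 9" "m' p 10 = m p 10"
    "\<forall>i<B. m' (p + 1 + i) 7 = m (p + 1 + i) 7"
    using assms(2) by auto
  then show ?thesis using assms(1,3) unfolding counts_def by simp
qed

lemma cntF_add_other:
  assumes "v div B ^ Suc h \<noteq> p" "j \<le> B"
  shows "cntF (add_mset v M) h p j = cntF M h p j"
proof -
  have "\<not> (p * B \<le> v div B ^ h \<and> v div B ^ h < p * B + j)"
  proof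
    assume a: "p * B \<le> v div B ^ h \<and> v div B ^ h < p * B + j"
    then have "v div B ^ h < Suc p * B" using assms(2) by simp
    then have "v div B ^ h div B < Suc p" using B_pos by (simp add: div_less_iff_less_mult)
    moreover have "p \<le> v div B ^ h div B" using a B_pos by (simp add: less_eq_div_iff_mult_less_eq)
    ultimately show False using assms(1) unfolding div_Suc by simp
  qed
  then show ?thesis by (auto simp: cntF_def)
qed

text \<open>The link between keys and masks: on its own path a key changes the prefix counts by
  \<open>above\<close> of its digit.\<close>

lemma cntF_add_same:
  assumes "i < B"
  shows "cntF (add_mset v M) h (v div B ^ Suc h) i =
    cntF M h (v div B ^ Suc h) i + above (v div B ^ h mod B) i"
proof -
  have e: "v div B ^ Suc h * B + v div B ^ h mod B = v div B ^ h"
    by (metis div_Suc div_mult_mod_eq)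
  have "(v div B ^ Suc h * B \<le> v div B ^ h \<and> v div B ^ h < v div B ^ Suc h * B + i) \<longleftrightarrow>
      v div B ^ h mod B < i"
    using e by linarith
  then show ?thesis by (auto simp: cntF_def)
qed

text \<open>Only the node on the path of \<open>k\<close> is written. The other nodes at height
  \<open>h\<close> have a different prefix, so their counts do not see \<open>k\<close>.\<close>

lemma inv_count:
  assumes inv: "inv g m ov KM" and n: "nd g h (k div B ^ Suc h) \<noteq> 0"
    and fr: "node_frame (nd g h (k div B ^ Suc h)) m m'"
    and cn: "counts m' (nd g h (k div B ^ Suc h)) (cntF M h (k div B ^ Suc h))"
    and M: "M = add_mset k (KM h) \<or> KM h = add_mset k M"
  shows "inv g m' ov (KM(h := M))"
proof -
  have I: "memI g m" "nodeI g m" "listI g m ov" "cellI g m" "countI g m KM"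
    using inv by (auto simp: inv_def)
  note f = node_frame_mem[OF I(2) n fr]
  have "countI g m' (KM(h := M))"
    unfolding countI_def
  proof (intro allI impI)
    fix h' p' assume p': "nd g h' p' \<noteq> 0"
    show "counts m' (nd g h' p') (cntF ((KM(h := M)) h') h' p')"
    proof (cases "h' = h \<and> p' = k div B ^ Suc h")
      case True
      then show ?thesis using cn by simp
    next
      case False
      then have d: "nd g h' p' + B < nd g h (k div B ^ Suc h) \<or> nd g h (k div B ^ Suc h) + B < nd g h' p'"
        using I(2) n p' unfolding nodeI_def by blast
      have "counts m (nd g h' p') (cntF (KM h') h' p')" using I(5) p' by (simp add: countI_def)
      then show ?thesis
      proof (rule counts_cong)
        show "\<forall>u f. nd g h' p' \<le> u \<longrightarrow> u \<le> nd g h' p' + B \<longrightarrow> 7 \<le> f \<longrightarrow> m' u f = m u f"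
          using fr d unfolding node_frame_def by fastforce
        show "\<forall>j<B. cntF ((KM(h := M)) h') h' p' j = cntF (KM h') h' p' j"
          using False M cntF_add_other[of k h p'] by auto
      qed
    qed
  qed
  then show ?thesis
    unfolding inv_def
    using memI_cong[OF I(1) f(1)] nodeI_cong[OF I(2)] listI_cong[OF I(3)] cellI_cong[OF I(4)] f by auto
qed

definition list_frame :: "nat \<Rightarrow> nat set \<Rightarrow> umem \<Rightarrow> umem \<Rightarrow> bool" where
  "list_frame q X m m' \<longleftrightarrow> (\<forall>u f. m' u f \<noteq> m u f \<longrightarrow> (u = q \<and> f \<in> {3, 4, 5}) \<or> (u \<in> X \<and> f = 1))"

lemma list_frame_mem:
  assumes "list_frame q X m m'"
  shows "u \<noteq> q \<Longrightarrow> u \<notin> X \<Longrightarrow> m' u = m u" "u \<notin> X \<Longrightarrow> m' u 1 = m u 1" "6 \<le> f \<Longrightarrow> m' u f = m u f"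
    "f = 0 \<or> f = 2 \<Longrightarrow> m' u f = m u f" "u \<noteq> q \<Longrightarrow> f \<noteq> 1 \<Longrightarrow> m' u f = m u f"
  using assms unfolding list_frame_def by (force simp: fun_eq_iff)+

lemma countI_cong:
  assumes "countI g m KM" "\<forall>u f. 7 \<le> f \<longrightarrow> m' u f = m u f" "nd g' = nd g"
  shows "countI g' m' KM"
  unfolding countI_def
proof (intro allI impI)
  fix h p assume "nd g' h p \<noteq> 0"
  then have "counts m (nd g' h p) (cntF (KM h) h p)" using assms by (simp add: countI_def)
  then show "counts m' (nd g' h p) (cntF (KM h) h p)" by (rule counts_cong) (use assms in simp_all)
qed

text \<open>Linking touches lists only, hence \<open>KM\<close> stays the same: the caller adjusts
  the counts beforehand. \<open>up\<close> and \<open>low\<close> are the two halves of the heap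
  order for the new cell.\<close>

lemma inv_insert:
  assumes inv: "inv g m None KM" and y: "y \<in> gT g" "y \<notin> gC g" "y \<notin> gP g"
    and P: "gK g y div B ^ h = P" and n: "nd g h (P div B) \<noteq> 0" and xs: "ls g h P = as @ bs"
    and path: "\<forall>h'. h \<le> h' \<longrightarrow> h' \<le> H \<longrightarrow> nd g h' (gK g y div B ^ Suc h') \<noteq> 0"
    and srt: "\<forall>c\<in>set as. gK g y \<le> gK g c" "\<forall>c\<in>set bs. gK g c \<le> gK g y"
    and up: "\<forall>c\<in>gC g. h < gh g c \<longrightarrow> gK g c div B ^ gh g c = gK g y div B ^ gh g c \<longrightarrow> gK g c \<le> gK g y"
    and low: "\<forall>c\<in>gC g. gh g c < h \<longrightarrow> gK g c div B ^ h = P \<longrightarrow> gK g y \<le> gK g c"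
    and fr: "list_frame (su g h P) (insert y (set as)) m m'" and l': "lst m' (su g h P) (as @ y # bs)"
    and g': "g' = g\<lparr>gC := insert y (gC g), gP := insert y (gP g), gh := (gh g)(y := h),
        ls := (ls g)(h := (ls g h)(P := as @ y # bs))\<rparr>"
    and ov: "ov = Some (h, P) \<or> h = 0 \<or> length (as @ bs) < B"
  shows "inv g' m' ov KM"
proof -
  have I: "memI g m" "nodeI g m" "listI g m None" "cellI g m" "countI g m KM"
    using inv by (auto simp: inv_def)
  have set_ls: "set (as @ bs) = {c \<in> gC g. gh g c = h \<and> gK g c div B ^ h = P}"
    using listD(2)[OF I(3) n] xs by simp
  have "gC g \<subseteq> {B+1..<ce g}" "y \<in> {B+1..<ce g}" using y(1) I(4) unfolding cellI_def by blast+
  then have X: "insert y (set as) \<subseteq> {B+1..<ce g}" using set_ls by auto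
  have q: "B + 1 < su g h P" "su g h P < ne g" using su_range[OF I(2) n] by auto
  note fm = list_frame_mem[OF fr]
  have su': "su g' h' P' = su g h' P'" for h' P' by (simp add: g' su_def)
  have m0: "\<forall>u\<le>B. \<forall>f. m' u f = m u f"
  proof (intro allI impI)
    fix u f assume "u \<le> B"
    then have "u \<notin> insert y (set as)" "u \<noteq> su g h P" using X q by auto
    then show "m' u f = m u f" using fm(1) by simp
  qed
  then have mem': "memI g' m'" using memI_cong[OF I(1)] by (simp add: memI_def g')
  have n2: "nodeI g m'"
  proof (rule nodeI_cong[OF I(2)])
    show "\<forall>u. m' u 6 = m u 6" using fm(3) by simp
    show "\<forall>u f. ne g \<le> u \<longrightarrow> 3 \<le> f \<longrightarrow> m' u f = m u f"
    proof (intro allI impI)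
      fix u f assume "ne g \<le> u" "3 \<le> (f::nat)"
      then show "m' u f = m u f" using fm(5)[of u f] q by simp
    qed
  qed
  have fin: "finite (gP g)" using I(4) unfolding cellI_def by (meson finite_atLeastLessThan finite_subset)
  have node': "nodeI g' m'"
  proof -
    \<comment> \<open>Redirecting \<open>gh\<close> at \<open>y\<close> cannot take a payment away,
      since \<open>y\<close> was not in \<open>gP\<close> before.\<close>
    have "B \<le> card {c \<in> gP g'. gh g' c = Suc h' \<and> gK g' c div B ^ Suc h' = p}"
      if "nd g' h' p \<noteq> 0" "h' < H" for h' p
    proof -
      have "B \<le> card {c \<in> gP g. gh g c = Suc h' \<and> gK g c div B ^ Suc h' = p}"
        using I(2) that unfolding nodeI_def by (simp add: g')
      also have "\<dots> \<le> card {c \<in> gP g'. gh g' c = Suc h' \<and> gK g' c div B ^ Suc h' = p}"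
        using fin y(3) by (intro card_mono) (auto simp: g')
      finally show ?thesis .
    qed
    then show ?thesis using nodeI_ghost[OF n2, of g'] by (simp add: g')
  qed
  have cell': "cellI g' m'"
  proof -
    have "m' u f = 0" if "ce g \<le> u" "f < 3" for u f
    proof -
      have "u \<notin> insert y (set as)" using X that by auto
      then have "m' u f = m u f" using fr that unfolding list_frame_def by fastforce
      then show ?thesis using I(4) that unfolding cellI_def by simp
    qed
    then show ?thesis using I(4) y(1) fm(4) unfolding cellI_def by (auto simp: g')
  qed
  have list': "listI g' m' ov"
    unfolding listI_def
  proof (intro conjI allI impI ballI)
    fix h' P' assume n': "nd g' h' (P' div B) \<noteq> 0"
    then have n'': "nd g h' (P' div B) \<noteq> 0" by (simp add: g')
    note d = listD[OF I(3) n'']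
    show "lst m' (su g' h' P') (ls g' h' P')"
    proof (cases "h' = h \<and> P' = P")
      case True
      then show ?thesis using l' unfolding su' by (simp add: g')
    next
      case False
      then have ne: "su g h' P' \<noteq> su g h P" using su_inj[OF I(2) n'' n] by blast
      have "c \<notin> insert y (set as)" if "c \<in> set (ls g h' P')" for c
        using that d(2) set_ls y False by auto
      then have "lst m' (su g h' P') (ls g h' P')"
        using d(1) lst_cong[of m' "su g h' P'" m "ls g h' P'"] fm(2) fm(5)[OF ne] by auto
      then show ?thesis using False unfolding su' by (auto simp: g')
    qed
    show "set (ls g' h' P') = {c \<in> gC g'. gh g' c = h' \<and> gK g' c div B ^ h' = P'}"
    proof (cases "h' = h \<and> P' = P")
      case True
      have "set (as @ y # bs) = insert y {c \<in> gC g. gh g c = h \<and> gK g c div B ^ h = P}"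
        unfolding set_ls[symmetric] by auto
      also have "\<dots> = {c \<in> gC g'. gh g' c = h' \<and> gK g' c div B ^ h' = P'}"
        using True y(2) P by (auto simp: g')
      finally show ?thesis using True by (simp add: g')
    next
      case False
      then have "{c \<in> gC g'. gh g' c = h' \<and> gK g' c div B ^ h' = P'} =
          {c \<in> gC g. gh g c = h' \<and> gK g c div B ^ h' = P'}"
        using y(2) P by (auto simp: g')
      then show ?thesis using d(2) False by (auto simp: g')
    qed
    have "y \<notin> set (as @ bs)" using set_ls y(2) by blast
    then show "distinct (ls g' h' P')" using d(3) listD(3)[OF I(3) n] unfolding xs by (auto simp: g')
    show "sorted_wrt (\<lambda>a b. gK g' b \<le> gK g' a) (ls g' h' P')"
      using d(4) srt listD(4)[OF I(3) n] unfolding xs by (auto simp: g' sorted_wrt_append)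
  next
    fix h' P' assume h': "0 < h'" "nd g' h' (P' div B) \<noteq> 0"
    then have "length (ls g h' P') \<le> B" using I(3) unfolding listI_def by (fastforce simp: g')
    then show "length (ls g' h' P') \<le> B + (if ov = Some (h', P') then 1 else 0)"
      using ov h'(1) xs by (auto simp: g')
  next
    fix c assume "c \<in> gC g'"
    then show "gh g' c \<le> H" using I(3) nodeD(1)[OF I(2) n] unfolding listI_def by (auto simp: g')
  next
    fix c h' assume "c \<in> gC g'" "gh g' c \<le> h'" "h' \<le> H"
    then show "nd g' h' (gK g' c div B ^ Suc h') \<noteq> 0"
      using listI_path[OF I(3), of c h'] path by (cases "c = y") (auto simp: g')
  next
    fix c c' assume c: "c \<in> gC g'" "c' \<in> gC g'" "gh g' c' < gh g' c"
      "gK g' c div B ^ gh g' c = gK g' c' div B ^ gh g' c"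
    show "gK g' c \<le> gK g' c'"
      using c listI_order[OF I(3), of c c'] up low P y
      by (cases "c = y"; cases "c' = y") (auto simp: g')
  qed
  have "countI g' m' KM" using countI_cong[OF I(5), of m' g'] fm(3) by (simp add: g')
  then show ?thesis using mem' node' cell' list' by (simp add: inv_def)
qed

text \<open>Unlinking a cell: either it is about to move down, or it dies.\<close>

lemma inv_remove:
  assumes inv: "inv g m ov KM" and ov: "ov = None \<or> ov = Some (h, P)" and n: "nd g h (P div B) \<noteq> 0"
    and xs: "ls g h P = as @ y # bs"
    and fr: "list_frame (su g h P) (set as) m m1" and l': "lst m1 (su g h P) (as @ bs)"
    and ch: "0 < h \<longrightarrow> length (as @ bs) \<le> B"
    and g': "g' = g\<lparr>gC := gC g - {y}, gT := T, gP := Pl, ls := (ls g)(h := (ls g h)(P := as @ bs))\<rparr>"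
    and T: "T = gT g \<and> Pl = gP g - {y} \<and> B \<le> length (as @ bs) \<and> m' = m1 \<or>
       T = gT g - {y} \<and> Pl = gP g \<and> m' = m1(y := (m1 y)(2 := 0))"
  shows "inv g' m' None KM" "y \<in> gC g" "gh g y = h" "gK g y div B ^ h = P"
proof -
  have I: "memI g m" "nodeI g m" "listI g m ov" "cellI g m" "countI g m KM"
    using inv by (auto simp: inv_def)
  have set_ls: "insert y (set (as @ bs)) = {c \<in> gC g. gh g c = h \<and> gK g c div B ^ h = P}"
    using listD(2)[OF I(3) n] xs by simp
  have dst: "y \<notin> set (as @ bs)" "distinct (as @ bs)" using listD(3)[OF I(3) n] xs by auto
  show yC: "y \<in> gC g" "gh g y = h" "gK g y div B ^ h = P" using set_ls by auto
  have "gC g \<subseteq> {B+1..<ce g}" using I(4) unfolding cellI_def by blast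
  then have X: "insert y (set as) \<subseteq> {B+1..<ce g}" using set_ls by auto
  have q: "B + 1 < su g h P" "su g h P < ne g" using su_range[OF I(2) n] by auto
  have fr': "m' u f = m1 u f" if "f \<noteq> 2" for u f using T that by auto
  have fr2: "m' u f = m1 u f" if "u \<noteq> y" for u f using T that by auto
  note fm = list_frame_mem[OF fr]
  have su': "su g' h' P' = su g h' P'" for h' P' by (simp add: g' su_def)
  have m0: "\<forall>u\<le>B. \<forall>f. m' u f = m u f"
  proof (intro allI impI)
    fix u f assume "u \<le> B"
    then have "u \<noteq> y" "u \<notin> set as" "u \<noteq> su g h P" using X q by auto
    then show "m' u f = m u f" using fr2 fm(1) by simp
  qed
  then have mem': "memI g' m'" using memI_cong[OF I(1)] by (simp add: memI_def g')
  have n2: "nodeI g m'"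
  proof (rule nodeI_cong[OF I(2)])
    show "\<forall>u. m' u 6 = m u 6" using fm(3) fr' by simp
    show "\<forall>u f. ne g \<le> u \<longrightarrow> 3 \<le> f \<longrightarrow> m' u f = m u f"
    proof (intro allI impI)
      fix u f assume "ne g \<le> u" "3 \<le> (f::nat)"
      then show "m' u f = m u f" using fm(5)[of u f] fr'[of f u] q by simp
    qed
  qed
  have fin: "finite (gP g)" using I(4) unfolding cellI_def by (meson finite_atLeastLessThan finite_subset)
  have node': "nodeI g' m'"
  proof -
    have "B \<le> card {c \<in> gP g'. gh g' c = Suc h' \<and> gK g' c div B ^ Suc h' = p}"
      if "nd g' h' p \<noteq> 0" "h' < H" for h' p
    proof (cases "Pl = gP g \<or> \<not> (h = Suc h' \<and> p = P)")
      case True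
      have "B \<le> card {c \<in> gP g. gh g c = Suc h' \<and> gK g c div B ^ Suc h' = p}"
        using I(2) that unfolding nodeI_def by (simp add: g')
      moreover have "{c \<in> gP g'. gh g' c = Suc h' \<and> gK g' c div B ^ Suc h' = p} =
          {c \<in> gP g. gh g c = Suc h' \<and> gK g c div B ^ Suc h' = p}"
        using True yC T by (auto simp: g')
      ultimately show ?thesis by simp
    next
      \<comment> \<open>A cell moving down leaves \<open>gP\<close> at its old slot; the at least
        \<open>B\<close> cells remaining in that list take over the payment for the child.\<close>
      case False
      then have *: "B \<le> length (as @ bs)" "Pl = gP g - {y}" using T by auto
      have "length (as @ bs) = card (set (as @ bs))" using dst distinct_card by metis
      also have "\<dots> \<le> card {c \<in> gP g'. gh g' c = Suc h' \<and> gK g' c div B ^ Suc h' = p}"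
      proof (rule card_mono)
        show "finite {c \<in> gP g'. gh g' c = Suc h' \<and> gK g' c div B ^ Suc h' = p}" using fin * by (simp add: g')
        show "set (as @ bs) \<subseteq> {c \<in> gP g'. gh g' c = Suc h' \<and> gK g' c div B ^ Suc h' = p}"
        proof
          fix c assume c: "c \<in> set (as @ bs)"
          then have "c \<in> gC g" "gh g c = h" "gK g c div B ^ h = P" "c \<noteq> y" using set_ls dst by auto
          moreover then have "c \<in> gP g" using cellD(6)[OF I(4)] by simp
          ultimately show "c \<in> {c \<in> gP g'. gh g' c = Suc h' \<and> gK g' c div B ^ Suc h' = p}"
            using False * by (simp add: g')
        qed
      qed
      finally show ?thesis using *(1) by simp
    qed
    then show ?thesis using nodeI_ghost[OF n2, of g'] by (simp add: g')
  qed
  have cell': "cellI g' m'"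
  proof -
    have z: "m' u f = 0" if "ce g \<le> u" "f < 3" for u f
    proof -
      have "u \<notin> set as" "u \<noteq> y" using X that by auto
      then have "m' u f = m u f" using fr fr2 that unfolding list_frame_def by fastforce
      then show ?thesis using I(4) that unfolding cellI_def by simp
    qed
    have k: "m' c 0 = m c 0" for c using fm(4)[of 0 c] fr'[of 0 c] by simp
    have tg: "m' c 2 = (if T = gT g - {y} \<and> c = y then 0 else m c 2)" for c
      using T fm(4)[of 2 c] cellD(5)[OF I(4) yC(1)] by auto
    have yT: "y \<in> gT g" using cellD(5)[OF I(4) yC(1)] .
    have T': "gT g - {y} \<noteq> gT g" using yT by blast
    show ?thesis
      using I(4) T z T' unfolding cellI_def g' by (auto simp: k tg)
  qed
  have list': "listI g' m' None"
    unfolding listI_def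
  proof (intro conjI allI impI ballI)
    fix h' P' assume n': "nd g' h' (P' div B) \<noteq> 0"
    then have n'': "nd g h' (P' div B) \<noteq> 0" by (simp add: g')
    note d = listD[OF I(3) n'']
    have c1: "lst m' q xs = lst m1 q xs" for q xs
      by (intro lst_cong) (auto intro: fr')
    show "lst m' (su g' h' P') (ls g' h' P')"
    proof (cases "h' = h \<and> P' = P")
      case True
      then show ?thesis using l' unfolding su' c1 by (simp add: g')
    next
      case False
      then have ne: "su g h' P' \<noteq> su g h P" using su_inj[OF I(2) n'' n] by blast
      have "c \<notin> set as" if "c \<in> set (ls g h' P')" for c
        using that d(2) set_ls False by auto
      then have "lst m1 (su g h' P') (ls g h' P')"
        using d(1) lst_cong[of m1 "su g h' P'" m "ls g h' P'"] fm(2) fm(5)[OF ne] by auto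
      then show ?thesis using False unfolding su' c1 by (auto simp: g')
    qed
    show "set (ls g' h' P') = {c \<in> gC g'. gh g' c = h' \<and> gK g' c div B ^ h' = P'}"
    proof (cases "h' = h \<and> P' = P")
      case True
      have "set (as @ bs) = {c \<in> gC g. gh g c = h \<and> gK g c div B ^ h = P} - {y}"
        using set_ls dst by blast
      also have "\<dots> = {c \<in> gC g'. gh g' c = h' \<and> gK g' c div B ^ h' = P'}"
        using True by (auto simp: g')
      finally show ?thesis using True by (simp add: g')
    next
      case False
      then have "{c \<in> gC g'. gh g' c = h' \<and> gK g' c div B ^ h' = P'} =
          {c \<in> gC g. gh g c = h' \<and> gK g c div B ^ h' = P'}"
        using yC by (auto simp: g')
      then show ?thesis using d(2) False by (auto simp: g')
    qed
    show "distinct (ls g' h' P')" using d(3) dst by (auto simp: g')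
    show "sorted_wrt (\<lambda>a b. gK g' b \<le> gK g' a) (ls g' h' P')"
      using d(4) listD(4)[OF I(3) n] unfolding xs by (auto simp: g' sorted_wrt_append)
  next
    fix h' P' assume h': "0 < h'" "nd g' h' (P' div B) \<noteq> 0"
    then have "length (ls g h' P') \<le> B + (if ov = Some (h', P') then 1 else 0)"
      using I(3) unfolding listI_def by (simp add: g')
    then show "length (ls g' h' P') \<le> B + (if None = Some (h', P') then 1 else 0)"
      using ov h'(1) ch by (auto simp: g')
  next
    fix c assume "c \<in> gC g'"
    then show "gh g' c \<le> H" using I(3) unfolding listI_def by (auto simp: g')
  next
    fix c h' assume "c \<in> gC g'" "gh g' c \<le> h'" "h' \<le> H"
    then show "nd g' h' (gK g' c div B ^ Suc h') \<noteq> 0"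
      using listI_path[OF I(3), of c h'] by (auto simp: g')
  next
    fix c c' assume c: "c \<in> gC g'" "c' \<in> gC g'" "gh g' c' < gh g' c"
      "gK g' c div B ^ gh g' c = gK g' c' div B ^ gh g' c"
    show "gK g' c \<le> gK g' c'"
      using c listI_order[OF I(3), of c c'] by (auto simp: g')
  qed
  have "countI g' m' KM" using countI_cong[OF I(5), of m' g'] fm(3) fr' by (simp add: g')
  then show "inv g' m' None KM" using mem' node' cell' list' by (simp add: inv_def)
qed

end

text \<open>A memory update that the simplifier evaluates pointwise instead of building nested
  function updates.\<close>

definition upd :: "umem \<Rightarrow> nat \<Rightarrow> nat \<Rightarrow> nat \<Rightarrow> umem" where
  "upd m u f v = m(u := (m u)(f := v))"

lemma upd_apply [simp]: "upd m u f v u' f' = (if u' = u \<and> f' = f then v else m u' f')"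
  by (simp add: upd_def)

lemma wp_St_upd: "wp w L (St x f r) Q t R m \<longleftrightarrow> R x < L \<and> f < 16 \<and> Q (t + 5) R (upd m (R x) f (R r))"
  by (simp add: upd_def)

declare wp_basic(6) [simp del] wp_St_upd [simp]

context trie begin

lemma inv_KM_cong:
  assumes "inv g m ov KM" "\<And>h. h \<le> H \<Longrightarrow> KM' h = KM h"
  shows "inv g m ov KM'"
proof -
  have "countI g m KM'"
    unfolding countI_def
  proof (intro allI impI)
    fix h p assume n: "nd g h p \<noteq> 0"
    have "h \<le> H" using nodeD(1)[of g m h p] assms(1) n by (auto simp: inv_def)
    then show "counts m (nd g h p) (cntF (KM' h) h p)"
      using assms n by (simp add: inv_def countI_def)
  qed
  then show ?thesis using assms(1) by (simp add: inv_def)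
qed

section \<open>Allocation of a child node\<close>

lemma counts_zero:
  assumes "\<forall>u f. p \<le> u \<longrightarrow> u \<le> p + B \<longrightarrow> 7 \<le> f \<longrightarrow> m u f = 0" "\<forall>j<B. F j = 0"
  shows "counts m p F"
proof -
  have "m p 8 = 0" "m p 9 = 0" "m p 10 = 0" "\<forall>i<B. m (p + 1 + i) 7 = 0" using assms(1) by auto
  then show ?thesis unfolding counts_def using assms(2) B_pos
    by (intro exI[of _ "\<lambda>_. 0"] conjI) (auto simp: enc_def)
qed

text \<open>Fresh units are zero in the node fields, so a pointer from the slot and the advance of
  \<open>ne\<close> suffice. Zero counts are correct because no key counted at height
  \<open>h - 1\<close> has prefix \<open>P\<close>; \<open>full\<close> provides the
  payment.\<close>

lemma inv_alloc:
  assumes inv: "inv g m None KM" and h: "0 < h" and n: "nd g h (P div B) \<noteq> 0" and z: "nd g (h - 1) P = 0"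
    and full: "B \<le> card {c \<in> gP g. gh g c = h \<and> gK g c div B ^ h = P}"
    and KM: "\<forall>v. v \<in># KM (h - 1) \<longrightarrow> v div B ^ h \<noteq> P"
    and m': "m' = upd (upd m (su g h P) 6 (ne g)) 0 3 (ne g + B + 1)"
    and g': "g' = g\<lparr>nd := (nd g)(h - 1 := (nd g (h - 1))(P := ne g)), ne := ne g + B + 1,
       ls := (ls g)(h - 1 := (\<lambda>P'. if P' div B = P then [] else ls g (h - 1) P'))\<rparr>"
  shows "inv g' m' None KM"
proof -
  have I: "memI g m" "nodeI g m" "listI g m None" "cellI g m" "countI g m KM"
    using inv by (auto simp: inv_def)
  let ?q = "su g h P"
  have q: "B + 1 < ?q" "?q < ne g" using su_range[OF I(2) n] by auto
  have hH: "h \<le> H" using nodeD(1)[OF I(2) n] .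
  have nd': "nd g' h' p = (if h' = h - 1 \<and> p = P then ne g else nd g h' p)" for h' p
    by (simp add: g')
  have ne': "ne g' = ne g + B + 1" by (simp add: g')
  have ls': "ls g' h' P' = (if h' = h - 1 \<and> P' div B = P then [] else ls g h' P')" for h' P'
    by (simp add: g')
  have rest: "gC g' = gC g" "gT g' = gT g" "gP g' = gP g" "gK g' = gK g" "gh g' = gh g" "ce g' = ce g"
    by (simp_all add: g')
  have su_old: "su g' h' P' = su g h' P'" if "nd g h' (P' div B) \<noteq> 0" for h' P'
    using that z unfolding su_def nd' by auto
  have su_new: "su g' (h - 1) P' = ne g + 1 + P' mod B" if "P' div B = P" for P'
    using that unfolding su_def nd' by simp
  have N: "nd g H 0 = B + 1"
    "\<And>h p. nd g h p \<noteq> 0 \<Longrightarrow>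
      h \<le> H \<and> (h = H \<longrightarrow> p = 0) \<and> B + 1 \<le> nd g h p \<and> nd g h p + B < ne g"
    "\<And>h p h' p'. nd g h p \<noteq> 0 \<Longrightarrow> nd g h' p' \<noteq> 0 \<Longrightarrow> (h, p) \<noteq> (h', p') \<Longrightarrow>
        nd g h p + B < nd g h' p' \<or> nd g h' p' + B < nd g h p"
    "\<And>h P. nd g h (P div B) \<noteq> 0 \<Longrightarrow> m (su g h P) 6 = (if h = 0 then 0 else nd g (h - 1) P)"
    "\<And>h p. nd g h p \<noteq> 0 \<Longrightarrow> h < H \<Longrightarrow> nd g (Suc h) (p div B) \<noteq> 0"
    "\<And>u f. ne g \<le> u \<Longrightarrow> 3 \<le> f \<Longrightarrow> m u f = 0"
    "finite {(h, p). nd g h p \<noteq> 0}" "ne g = (B + 1) * (card {(h, p). nd g h p \<noteq> 0} + 1)"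
    "\<And>h p. nd g h p \<noteq> 0 \<Longrightarrow> h < H \<Longrightarrow>
        B \<le> card {c \<in> gP g. gh g c = Suc h \<and> gK g c div B ^ Suc h = p}"
    using I(2) unfolding nodeI_def by blast+
  have ne0: "0 < ne g" using q by simp
  have m6: "m' u f = m u f" if "f \<noteq> 6" "u \<noteq> 0" for u f using that by (simp add: m')
  have m7: "m' u f = m u f" if "7 \<le> f" for u f using that by (simp add: m')
  have m1: "m' u f = m u f" if "f < 3" for u f using that by (simp add: m')
  have m6': "m' u 6 = m u 6" if "u \<noteq> ?q" for u using that by (simp add: m')
  have lt: "P' mod B < B" for P' using B_pos by simp
  have child: "m' (su g' h' P') 6 = (if h' = 0 then 0 else nd g' (h' - 1) P')"
    if n': "nd g' h' (P' div B) \<noteq> 0" for h' P'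
  proof (cases "h' = h - 1 \<and> P' div B = P")
    case True
    have "su g' h' P' = ne g + 1 + P' mod B" using su_new True by simp
    then have "m' (su g' h' P') 6 = 0" using q N(6) m6' by simp
    moreover have "nd g' (h' - 1) P' = 0" if "h' \<noteq> 0"
    proof -
      \<comment> \<open>Nodes are closed under parents: a grandchild would make the absent node
        exist.\<close>
      have "nd g (h' - 1) P' = 0"
      proof (rule ccontr)
        assume "\<not> ?thesis"
        then have "nd g (Suc (h' - 1)) (P' div B) \<noteq> 0" using True hH that by (intro N(5)) auto
        moreover have "Suc (h' - 1) = h'" using that by simp
        ultimately have "nd g h' (P' div B) \<noteq> 0" by metis
        then show False using True z by simp
      qed
      moreover have "h' - 1 \<noteq> h - 1" using True that h by linarith
      ultimately show ?thesis unfolding nd' by metis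
    qed
    ultimately show ?thesis by simp
  next
    case False
    then have n'': "nd g h' (P' div B) \<noteq> 0" using n' by (auto simp: nd')
    show ?thesis
    proof (cases "h' = h \<and> P' = P")
      case True
      then show ?thesis using su_old[OF n''] h by (simp add: nd' m')
    next
      case False
      then have "su g h' P' \<noteq> ?q" using su_inj[OF I(2) n'' n] by blast
      then have "m' (su g' h' P') 6 = m (su g h' P') 6" using su_old[OF n''] m6' by simp
      moreover have "nd g' (h' - 1) P' = nd g (h' - 1) P'" if "h' \<noteq> 0"
        using False that h by (auto simp: nd')
      ultimately show ?thesis using N(4)[OF n''] by auto
    qed
  qed
  have set_nd: "{(h', p). nd g' h' p \<noteq> 0} = insert (h - 1, P) {(h', p). nd g h' p \<noteq> 0}"
    using ne0 by (auto simp: nd')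
  have "nodeI g' m'"
    unfolding nodeI_def
  proof (intro conjI allI impI)
    show "nd g' H 0 = B + 1" using N(1) z by (auto simp: nd')
    show "finite {(h, p). nd g' h p \<noteq> 0}" unfolding set_nd using N(7) by simp
    show "ne g' = (B + 1) * (card {(h, p). nd g' h p \<noteq> 0} + 1)"
      unfolding set_nd ne' using N(7) z by (subst card_insert_disjoint) (simp_all add: N(8)[symmetric], simp add: N(8))
  next
    fix h' p assume a: "nd g' h' p \<noteq> 0"
    show "h' \<le> H" "B + 1 \<le> nd g' h' p" "nd g' h' p + B < ne g'"
      using a N(2)[of h' p] hH q by (auto simp: nd' ne' split: if_splits)
    assume "h' = H"
    then show "p = 0"
      using a N(2)[of h' p] hH h by (auto simp: nd' ne' split: if_splits)
  next
    fix h1 p1 h2 p2 assume a: "nd g' h1 p1 \<noteq> 0" "nd g' h2 p2 \<noteq> 0" "(h1, p1) \<noteq> (h2, p2)"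
    show "nd g' h1 p1 + B < nd g' h2 p2 \<or> nd g' h2 p2 + B < nd g' h1 p1"
      using a N(2)[of h1 p1] N(2)[of h2 p2] N(3)[of h1 p1 h2 p2] by (auto simp: nd' split: if_splits)
  next
    fix h' P' assume "nd g' h' (P' div B) \<noteq> 0"
    then show "m' (su g' h' P') 6 = (if h' = 0 then 0 else nd g' (h' - 1) P')" by (rule child)
  next
    fix h' p assume a: "nd g' h' p \<noteq> 0" "h' < H"
    show "nd g' (Suc h') (p div B) \<noteq> 0"
    proof (cases "h' = h - 1 \<and> p = P")
      case True
      then show ?thesis using n h ne0 by (simp add: nd')
    next
      case False
      then have "nd g h' p \<noteq> 0" using a by (auto simp: nd')
      then have "nd g (Suc h') (p div B) \<noteq> 0" using N(5) a(2) by blast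
      then show ?thesis unfolding nd' using ne0 by simp
    qed
  next
    fix u f assume "ne g' \<le> u" "3 \<le> (f::nat)"
    then show "m' u f = 0" using N(6)[of u f] q by (simp add: m' ne')
  next
    fix h' p assume a: "nd g' h' p \<noteq> 0" "h' < H"
    show "B \<le> card {c \<in> gP g'. gh g' c = Suc h' \<and> gK g' c div B ^ Suc h' = p}"
    proof (cases "h' = h - 1 \<and> p = P")
      case True
      then have "Suc h' = h" using h by simp
      then show ?thesis unfolding rest using full True by metis
    next
      case False
      then show ?thesis unfolding rest using a N(9)[of h' p] by (auto simp: nd')
    qed
  qed
  moreover have "listI g' m' None"
    unfolding listI_def
  proof (intro conjI allI impI ballI)
    fix h' P' assume n': "nd g' h' (P' div B) \<noteq> 0"
    have "lst m' (su g' h' P') (ls g' h' P') \<and>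
       set (ls g' h' P') = {c \<in> gC g'. gh g' c = h' \<and> gK g' c div B ^ h' = P'} \<and>
       distinct (ls g' h' P') \<and> sorted_wrt (\<lambda>a b. gK g' b \<le> gK g' a) (ls g' h' P')"
    proof (cases "h' = h - 1 \<and> P' div B = P")
      case True
      then have su: "su g' h' P' = ne g + 1 + P' mod B" using su_new by simp
      \<comment> \<open>The path of a cell consists of existing nodes, so no cell can sit at the
        node that is only now created.\<close>
      have e: "{c \<in> gC g. gh g c = h' \<and> gK g c div B ^ h' = P'} = {}"
      proof (rule ccontr)
        assume "\<not> ?thesis"
        then obtain c where c: "c \<in> gC g" "gh g c = h'" "gK g c div B ^ h' = P'" by blast
        then have "nd g h' (gK g c div B ^ Suc h') \<noteq> 0"
          using listI_path[OF I(3), of c h'] True hH by simp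
        then show False using True c z by (simp only: div_Suc[symmetric])
      qed
      have su': "ne g \<le> su g' h' P'" "su g' h' P' \<noteq> 0" using su ne0 by simp_all
      have "m' (su g' h' P') f = 0" if "f \<in> {3, 4, 5}" for f
        using N(6)[OF su'(1), of f] m6[OF _ su'(2), of f] that by auto
      then have "lst m' (su g' h' P') []" by (simp add: lst_def)
      then show ?thesis
        unfolding rest e using True by (simp add: ls')
    next
      case False
      then have n'': "nd g h' (P' div B) \<noteq> 0" using n' by (auto simp: nd')
      note d = listD[OF I(3) n'']
      have "su g h' P' \<noteq> 0" using su_range[OF I(2) n''] by simp
      then have "lst m' (su g h' P') (ls g h' P') = lst m (su g h' P') (ls g h' P')"
        by (intro lst_cong) (auto simp: m6 m1)
      then show ?thesis using False d su_old[OF n''] by (simp only: ls' rest if_False)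
    qed
    then show "lst m' (su g' h' P') (ls g' h' P')"
      "set (ls g' h' P') = {c \<in> gC g'. gh g' c = h' \<and> gK g' c div B ^ h' = P'}"
      "distinct (ls g' h' P')" "sorted_wrt (\<lambda>a b. gK g' b \<le> gK g' a) (ls g' h' P')" by blast+
  next
    fix h' P' assume a: "0 < h'" "nd g' h' (P' div B) \<noteq> 0"
    show "length (ls g' h' P') \<le> B + (if None = Some (h', P') then 1 else 0)"
    proof (cases "h' = h - 1 \<and> P' div B = P")
      case False
      then have "nd g h' (P' div B) \<noteq> 0" using a by (auto simp: nd')
      then show ?thesis using False a(1) I(3) unfolding listI_def by (auto simp: ls')
    qed (simp add: ls')
  next
    fix c assume "c \<in> gC g'"
    then show "gh g' c \<le> H" using I(3) unfolding listI_def rest by blast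
  next
    fix c h' assume "c \<in> gC g'" "gh g' c \<le> h'" "h' \<le> H"
    then show "nd g' h' (gK g' c div B ^ Suc h') \<noteq> 0"
      using listI_path[OF I(3), of c h'] ne0 unfolding rest by (simp add: nd')
  next
    fix c c' assume "c \<in> gC g'" "c' \<in> gC g'" "gh g' c' < gh g' c"
      "gK g' c div B ^ gh g' c = gK g' c' div B ^ gh g' c"
    then show "gK g' c \<le> gK g' c'" using listI_order[OF I(3), of c c'] unfolding rest by blast
  qed
  moreover have "cellI g' m'" using I(4) unfolding cellI_def rest by (simp add: m1)
  moreover have "memI g' m'"
    using I(1) q unfolding memI_def table_def by (auto simp: m' ne' rest)
  moreover have "countI g' m' KM"
    unfolding countI_def
  proof (intro allI impI)
    fix h' p assume a: "nd g' h' p \<noteq> 0"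
    show "counts m' (nd g' h' p) (cntF (KM h') h' p)"
    proof (cases "h' = h - 1 \<and> p = P")
      case True
      have "v div B ^ (h - 1) div B \<noteq> P" if "v \<in># KM (h - 1)" for v
        using KM that h div_Suc[of v "h - 1"] by simp
      then have c0: "cntF (KM (h - 1)) (h - 1) P j = 0" if "j < B" for j
      proof -
        have "\<not> (P * B \<le> v div B ^ (h - 1) \<and> v div B ^ (h - 1) < P * B + j)" if v: "v \<in># KM (h - 1)" for v
        proof
          assume a: "P * B \<le> v div B ^ (h - 1) \<and> v div B ^ (h - 1) < P * B + j"
          then have "v div B ^ (h - 1) < Suc P * B" using \<open>j < B\<close> by simp
          then have "v div B ^ (h - 1) div B < Suc P" using B_pos by (simp add: div_less_iff_less_mult)
          moreover have "P \<le> v div B ^ (h - 1) div B" using a B_pos by (simp add: less_eq_div_iff_mult_less_eq)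
          ultimately have "v div B ^ (h - 1) div B = P" by simp
          moreover have "v div B ^ (h - 1) div B = v div B ^ h" using h div_Suc[of v "h - 1"] by simp
          ultimately show False using KM v by metis
        qed
        then show ?thesis by (simp add: cntF_def)
      qed
      have "counts m' (ne g) (cntF (KM (h - 1)) (h - 1) P)"
        by (rule counts_zero) (use N(6) m7 c0 in auto)
      then show ?thesis using True by (simp add: nd')
    next
      case False
      then have e: "nd g' h' p = nd g h' p" by (auto simp: nd')
      then have "counts m (nd g h' p) (cntF (KM h') h' p)" using I(5) a by (simp add: countI_def)
      then show ?thesis unfolding e by (rule counts_cong) (simp_all add: m7)
    qed
  qed
  ultimately show ?thesis by (simp add: inv_def)
qed

text \<open>Distinct nodes below the root are paid for by disjoint sets of at least \<open>B\<close>
  cells, so there are at most \<open>(ce g - (B + 1)) / B\<close> of them. As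
  \<open>B + 1 \<le> 2 * B\<close>, they take at most two units per cell; the reserved units and the
  root add \<open>2 * (B + 1)\<close>.\<close>

lemma nodes_bound:
  assumes "nodeI g m" "cellI g m"
  shows "ne g \<le> 2 * (B + 1) + 2 * (ce g - (B + 1))"
proof -
  let ?N = "{(h, p). nd g h p \<noteq> 0}"
  let ?S = "\<lambda>x. {c \<in> gP g. gh g c = Suc (fst x) \<and> gK g c div B ^ Suc (fst x) = snd x}"
  have fin: "finite ?N" "ne g = (B + 1) * (card ?N + 1)" using assms(1) unfolding nodeI_def by blast+
  have N8: "\<And>h p. nd g h p \<noteq> 0 \<Longrightarrow> h < H \<Longrightarrow>
        B \<le> card {c \<in> gP g. gh g c = Suc h \<and> gK g c div B ^ Suc h = p}"
    using assms(1) unfolding nodeI_def by blast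
  have P: "gP g \<subseteq> {B+1..<ce g}" using assms(2) unfolding cellI_def by blast
  then have finP: "finite (gP g)" using finite_subset by blast
  let ?M = "?N - {(H, 0)}"
  have top: "x \<in> ?M \<Longrightarrow> fst x < H \<and> nd g (fst x) (snd x) \<noteq> 0" for x
  proof -
    assume x: "x \<in> ?M"
    obtain h p where hp: "x = (h, p)" by (cases x)
    have n: "nd g h p \<noteq> 0" and ne: "(h, p) \<noteq> (H, 0)" using x hp by auto
    have "h \<le> H \<and> (h = H \<longrightarrow> p = 0)" using assms(1) n unfolding nodeI_def by blast
    then have "h < H" using ne by auto
    then show ?thesis using n hp by simp
  qed
  have "B * card ?M = (\<Sum>x\<in>?M. B)" by simp
  also have "\<dots> \<le> (\<Sum>x\<in>?M. card (?S x))"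
  proof (rule sum_mono)
    fix x assume "x \<in> ?M"
    then show "B \<le> card (?S x)" using top[of x] N8 by simp
  qed
  also have "\<dots> = card (\<Union>x\<in>?M. ?S x)"
  proof (rule card_UN_disjoint[symmetric])
    show "finite ?M" using fin by simp
    show "\<forall>x\<in>?M. finite (?S x)" using finP by simp
    show "\<forall>x\<in>?M. \<forall>y\<in>?M. x \<noteq> y \<longrightarrow> ?S x \<inter> ?S y = {}"
    proof (intro ballI impI)
      fix x y :: "nat \<times> nat" assume "x \<noteq> y"
      then have "fst x \<noteq> fst y \<or> snd x \<noteq> snd y" by (simp add: prod_eq_iff)
      then show "?S x \<inter> ?S y = {}" by auto
    qed
  qed
  also have "\<dots> \<le> card {B+1..<ce g}"
  proof (rule card_mono)
    show "(\<Union>x\<in>?M. ?S x) \<subseteq> {B+1..<ce g}" using P by blast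
  qed simp
  finally have *: "B * card ?M \<le> ce g - (B + 1)" by simp
  have "nd g H 0 \<noteq> 0" using assms(1) by (simp add: nodeI_def)
  then have c: "card ?N = card ?M + 1"
    using fin(1) card_Suc_Diff1[of ?N "(H, 0)"] by simp
  have "card ?M \<le> B * card ?M" using B_pos by simp
  then have "card ?M + B * card ?M \<le> 2 * (ce g - (B + 1))" using * by linarith
  then show ?thesis unfolding fin(2) c by (simp add: algebra_simps)
qed

end

subsection \<open>Walking down the search path\<close>

context trie begin

definition start_com :: com where
  "start_com = Ld 7 4 5 ;; Ld 10 4 1 ;; Imm 23 1"

definition walk_com :: "nat \<Rightarrow> com" where
  "walk_com f = Until (Eq 23 4) (count_com f ;; visit ;; If (Eq 23 4) Skip descend)"

text \<open>The counts in the middle of a walk: heights from \<open>j\<close> upwards are already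
  updated, lower ones are still old.\<close>

definition KMw :: "ghost \<Rightarrow> (nat \<Rightarrow> nat multiset) \<Rightarrow> nat \<Rightarrow> nat \<Rightarrow> nat multiset" where
  "KMw g M j h = (if j \<le> h then M h else KMr g h)"

lemma KMw_upd: "(KMw g M (Suc h))(h := M h) = KMw g M h"
  by (auto simp: KMw_def fun_eq_iff)

lemma cntF_le_size: "cntF M h p j \<le> size M"
  unfolding cntF_def by (rule size_filter_mset_lesseq)

abbreviation walk_regs :: "nat set" where
  "walk_regs \<equiv> {7, 8} \<union> {10..19} \<union> {21..24}"

text \<open>Serves insertion and removal alike. \<open>D h\<close> records what the descent to
  height \<open>h\<close> has established; it has to justify the change of the counted multiset from
  \<open>KMr g h\<close> to \<open>M h\<close>.\<close>

lemma wp_walk: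
  assumes inv: "inv g m None (KMr g)" and R: "cregs R" "R 8 = k div B ^ H" "R 9 = k mod B ^ H"
    and k: "k < 2 * B ^ H" and b: "ne g \<le> L" "ce g \<le> L"
    and D: "D H" "\<And>h. D h \<Longrightarrow> h \<le> H \<Longrightarrow> 0 < h \<Longrightarrow> nd g h (k div B ^ Suc h) \<noteq> 0 \<Longrightarrow>
      goes_down g h k \<Longrightarrow> D (h - 1)"
    and M: "\<And>h. D h \<Longrightarrow> h \<le> H \<Longrightarrow>
      f = 8 \<and> M h = add_mset k (KMr g h) \<or> f = 9 \<and> KMr g h = add_mset k (M h)"
    and sz: "\<And>h. size (M h) \<le> ce g"
    and Q: "\<And>t' R' m' h. t' \<le> t + 200 * (H + 1) \<Longrightarrow> same_regs walk_regs R R' \<Longrightarrow> h \<le> H \<Longrightarrow> D h \<Longrightarrow>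
      pos g h k R' \<Longrightarrow> nd g h (k div B ^ Suc h) \<noteq> 0 \<Longrightarrow> \<not> goes_down g h k \<Longrightarrow>
      R' 11 = su g h (k div B ^ h) \<Longrightarrow> R' 22 = hd0 (ls g h (k div B ^ h)) \<Longrightarrow>
      inv g m' None (KMw g M h) \<Longrightarrow> m' 0 = m 0 \<Longrightarrow> Q t' R' m'"
  shows "wp w L (start_com ;; walk_com f) Q t R m"
proof -
  have tab: "table m" and nI: "nodeI g m" using inv by (auto simp: inv_def memI_def)
  define J1 where "J1 = (\<lambda>n t' (R' :: regs) m'. R' 23 = 1 \<and> (\<exists>h\<le>H. n = Suc h \<and> pos g h k R' \<and>
      nd g h (k div B ^ Suc h) \<noteq> 0 \<and> t' \<le> t + 20 + 160 * (H - h) \<and> D h \<and>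
      inv g m' None (KMw g M (Suc h))))"
  define J2 where "J2 = (\<lambda>(n :: nat) t' (R' :: regs) m'. R' 23 = 0 \<and> n = 0 \<and> (\<exists>h\<le>H. pos g h k R' \<and>
      nd g h (k div B ^ Suc h) \<noteq> 0 \<and> \<not> goes_down g h k \<and> R' 11 = su g h (k div B ^ h) \<and>
      R' 22 = hd0 (ls g h (k div B ^ h)) \<and> t' \<le> t + 20 + 160 * (H + 1) \<and> D h \<and>
      inv g m' None (KMw g M h)))"
  define J where "J = (\<lambda>n t' R' m'. m' 0 = m 0 \<and> same_regs walk_regs R R' \<and>
      (J1 n t' R' m' \<or> J2 n t' R' m'))"
  have loop: "wp w L (walk_com f) Q t' R' m'" if J0: "J (Suc H) t' R' m'" for t' R' m'
    unfolding walk_com_def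
  proof (rule wp_Until[where I = J, OF J0])
    fix n t1 R1 m1
    assume J: "J n t1 R1 m1" and nb: "\<not> bval (Eq 23 4) R1"
    have S1: "same_regs walk_regs R R1" and m0: "m1 0 = m 0" using J by (auto simp: J_def)
    have c1: "R1 4 = 0" "R1 5 = 1" "R1 6 = B" using S1 R(1) by (auto simp: same_regs_def cregs_def)
    have "J1 n t1 R1 m1" using J nb c1 by (auto simp: J_def J2_def)
    then obtain h where h: "h \<le> H" "n = Suc h" "pos g h k R1" "nd g h (k div B ^ Suc h) \<noteq> 0"
       "t1 \<le> t + 20 + 160 * (H - h)" "D h" and iv: "inv g m1 None (KMw g M (Suc h))"
      unfolding J1_def by blast
    let ?P = "k div B ^ h" and ?p = "k div B ^ Suc h"
    have I1: "nodeI g m1" "listI g m1 None" "cellI g m1" "table m1" "countI g m1 (KMw g M (Suc h))"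
      using iv by (auto simp: inv_def memI_def)
    have cn: "counts m1 (nd g h ?p) (cntF (KMr g h) h ?p)"
    proof -
      have "counts m1 (nd g h ?p) (cntF (KMw g M (Suc h) h) h ?p)"
        using I1(5) h(4) unfolding countI_def by blast
      moreover have "KMw g M (Suc h) h = KMr g h" by (simp add: KMw_def)
      ultimately show ?thesis by (simp only:)
    qed
    have nb': "B < nd g h ?p" "nd g h ?p + B < L" using nodeD[OF I1(1) h(4)] b(1) by auto
    have Fb: "\<forall>i<B. cntF (M h) h ?p i + B < 2 ^ w"
    proof (intro allI impI)
      fix i show "cntF (M h) h ?p i + B < 2 ^ w"
        using cntF_le_size[of "M h" h ?p i] sz[of h] b(2) L1 L2 by linarith
    qed
    have f: "f = 8 \<and> (\<forall>i<B. cntF (M h) h ?p i = cntF (KMr g h) h ?p i + above (?P mod B) i) \<or>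
        f = 9 \<and> (\<forall>i<B. cntF (M h) h ?p i + above (?P mod B) i = cntF (KMr g h) h ?p i)"
      using M[OF h(6,1)]
    proof
      assume "f = 8 \<and> M h = add_mset k (KMr g h)"
      then show ?thesis using cntF_add_same[of _ k "KMr g h" h] by simp
    next
      assume "f = 9 \<and> KMr g h = add_mset k (M h)"
      then show ?thesis using cntF_add_same[of _ k "M h" h] by simp
    qed
    show "wp w L (count_com f ;; visit ;; If (Eq 23 4) Skip descend)
      (\<lambda>t R m. \<exists>n'<n. J n' (t + 1) R m) (t1 + 1) R1 m1"
      unfolding wp_Seq
    proof (rule wp_count[where p = "nd g h ?p" and j = "?P mod B", OF _ _ _ _ nb' I1(4) cn f Fb])
      show "cregs R1" "R1 7 = nd g h ?p" "R1 8 = ?P mod B" using h(3) by (auto simp: pos_def)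
      show "?P mod B < B" using B_pos by simp
    next
      fix t2 R2 m2
      assume 2: "t2 \<le> t1 + 1 + 100" "same_regs {12..19} R1 R2" "node_frame (nd g h ?p) m1 m2"
        "counts m2 (nd g h ?p) (cntF (M h) h ?p)"
      have iv2: "inv g m2 None (KMw g M h)"
        using inv_count[OF iv h(4) 2(3,4)] M[OF h(6,1)] unfolding KMw_upd by (auto simp: KMw_def)
      then have I2: "nodeI g m2" "listI g m2 None" "cellI g m2" by (auto simp: inv_def)
      have m20: "m2 0 = m 0" using node_frame_mem(1)[OF I1(1) h(4) 2(3)] m0 by (auto simp: fun_eq_iff)
      have p2: "pos g h k R2" using h(3) 2(2) by (auto simp: pos_def cregs_def same_regs_def)
      show "wp w L visit (wp w L (If (Eq 23 4) Skip descend)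
         (\<lambda>t R m. \<exists>n'<n. J n' (t + 1) R m)) t2 R2 m2"
      proof (rule wp_visit[OF I2 p2 h(4) b(1,2)])
        fix t3 R3
        assume 3: "t3 \<le> t2 + 40" "same_regs {11, 21, 22, 23, 24} R2 R3" "R3 11 = su g h ?P"
          "R3 21 = child g h ?P" "R3 22 = hd0 (ls g h ?P)" "R3 23 = (if goes_down g h k then 1 else 0)"
        have p3: "pos g h k R3" using p2 3(2) by (auto simp: pos_def cregs_def same_regs_def)
        have S3: "same_regs walk_regs R R3" using S1 2(2) 3(2) by (auto simp: same_regs_def)
        have c3: "R3 4 = 0" using p3 by (simp add: pos_def cregs_def)
        show "wp w L (If (Eq 23 4) Skip descend) (\<lambda>t R m. \<exists>n'<n. J n' (t + 1) R m) t3 R3 m2"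
        proof (cases "goes_down g h k")
          case False
          have "J2 0 (t3 + 2) R3 m2"
            unfolding J2_def using False 3 h p3 iv2 2(1) by (auto intro!: exI[of _ h])
          then have "\<exists>n'<n. J n' (t3 + 2) R3 m2" using S3 h(2) m20 by (auto simp: J_def)
          then show ?thesis using False 3(6) c3 by simp
        next
          case True
          have h0: "0 < h" using True by (cases h) (auto simp: goes_down_def child_def)
          have ch: "R3 21 = nd g (h - 1) ?P" "nd g (h - 1) ?P \<noteq> 0"
            using 3(4) h0 True by (auto simp: child_def goes_down_def)
          have fin2: "wp w L descend (\<lambda>t R m. \<exists>n'<n. J n' (t + 1 + 1) R m) (t3 + 1) R3 m2"
          proof (rule wp_descend[OF p3 h0 h(1) ch(1)])
            show "R3 21 < L" using ch nodeD(3)[OF I2(1) ch(2)] b(1) by simp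
            fix t5 R5
            assume 5: "t5 \<le> t3 + 1 + 4" "same_regs {7, 8, 10, 24} R3 R5" "pos g (h - 1) k R5"
            have "J1 h (t5 + 1 + 1) R5 m2"
              unfolding J1_def
            proof (intro conjI exI[of _ "h - 1"])
              show "R5 23 = 1" using 5(2) 3(6) True by (simp add: same_regs_def)
              show "t5 + 1 + 1 \<le> t + 20 + 160 * (H - (h - 1))"
                using 5(1) 3(1) 2(1) h(1,5) h0 by simp
              show "D (h - 1)" using D(2) h True h0 by blast
            qed (use h h0 ch 5(3) iv2 in auto)
            moreover have "same_regs walk_regs R R5" using S3 5(2) by (auto simp: same_regs_def)
            ultimately show "\<exists>n'<n. J n' (t5 + 1 + 1) R5 m2" using h(2) m20 by (auto simp: J_def)
          qed
          then show ?thesis using 3(6) True c3 by simp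
        qed
      qed
    qed
  next
    fix n t1 R1 m1
    assume J: "J n t1 R1 m1" and nb: "bval (Eq 23 4) R1"
    have S1: "same_regs walk_regs R R1" and m0: "m1 0 = m 0" using J by (auto simp: J_def)
    have "R1 4 = 0" using S1 R(1) by (auto simp: same_regs_def cregs_def)
    then have "J2 n t1 R1 m1" using J nb by (auto simp: J_def J1_def)
    then obtain h where "h \<le> H" "pos g h k R1"
      "nd g h (k div B ^ Suc h) \<noteq> 0" "\<not> goes_down g h k" "R1 11 = su g h (k div B ^ h)"
      "R1 22 = hd0 (ls g h (k div B ^ h))" "t1 \<le> t + 20 + 160 * (H + 1)" "D h"
      "inv g m1 None (KMw g M h)" unfolding J2_def by blast
    then show "Q (t1 + 1) R1 m1" using S1 m0 by (intro Q) auto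
  qed
  have st: "J (Suc H) (11 + t) (R(7 := m 0 5, 10 := m 0 1, 23 := 1)) m"
  proof -
    let ?R = "R(7 := m 0 5, 10 := m 0 1, 23 := 1)"
    have p: "pos g H k ?R" and z: "k div B ^ Suc H = 0"
      using pos_start[OF tab R k, of g "R(7 := m 0 5, 10 := m 0 1)"] nI
      by (auto simp: nodeI_def pos_def cregs_def)
    have "inv g m None (KMw g M (Suc H))"
      using inv by (rule inv_KM_cong) (simp add: KMw_def)
    then have "J1 (Suc H) (11 + t) ?R m"
      unfolding J1_def using p z nI D(1) by (auto simp: nodeI_def)
    then show ?thesis by (auto simp: J_def same_regs_def)
  qed
  have "(1::nat) < 2 ^ w" using small(1) L1 by linarith
  then show ?thesis
    unfolding start_com_def wp_Seq using L1 R(1) loop[OF st] by (simp add: cregs_def del: wp_If)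
qed

subsection \<open>Insertion\<close>

text \<open>The scan passes strictly larger keys only. Hence at height 0, where all keys are equal,
  it stops at once.\<close>

definition find_com :: com where
  "find_com = Imm 24 0 ;; Imm 23 1 ;;
     Until (Eq 23 4) (Imm 23 0 ;; If (Eq 22 4) Skip
       (Ld 25 22 0 ;; If (Lt 9 25) (Bin Add 24 22 4 ;; Ld 22 22 1 ;; Imm 23 1) Skip))"

text \<open>Inserts cell 20 between the cells 24 and 22 (\<open>0\<close>: none) of the slot 11.\<close>

definition ins_com :: com where
  "ins_com = St 20 1 22 ;; If (Eq 24 4) (St 11 3 20) (St 24 1 20) ;;
     If (Eq 22 4) (St 11 4 20) Skip ;; Ld 25 11 5 ;; Bin Add 25 25 5 ;; St 11 5 25"

lemma wp_ins:
  assumes R: "R 4 = 0" "R 5 = 1" "R 11 = q" "R 20 = y" "R 24 = last0 as" "R 22 = hd0 bs"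
    and l: "lst m q (as @ bs)" and y: "y \<notin> set (as @ bs)" "0 < y" and d: "distinct (as @ bs)"
    and pos: "\<forall>c\<in>set (as @ bs). 0 < c \<and> c < L" and b: "q < L" "y < L" "length (as @ bs) + 1 < 2 ^ w"
    and Q: "\<And>t' R' m'. t' \<le> t + 30 \<Longrightarrow> same_regs {25} R R' \<Longrightarrow> R' 25 = length (as @ bs) + 1 \<Longrightarrow>
      lst m' q (as @ y # bs) \<Longrightarrow> list_frame q (insert y (set as)) m m' \<Longrightarrow> Q t' R' m'"
  shows "wp w L ins_com Q t R m"
proof -
  define m2 where "m2 = (if as = [] then upd (upd m y 1 (hd0 bs)) q 3 y else upd (upd m y 1 (hd0 bs)) (last as) 1 y)"
  define m3 where "m3 = (if bs = [] then upd m2 q 4 y else m2)"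
  define m4 where "m4 = upd m3 q 5 (length (as @ bs) + 1)"
  have la: "last as \<noteq> y" if "as \<noteq> []" using that y(1) by (metis Un_iff last_in_set set_append)
  have fr: "list_frame q (insert y (set as)) m m4"
    unfolding list_frame_def by (auto simp: m4_def m3_def m2_def split: if_splits)
  have ch: "chain m4 (as @ y # bs)"
  proof (rule chain_insert[where m = m])
    show "chain m (as @ bs)" using l by (simp add: lst_def)
  qed (use y d la in \<open>auto simp: m4_def m3_def m2_def\<close>)
  have l4: "lst m4 q (as @ y # bs)"
    unfolding lst_def using l ch
    by (cases as; cases bs rule: rev_cases) (auto simp: m4_def m3_def m2_def lst_def last0_def hd0_def)
  have 5: "m q 5 = length (as @ bs)" using l by (simp add: lst_def)
  have 0: "last0 as = 0 \<longleftrightarrow> as = []" "hd0 bs = 0 \<longleftrightarrow> bs = []" "as \<noteq> [] \<Longrightarrow> last0 as < L"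
    using pos by (auto simp: last0_def hd0_def split: list.splits)
  have Q': "Q t' R' mm" if "mm = m4" "t' \<le> t + 30" "same_regs {25} R R'"
    "R' 25 = Suc (length as + length bs)" for t' R' mm
    using Q[of t' R' m4] that fr l4 by simp
  have len: "Suc (length as + length bs) < 2 ^ w" using b(3) by simp
  have 50: "m q 5 = length as + length bs" using 5 by simp
  show ?thesis
  proof (cases "as = []")
    case True
    show ?thesis
    proof (cases "bs = []")
      case bs: True
      show ?thesis
        unfolding ins_com_def using b(1,2) len True bs
        by (simp add: R 50) (rule Q'; simp add: same_regs_def m4_def m3_def m2_def)
    next
      case bs: False
      show ?thesis
        unfolding ins_com_def using b(1,2) len True bs 0
        by (simp add: R 50) (rule Q'; simp add: same_regs_def m4_def m3_def m2_def)
    qed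
  next
    case as: False
    have la': "last0 as = last as" using as by (simp add: last0_def)
    have la0: "last as \<noteq> 0" "last as < L" using 0 as la' by auto
    show ?thesis
    proof (cases "bs = []")
      case bs: True
      show ?thesis
        unfolding ins_com_def using b(1,2) len as bs la0
        by (simp add: R 50 la') (rule Q'; simp add: same_regs_def m4_def m3_def m2_def)
    next
      case bs: False
      show ?thesis
        unfolding ins_com_def using b(1,2) len as bs la0 0
        by (simp add: R 50 la') (rule Q'; simp add: same_regs_def m4_def m3_def m2_def)
    qed
  qed
qed

lemma wp_find:
  assumes xs: "chain m xs" "\<forall>c\<in>set xs. 0 < c \<and> c < L \<and> (R 9 < m c 0 \<longleftrightarrow> P c)"
    and R: "R 22 = hd0 xs" "R 4 = 0"
    and Q: "\<And>t' R' as bs. t' \<le> t + 30 * length as + 30 \<Longrightarrow> same_regs {22, 23, 24, 25} R R' \<Longrightarrow>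
      xs = as @ bs \<Longrightarrow> R' 24 = last0 as \<Longrightarrow> R' 22 = hd0 bs \<Longrightarrow> \<forall>c\<in>set as. P c \<Longrightarrow>
      bs = [] \<or> \<not> P (hd bs) \<Longrightarrow> Q t' R' m"
  shows "wp w L find_com Q t R m"
proof -
  have w1: "(1::nat) < 2 ^ w" using small(1) L1 by linarith
  \<comment> \<open>The variant is 0 once the scan has stopped; the successor in the other case
    accounts for the round that detects this.\<close>
  define I where "I = (\<lambda>n t' R' m'. m' = m \<and> same_regs {22, 23, 24, 25} R R' \<and>
      (\<exists>as bs. xs = as @ bs \<and> R' 24 = last0 as \<and> R' 22 = hd0 bs \<and> (\<forall>c\<in>set as. P c) \<and>
        t' \<le> t + 2 + 30 * length as + (if R' 23 = 0 then 20 else 0) \<and>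
        (if R' 23 = 0 then n = 0 \<and> (bs = [] \<or> \<not> P (hd bs)) else n = Suc (length bs))))"
  have "wp w L (Until (Eq 23 4) (Imm 23 0 ;; If (Eq 22 4) Skip
       (Ld 25 22 0 ;; If (Lt 9 25) (Bin Add 24 22 4 ;; Ld 22 22 1 ;; Imm 23 1) Skip))) Q (t + 2)
       (R(24 := 0, 23 := 1)) m"
  proof (rule wp_Until[where I = I and n = "Suc (length xs)"])
    show "I (Suc (length xs)) (t + 2) (R(24 := 0, 23 := 1)) m"
      unfolding I_def using R by (intro conjI exI[of _ "[]"] exI[of _ xs]) (auto simp: same_regs_def)
  next
    fix n t1 R1 m1
    assume I: "I n t1 R1 m1" and nb: "\<not> bval (Eq 23 4) R1"
    have s: "same_regs {22, 23, 24, 25} R R1" and m1: "m1 = m" using I by (auto simp: I_def)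
    have r: "R1 4 = 0" "R1 9 = R 9" "R1 23 \<noteq> 0" using s R nb by (auto simp: same_regs_def)
    obtain as bs where 1: "xs = as @ bs" "R1 24 = last0 as" "R1 22 = hd0 bs" "\<forall>c\<in>set as. P c"
      "t1 \<le> t + 2 + 30 * length as" "n = Suc (length bs)"
      using I r(3) unfolding I_def by auto
    have stop: "\<exists>n'<n. I n' t' R' m" if "same_regs {23, 25} R1 R'" "R' 23 = 0" "t' \<le> t1 + 20"
      "bs = [] \<or> \<not> P (hd bs)" for t' R'
    proof (intro exI[of _ 0] conjI)
      show "I 0 t' R' m"
        unfolding I_def using that 1 s
        by (intro conjI exI[of _ as] exI[of _ bs]) (auto simp: same_regs_def)
    qed (simp add: 1)
    show "wp w L (Imm 23 0 ;; If (Eq 22 4) Skip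
       (Ld 25 22 0 ;; If (Lt 9 25) (Bin Add 24 22 4 ;; Ld 22 22 1 ;; Imm 23 1) Skip))
       (\<lambda>t R m. \<exists>n'<n. I n' (t + 1) R m) (t1 + 1) R1 m1"
    proof (cases bs)
      case Nil
      have "\<exists>n'<n. I n' (Suc (Suc (Suc (t1 + 1)))) (R1(23 := 0)) m"
        by (rule stop) (use Nil in \<open>auto simp: same_regs_def\<close>)
      then show ?thesis using Nil 1(3) r m1 by simp
    next
      case (Cons c cs)
      have c: "0 < c" "c < L" "R 9 < m c 0 \<longleftrightarrow> P c" using xs(2) 1(1) Cons by auto
      have n: "m c (Suc 0) = hd0 cs" using chain_append[of m as bs] xs(1) 1(1) Cons by simp
      have c22: "R1 22 = c" using 1(3) Cons by simp
      show ?thesis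
      proof (cases "P c")
        case True
        have "\<exists>n'<n. I n' t' R' m" if "t' \<le> t1 + 25" "same_regs {22, 23, 24, 25} R1 R'" "R' 23 = 1"
          "R' 24 = c" "R' 22 = hd0 cs" for t' R'
        proof (intro exI[of _ "Suc (length cs)"] conjI)
          show "I (Suc (length cs)) t' R' m"
            unfolding I_def using that 1 s True Cons
            by (intro conjI exI[of _ "as @ [c]"] exI[of _ cs]) (auto simp: same_regs_def)
        qed (simp add: 1 Cons)
        moreover have "c < 2 ^ w" using c(2) small(1) by simp
        ultimately show ?thesis
          using c w1 True by (simp add: c22 r m1 n same_regs_def)
      next
        case False
        then show ?thesis
          using c(1,2) by (simp add: c22 r m1 c(3)) (rule stop; simp add: same_regs_def Cons)
      qed
    qed
  next
    fix n t1 R1 m1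
    assume I: "I n t1 R1 m1" and nb: "bval (Eq 23 4) R1"
    have s: "same_regs {22, 23, 24, 25} R R1" and m1: "m1 = m" using I by (auto simp: I_def)
    have r: "R1 23 = 0" using s R nb by (auto simp: same_regs_def)
    obtain as bs where 1: "xs = as @ bs" "R1 24 = last0 as" "R1 22 = hd0 bs" "\<forall>c\<in>set as. P c"
      "t1 \<le> t + 2 + 30 * length as + 20" "bs = [] \<or> \<not> P (hd bs)"
      using I r unfolding I_def by auto
    then show "Q (t1 + 1) R1 m1" unfolding m1 using s by (intro Q[of _ as _ bs]) auto
  qed
  then show ?thesis unfolding find_com_def using w1 by simp
qed

end

lemma wp_Seq_fun: "wp w L (c1 ;; c2) Q = wp w L c1 (wp w L c2 Q)"
  by (intro ext) simp

context trie begin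

section \<open>Linking a cell and relieving overfull slots\<close>

text \<open>Register 10 is 0 at the bottom, where lists may grow without limit; register 25 still
  holds the length left by \<open>ins_com\<close>.\<close>

definition over_com :: com where
  "over_com = Imm 23 0 ;; If (Eq 10 4) Skip (If (Lt 6 25) (Imm 23 1) Skip)"

text \<open>Register 9 receives the word of the popped cell, so that \<open>descend\<close> follows
  its key instead of the key inserted originally.\<close>

definition pop_com :: com where
  "pop_com = Ld 20 11 3 ;; Ld 24 20 1 ;; St 11 3 24 ;; Bin Sub 25 25 5 ;; St 11 5 25 ;;
     Ld 9 20 0 ;; Ld 21 11 6"

definition alloc_com :: com where
  "alloc_com = If (Eq 21 4)
     (Ld 21 4 3 ;; St 11 6 21 ;; Bin Add 24 21 6 ;; Bin Add 24 24 5 ;; St 4 3 24) Skip"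

text \<open>A move increases only the counts of the child: at the old height and above, the key was
  counted before and still is.\<close>

definition push_com :: com where
  "push_com = Until (Eq 23 4) (pop_com ;; alloc_com ;; descend ;; count_com 8 ;;
     Bin Add 11 7 8 ;; Bin Add 11 11 5 ;; Ld 24 11 4 ;; Imm 22 0 ;; ins_com ;; over_com)"

definition link_com :: com where
  "link_com = (start_com ;; walk_com 8) ;; find_com ;; ins_com ;; over_com ;; push_com"

text \<open>The bound of \<open>nodes_bound\<close> on \<open>ne\<close>, with a third
  \<open>B + 1\<close> as space for one more node.\<close>

definition roomy :: "ghost \<Rightarrow> bool" where
  "roomy g \<longleftrightarrow> 3 * (B + 1) + 2 * (ce g - (B + 1)) \<le> L \<and> ce g \<le> L"

lemma roomyD:
  assumes "roomy g" "nodeI g m" "cellI g m"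
  shows "ne g \<le> L" "ce g \<le> L" "ne g + B + 1 \<le> L"
proof -
  obtain x where x: "x = ce g - (B + 1)" by simp
  have "ne g \<le> 2 * (B + 1) + 2 * x" "3 * (B + 1) + 2 * x \<le> L" "ce g \<le> L"
    using nodes_bound[OF assms(2,3)] assms(1) unfolding roomy_def x by blast+
  then show "ne g \<le> L" "ce g \<le> L" "ne g + B + 1 \<le> L" by simp_all
qed

lemma listI_length:
  assumes "listI g m ov" "0 < h" "nd g h (P div B) \<noteq> 0"
  shows "length (ls g h P) \<le> B + (if ov = Some (h, P) then 1 else 0)"
  using assms unfolding listI_def by blast

lemma nodeI_child:
  assumes "nodeI g m" "nd g h (P div B) \<noteq> 0"
  shows "m (su g h P) 6 = (if h = 0 then 0 else nd g (h - 1) P)"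
  using assms unfolding nodeI_def by blast

lemma wp_over:
  assumes "cregs R" "R 10 = B ^ h div B"
    and Q: "\<And>t' R'. t' \<le> t + 6 \<Longrightarrow> same_regs {23} R R' \<Longrightarrow>
      R' 23 = (if 0 < h \<and> B < R 25 then 1 else 0) \<Longrightarrow> Q t' R' m"
  shows "wp w L over_com Q t R m"
proof -
  have w1: "(1::nat) < 2 ^ w" using small(1) L1 by linarith
  show ?thesis
  proof (cases "h = 0")
    case True
    then have "R 10 = 0" using assms(2) B2 by simp
    then show ?thesis
      unfolding over_com_def using assms(1) True
      by (simp add: cregs_def) (rule Q; simp add: same_regs_def)
  next
    case False
    then have "R 10 \<noteq> 0" using assms(2) B_pos by (cases h) auto
    then show ?thesis
      unfolding over_com_def using assms(1) False w1
      by (simp add: cregs_def) (intro conjI impI Q; simp add: same_regs_def)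
  qed
qed

lemma size_KMr_less: "cellI g m \<Longrightarrow> size (KMr g h) < ce g"
  unfolding KMr_def using card_le_gC[of g m "\<lambda>c. gh g c \<le> h"] by simp

text \<open>
  The maximum of an overfull slot moves to the child. It is at most as large as every key below the
  slot, so it becomes the last cell of its new list.
\<close>

lemma wp_push_step:
  assumes inv: "inv g m (Some (h, P)) (KMr g)" and h: "0 < h" and len: "B < length (ls g h P)"
    and a: "pos g h k R" "k div B ^ h = P" and n: "nd g h (P div B) \<noteq> 0"
    and R: "R 11 = su g h P" "R 25 = length (ls g h P)" and room: "roomy g"
    and Q: "\<And>t' R' m' g' k' P'. t' \<le> t + 240 \<Longrightarrow> same_regs {7..25} R R' \<Longrightarrow> P' = k' div B ^ (h - 1) \<Longrightarrow>
      inv g' m' (if 0 < h - 1 \<and> B < length (ls g' (h - 1) P') then Some (h - 1, P') else None) (KMr g') \<Longrightarrow>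
      pos g' (h - 1) k' R' \<Longrightarrow> nd g' (h - 1) (P' div B) \<noteq> 0 \<Longrightarrow> R' 11 = su g' (h - 1) P' \<Longrightarrow>
      R' 25 = length (ls g' (h - 1) P') \<Longrightarrow>
      R' 23 = (if 0 < h - 1 \<and> B < length (ls g' (h - 1) P') then 1 else 0) \<Longrightarrow>
      gC g' = gC g \<and> gT g' = gT g \<and> gP g' = gP g \<and> gK g' = gK g \<and> ce g' = ce g \<Longrightarrow>
      \<forall>f. f \<noteq> 3 \<longrightarrow> m' 0 f = m 0 f \<Longrightarrow> Q t' R' m'"
  shows "wp w L (pop_com ;; alloc_com ;; descend ;; count_com 8 ;;
     Bin Add 11 7 8 ;; Bin Add 11 11 5 ;; Ld 24 11 4 ;; Imm 22 0 ;; ins_com ;; over_com) Q t R m"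
proof -
  have w1: "(1::nat) < 2 ^ w" using small(1) L1 by linarith
  have I: "memI g m" "nodeI g m" "listI g m (Some (h, P))" "cellI g m" "countI g m (KMr g)"
    using inv by (auto simp: inv_def)
  have fin: "finite (gC g)" using finite_cells I by blast
  note rm = roomyD[OF room I(2,4)]
  let ?q = "su g h P"
  have qr: "B + 1 < ?q" "?q < ne g" using su_range[OF I(2) n] by auto
  have hH: "h \<le> H" using nodeD(1)[OF I(2) n] .
  obtain y ys where xs: "ls g h P = y # ys" using len by (cases "ls g h P") auto
  have "length (ls g h P) \<le> B + 1" using listI_length[OF I(3) h n] by simp
  \<comment> \<open>Exactly \<open>B\<close> cells remain in the slot, just enough to pay for a
    child.\<close>
  then have lys: "length ys = B" using len xs by simp
  then have ys0: "ys \<noteq> []" using B_pos by auto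
  note lD = listD[OF I(3) n]
  have set_ls: "insert y (set ys) = {c \<in> gC g. gh g c = h \<and> gK g c div B ^ h = P}" using lD(2) xs by simp
  have "y \<in> {c \<in> gC g. gh g c = h \<and> gK g c div B ^ h = P}" using set_ls by blast
  then have y: "y \<in> gC g" "gh g y = h" "gK g y div B ^ h = P" by simp_all
  have dy: "y \<notin> set ys" "distinct ys" using lD(3) xs by auto
  note cy = cellD[OF I(4) y(1)]
  define k' where "k' = gK g y"
  define P' where "P' = k' div B ^ (h - 1)"
  have sh: "Suc (h - 1) = h" using h by simp
  have P'P: "P' div B = P" using div_Suc[of k' "h - 1"] y(3) unfolding P'_def k'_def sh by simp
  have l0: "m ?q 3 = y" "m ?q 4 = last ys" "m ?q 5 = Suc B" "m y (Suc 0) = hd0 ys" "chain m ys"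
    using lD(1) ys0 lys unfolding xs by (simp_all add: lst_def last0_def)
  have m6: "m ?q 6 = nd g (h - 1) P" using nodeI_child[OF I(2) n] h by simp
  define m1 where "m1 = upd (upd m ?q 3 (hd0 ys)) ?q 5 B"
  define g1 where "g1 = g\<lparr>gC := gC g - {y}, gT := gT g, gP := gP g - {y},
      ls := (ls g)(h := (ls g h)(P := [] @ ys))\<rparr>"
  have lst1: "lst m1 ?q ([] @ ys)"
    using l0 chain_cong[of ys m1 m] lys ys0 by (auto simp: lst_def m1_def last0_def)
  have fr1: "list_frame ?q (set []) m m1" by (auto simp: list_frame_def m1_def split: if_splits)
  \<comment> \<open>The popped cell is live but unlinked, while the counts still include it;
    therefore the multisets remain those of \<open>g\<close>.\<close>
  have inv1: "inv g1 m1 None (KMr g)"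
    by (rule inv_remove(1)[OF inv _ n _ fr1 lst1 _ g1_def]) (use xs lys in auto)
  have pop: "wp w L pop_com Q' t R m" if Q': "\<And>R'. same_regs {9, 20, 21, 24, 25} R R' \<Longrightarrow> R' 20 = y \<Longrightarrow>
      R' 9 = k' mod B ^ H \<Longrightarrow> R' 21 = nd g (h - 1) P \<Longrightarrow> R' 25 = B \<Longrightarrow> Q' (t + 31) R' m1" for Q'
  proof -
    have c: "R 4 = 0" "R 5 = 1" using a(1) by (auto simp: pos_def cregs_def)
    have b: "?q < L" "y < L" "Suc B < 2 ^ w" using qr rm cy small(1) L1 by auto
    have k0: "m y 0 = k' mod B ^ H" using cy(1) by (simp add: k'_def)
    have Q'': "Q' tt R' mm" if "tt = t + 31" "mm = m1" "same_regs {9, 20, 21, 24, 25} R R'" "R' 20 = y"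
      "R' 9 = k' mod B ^ H" "R' 21 = nd g (h - 1) P" "R' 25 = B" for tt R' mm
      using Q' that by simp
    show ?thesis
      unfolding pop_com_def using b
      by (simp add: R c l0 m6 k0 xs lys) (rule Q''; simp add: same_regs_def m1_def)
  qed
  have gC1: "gC g1 = gC g - {y}" "gT g1 = gT g" "gP g1 = gP g - {y}" "gK g1 = gK g" "gh g1 = gh g"
    "ce g1 = ce g" "nd g1 = nd g" "ne g1 = ne g" by (simp_all add: g1_def)
  have KM1: "KMr g h' = (if h \<le> h' then add_mset k' (KMr g1 h') else KMr g1 h')" for h'
    using KMr_remove[OF fin y(1) gC1(1,5,4)] y(2) by (simp add: k'_def)
  \<comment> \<open>A cell below the slot needs all nodes of its path, the child among them. So an
    absent child has nothing to count.\<close>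
  have low_none: "nd g (h - 1) P \<noteq> 0" if "c \<in> gC g" "gh g c < h" "gK g c div B ^ h = P" for c
    using listI_path[OF I(3) that(1), of "h - 1"] that(2,3) hH unfolding sh by auto
  define rest where "rest = descend ;; count_com 8 ;;
     Bin Add 11 7 8 ;; Bin Add 11 11 5 ;; Ld 24 11 4 ;; Imm 22 0 ;; ins_com ;; over_com"
  have alloc: "wp w L alloc_com Q' t' R' m1"
    if R': "cregs R'" "R' 11 = ?q" "R' 21 = nd g (h - 1) P"
      and Q': "\<And>t2 R2 m2 g2. t2 \<le> t' + 25 \<Longrightarrow> same_regs {21, 24} R' R2 \<Longrightarrow> R2 21 = nd g2 (h - 1) P \<Longrightarrow>
        inv g2 m2 None (KMr g) \<Longrightarrow> nd g2 (h - 1) P \<noteq> 0 \<Longrightarrow> (\<forall>h p. nd g h p \<noteq> 0 \<longrightarrow> nd g2 h p = nd g h p) \<Longrightarrow>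
        gC g2 = gC g1 \<and> gT g2 = gT g1 \<and> gP g2 = gP g1 \<and> gK g2 = gK g1 \<and> gh g2 = gh g1 \<and> ce g2 = ce g1 \<and> ne g2 \<le> L \<Longrightarrow>
        (\<forall>f. f \<noteq> 3 \<longrightarrow> m2 0 f = m1 0 f) \<Longrightarrow> Q' t2 R2 m2" for Q' t' R'
  proof (cases "nd g (h - 1) P = 0")
    case False
    have "R' 4 = 0" using R'(1) by (simp add: cregs_def)
    then show ?thesis
      unfolding alloc_com_def using R' False inv1 rm(1)
      by simp (rule Q'[of _ _ g1]; simp add: gC1 same_regs_def)
  next
    case True
    define m2 where "m2 = upd (upd m1 ?q 6 (ne g)) 0 3 (ne g + B + 1)"
    define g2 where "g2 = g1\<lparr>nd := (nd g1)(h - 1 := (nd g1 (h - 1))(P := ne g1)), ne := ne g1 + B + 1,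
       ls := (ls g1)(h - 1 := (\<lambda>P'. if P' div B = P then [] else ls g1 (h - 1) P'))\<rparr>"
    have inv2: "inv g2 m2 None (KMr g)"
    proof (rule inv_alloc[OF inv1 h _ _ _ _ _ g2_def])
      show "nd g1 h (P div B) \<noteq> 0" "nd g1 (h - 1) P = 0" using n True by (simp_all add: gC1)
      show "m2 = upd (upd m1 (su g1 h P) 6 (ne g1)) 0 3 (ne g1 + B + 1)"
        by (simp add: m2_def gC1 su_def)
      have "set ys \<subseteq> {c \<in> gP g1. gh g1 c = h \<and> gK g1 c div B ^ h = P}"
      proof
        fix c assume c: "c \<in> set ys"
        then have "c \<in> gC g" "gh g c = h" "gK g c div B ^ h = P" "c \<noteq> y" using set_ls dy by auto
        then show "c \<in> {c \<in> gP g1. gh g1 c = h \<and> gK g1 c div B ^ h = P}"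
          using cellD(6)[OF I(4)] by (simp add: gC1)
      qed
      moreover have "finite (gP g1)"
        using I(4) unfolding cellI_def gC1 by (meson finite_Diff finite_atLeastLessThan finite_subset)
      ultimately have "card (set ys) \<le> card {c \<in> gP g1. gh g1 c = h \<and> gK g1 c div B ^ h = P}"
        by (intro card_mono) auto
      then show "B \<le> card {c \<in> gP g1. gh g1 c = h \<and> gK g1 c div B ^ h = P}"
        using lys dy(2) distinct_card by metis
      show "\<forall>v. v \<in># KMr g (h - 1) \<longrightarrow> v div B ^ h \<noteq> P"
        using low_none True h fin by (force simp: KMr_def)
    qed
    have c: "R' 4 = 0" "R' 5 = 1" "R' 6 = B" using R'(1) by (auto simp: cregs_def)
    have b: "?q < L" "0 < L" "ne g + B < 2 ^ w" "Suc (ne g + B) < 2 ^ w" "ne g < 2 ^ w"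
      using qr rm small(1) by auto
    have m03: "m1 0 3 = ne g" using inv1 by (simp add: inv_def memI_def gC1)
    have Q'': "Q' t2 R2 mm" if "mm = m2" "t2 \<le> t' + 25" "same_regs {21, 24} R' R2" "R2 21 = ne g" for t2 R2 mm
    proof -
      have nz: "ne g \<noteq> 0" using qr by simp
      show ?thesis unfolding that(1)
        by (rule Q'[of _ _ g2]) (use that inv2 True rm(3) nz qr in \<open>auto simp: g2_def gC1 m2_def\<close>)
    qed
    show ?thesis
      unfolding alloc_com_def using R' True b
      by (simp add: c m03) (rule Q''; simp add: same_regs_def m2_def)
  qed
  have last: "wp w L rest Q t' R' m2"
    if t': "t' \<le> t + 60" and S: "same_regs {9, 20, 21, 24, 25} R R'" and R': "R' 20 = y" "R' 9 = k' mod B ^ H"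
      "R' 21 = nd g2 (h - 1) P" and inv2: "inv g2 m2 None (KMr g)" and n2: "nd g2 (h - 1) P \<noteq> 0"
      and mono: "\<forall>h p. nd g h p \<noteq> 0 \<longrightarrow> nd g2 h p = nd g h p"
      and gg: "gC g2 = gC g1 \<and> gT g2 = gT g1 \<and> gP g2 = gP g1 \<and> gK g2 = gK g1 \<and> gh g2 = gh g1 \<and> ce g2 = ce g1 \<and> ne g2 \<le> L"
      and m2: "\<forall>f. f \<noteq> 3 \<longrightarrow> m2 0 f = m 0 f" for t' R' g2 m2
  proof -
    have I2: "memI g2 m2" "nodeI g2 m2" "listI g2 m2 None" "cellI g2 m2" "countI g2 m2 (KMr g)"
      using inv2 by (auto simp: inv_def)
    have kS: "k' div B ^ Suc h = P div B" using y(3) div_Suc[of k' h] by (simp add: k'_def)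
    have aS: "k div B ^ Suc h = P div B" using a(2) div_Suc[of k h] by simp
    have p2: "pos g2 h k' R'"
      using a S R'(2) mono n y(3) unfolding pos_def kS aS
      by (auto simp: cregs_def same_regs_def k'_def)
    have nh: "nd g2 (h - 1) (k' div B ^ Suc (h - 1)) \<noteq> 0" using n2 y(3) unfolding sh k'_def by simp
    have nh': "nd g2 (h - 1) (P' div B) \<noteq> 0" using n2 P'P by simp
    have c21: "R' 21 = nd g2 (h - 1) (k' div B ^ h)" using R'(3) y(3) by (simp add: k'_def)
    have L21: "R' 21 < L" using nodeD(3)[OF I2(2) n2] gg R'(3) by simp
    show ?thesis
      unfolding rest_def wp_Seq[of w L descend]
    proof (rule wp_descend[OF p2 h hH c21 L21])
      fix t3 R3
      assume 3: "t3 \<le> t' + 4" "same_regs {7, 8, 10, 24} R' R3" "pos g2 (h - 1) k' R3"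
      have r3: "cregs R3" "R3 7 = nd g2 (h - 1) P" "R3 8 = P' mod B" "P' mod B < B"
        using 3(3) y(3) B_pos unfolding pos_def sh by (auto simp: P'_def k'_def)
      have nb: "B < nd g2 (h - 1) P" "nd g2 (h - 1) P + B < L" using nodeD[OF I2(2) n2] gg by auto
      have t2: "table m2" using I2(1) by (simp add: memI_def)
      let ?F = "cntF (KMr g (h - 1)) (h - 1) P" and ?F' = "cntF (add_mset k' (KMr g (h - 1))) (h - 1) P"
      have cn: "counts m2 (nd g2 (h - 1) P) ?F" using I2(5) n2 by (simp add: countI_def)
      have ksh: "k' div B ^ Suc (h - 1) = P" using y(3) unfolding sh k'_def by simp
      have F: "8 = (8::nat) \<and> (\<forall>i<B. ?F' i = ?F i + above (P' mod B) i) \<or>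
          8 = (9::nat) \<and> (\<forall>i<B. ?F' i + above (P' mod B) i = ?F i)"
        using cntF_add_same[of _ k' "KMr g (h - 1)" "h - 1"] unfolding ksh P'_def by simp
      have Fb: "\<forall>i<B. ?F' i + B < 2 ^ w"
      proof (intro allI impI)
        fix i show "?F' i + B < 2 ^ w"
          using cntF_le_size[of "add_mset k' (KMr g (h - 1))" "h - 1" P i]
            size_KMr_less[OF I(4), of "h - 1"] rm(2) L1 L2 by simp
      qed
      show "wp w L (count_com 8 ;; Bin Add 11 7 8 ;; Bin Add 11 11 5 ;; Ld 24 11 4 ;; Imm 22 0 ;; ins_com ;; over_com) Q t3 R3 m2"
        unfolding wp_Seq[of w L "count_com 8"]
      proof (rule wp_count[OF r3 nb t2 cn F Fb])
        fix t4 R4 m4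
        assume 4: "t4 \<le> t3 + 100" "same_regs {12..19} R3 R4" "node_frame (nd g2 (h - 1) P) m2 m4"
          "counts m4 (nd g2 (h - 1) P) ?F'"
        define KM4 where "KM4 = (KMr g)(h - 1 := add_mset k' (KMr g (h - 1)))"
        have inv4: "inv g2 m4 None KM4"
          unfolding KM4_def
          using inv_count[OF inv2 nh, of m4 "add_mset k' (KMr g (h - 1))"] 4(3,4) unfolding ksh by blast
        have I4: "nodeI g2 m4" "listI g2 m4 None" "cellI g2 m4" using inv4 by (auto simp: inv_def)
        have m40: "\<forall>f. m4 0 f = m2 0 f" using node_frame_mem(1)[OF I2(2) n2 4(3)] by simp
        have p4: "pos g2 (h - 1) k' R4" using 3(3) 4(2) by (auto simp: pos_def cregs_def same_regs_def)
        let ?q' = "su g2 (h - 1) P'"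
        define zs where "zs = ls g2 (h - 1) P'"
        note zD = listD[OF I4(2) nh', folded zs_def]
        have q': "?q' = Suc (R4 7 + R4 8)" "B + 1 < ?q'" "?q' < L"
          using p4 su_range[OF I4(1) nh'] gg unfolding pos_def sh su_def P'P
          by (auto simp: y(3)[folded k'_def] P'_def)
        have r4: "R4 4 = 0" "R4 5 = 1" "R4 20 = y" using p4 4(2) 3(2) R'(1) by (auto simp: pos_def cregs_def same_regs_def)
        have q'w: "R4 7 + R4 8 < 2 ^ w" "Suc (R4 7 + R4 8) < 2 ^ w" using q' small(1) by auto
        have m44: "m4 ?q' 4 = last0 zs" using zD(1) by (simp add: lst_def)
        define R5 where "R5 = R4(11 := ?q', 24 := last0 zs, 22 := 0)"
        have yz: "y \<notin> set zs" using zD(2) gg gC1 by auto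
        have zc: "c \<in> gC g \<and> c \<noteq> y \<and> gh g c = h - 1 \<and> gK g c div B ^ (h - 1) = P'" if "c \<in> set zs" for c
          using that zD(2) gg gC1 by auto
        have lz: "length zs < L"
        proof -
          have "length zs = card (set zs)" using zD(3) distinct_card by metis
          also have "\<dots> \<le> card (gC g)" using zc fin by (intro card_mono) auto
          also have "\<dots> < ce g" by (rule card_gC_less[OF I(4)])
          finally show ?thesis using rm(2) by simp
        qed
        have ins: "wp w L ins_com (wp w L over_com Q) (8 + t4) R5 m4"
        proof (rule wp_ins[where as = zs and bs = "[]" and q = ?q' and y = y])
          show "R5 4 = 0" "R5 5 = 1" "R5 11 = ?q'" "R5 20 = y" "R5 24 = last0 zs" "R5 22 = hd0 []"
            using r4 by (simp_all add: R5_def)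
          show "lst m4 ?q' (zs @ [])" using zD(1) by simp
          show "y \<notin> set (zs @ [])" "0 < y" "distinct (zs @ [])" using yz cy zD(3) by auto
          show "\<forall>c\<in>set (zs @ []). 0 < c \<and> c < L"
          proof
            fix c assume "c \<in> set (zs @ [])"
            then have "c \<in> gC g" using zc by auto
            then show "0 < c \<and> c < L" using cellD(2,3)[OF I(4)] rm(2) by fastforce
          qed
          show "?q' < L" "y < L" "length (zs @ []) + 1 < 2 ^ w" using q' cy rm(2) lz small(1) L1 L2 by auto
        next
          fix t6 R6 m6
          assume 6: "t6 \<le> 8 + t4 + 30" "same_regs {25} R5 R6" "R6 25 = length (zs @ []) + 1"
            "lst m6 ?q' (zs @ [y])" "list_frame ?q' (insert y (set zs)) m4 m6"
          define fl where "fl = (0 < h - 1 \<and> B < length zs + 1)"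
          define g6 where "g6 = g2\<lparr>gC := insert y (gC g2), gP := insert y (gP g2), gh := (gh g2)(y := h - 1),
            ls := (ls g2)(h - 1 := (ls g2 (h - 1))(P' := zs @ [y]))\<rparr>"
          have inv6: "inv g6 m6 (if fl then Some (h - 1, P') else None) KM4"
          proof (rule inv_insert[OF inv4 _ _ _ _ nh' _ _ _ _ _ _ 6(5,4) g6_def])
            show "y \<in> gT g2" "y \<notin> gC g2" "y \<notin> gP g2" using gg gC1 cy by auto
            show "gK g2 y div B ^ (h - 1) = P'" using gg gC1 by (simp add: P'_def k'_def)
            show "ls g2 (h - 1) P' = zs @ []" by (simp add: zs_def)
            show "\<forall>h'. h - 1 \<le> h' \<longrightarrow> h' \<le> H \<longrightarrow> nd g2 h' (gK g2 y div B ^ Suc h') \<noteq> 0"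
            proof (intro allI impI)
              fix h' assume h': "h - 1 \<le> h'" "h' \<le> H"
              show "nd g2 h' (gK g2 y div B ^ Suc h') \<noteq> 0"
              proof (cases "h' = h - 1")
                case True
                then show ?thesis using nh gg gC1 by (simp add: k'_def)
              next
                case False
                then have "nd g h' (gK g y div B ^ Suc h') \<noteq> 0"
                  using h' y(2) by (intro listI_path[OF I(3) y(1)]) auto
                then show ?thesis using mono gg gC1 by metis
              qed
            qed
            have below: "k' \<le> gK g c" if "c \<in> gC g" "gh g c < h" "gK g c div B ^ (h - 1) = P'" for c
            proof -
              have "gK g c div B ^ h = P"
                using that(3) P'P div_Suc[of "gK g c" "h - 1"] unfolding sh by simp
              then show ?thesis
                using listI_order[OF I(3) y(1) that(1)] that(2) y by (simp add: k'_def)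
            qed
            show "\<forall>c\<in>set zs. gK g2 y \<le> gK g2 c" using below zc h gg gC1 by (auto simp: k'_def)
            show "\<forall>c\<in>gC g2. gh g2 c < h - 1 \<longrightarrow> gK g2 c div B ^ (h - 1) = P' \<longrightarrow> gK g2 y \<le> gK g2 c"
              using below gg gC1 by (auto simp: k'_def)
            show "\<forall>c\<in>gC g2. h - 1 < gh g2 c \<longrightarrow> gK g2 c div B ^ gh g2 c = gK g2 y div B ^ gh g2 c \<longrightarrow> gK g2 c \<le> gK g2 y"
            proof (intro ballI impI)
              fix c assume c: "c \<in> gC g2" "h - 1 < gh g2 c" "gK g2 c div B ^ gh g2 c = gK g2 y div B ^ gh g2 c"
              have c': "c \<in> gC g" "c \<noteq> y" "h \<le> gh g c" "gK g c div B ^ gh g c = gK g y div B ^ gh g c"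
                using c gg gC1 by auto
              show "gK g2 c \<le> gK g2 y"
              proof (cases "gh g c = h")
                case True
                then have "c \<in> set ys" using c' set_ls y(3) by auto
                then show ?thesis using lD(4) xs gg gC1 by simp
              next
                case False
                then show ?thesis using listI_order[OF I(3) c'(1) y(1)] c' y(2) gg gC1 by simp
              qed
            qed
            show "(if fl then Some (h - 1, P') else None) = Some (h - 1, P') \<or> h - 1 = 0 \<or> length (zs @ []) < B"
              by (auto simp: fl_def)
          qed simp
          have KM6: "KMr g6 h' = KM4 h'" for h'
          proof -
            have f2: "finite (gC g2)" "y \<notin> gC g2" using gg gC1 fin by auto
            have "KMr g6 h' = (if h - 1 \<le> h' then add_mset k' (KMr g2 h') else KMr g2 h')"
              using KMr_insert[OF f2, of g6 "h - 1"] gg gC1 by (simp add: g6_def k'_def)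
            moreover have "KMr g2 h' = KMr g1 h'" using gg by (simp add: KMr_def)
            ultimately show ?thesis
              unfolding KM4_def using KM1[of h'] KM1[of "h - 1"] h by (auto split: if_splits)
          qed
          have inv6': "inv g6 m6 (if fl then Some (h - 1, P') else None) (KMr g6)"
            using inv_KM_cong[OF inv6] KM6 by blast
          have c6: "cregs R6" "R6 10 = B ^ (h - 1) div B"
            using p4 6(2) by (auto simp: R5_def pos_def cregs_def same_regs_def)
          have ls6: "ls g6 (h - 1) P' = zs @ [y]" by (simp add: g6_def)
          have nd6: "nd g6 = nd g2" by (simp add: g6_def)
          have s6: "su g6 h' p = su g2 h' p" for h' p by (simp add: su_def nd6)
          show "wp w L over_com Q t6 R6 m6"
          proof (rule wp_over[OF c6])
            fix t7 R7
            assume 7: "t7 \<le> t6 + 6" "same_regs {23} R6 R7" "R7 23 = (if 0 < h - 1 \<and> B < R6 25 then 1 else 0)"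
            show "Q t7 R7 m6"
            proof (rule Q[of t7 R7 P' k' g6 m6])
              show "t7 \<le> t + 240" using 7(1) 6(1) 4(1) 3(1) t' by simp
              show "same_regs {7..25} R R7"
                using 7(2) 6(2) 4(2) 3(2) S by (auto simp: same_regs_def R5_def)
              show "inv g6 m6 (if 0 < h - 1 \<and> B < length (ls g6 (h - 1) P') then Some (h - 1, P') else None) (KMr g6)"
                using inv6' unfolding ls6 fl_def by simp
              show "pos g6 (h - 1) k' R7"
                using p4 6(2) 7(2) by (auto simp: R5_def pos_def cregs_def same_regs_def nd6)
              show "nd g6 (h - 1) (P' div B) \<noteq> 0" using nh' by (simp add: nd6)
              show "R7 11 = su g6 (h - 1) P'"
                using 6(2) 7(2) unfolding s6 by (simp add: same_regs_def R5_def)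
              show "R7 25 = length (ls g6 (h - 1) P')" using 6(3) 7(2) unfolding ls6 by (simp add: same_regs_def)
              show "R7 23 = (if 0 < h - 1 \<and> B < length (ls g6 (h - 1) P') then 1 else 0)"
                using 7(3) 6(3) unfolding ls6 by simp
              show "gC g6 = gC g \<and> gT g6 = gT g \<and> gP g6 = gP g \<and> gK g6 = gK g \<and> ce g6 = ce g"
                using gg y(1) cy(6) by (auto simp: g6_def gC1)
              have "m6 0 f = m4 0 f" for f
                using list_frame_mem(1)[OF 6(5), of 0] q'(2) cy(2) zc cellD(2)[OF I(4)] by fastforce
              then show "\<forall>f. f \<noteq> 3 \<longrightarrow> m6 0 f = m 0 f" using m40 m2 by simp
            qed (simp add: P'_def)
          qed
        qed
        have e: "R4(11 := Suc (R4 7 + R4 8), 24 := last0 zs, 22 := 0) = R5" unfolding R5_def q'(1) by (rule refl)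
        show "wp w L (Bin Add 11 7 8 ;; Bin Add 11 11 5 ;; Ld 24 11 4 ;; Imm 22 0 ;; ins_com ;; over_com) Q t4 R4 m4"
          using q'w q'(3) m44[unfolded q'(1)] r4 ins unfolding q'(1) by (simp add: e[unfolded q'(1)])
      qed
    qed
  qed
  have "wp w L pop_com (wp w L alloc_com (wp w L rest Q)) t R m"
  proof (rule pop)
    fix R' assume R': "same_regs {9, 20, 21, 24, 25} R R'" "R' 20 = y" "R' 9 = k' mod B ^ H"
      "R' 21 = nd g (h - 1) P" "R' 25 = B"
    have c: "cregs R'" "R' 11 = ?q" using a(1) R R'(1) by (auto simp: pos_def cregs_def same_regs_def)
    have m10: "m1 0 f = m 0 f" for f using qr by (simp add: m1_def)
    show "wp w L alloc_com (wp w L rest Q) (t + 31) R' m1"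
    proof (rule alloc[OF c R'(4)], rule last)
      fix t2 R2 m2 g2
      assume 2: "t2 \<le> t + 31 + 25" "same_regs {21, 24} R' R2" "R2 21 = nd g2 (h - 1) P"
        "\<forall>f. f \<noteq> 3 \<longrightarrow> m2 0 f = m1 0 f"
      show "t2 \<le> t + 60" using 2 by simp
      show "same_regs {9, 20, 21, 24, 25} R R2" "R2 20 = y" "R2 9 = k' mod B ^ H"
        using 2(2) R' by (auto simp: same_regs_def)
      show "\<forall>f. f \<noteq> 3 \<longrightarrow> m2 0 f = m 0 f" using 2(4) m10 by simp
    qed
  qed
  then show ?thesis by (simp only: rest_def wp_Seq_fun)
qed


definition linked :: "ghost \<Rightarrow> ghost \<Rightarrow> nat \<Rightarrow> bool" where
  "linked g g' y \<longleftrightarrow> gC g' = insert y (gC g) \<and> gP g' = insert y (gP g) \<and> gT g' = gT g \<and>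
     gK g' = gK g \<and> ce g' = ce g"

text \<open>Every round moves the overflow one level down, so there are at most \<open>h\<close>
  rounds of constant cost. The key whose path is followed changes from round to round and is
  therefore quantified in the invariant.\<close>

lemma wp_push:
  assumes inv: "inv g m (if 0 < h \<and> B < length (ls g h P) then Some (h, P) else None) (KMr g)"
    and h: "h \<le> H" and a: "pos g h k R" "P = k div B ^ h" and n: "nd g h (P div B) \<noteq> 0"
    and R: "R 11 = su g h P" "R 25 = length (ls g h P)"
      "R 23 = (if 0 < h \<and> B < length (ls g h P) then 1 else 0)" and room: "roomy g"
    and Q: "\<And>t' R' m' g'. t' \<le> t + 250 * h + 10 \<Longrightarrow> same_regs {7..25} R R' \<Longrightarrow>
      inv g' m' None (KMr g') \<Longrightarrow>
      gC g' = gC g \<and> gT g' = gT g \<and> gP g' = gP g \<and> gK g' = gK g \<and> ce g' = ce g \<Longrightarrow>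
      \<forall>f. f \<noteq> 3 \<longrightarrow> m' 0 f = m 0 f \<Longrightarrow> Q t' R' m'"
  shows "wp w L push_com Q t R m"
proof -
  define J where "J = (\<lambda>n t' R' m'. \<exists>g' i k' P'. i \<le> h \<and> P' = k' div B ^ i \<and>
      inv g' m' (if 0 < i \<and> B < length (ls g' i P') then Some (i, P') else None) (KMr g') \<and>
      pos g' i k' R' \<and> nd g' i (P' div B) \<noteq> 0 \<and> R' 11 = su g' i P' \<and> R' 25 = length (ls g' i P') \<and>
      R' 23 = (if 0 < i \<and> B < length (ls g' i P') then 1 else 0) \<and>
      gC g' = gC g \<and> gT g' = gT g \<and> gP g' = gP g \<and> gK g' = gK g \<and> ce g' = ce g \<and>
      (\<forall>f. f \<noteq> 3 \<longrightarrow> m' 0 f = m 0 f) \<and> same_regs {7..25} R R' \<and> t' + 250 * i \<le> t + 250 * h \<and>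
      n = (if 0 < i \<and> B < length (ls g' i P') then i else 0))"
  have JI: "J n t' R' m'" if "i \<le> h" "P' = k' div B ^ i"
      "inv g' m' (if 0 < i \<and> B < length (ls g' i P') then Some (i, P') else None) (KMr g')"
      "pos g' i k' R'" "nd g' i (P' div B) \<noteq> 0" "R' 11 = su g' i P'" "R' 25 = length (ls g' i P')"
      "R' 23 = (if 0 < i \<and> B < length (ls g' i P') then 1 else 0)"
      "gC g' = gC g \<and> gT g' = gT g \<and> gP g' = gP g \<and> gK g' = gK g \<and> ce g' = ce g"
      "\<forall>f. f \<noteq> 3 \<longrightarrow> m' 0 f = m 0 f" "same_regs {7..25} R R'" "t' + 250 * i \<le> t + 250 * h"
      "n = (if 0 < i \<and> B < length (ls g' i P') then i else 0)" for n t' R' m' g' i k' P'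
    unfolding J_def using that by blast
  show ?thesis
    unfolding push_com_def
  proof (rule wp_Until[where I = J])
    show "J (if 0 < h \<and> B < length (ls g h P) then h else 0) t R m"
      by (rule JI[of h P k g]) (use inv a n R in \<open>auto simp: same_regs_def\<close>)
  next
    fix n t1 R1 m1
    assume J: "J n t1 R1 m1" and nb: "\<not> bval (Eq 23 4) R1"
    obtain g1 i k1 P1 where 1: "i \<le> h" "P1 = k1 div B ^ i"
      "inv g1 m1 (if 0 < i \<and> B < length (ls g1 i P1) then Some (i, P1) else None) (KMr g1)"
      "pos g1 i k1 R1" "nd g1 i (P1 div B) \<noteq> 0" "R1 11 = su g1 i P1" "R1 25 = length (ls g1 i P1)"
      "R1 23 = (if 0 < i \<and> B < length (ls g1 i P1) then 1 else 0)"
      "gC g1 = gC g \<and> gT g1 = gT g \<and> gP g1 = gP g \<and> gK g1 = gK g \<and> ce g1 = ce g"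
      "\<forall>f. f \<noteq> 3 \<longrightarrow> m1 0 f = m 0 f" "same_regs {7..25} R R1" "t1 + 250 * i \<le> t + 250 * h"
      "n = (if 0 < i \<and> B < length (ls g1 i P1) then i else 0)"
      using J unfolding J_def by blast
    have "R1 4 = 0" using 1(4) by (simp add: pos_def cregs_def)
    then have c: "0 < i" "B < length (ls g1 i P1)" using nb 1(8) by (auto split: if_splits)
    then have n: "n = i" and iv: "inv g1 m1 (Some (i, P1)) (KMr g1)" using 1(3,13) by auto
    have rm: "roomy g1" using room 1(9) by (simp add: roomy_def)
    show "wp w L (pop_com ;; alloc_com ;; descend ;; count_com 8 ;;
     Bin Add 11 7 8 ;; Bin Add 11 11 5 ;; Ld 24 11 4 ;; Imm 22 0 ;; ins_com ;; over_com)
      (\<lambda>t R m. \<exists>n'<n. J n' (t + 1) R m) (t1 + 1) R1 m1"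
    proof (rule wp_push_step[OF iv c 1(4) 1(2)[symmetric] 1(5-7) rm])
      fix t2 R2 m2 g2 k2 P2
      assume 2: "t2 \<le> t1 + 1 + 240" "same_regs {7..25} R1 R2" "P2 = k2 div B ^ (i - 1)"
       "inv g2 m2 (if 0 < i - 1 \<and> B < length (ls g2 (i - 1) P2) then Some (i - 1, P2) else None) (KMr g2)"
       "pos g2 (i - 1) k2 R2" "nd g2 (i - 1) (P2 div B) \<noteq> 0" "R2 11 = su g2 (i - 1) P2"
       "R2 25 = length (ls g2 (i - 1) P2)"
       "R2 23 = (if 0 < i - 1 \<and> B < length (ls g2 (i - 1) P2) then 1 else 0)"
       "gC g2 = gC g1 \<and> gT g2 = gT g1 \<and> gP g2 = gP g1 \<and> gK g2 = gK g1 \<and> ce g2 = ce g1"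
       "\<forall>f. f \<noteq> 3 \<longrightarrow> m2 0 f = m1 0 f"
      have ti: "t2 + 1 + 250 * (i - 1) \<le> t + 250 * h" using 2(1) 1(12) c(1) by (cases i) auto
      have s: "same_regs {7..25} R R2" using 2(2) 1(11) by (auto simp: same_regs_def)
      have "J (if 0 < i - 1 \<and> B < length (ls g2 (i - 1) P2) then i - 1 else 0) (t2 + 1) R2 m2"
        by (rule JI[OF _ 2(3-9) _ _ s ti refl]) (use 1 2(10,11) in auto)
      moreover have "(if 0 < i - 1 \<and> B < length (ls g2 (i - 1) P2) then i - 1 else 0) < n"
        using n c(1) by auto
      ultimately show "\<exists>n'<n. J n' (t2 + 1) R2 m2" by blast
    qed
  next
    fix n t1 R1 m1
    assume J: "J n t1 R1 m1" and nb: "bval (Eq 23 4) R1"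
    obtain g1 i k1 P1 where 1:
      "inv g1 m1 (if 0 < i \<and> B < length (ls g1 i P1) then Some (i, P1) else None) (KMr g1)"
      "pos g1 i k1 R1" "R1 23 = (if 0 < i \<and> B < length (ls g1 i P1) then 1 else 0)"
      "gC g1 = gC g \<and> gT g1 = gT g \<and> gP g1 = gP g \<and> gK g1 = gK g \<and> ce g1 = ce g"
      "\<forall>f. f \<noteq> 3 \<longrightarrow> m1 0 f = m 0 f" "same_regs {7..25} R R1" "t1 + 250 * i \<le> t + 250 * h"
      using J unfolding J_def by blast
    have "R1 4 = 0" using 1(2) by (simp add: pos_def cregs_def)
    then have "R1 23 = 0" using nb by simp
    then have "inv g1 m1 None (KMr g1)" using 1(1,3) by (auto split: if_splits)
    then show "Q (t1 + 1) R1 m1" using 1 by (intro Q[of _ _ g1]) auto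
  qed
qed

text \<open>A walk of at most \<open>H + 1\<close> levels, a search in one list and a cascade of at
  most \<open>H\<close> moves add up to \<open>O(H + B)\<close>.\<close>

lemma wp_link:
  assumes inv: "inv g m None (KMr g)" and y: "y \<in> gT g" "y \<notin> gP g" and k: "k = gK g y"
    and R: "cregs R" "R 20 = y" "R 8 = k div B ^ H" "R 9 = k mod B ^ H" and room: "roomy g"
    and Q: "\<And>t' R' m' g'. t' \<le> t + 600 * (H + B + 1) \<Longrightarrow> same_regs {7..26} R R' \<Longrightarrow>
      inv g' m' None (KMr g') \<Longrightarrow> linked g g' y \<Longrightarrow> \<forall>f. f \<noteq> 3 \<longrightarrow> m' 0 f = m 0 f \<Longrightarrow> Q t' R' m'"
  shows "wp w L link_com Q t R m"
proof -
  have I: "memI g m" "nodeI g m" "listI g m None" "cellI g m" "countI g m (KMr g)"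
    using inv by (auto simp: inv_def)
  note rm = roomyD[OF room I(2,4)]
  have fin: "finite (gC g)" using finite_cells I by blast
  have yC: "y \<notin> gC g" using y(2) I(4) unfolding cellI_def by blast
  have yb: "B + 1 \<le> y" "y < ce g" "k < 2 * B ^ H" using y(1) I(4) unfolding cellI_def k by auto
  define M where "M = (\<lambda>h. add_mset k (KMr g h))"
  \<comment> \<open>All cells passed on the way down are at most \<open>k\<close>: the half of the
    heap order that concerns cells above the new one.\<close>
  define D where "D = (\<lambda>h. \<forall>c\<in>gC g. h < gh g c \<longrightarrow> gK g c div B ^ gh g c = k div B ^ gh g c \<longrightarrow> gK g c \<le> k)"
  have DH: "D H" using I(3) unfolding D_def listI_def by fastforce
  \<comment> \<open>Going down requires an empty list or a head below \<open>k\<close>, and the head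
    is the maximum of the list.\<close>
  have step: "D (h - 1)" if "D h" "h \<le> H" "0 < h" "nd g h (k div B ^ Suc h) \<noteq> 0" "goes_down g h k" for h
    unfolding D_def
  proof (intro ballI impI)
    fix c assume c: "c \<in> gC g" "h - 1 < gh g c" "gK g c div B ^ gh g c = k div B ^ gh g c"
    show "gK g c \<le> k"
    proof (cases "gh g c = h")
      case True
      have n': "nd g h (k div B ^ h div B) \<noteq> 0" using that by (simp add: div_Suc)
      have c': "c \<in> set (ls g h (k div B ^ h))" using listD(2)[OF I(3) n'] c True by simp
      then have "gK g (hd (ls g h (k div B ^ h))) < k" using that(5) by (auto simp: goes_down_def)
      moreover have "gK g c \<le> gK g (hd (ls g h (k div B ^ h)))"
        using listD(4)[OF I(3) n'] c' by (cases "ls g h (k div B ^ h)") auto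
      ultimately show ?thesis by simp
    next
      case False
      then show ?thesis using that(1) c unfolding D_def by simp
    qed
  qed
  have sz: "size (M h) \<le> ce g" for h using size_KMr_less[OF I(4), of h] by (simp add: M_def)
  have w1: "(1::nat) < 2 ^ w" using small(1) L1 by linarith
  show ?thesis
    unfolding link_com_def wp_Seq[of w L "start_com ;; walk_com 8"]
  proof (rule wp_walk[where M = M and D = D, OF inv R(1,3,4) yb(3) rm(1,2) DH step _ sz])
    show "\<And>h. D h \<Longrightarrow> h \<le> H \<Longrightarrow> 8 = (8::nat) \<and> M h = add_mset k (KMr g h) \<or> 8 = (9::nat) \<and> KMr g h = add_mset k (M h)"
      by (simp add: M_def)
  next
    fix t1 R1 m1 h
    assume 1: "t1 \<le> t + 200 * (H + 1)" "same_regs walk_regs R R1" "h \<le> H" "D h" "pos g h k R1"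
      "nd g h (k div B ^ Suc h) \<noteq> 0" "\<not> goes_down g h k" "R1 11 = su g h (k div B ^ h)"
      "R1 22 = hd0 (ls g h (k div B ^ h))" "inv g m1 None (KMw g M h)" "m1 0 = m 0"
    let ?P = "k div B ^ h" and ?q = "su g h (k div B ^ h)"
    let ?xs = "ls g h ?P"
    have I1: "nodeI g m1" "listI g m1 None" "cellI g m1" using 1(10) by (auto simp: inv_def)
    have n': "nd g h (?P div B) \<noteq> 0" using 1(6) by (simp add: div_Suc)
    note xD = listD[OF I1(2) n']
    have xc: "c \<in> gC g \<and> gh g c = h \<and> gK g c div B ^ h = ?P" if "c \<in> set ?xs" for c
      using xD(2) that by simp
    have R1: "R1 4 = 0" "R1 5 = 1" "R1 9 = k mod B ^ H" "R1 20 = y" "R1 10 = B ^ h div B"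
      using 1(5,2) R(2) by (auto simp: pos_def cregs_def same_regs_def)
    have el: "\<forall>c\<in>set ?xs. 0 < c \<and> c < L \<and> (R1 9 < m1 c 0 \<longleftrightarrow> k < gK g c)"
    proof
      fix c assume "c \<in> set ?xs"
      note c = xc[OF this]
      show "0 < c \<and> c < L \<and> (R1 9 < m1 c 0 \<longleftrightarrow> k < gK g c)"
        using cellD(1-3)[OF I1(3), of c] less_low[OF 1(3), of k "gK g c"] c rm(2) R1 by auto
    qed
    have chn: "chain m1 ?xs" using xD(1) by (simp add: lst_def)
    have lenB: "0 < h \<longrightarrow> length ?xs \<le> B" using listI_length[OF I1(2) _ n'] by auto
    have lenL: "length ?xs < L"
    proof -
      have "length ?xs = card (set ?xs)" using xD(3) distinct_card by metis
      also have "\<dots> \<le> card (gC g)" using xc fin by (intro card_mono) auto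
      also have "\<dots> < ce g" by (rule card_gC_less[OF I(4)])
      finally show ?thesis using rm(2) by simp
    qed
    show "wp w L (find_com ;; ins_com ;; over_com ;; push_com) Q t1 R1 m1"
      unfolding wp_Seq[of w L find_com]
    proof (rule wp_find[OF chn el 1(9) R1(1)])
      fix t2 R2 as bs
      assume 2: "t2 \<le> t1 + 30 * length as + 30" "same_regs {22, 23, 24, 25} R1 R2" "?xs = as @ bs"
        "R2 24 = last0 as" "R2 22 = hd0 bs" "\<forall>c\<in>set as. k < gK g c" "bs = [] \<or> \<not> k < gK g (hd bs)"
      \<comment> \<open>At height 0 all keys of the slot equal \<open>k\<close>, so the search stops
        at the first cell although the list may be long.\<close>
      have lenas: "length as \<le> B"
      proof (cases "h = 0")
        case True
        have "as = []"
        proof (rule ccontr)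
          assume "as \<noteq> []"
          then have "hd as \<in> set as" by simp
          then have "gK g (hd as) = k" "k < gK g (hd as)" using xc[of "hd as"] 2(3,6) True by auto
          then show False by simp
        qed
        then show ?thesis by simp
      next
        case False
        then show ?thesis using lenB 2(3) by simp
      qed
      have q: "?q < L" "B + 1 < ?q" using su_range[OF I1(1) n'] rm(1) by auto
      have yxs: "y \<notin> set ?xs" using xc yC by blast
      show "wp w L (ins_com ;; over_com ;; push_com) Q t2 R2 m1"
        unfolding wp_Seq[of w L ins_com]
      proof (rule wp_ins[where as = as and bs = bs and q = ?q and y = y])
        show "R2 4 = 0" "R2 5 = 1" "R2 11 = ?q" "R2 20 = y" using 2(2) R1 1(8) by (auto simp: same_regs_def)
        show "R2 24 = last0 as" "R2 22 = hd0 bs" by fact+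
        show "lst m1 ?q (as @ bs)" "distinct (as @ bs)" "y \<notin> set (as @ bs)" using xD(1,3) yxs 2(3) by auto
        show "0 < y" "?q < L" "y < L" using yb rm(2) q by auto
        show "length (as @ bs) + 1 < 2 ^ w" using lenL small(1) L1 L2 unfolding 2(3) by simp
        show "\<forall>c\<in>set (as @ bs). 0 < c \<and> c < L" using el unfolding 2(3) by blast
      next
        fix t3 R3 m3
        assume 3: "t3 \<le> t2 + 30" "same_regs {25} R2 R3" "R3 25 = length (as @ bs) + 1"
          "lst m3 ?q (as @ y # bs)" "list_frame ?q (insert y (set as)) m1 m3"
        define fl where "fl = (0 < h \<and> B < length (as @ bs) + 1)"
        define g3 where "g3 = g\<lparr>gC := insert y (gC g), gP := insert y (gP g), gh := (gh g)(y := h),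
            ls := (ls g)(h := (ls g h)(?P := as @ y # bs))\<rparr>"
        have inv3: "inv g3 m3 (if fl then Some (h, ?P) else None) (KMw g M h)"
        proof (rule inv_insert[OF 1(10) y(1) yC y(2) _ n' 2(3) _ _ _ _ _ 3(5,4) g3_def])
          show "gK g y div B ^ h = ?P" by (simp add: k)
          show "\<forall>h'. h \<le> h' \<longrightarrow> h' \<le> H \<longrightarrow> nd g h' (gK g y div B ^ Suc h') \<noteq> 0"
          proof (intro allI impI)
            fix h' assume "h \<le> h'" "h' \<le> H"
            then show "nd g h' (gK g y div B ^ Suc h') \<noteq> 0"
            proof (induction h' rule: dec_induct)
              case base
              then show ?case using 1(6) k by simp
            next
              case (step i)
              then have "nd g i (gK g y div B ^ Suc i) \<noteq> 0" "i < H" by auto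
              then have "nd g (Suc i) (gK g y div B ^ Suc i div B) \<noteq> 0"
                using I(2) unfolding nodeI_def by blast
              then show ?case unfolding div_Suc .
            qed
          qed
          show "\<forall>c\<in>set as. gK g y \<le> gK g c" using 2(6) k by auto
          show "\<forall>c\<in>set bs. gK g c \<le> gK g y"
          proof
            fix c assume c: "c \<in> set bs"
            then have "gK g (hd bs) \<le> k" "bs \<noteq> []" using 2(7) by auto
            moreover have "sorted_wrt (\<lambda>a b. gK g b \<le> gK g a) bs"
              using xD(4) unfolding 2(3) sorted_wrt_append by blast
            ultimately show "gK g c \<le> gK g y" using c k by (cases bs) auto
          qed
          show "\<forall>c\<in>gC g. h < gh g c \<longrightarrow> gK g c div B ^ gh g c = gK g y div B ^ gh g c \<longrightarrow> gK g c \<le> gK g y"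
            using 1(4) unfolding D_def k .
          \<comment> \<open>The walk ended here, so the presence of a deeper cell implies a head of
            at least \<open>k\<close>; the deeper cell is at least the head.\<close>
          show "\<forall>c\<in>gC g. gh g c < h \<longrightarrow> gK g c div B ^ h = ?P \<longrightarrow> gK g y \<le> gK g c"
          proof (intro ballI impI)
            fix c assume c: "c \<in> gC g" "gh g c < h" "gK g c div B ^ h = ?P"
            have "Suc (h - 1) = h" using c(2) by simp
            then have "nd g (h - 1) ?P \<noteq> 0"
              using listI_path[OF I(3) c(1), of "h - 1"] c(2,3) 1(3) by simp
            then have "child g h ?P \<noteq> 0" using c(2) by (simp add: child_def)
            then have xs: "?xs \<noteq> []" "k \<le> gK g (hd ?xs)" using 1(7) by (auto simp: goes_down_def)
            then have "hd ?xs \<in> set ?xs" by simp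
            note hx = xc[OF this]
            have "gK g (hd ?xs) \<le> gK g c" using listI_order[OF I(3) _ c(1), of "hd ?xs"] hx c by simp
            then show "gK g y \<le> gK g c" using xs k by simp
          qed
          show "(if fl then Some (h, ?P) else None) = Some (h, ?P) \<or> h = 0 \<or> length (as @ bs) < B"
            by (auto simp: fl_def)
        qed
        have KM3: "KMr g3 h' = KMw g M h h'" for h'
          using KMr_insert[OF fin yC, of g3 h h'] by (simp add: g3_def KMw_def M_def k)
        have inv3': "inv g3 m3 (if fl then Some (h, ?P) else None) (KMr g3)"
          using inv_KM_cong[OF inv3] KM3 by blast
        have nd3: "nd g3 = nd g" by (simp add: g3_def)
        have s3: "su g3 h' p = su g h' p" for h' p by (simp add: su_def nd3)
        have ls3: "ls g3 h ?P = as @ y # bs" by (simp add: g3_def)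
        have c3: "cregs R3" "R3 10 = B ^ h div B"
          using 1(5) 2(2) 3(2) by (auto simp: pos_def cregs_def same_regs_def)
        show "wp w L (over_com ;; push_com) Q t3 R3 m3"
          unfolding wp_Seq
        proof (rule wp_over[OF c3])
          fix t4 R4
          assume 4: "t4 \<le> t3 + 6" "same_regs {23} R3 R4" "R4 23 = (if 0 < h \<and> B < R3 25 then 1 else 0)"
          have m30: "m3 0 f = m 0 f" for f
          proof -
            have "0 \<notin> insert y (set as)" using el yb(1) unfolding 2(3) by auto
            then show ?thesis using list_frame_mem(1)[OF 3(5), of 0] q(2) 1(11) by simp
          qed
          show "wp w L push_com Q t4 R4 m3"
          proof (rule wp_push[where g = g3 and h = h and P = ?P and k = k])
            show "inv g3 m3 (if 0 < h \<and> B < length (ls g3 h ?P) then Some (h, ?P) else None) (KMr g3)"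
              using inv3' unfolding ls3 fl_def by simp
            show "pos g3 h k R4"
              using 1(5) 2(2) 3(2) 4(2) by (auto simp: pos_def cregs_def same_regs_def nd3)
            show "nd g3 h (?P div B) \<noteq> 0" using n' unfolding nd3 .
            show "R4 11 = su g3 h ?P" unfolding s3 using 1(8) 2(2) 3(2) 4(2) by (simp add: same_regs_def)
            show "R4 25 = length (ls g3 h ?P)" unfolding ls3 using 3(3) 4(2) by (simp add: same_regs_def)
            show "R4 23 = (if 0 < h \<and> B < length (ls g3 h ?P) then 1 else 0)"
              unfolding ls3 using 3(3) 4(3) by simp
            show "roomy g3" using room by (simp add: roomy_def g3_def)
          next
            fix t5 R5 m5 g5
            assume 5: "t5 \<le> t4 + 250 * h + 10" "same_regs {7..25} R4 R5" "inv g5 m5 None (KMr g5)"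
              "gC g5 = gC g3 \<and> gT g5 = gT g3 \<and> gP g5 = gP g3 \<and> gK g5 = gK g3 \<and> ce g5 = ce g3"
              "\<forall>f. f \<noteq> 3 \<longrightarrow> m5 0 f = m3 0 f"
            show "Q t5 R5 m5"
            proof (rule Q[OF _ _ 5(3)])
              have "250 * h \<le> 250 * H" using 1(3) by simp
              then show "t5 \<le> t + 600 * (H + B + 1)" using 5(1) 4(1) 3(1) 2(1) 1(1) lenas by simp
              show "same_regs {7..26} R R5"
                using 5(2) 4(2) 3(2) 2(2) 1(2) by (auto simp: same_regs_def)
              show "linked g g5 y" using 5(4) by (simp add: linked_def g3_def)
              show "\<forall>f. f \<noteq> 3 \<longrightarrow> m5 0 f = m 0 f" using 5(5) m30 by simp
            qed
          qed (use 1(3) in auto)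
        qed
      qed
    qed
  qed
qed

end

context trie begin

subsection \<open>Removal\<close>

definition seek_com :: com where
  "seek_com = Imm 24 0 ;; Ld 25 22 0 ;; Until (Eq 25 9) (Bin Add 24 22 4 ;; Ld 22 22 1 ;; Ld 25 22 0)"

text \<open>Register 4 is 0, so the final store marks the cell as dead.\<close>

definition rem_com :: com where
  "rem_com = Ld 25 22 1 ;; If (Eq 24 4) (St 11 3 25) (St 24 1 25) ;;
     If (Eq 25 4) (St 11 4 24) Skip ;; Ld 25 11 5 ;; Bin Sub 25 25 5 ;; St 11 5 25 ;; St 22 2 4"

definition unlink_com :: com where
  "unlink_com = (start_com ;; walk_com 9) ;; seek_com ;; rem_com"

lemma wp_seek:
  assumes xs: "chain m xs" "\<forall>c\<in>set xs. 0 < c \<and> c < L \<and> (m c 0 = R 9 \<longleftrightarrow> P c)" "\<exists>c\<in>set xs. P c"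
    and R: "R 22 = hd0 xs" "R 4 = 0"
    and Q: "\<And>t' R' as y bs. t' \<le> t + 30 * length as + 30 \<Longrightarrow> same_regs {22, 24, 25} R R' \<Longrightarrow>
      xs = as @ y # bs \<Longrightarrow> R' 24 = last0 as \<Longrightarrow> R' 22 = y \<Longrightarrow> P y \<Longrightarrow> \<forall>c\<in>set as. \<not> P c \<Longrightarrow> Q t' R' m"
  shows "wp w L seek_com Q t R m"
proof -
  define I where "I = (\<lambda>n t' R' m'. m' = m \<and> same_regs {22, 24, 25} R R' \<and>
      (\<exists>as y bs. xs = as @ y # bs \<and> R' 24 = last0 as \<and> R' 22 = y \<and> R' 25 = m y 0 \<and> (\<forall>c\<in>set as. \<not> P c) \<and>
        t' \<le> t + 6 + 30 * length as \<and> n = length bs))"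
  obtain x xs' where x: "xs = x # xs'" using xs(3) by (cases xs) auto
  have "wp w L (Until (Eq 25 9) (Bin Add 24 22 4 ;; Ld 22 22 1 ;; Ld 25 22 0)) Q (t + 6)
       (R(24 := 0, 25 := m x 0)) m"
  proof (rule wp_Until[where I = I and n = "length xs'"])
    show "I (length xs') (t + 6) (R(24 := 0, 25 := m x 0)) m"
      unfolding I_def using R x
      by (intro conjI exI[of _ "[]"] exI[of _ x] exI[of _ xs']) (auto simp: same_regs_def)
  next
    fix n t1 R1 m1
    assume I: "I n t1 R1 m1" and nb: "\<not> bval (Eq 25 9) R1"
    obtain as y bs where 1: "xs = as @ y # bs" "R1 24 = last0 as" "R1 22 = y" "R1 25 = m y 0"
      "\<forall>c\<in>set as. \<not> P c" "t1 \<le> t + 6 + 30 * length as" "n = length bs"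
      and s: "same_regs {22, 24, 25} R R1" and m1: "m1 = m"
      using I unfolding I_def by blast
    have r: "R1 4 = 0" "R1 9 = R 9" using s R by (auto simp: same_regs_def)
    have yc: "y < L" "m y 0 = R 9 \<longleftrightarrow> P y" using xs(2) 1(1) by auto
    then have nP: "\<not> P y" using nb 1(4) r by simp
    then obtain z zs where bs: "bs = z # zs" using xs(3) 1(1,5) by (cases bs) auto
    have n: "m y (Suc 0) = z" using chain_append[of m as "y # bs"] xs(1) 1(1) bs by simp
    have z: "z < L" using xs(2) 1(1) bs by auto
    have "\<exists>n'<n. I n' t' R' m" if "t' \<le> t1 + 20" "same_regs {22, 24, 25} R1 R'" "R' 24 = y" "R' 22 = z"
      "R' 25 = m z 0" for t' R'
    proof (intro exI[of _ "length zs"] conjI)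
      show "I (length zs) t' R' m"
        unfolding I_def using that 1 s nP bs
        by (intro conjI exI[of _ "as @ [y]"] exI[of _ z] exI[of _ zs]) (auto simp: same_regs_def)
    qed (simp add: 1 bs)
    moreover have "y < 2 ^ w" using yc(1) small(1) by simp
    ultimately show "wp w L (Bin Add 24 22 4 ;; Ld 22 22 1 ;; Ld 25 22 0)
       (\<lambda>t R m. \<exists>n'<n. I n' (t + 1) R m) (t1 + 1) R1 m1"
      using yc(1) z by (simp add: 1(3) r m1 n same_regs_def)
  next
    fix n t1 R1 m1
    assume I: "I n t1 R1 m1" and nb: "bval (Eq 25 9) R1"
    obtain as y bs where 1: "xs = as @ y # bs" "R1 24 = last0 as" "R1 22 = y" "R1 25 = m y 0"
      "\<forall>c\<in>set as. \<not> P c" "t1 \<le> t + 6 + 30 * length as"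
      and s: "same_regs {22, 24, 25} R R1" and m1: "m1 = m"
      using I unfolding I_def by blast
    have "R1 9 = R 9" using s by (auto simp: same_regs_def)
    then have "P y" using xs(2) 1(1,4) nb by auto
    then show "Q (t1 + 1) R1 m1" unfolding m1 using 1 s by (intro Q[of _ as _ y bs]) auto
  qed
  moreover have "x < L" using xs(2) x by simp
  ultimately show ?thesis unfolding seek_com_def using R x by (simp add: add.commute)
qed

lemma wp_rem:
  assumes R: "R 4 = 0" "R 5 = 1" "R 11 = q" "R 22 = y" "R 24 = last0 as"
    and l: "lst m q (as @ y # bs)" and d: "distinct (as @ y # bs)"
    and pos: "\<forall>c\<in>set (as @ y # bs). 0 < c \<and> c < L" and b: "q < L" "length (as @ y # bs) < 2 ^ w"
    and Q: "\<And>t' R' m1. t' \<le> t + 40 \<Longrightarrow> same_regs {25} R R' \<Longrightarrow>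
      lst m1 q (as @ bs) \<Longrightarrow> list_frame q (set as) m m1 \<Longrightarrow> Q t' R' (upd m1 y 2 0)"
  shows "wp w L rem_com Q t R m"
proof -
  define m2 where "m2 = (if as = [] then upd m q 3 (hd0 bs) else upd m (last as) 1 (hd0 bs))"
  define m3 where "m3 = (if bs = [] then upd m2 q 4 (last0 as) else m2)"
  define m4 where "m4 = upd m3 q 5 (length (as @ bs))"
  have fr: "list_frame q (set as) m m4"
    unfolding list_frame_def by (auto simp: m4_def m3_def m2_def split: if_splits)
  have ch: "chain m4 (as @ bs)"
  proof (rule chain_remove[where m = m and y = y])
    show "chain m (as @ y # bs)" using l by (simp add: lst_def)
  qed (use d in \<open>auto simp: m4_def m3_def m2_def\<close>)
  have l0: "m q 3 = hd0 (as @ y # bs)" "m q 4 = last (y # bs)" "m q 5 = Suc (length as + length bs)"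
    using l by (auto simp: lst_def last0_def)
  have l4: "lst m4 q (as @ bs)"
  proof (cases "as = []")
    case True
    then show ?thesis
      unfolding lst_def using l0 ch by (cases "bs = []") (simp_all add: m4_def m3_def m2_def last0_def)
  next
    case False
    then have "hd0 (as @ y # bs) = hd0 (as @ bs)" by (cases as) auto
    then show ?thesis
      unfolding lst_def using l0 ch False
      by (cases "bs = []") (simp_all add: m4_def m3_def m2_def last0_def)
  qed
  have n: "m y (Suc 0) = hd0 bs" using l chain_append[of m as "y # bs"] by (simp add: lst_def)
  have 0: "hd0 bs = 0 \<longleftrightarrow> bs = []" using pos by (auto simp: hd0_def split: list.splits)
  have Q': "Q t' R' mm" if "mm = upd m4 y 2 0" "t' \<le> t + 40" "same_regs {25} R R'" for t' R' mm
    using Q[of t' R' m4] that fr l4 by simp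
  have b': "Suc (length as + length bs) < 2 ^ w" "y < L" using b pos by auto
  show ?thesis
  proof (cases "as = []")
    case True
    show ?thesis
    proof (cases "bs = []")
      case bs: True
      show ?thesis
        unfolding rem_com_def using b(1) b' True bs l0(3) n
        by (simp add: R) (rule Q'; simp add: same_regs_def m4_def m3_def m2_def)
    next
      case bs: False
      show ?thesis
        unfolding rem_com_def using b(1) b' True bs l0(3) n 0
        by (simp add: R) (rule Q'; simp add: same_regs_def m4_def m3_def m2_def)
    qed
  next
    case as: False
    have la': "last0 as = last as" using as by (simp add: last0_def)
    have "last as \<in> set as" using as by simp
    then have la0: "last as \<noteq> 0" "last as < L" using pos by auto
    show ?thesis
    proof (cases "bs = []")
      case bs: True
      show ?thesis
        unfolding rem_com_def using b(1) b' as bs l0(3) n la0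
        by (simp add: R la') (rule Q'; simp add: same_regs_def m4_def m3_def m2_def la')
    next
      case bs: False
      show ?thesis
        unfolding rem_com_def using b(1) b' as bs l0(3) n la0 0
        by (simp add: R la') (rule Q'; simp add: same_regs_def m4_def m3_def m2_def la')
    qed
  qed
qed

text \<open>\<open>gP\<close> and \<open>ce\<close> are unchanged: the dead cell keeps its unit and
  continues to pay for nodes.\<close>

definition unlinked :: "ghost \<Rightarrow> ghost \<Rightarrow> nat \<Rightarrow> bool" where
  "unlinked g g' y \<longleftrightarrow> gC g' = gC g - {y} \<and> gP g' = gP g \<and> gT g' = gT g - {y} \<and>
     gK g' = gK g \<and> ce g' = ce g \<and> ne g' = ne g"

text \<open>With duplicate keys it is not determined which cell is met, so the postcondition speaks
  of some \<open>y\<close>. Any cell with key \<open>k\<close> will do, as only the multiset of keys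
  matters.\<close>

lemma wp_unlink:
  assumes inv: "inv g m None (KMr g)" and ex: "\<exists>c\<in>gC g. gK g c = k"
    and R: "cregs R" "R 8 = k div B ^ H" "R 9 = k mod B ^ H" and room: "roomy g"
    and Q: "\<And>t' R' m' g' y. t' \<le> t + 600 * (H + B + 1) \<Longrightarrow> same_regs {7..26} R R' \<Longrightarrow>
      inv g' m' None (KMr g') \<Longrightarrow> y \<in> gC g \<Longrightarrow> gK g y = k \<Longrightarrow> unlinked g g' y \<Longrightarrow>
      m' 0 = m 0 \<Longrightarrow> Q t' R' m'"
  shows "wp w L unlink_com Q t R m"
proof -
  have I: "memI g m" "nodeI g m" "listI g m None" "cellI g m" "countI g m (KMr g)"
    using inv by (auto simp: inv_def)
  note rm = roomyD[OF room I(2,4)]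
  have fin: "finite (gC g)" using finite_cells I by blast
  have kb: "k < 2 * B ^ H" using ex cellD(4)[OF I(4)] by auto
  define M where "M = (\<lambda>h. KMr g h - {#k#})"
  \<comment> \<open>\<open>D h\<close> guarantees that the counted multiset at height
    \<open>h\<close> contains \<open>k\<close>, so that removing \<open>k\<close> from it is
    meaningful.\<close>
  define D where "D = (\<lambda>h. \<exists>c\<in>gC g. gh g c \<le> h \<and> gK g c = k)"
  have DH: "D H" using ex I(3) unfolding D_def listI_def by blast
  have step: "D (h - 1)" if "D h" "h \<le> H" "0 < h" "nd g h (k div B ^ Suc h) \<noteq> 0" "goes_down g h k" for h
  proof -
    obtain c where c: "c \<in> gC g" "gh g c \<le> h" "gK g c = k" using \<open>D h\<close> unfolding D_def by blast
    \<comment> \<open>Descending means that the whole list lies below \<open>k\<close>, so the cell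
      sought is deeper.\<close>
    have "gh g c \<noteq> h"
    proof
      assume "gh g c = h"
      have n': "nd g h (k div B ^ h div B) \<noteq> 0" using that by (simp add: div_Suc)
      have c': "c \<in> set (ls g h (k div B ^ h))" using listD(2)[OF I(3) n'] c \<open>gh g c = h\<close> by simp
      then have "gK g (hd (ls g h (k div B ^ h))) < k" using that(5) by (auto simp: goes_down_def)
      moreover have "gK g c \<le> gK g (hd (ls g h (k div B ^ h)))"
        using listD(4)[OF I(3) n'] c' by (cases "ls g h (k div B ^ h)") auto
      ultimately show False using c by simp
    qed
    then show ?thesis using c unfolding D_def by (intro bexI[of _ c]) auto
  qed
  have sz: "size (M h) \<le> ce g" for h
    using size_KMr_less[OF I(4), of h] size_Diff_submset[of "{#k#}" "KMr g h"]
      size_mset_mono[OF diff_subset_eq_self, of "KMr g h" "{#k#}"] by (simp add: M_def)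
  have MD: "KMr g h = add_mset k (M h)" if "D h" for h
  proof -
    have "k \<in># KMr g h" using that fin unfolding D_def KMr_def by auto
    then show ?thesis by (simp add: M_def)
  qed
  show ?thesis
    unfolding unlink_com_def wp_Seq[of w L "start_com ;; walk_com 9"]
  proof (rule wp_walk[where M = M and D = D, OF inv R kb rm(1,2) DH step _ sz])
    show "\<And>h. D h \<Longrightarrow> h \<le> H \<Longrightarrow> 9 = (8::nat) \<and> M h = add_mset k (KMr g h) \<or> 9 = (9::nat) \<and> KMr g h = add_mset k (M h)"
      using MD by simp
  next
    fix t1 R1 m1 h
    assume 1: "t1 \<le> t + 200 * (H + 1)" "same_regs walk_regs R R1" "h \<le> H" "D h" "pos g h k R1"
      "nd g h (k div B ^ Suc h) \<noteq> 0" "\<not> goes_down g h k" "R1 11 = su g h (k div B ^ h)"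
      "R1 22 = hd0 (ls g h (k div B ^ h))" "inv g m1 None (KMw g M h)" "m1 0 = m 0"
    let ?P = "k div B ^ h" and ?q = "su g h (k div B ^ h)"
    let ?xs = "ls g h ?P"
    have I1: "nodeI g m1" "listI g m1 None" "cellI g m1" using 1(10) by (auto simp: inv_def)
    have n': "nd g h (?P div B) \<noteq> 0" using 1(6) by (simp add: div_Suc)
    note xD = listD[OF I1(2) n']
    have xc: "c \<in> gC g \<and> gh g c = h \<and> gK g c div B ^ h = ?P" if "c \<in> set ?xs" for c
      using xD(2) that by simp
    have R1: "R1 4 = 0" "R1 5 = 1" "R1 9 = k mod B ^ H"
      using 1(5) by (auto simp: pos_def cregs_def)
    have el: "\<forall>c\<in>set ?xs. 0 < c \<and> c < L \<and> (m1 c 0 = R1 9 \<longleftrightarrow> gK g c = k)"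
    proof
      fix c assume "c \<in> set ?xs"
      note c = xc[OF this]
      show "0 < c \<and> c < L \<and> (m1 c 0 = R1 9 \<longleftrightarrow> gK g c = k)"
        using cellD(1-3)[OF I1(3), of c] inj_low[OF 1(3), of "gK g c" k] c rm(2) R1 by auto
    qed
    have found: "\<exists>c\<in>set ?xs. gK g c = k"
    proof -
      obtain c where c: "c \<in> gC g" "gh g c \<le> h" "gK g c = k" using 1(4) unfolding D_def by blast
      show ?thesis
      proof (cases "gh g c = h")
        case True
        then show ?thesis using xD(2) c by auto
      next
        case False
        then have "Suc (h - 1) = h" "gh g c \<le> h - 1" using c by auto
        then have "nd g (h - 1) ?P \<noteq> 0"
          using listI_path[OF I(3) c(1), of "h - 1"] c(3) 1(3) by simp
        then have "child g h ?P \<noteq> 0" using \<open>Suc (h - 1) = h\<close> by (auto simp: child_def)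
        then have xs: "?xs \<noteq> []" "k \<le> gK g (hd ?xs)" using 1(7) by (auto simp: goes_down_def)
        then have hin: "hd ?xs \<in> set ?xs" by simp
        note hx = xc[OF this]
        \<comment> \<open>The head is at least \<open>k\<close> and at most the key of the deeper
          cell, which is \<open>k\<close>. So the head is a duplicate and can be removed
          instead.\<close>
        have "gK g (hd ?xs) \<le> gK g c" using listI_order[OF I(3) _ c(1), of "hd ?xs"] hx c False by simp
        then show ?thesis using xs c hin by (intro bexI[of _ "hd ?xs"]) auto
      qed
    qed
    have chn: "chain m1 ?xs" using xD(1) by (simp add: lst_def)
    have lenB: "0 < h \<longrightarrow> length ?xs \<le> B" using listI_length[OF I1(2) _ n'] by auto
    have lenL: "length ?xs < L"
    proof -
      have "length ?xs = card (set ?xs)" using xD(3) distinct_card by metis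
      also have "\<dots> \<le> card (gC g)" using xc fin by (intro card_mono) auto
      also have "\<dots> < ce g" by (rule card_gC_less[OF I(4)])
      finally show ?thesis using rm(2) by simp
    qed
    show "wp w L (seek_com ;; rem_com) Q t1 R1 m1"
      unfolding wp_Seq
    proof (rule wp_seek[OF chn el found 1(9) R1(1)])
      fix t2 R2 as y bs
      assume 2: "t2 \<le> t1 + 30 * length as + 30" "same_regs {22, 24, 25} R1 R2" "?xs = as @ y # bs"
        "R2 24 = last0 as" "R2 22 = y" "gK g y = k" "\<forall>c\<in>set as. gK g c \<noteq> k"
      have y: "y \<in> gC g" "gh g y = h" using xc[of y] 2(3) by auto
      have lenas: "length as \<le> B"
      proof (cases "h = 0")
        case True
        have "as = []"
        proof (rule ccontr)
          assume "as \<noteq> []"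
          then have "hd as \<in> set as" by simp
          then have "gK g (hd as) = k" "gK g (hd as) \<noteq> k" using xc[of "hd as"] 2(3,7) True by auto
          then show False by simp
        qed
        then show ?thesis by simp
      next
        case False
        then show ?thesis using lenB 2(3) by simp
      qed
      have q: "?q < L" "B + 1 < ?q" using su_range[OF I1(1) n'] rm(1) by auto
      show "wp w L rem_com Q t2 R2 m1"
      proof (rule wp_rem[where as = as and bs = bs and q = ?q and y = y])
        show "R2 4 = 0" "R2 5 = 1" "R2 11 = ?q" using 2(2) R1 1(8) by (auto simp: same_regs_def)
        show "R2 24 = last0 as" "R2 22 = y" by fact+
        show "lst m1 ?q (as @ y # bs)" "distinct (as @ y # bs)" using xD(1,3) 2(3) by auto
        show "?q < L" by fact
        show "length (as @ y # bs) < 2 ^ w" using lenL small(1) unfolding 2(3) by simp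
        show "\<forall>c\<in>set (as @ y # bs). 0 < c \<and> c < L" using el unfolding 2(3) by blast
      next
        fix t3 R3 m3
        assume 3: "t3 \<le> t2 + 40" "same_regs {25} R2 R3" "lst m3 ?q (as @ bs)" "list_frame ?q (set as) m1 m3"
        define g3 where "g3 = g\<lparr>gC := gC g - {y}, gT := gT g - {y}, gP := gP g,
            ls := (ls g)(h := (ls g h)(?P := as @ bs))\<rparr>"
        have ch: "0 < h \<longrightarrow> length (as @ bs) \<le> B" using lenB unfolding 2(3) by auto
        have inv3: "inv g3 (upd m3 y 2 0) None (KMw g M h)"
          by (rule inv_remove(1)[OF 1(10) _ n' 2(3) 3(4,3) ch g3_def]) (simp_all add: upd_def)
        have gg: "gC g3 = gC g - {y}" "gh g3 = gh g" "gK g3 = gK g" by (simp_all add: g3_def)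
        have KM3: "KMr g3 h' = KMw g M h h'" for h'
          using KMr_remove[OF fin y(1) gg, of h'] y(2) 2(6) by (auto simp: KMw_def M_def)
        have inv3': "inv g3 (upd m3 y 2 0) None (KMr g3)"
          using inv_KM_cong[OF inv3] KM3 by blast
        show "Q t3 R3 (upd m3 y 2 0)"
        proof (rule Q[OF _ _ inv3' y(1) 2(6)])
          show "t3 \<le> t + 600 * (H + B + 1)" using 3(1) 2(1) 1(1) lenas by simp
          show "same_regs {7..26} R R3" using 3(2) 2(2) 1(2) by (auto simp: same_regs_def)
          show "unlinked g g3 y" by (simp add: unlinked_def g3_def)
          have "y \<noteq> 0" "0 \<notin> set as" using el unfolding 2(3) by auto
          then show "upd m3 y 2 0 0 = m 0"
            using list_frame_mem(1)[OF 3(4), of 0] q(2) 1(11) by (simp add: upd_def)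
        qed
      qed
    qed
  qed
qed

subsection \<open>The empty trie\<close>

text \<open>Recombines tag and word. Tags are stored as 1 and 2 because 0 marks a dead cell.\<close>

definition cellKey :: "umem \<Rightarrow> nat \<Rightarrow> nat" where
  "cellKey m u = (m u 2 - 1) * B ^ H + m u 0"

text \<open>The cells below \<open>j\<close> are live but not linked. With \<open>j = B + 1\<close>
  this is the initial state, otherwise the starting point for relinking.\<close>

definition empty_g :: "umem \<Rightarrow> nat \<Rightarrow> ghost" where
  "empty_g m j = \<lparr>gC = {}, gT = {B + 1..<j}, gP = {}, gK = cellKey m, gh = (\<lambda>_. 0),
     nd = (\<lambda>h p. if h = H \<and> p = 0 then B + 1 else 0), ls = (\<lambda>_ _. []), ce = j, ne = 2 * (B + 1)\<rparr>"

lemma cellKey_parts: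
  assumes "m u 2 = 1 \<or> m u 2 = 2" "m u 0 < 2 ^ w"
  shows "cellKey m u div B ^ H = m u 2 - 1" "cellKey m u mod B ^ H = m u 0" "cellKey m u < 2 * B ^ H"
proof -
  have "m u 0 < B ^ H" "B ^ H \<noteq> 0" using assms(2) BH B_pos by simp_all
  then show "cellKey m u div B ^ H = m u 2 - 1" "cellKey m u mod B ^ H = m u 0" "cellKey m u < 2 * B ^ H"
    using assms(1) by (auto simp: cellKey_def div_add_self1)
qed

lemma inv_empty:
  assumes tab: "table m" "m 0 2 = j" "m 0 3 = 2 * (B + 1)" and j: "B + 1 \<le> j"
    and z: "\<forall>u f. B < u \<longrightarrow> 3 \<le> f \<longrightarrow> m u f = 0"
    and c: "\<forall>u\<in>{B+1..<j}. (m u 2 = 1 \<or> m u 2 = 2) \<and> m u 0 < 2 ^ w"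
    and zc: "\<forall>u f. j \<le> u \<longrightarrow> f < 3 \<longrightarrow> m u f = 0"
  shows "inv (empty_g m j) m None (KMr (empty_g m j))"
proof -
  let ?g = "empty_g m j"
  have nd: "nd ?g h p = (if h = H \<and> p = 0 then B + 1 else 0)" for h p by (simp add: empty_g_def)
  have set_nd: "{(h, p). nd ?g h p \<noteq> 0} = {(H, 0)}" by (auto simp: nd)
  have K: "KMr ?g h = {#}" for h by (simp add: KMr_def empty_g_def)
  have su: "B < su ?g h P" if "nd ?g h (P div B) \<noteq> 0" for h P
    using that by (auto simp: su_def nd split: if_splits)
  have "nodeI ?g m"
    unfolding nodeI_def
  proof (intro conjI allI impI)
    show "finite {(h, p). nd ?g h p \<noteq> 0}" unfolding set_nd by simp
    show "ne ?g = (B + 1) * (card {(h, p). nd ?g h p \<noteq> 0} + 1)" unfolding set_nd by (simp add: empty_g_def)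
    fix h P assume a: "nd ?g h (P div B) \<noteq> 0"
    then have "h = H" by (auto simp: nd split: if_splits)
    then show "m (su ?g h P) 6 = (if h = 0 then 0 else nd ?g (h - 1) P)"
      using z su[OF a] H1 by (auto simp: nd)
  next
    fix h p assume a: "nd ?g h p \<noteq> 0"
    then have "h = H \<and> p = 0" by (auto simp: nd split: if_splits)
    then show "h \<le> H" "h = H \<Longrightarrow> p = 0" "B + 1 \<le> nd ?g h p" "nd ?g h p + B < ne ?g"
      by (auto simp: nd empty_g_def)
    assume "h < H"
    then show "nd ?g (Suc h) (p div B) \<noteq> 0"
      "B \<le> card {c \<in> gP ?g. gh ?g c = Suc h \<and> gK ?g c div B ^ Suc h = p}"
      using a by (auto simp: nd)
  next
    fix u f assume "ne ?g \<le> u" "3 \<le> (f::nat)"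
    then show "m u f = 0" using z by (simp add: empty_g_def)
  next
    fix h p h' p' assume "nd ?g h p \<noteq> 0" "nd ?g h' p' \<noteq> 0" "(h, p) \<noteq> (h', p')"
    then show "nd ?g h p + B < nd ?g h' p' \<or> nd ?g h' p' + B < nd ?g h p"
      by (auto simp: nd split: if_splits)
  qed (simp add: nd)
  moreover have "listI ?g m None"
  proof -
    have "lst m (su ?g h P) []" if "nd ?g h (P div B) \<noteq> 0" for h P
      using su[OF that] z by (simp add: lst_def)
    then show ?thesis unfolding listI_def by (simp add: empty_g_def)
  qed
  moreover have "cellI ?g m"
    unfolding cellI_def
  proof (intro conjI allI impI ballI)
    fix u assume "u \<in> gT ?g"
    then have "(m u 2 = 1 \<or> m u 2 = 2) \<and> m u 0 < 2 ^ w" using c by (simp add: empty_g_def)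
    then show "m u 0 = gK ?g u mod B ^ H" "gK ?g u < 2 * B ^ H" "gK ?g u mod B ^ H < 2 ^ w"
      using cellKey_parts[of m u] by (auto simp: empty_g_def)
  next
    fix u assume u: "u \<in> {B + 1..<ce ?g}"
    then have "(m u 2 = 1 \<or> m u 2 = 2) \<and> m u 0 < 2 ^ w" using c by (simp add: empty_g_def)
    then show "m u 2 = (if u \<in> gT ?g then 1 + gK ?g u div B ^ H else 0)"
      using cellKey_parts(1)[of m u] u by (auto simp: empty_g_def)
  qed (use j zc in \<open>auto simp: empty_g_def\<close>)
  moreover have "countI ?g m (KMr ?g)"
    unfolding countI_def
  proof (intro allI impI)
    fix h p assume "nd ?g h p \<noteq> 0"
    then have "B < nd ?g h p" by (auto simp: nd split: if_splits)
    then show "counts m (nd ?g h p) (cntF (KMr ?g h) h p)"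
      by (intro counts_zero) (use z in \<open>auto simp: K cntF_def\<close>)
  qed
  moreover have "memI ?g m" using tab by (simp add: memI_def empty_g_def)
  ultimately show ?thesis by (simp add: inv_def)
qed

subsection \<open>Rebuilding\<close>

text \<open>The fields 0 to 2 of the same units are spared, as they belong to cells.\<close>

definition clear_com :: com where
  "clear_com = Ld 7 4 5 ;; Ld 8 4 3 ;; Until (Eq 7 8) (St 7 3 4 ;; St 7 4 4 ;; St 7 5 4 ;; St 7 6 4 ;;
     St 7 7 4 ;; St 7 8 4 ;; St 7 9 4 ;; St 7 10 4 ;; Bin Add 7 7 5)"

text \<open>The write position never overtakes the read position, and a cell is loaded and cleared
  before its contents are written, so equal positions do no harm.\<close>

definition compact_com :: com where
  "compact_com = Ld 7 4 5 ;; Ld 8 4 2 ;; Ld 9 4 5 ;;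
     Until (Eq 7 8) (Ld 12 7 0 ;; Ld 13 7 2 ;; St 7 0 4 ;; St 7 1 4 ;; St 7 2 4 ;;
       If (Eq 13 4) Skip (St 9 0 12 ;; St 9 2 13 ;; Bin Add 9 9 5) ;; Bin Add 7 7 5)"

text \<open>Registers 27 and 28 control the loop because \<open>link_com\<close> works on the
  registers 7 to 26.\<close>

definition relink_com :: com where
  "relink_com = St 4 2 9 ;; Ld 27 4 5 ;; Bin Add 8 27 27 ;; St 4 3 8 ;; Bin Add 28 9 4 ;;
     Until (Eq 27 28) (Bin Add 20 27 4 ;; Ld 9 27 0 ;; Ld 8 27 2 ;; Bin Sub 8 8 5 ;; link_com ;;
       Bin Add 27 27 5)"

definition rebuild_com :: com where
  "rebuild_com = clear_com ;; compact_com ;; relink_com"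

text \<open>\<open>inv_empty\<close> asks for entirely clean node fields, including those from 11
  on, which the program does not write; that they are zero has to be known in advance.\<close>

lemma wp_clear:
  assumes c: "cregs R" and tab: "table m" and n: "m 0 3 = n" "B + 1 \<le> n" "n \<le> L"
    and z: "\<forall>u f. n \<le> u \<longrightarrow> 3 \<le> f \<longrightarrow> m u f = 0" "\<forall>u f. 11 \<le> f \<longrightarrow> m u f = 0"
    and Q: "\<And>t' R' m'. t' \<le> t + 60 * n \<Longrightarrow> same_regs {7..26} R R' \<Longrightarrow>
      \<forall>u f. B < u \<longrightarrow> 3 \<le> f \<longrightarrow> m' u f = 0 \<Longrightarrow> \<forall>u f. u \<le> B \<or> f < 3 \<longrightarrow> m' u f = m u f \<Longrightarrow> Q t' R' m'"
  shows "wp w L clear_com Q t R m"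
proof -
  have c': "R 4 = 0" "R 5 = 1" using c by (auto simp: cregs_def)
  have nw: "n < 2 ^ w" using n(3) small(1) by simp
  define I where "I = (\<lambda>k t' R' m'. \<exists>i. B + 1 \<le> i \<and> i \<le> n \<and> k = n - i \<and> same_regs {7, 8} R R' \<and>
     R' 7 = i \<and> R' 8 = n \<and> t' + 50 * (n - i) \<le> t + 10 + 50 * n \<and>
     m' = (\<lambda>u f. if B < u \<and> u < i \<and> 3 \<le> f then 0 else m u f))"
  have "wp w L (Until (Eq 7 8) (St 7 3 4 ;; St 7 4 4 ;; St 7 5 4 ;; St 7 6 4 ;;
     St 7 7 4 ;; St 7 8 4 ;; St 7 9 4 ;; St 7 10 4 ;; Bin Add 7 7 5)) Q (10 + t) (R(7 := B + 1, 8 := n)) m"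
  proof (rule wp_Until[where I = I])
    show "I (n - (B + 1)) (10 + t) (R(7 := B + 1, 8 := n)) m"
      unfolding I_def using n by (intro exI[of _ "B + 1"]) (auto simp: same_regs_def fun_eq_iff)
  next
    fix k t1 R1 m1
    assume I: "I k t1 R1 m1" and nb: "\<not> bval (Eq 7 8) R1"
    obtain i where i: "B + 1 \<le> i" "i \<le> n" "k = n - i" "same_regs {7, 8} R R1" "R1 7 = i" "R1 8 = n"
      "t1 + 50 * (n - i) \<le> t + 10 + 50 * n" "m1 = (\<lambda>u f. if B < u \<and> u < i \<and> 3 \<le> f then 0 else m u f)"
      using I unfolding I_def by blast
    have "i < n" using i nb by auto
    have r: "R1 4 = 0" "R1 5 = 1" using i(4) c' by (auto simp: same_regs_def)
    have goal: "\<exists>n'<k. I n' t' R' m'" if "t' \<le> t1 + 45" "same_regs {7, 8} R1 R'" "R' 7 = Suc i" "R' 8 = n"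
      "m' = upd (upd (upd (upd (upd (upd (upd (upd m1 i 3 0) i 4 0) i 5 0) i 6 0) i 7 0) i 8 0) i 9 0) i 10 0"
      for t' R' m'
    proof (intro exI[of _ "n - Suc i"] conjI)
      have z': "3 \<le> f \<Longrightarrow> f \<notin> {3,4,5,6,7,8,9,10} \<Longrightarrow> m u f = 0" for u f using z(2) by auto
      have "m' = (\<lambda>u f. if B < u \<and> u < Suc i \<and> 3 \<le> f then 0 else m u f)"
      proof (intro ext)
        fix u f
        show "m' u f = (if B < u \<and> u < Suc i \<and> 3 \<le> f then 0 else m u f)"
          using that(5) i(1,8) z'[of f u] by (cases "u = i") auto
      qed
      then show "I (n - Suc i) t' R' m'"
        unfolding I_def using that(1-4) i \<open>i < n\<close>
        by (intro exI[of _ "Suc i"]) (auto simp: same_regs_def)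
    qed (use i \<open>i < n\<close> in auto)
    show "wp w L (St 7 3 4 ;; St 7 4 4 ;; St 7 5 4 ;; St 7 6 4 ;;
     St 7 7 4 ;; St 7 8 4 ;; St 7 9 4 ;; St 7 10 4 ;; Bin Add 7 7 5)
       (\<lambda>t R m. \<exists>n'<k. I n' (t + 1) R m) (t1 + 1) R1 m1"
      using \<open>i < n\<close> n(3) nw i(5,6) by (simp add: r) (rule goal; simp add: same_regs_def)
  next
    fix k t1 R1 m1
    assume I: "I k t1 R1 m1" and nb: "bval (Eq 7 8) R1"
    obtain i where i: "same_regs {7, 8} R R1" "R1 7 = i" "R1 8 = n"
      "t1 + 50 * (n - i) \<le> t + 10 + 50 * n" "m1 = (\<lambda>u f. if B < u \<and> u < i \<and> 3 \<le> f then 0 else m u f)"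
      using I unfolding I_def by blast
    have "i = n" using i nb by simp
    then show "Q (t1 + 1) R1 m1"
      using i n z B2 by (intro Q) (auto simp: same_regs_def)
  qed
  moreover have "m 0 5 = Suc B" using tab by (simp add: table_def)
  ultimately show ?thesis
    unfolding clear_com_def using c' n L1 by simp
qed


text \<open>The sums of singletons say that the multiset of live keys is preserved, without tracking
  where each cell has moved.\<close>

lemma wp_compact:
  assumes c: "cregs R" and tab: "table m" and e: "m 0 2 = e" "B + 1 \<le> e" "e \<le> L"
    and val: "\<forall>u\<in>{B+1..<e}. m u 2 \<noteq> 0 \<longrightarrow> (m u 2 = 1 \<or> m u 2 = 2) \<and> m u 0 < 2 ^ w"
    and Q: "\<And>t' R' m' j. t' \<le> t + 60 * e \<Longrightarrow> same_regs {7..26} R R' \<Longrightarrow> R' 9 = j \<Longrightarrow> B + 1 \<le> j \<Longrightarrow> j \<le> e \<Longrightarrow>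
      \<forall>u\<in>{B+1..<j}. (m' u 2 = 1 \<or> m' u 2 = 2) \<and> m' u 0 < 2 ^ w \<Longrightarrow>
      \<forall>u f. j \<le> u \<longrightarrow> u < e \<longrightarrow> f < 3 \<longrightarrow> m' u f = 0 \<Longrightarrow>
      \<forall>u f. u \<le> B \<or> e \<le> u \<or> 3 \<le> f \<longrightarrow> m' u f = m u f \<Longrightarrow>
      (\<Sum>u\<in>{B+1..<j}. {#cellKey m' u#}) = (\<Sum>u\<in>{B+1..<e}. if m u 2 = 0 then {#} else {#cellKey m u#}) \<Longrightarrow>
      Q t' R' m'"
  shows "wp w L compact_com Q t R m"
proof -
  have c': "R 4 = 0" "R 5 = 1" using c by (auto simp: cregs_def)
  have ew: "e < 2 ^ w" using e(3) small(1) by simp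
  let ?body = "Ld 12 7 0 ;; Ld 13 7 2 ;; St 7 0 4 ;; St 7 1 4 ;; St 7 2 4 ;;
       If (Eq 13 4) Skip (St 9 0 12 ;; St 9 2 13 ;; Bin Add 9 9 5) ;; Bin Add 7 7 5"
  define S where "S = (\<lambda>i. \<Sum>u\<in>{B+1..<i}. if m u 2 = 0 then {#} else {#cellKey m u#})"
  define I where "I = (\<lambda>k t' R' m'. \<exists>i j. B + 1 \<le> j \<and> j \<le> i \<and> i \<le> e \<and> k = e - i \<and>
     same_regs {7, 8, 9, 12, 13} R R' \<and> R' 7 = i \<and> R' 8 = e \<and> R' 9 = j \<and> t' + 50 * (e - i) \<le> t + 15 + 50 * e \<and>
     (\<forall>u\<in>{B+1..<j}. (m' u 2 = 1 \<or> m' u 2 = 2) \<and> m' u 0 < 2 ^ w) \<and>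
     (\<forall>u f. j \<le> u \<longrightarrow> u < i \<longrightarrow> f < 3 \<longrightarrow> m' u f = 0) \<and>
     (\<forall>u f. u \<le> B \<or> i \<le> u \<or> 3 \<le> f \<longrightarrow> m' u f = m u f) \<and>
     (\<Sum>u\<in>{B+1..<j}. {#cellKey m' u#}) = S i)"
  have "wp w L (Until (Eq 7 8) ?body) Q (15 + t) (R(7 := B + 1, 8 := e, 9 := B + 1)) m"
  proof (rule wp_Until[where I = I])
    show "I (e - (B + 1)) (15 + t) (R(7 := B + 1, 8 := e, 9 := B + 1)) m"
      unfolding I_def using e by (intro exI[of _ "B + 1"]) (auto simp: same_regs_def S_def)
  next
    fix k t1 R1 m1
    assume I: "I k t1 R1 m1" and nb: "\<not> bval (Eq 7 8) R1"
    obtain i j where i: "B + 1 \<le> j" "j \<le> i" "i \<le> e" "k = e - i" "same_regs {7, 8, 9, 12, 13} R R1"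
      "R1 7 = i" "R1 8 = e" "R1 9 = j" "t1 + 50 * (e - i) \<le> t + 15 + 50 * e"
     "\<forall>u\<in>{B+1..<j}. (m1 u 2 = 1 \<or> m1 u 2 = 2) \<and> m1 u 0 < 2 ^ w"
     "\<forall>u f. j \<le> u \<longrightarrow> u < i \<longrightarrow> f < 3 \<longrightarrow> m1 u f = 0"
     "\<forall>u f. u \<le> B \<or> i \<le> u \<or> 3 \<le> f \<longrightarrow> m1 u f = m u f"
     "(\<Sum>u\<in>{B+1..<j}. {#cellKey m1 u#}) = S i"
      using I unfolding I_def by blast
    have ie: "i < e" using i nb by auto
    have r: "R1 4 = 0" "R1 5 = 1" using i(5) c' by (auto simp: same_regs_def)
    have mi: "m1 i f = m i f" for f using i(12) by simp
    have Si: "S (Suc i) = S i + (if m i 2 = 0 then {#} else {#cellKey m i#})"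
      unfolding S_def using i(1,2) by (subst sum.atLeastLessThan_Suc) auto
    define mz where "mz = upd (upd (upd m1 i 0 0) i 1 0) i 2 0"
    have f3: "f < 3 \<Longrightarrow> f = 0 \<or> f = 1 \<or> f = 2" for f :: nat by auto
    have dead: "\<exists>n'<k. I n' t' R' mm" if "mm = mz" "t' \<le> t1 + 45" "same_regs {7, 8, 9, 12, 13} R1 R'"
      "R' 7 = Suc i" "R' 8 = e" "R' 9 = j" "m i 2 = 0" for t' R' mm
    proof (intro exI[of _ "e - Suc i"] conjI)
      have 1: "\<forall>u\<in>{B+1..<j}. (mz u 2 = 1 \<or> mz u 2 = 2) \<and> mz u 0 < 2 ^ w"
        using i(2,10) by (auto simp: mz_def)
      have 2: "\<forall>u f. j \<le> u \<longrightarrow> u < Suc i \<longrightarrow> f < 3 \<longrightarrow> mz u f = 0"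
        using i(11) f3 by (auto simp: mz_def less_Suc_eq)
      have 3: "\<forall>u f. u \<le> B \<or> Suc i \<le> u \<or> 3 \<le> f \<longrightarrow> mz u f = m u f"
        using i(1,2,12) by (auto simp: mz_def)
      have "(\<Sum>u\<in>{B+1..<j}. {#cellKey mz u#}) = (\<Sum>u\<in>{B+1..<j}. {#cellKey m1 u#})"
        using i(2) by (intro sum.cong) (auto simp: mz_def cellKey_def)
      then have 4: "(\<Sum>u\<in>{B+1..<j}. {#cellKey mz u#}) = S (Suc i)" using i(13) Si that(7) by simp
      show "I (e - Suc i) t' R' mm"
        unfolding I_def that(1) using that(2-6) i(1-5,9) ie 1 2 3 4
        by (intro exI[of _ "Suc i"] exI[of _ j]) (auto simp: same_regs_def)
    qed (use i ie in auto)
    have live: "\<exists>n'<k. I n' t' R' mm" if "mm = upd (upd mz j 0 (m i 0)) j 2 (m i 2)" "t' \<le> t1 + 45"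
      "same_regs {7, 8, 9, 12, 13} R1 R'" "R' 7 = Suc i" "R' 8 = e" "R' 9 = Suc j" "m i 2 \<noteq> 0" for t' R' mm
    proof (intro exI[of _ "e - Suc i"] conjI)
      have vi: "(m i 2 = 1 \<or> m i 2 = 2) \<and> m i 0 < 2 ^ w" using val that(7) i(1,2) ie by auto
      have 1: "\<forall>u\<in>{B+1..<Suc j}. (mm u 2 = 1 \<or> mm u 2 = 2) \<and> mm u 0 < 2 ^ w"
        using i(2,10) vi unfolding that(1) by (auto simp: mz_def less_Suc_eq)
      have 2: "\<forall>u f. Suc j \<le> u \<longrightarrow> u < Suc i \<longrightarrow> f < 3 \<longrightarrow> mm u f = 0"
        using i(11) f3 unfolding that(1) by (auto simp: mz_def less_Suc_eq)
      have 3: "\<forall>u f. u \<le> B \<or> Suc i \<le> u \<or> 3 \<le> f \<longrightarrow> mm u f = m u f"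
        using i(1,2,12) unfolding that(1) by (auto simp: mz_def)
      have "(\<Sum>u\<in>{B+1..<j}. {#cellKey mm u#}) = (\<Sum>u\<in>{B+1..<j}. {#cellKey m1 u#})"
        using i(2) unfolding that(1) by (intro sum.cong) (auto simp: mz_def cellKey_def)
      moreover have "cellKey mm j = cellKey m i" unfolding that(1) by (simp add: cellKey_def)
      ultimately have 4: "(\<Sum>u\<in>{B+1..<Suc j}. {#cellKey mm u#}) = S (Suc i)"
        using i(1,13) Si that(7) by (subst sum.atLeastLessThan_Suc) auto
      show "I (e - Suc i) t' R' mm"
        unfolding I_def using that(2-6) i(1-5,9) ie 1 2 3 4
        by (intro exI[of _ "Suc i"] exI[of _ "Suc j"]) (auto simp: same_regs_def)
    qed (use i ie in auto)
    have b: "i < L" "j < L" "Suc i < 2 ^ w" "Suc j < 2 ^ w" using ie e(3) ew i(2) by auto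
    show "wp w L ?body (\<lambda>t R m. \<exists>n'<k. I n' (t + 1) R m) (t1 + 1) R1 m1"
    proof (cases "m i 2 = 0")
      case True
      then show ?thesis
        using b by (simp add: r i(6-8) mi) (rule dead; simp add: same_regs_def mz_def i)
    next
      case False
      then show ?thesis
        using b by (simp add: r i(6-8) mi) (rule live; simp add: same_regs_def mz_def i)
    qed
  next
    fix k t1 R1 m1
    assume I: "I k t1 R1 m1" and nb: "bval (Eq 7 8) R1"
    obtain i j where i: "B + 1 \<le> j" "j \<le> i" "same_regs {7, 8, 9, 12, 13} R R1"
      "R1 7 = i" "R1 8 = e" "R1 9 = j" "t1 + 50 * (e - i) \<le> t + 15 + 50 * e"
     "\<forall>u\<in>{B+1..<j}. (m1 u 2 = 1 \<or> m1 u 2 = 2) \<and> m1 u 0 < 2 ^ w"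
     "\<forall>u f. j \<le> u \<longrightarrow> u < i \<longrightarrow> f < 3 \<longrightarrow> m1 u f = 0"
     "\<forall>u f. u \<le> B \<or> i \<le> u \<or> 3 \<le> f \<longrightarrow> m1 u f = m u f"
     "(\<Sum>u\<in>{B+1..<j}. {#cellKey m1 u#}) = S i"
      using I unfolding I_def by blast
    have ie: "i = e" using i nb by simp
    show "Q (t1 + 1) R1 m1"
    proof (rule Q[of _ _ j])
      show "t1 + 1 \<le> t + 60 * e" using i(7) e(2) B2 unfolding ie by simp
      show "same_regs {7..26} R R1" using i(3) by (auto simp: same_regs_def)
      show "R1 9 = j" "B + 1 \<le> j" "j \<le> e" using i(1,2,6) unfolding ie by blast+
      show "\<forall>u\<in>{B+1..<j}. (m1 u 2 = 1 \<or> m1 u 2 = 2) \<and> m1 u 0 < 2 ^ w" by (rule i(8))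
      show "\<forall>u f. j \<le> u \<longrightarrow> u < e \<longrightarrow> f < 3 \<longrightarrow> m1 u f = 0" using i(9) unfolding ie .
      show "\<forall>u f. u \<le> B \<or> e \<le> u \<or> 3 \<le> f \<longrightarrow> m1 u f = m u f" using i(10) unfolding ie .
      show "(\<Sum>u\<in>{B+1..<j}. {#cellKey m1 u#}) = (\<Sum>u\<in>{B+1..<e}. if m u 2 = 0 then {#} else {#cellKey m u#})"
        using i(11) unfolding ie S_def .
    qed
  qed
  moreover have "m 0 5 = Suc B" using tab by (simp add: table_def)
  ultimately show ?thesis
    unfolding compact_com_def using c' e L1 by simp
qed

text \<open>The old payments vanish together with the old nodes: the ghost state restarts from
  \<open>empty_g\<close>, and during the loop \<open>gP\<close> equals \<open>gC\<close>.\<close>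

lemma wp_relink:
  assumes c: "cregs R" "R 9 = j" and tab: "table m" and j: "B + 1 \<le> j"
    and room: "3 * (B + 1) + 2 * (j - (B + 1)) \<le> L" "j \<le> L"
    and z: "\<forall>u f. B < u \<longrightarrow> 3 \<le> f \<longrightarrow> m u f = 0"
    and val: "\<forall>u\<in>{B+1..<j}. (m u 2 = 1 \<or> m u 2 = 2) \<and> m u 0 < 2 ^ w"
    and zc: "\<forall>u f. j \<le> u \<longrightarrow> f < 3 \<longrightarrow> m u f = 0"
    and Q: "\<And>t' R' m' g. t' \<le> t + 40 + (600 * (H + B + 1) + 40) * j \<Longrightarrow>
      inv g m' None (KMr g) \<Longrightarrow> gC g = {B+1..<j} \<Longrightarrow> gT g = {B+1..<j} \<Longrightarrow> \<forall>u\<in>{B+1..<j}. gK g u = cellKey m u \<Longrightarrow> ce g = j \<Longrightarrow>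
      \<forall>f. f \<noteq> 2 \<longrightarrow> f \<noteq> 3 \<longrightarrow> m' 0 f = m 0 f \<Longrightarrow> Q t' R' m'"
  shows "wp w L relink_com Q t R m"
proof -
  have c': "R 4 = 0" "R 5 = 1" using c by (auto simp: cregs_def)
  have jw: "j < 2 ^ w" "2 * (B + 1) < 2 ^ w" using room small(1) by auto
  let ?body = "Bin Add 20 27 4 ;; Ld 9 27 0 ;; Ld 8 27 2 ;; Bin Sub 8 8 5 ;; link_com ;; Bin Add 27 27 5"
  define C where "C = 600 * (H + B + 1) + 30"
  define m1 where "m1 = upd (upd m 0 2 j) 0 3 (2 * (B + 1))"
  have tab1: "table m1" using tab by (auto simp: table_def m1_def)
  define I where "I = (\<lambda>k t' R' m'. \<exists>i g. B + 1 \<le> i \<and> i \<le> j \<and> k = j - i \<and> cregs R' \<and> R' 27 = i \<and> R' 28 = j \<and>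
     inv g m' None (KMr g) \<and> gC g = {B+1..<i} \<and> gP g = {B+1..<i} \<and> gT g = {B+1..<j} \<and> gK g = cellKey m1 \<and>
     ce g = j \<and> (\<forall>f. f \<noteq> 2 \<longrightarrow> f \<noteq> 3 \<longrightarrow> m' 0 f = m 0 f) \<and> t' + C * (j - i) \<le> t + 30 + C * j)"
  have "wp w L (Until (Eq 27 28) ?body) Q (17 + t) (R(27 := B + 1, 8 := 2 * (B + 1), 28 := j)) m1"
  proof (rule wp_Until[where I = I])
    have iv: "inv (empty_g m1 j) m1 None (KMr (empty_g m1 j))"
      by (rule inv_empty[OF tab1]) (use j z val zc in \<open>auto simp: m1_def\<close>)
    have Cj: "C * (j - (B + 1)) \<le> C * j" by simp
    show "I (j - (B + 1)) (17 + t) (R(27 := B + 1, 8 := 2 * (B + 1), 28 := j)) m1"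
      unfolding I_def
    proof (intro exI[of _ "B + 1"] exI[of _ "empty_g m1 j"] conjI)
      show "inv (empty_g m1 j) m1 None (KMr (empty_g m1 j))" by (rule iv)
      show "cregs (R(27 := B + 1, 8 := 2 * (B + 1), 28 := j))" using c(1) by (simp add: cregs_def)
      show "17 + t + C * (j - (B + 1)) \<le> t + 30 + C * j" using Cj by linarith
    qed (use j in \<open>auto simp: empty_g_def m1_def\<close>)
  next
    fix k t1 R1 m2
    assume I: "I k t1 R1 m2" and nb: "\<not> bval (Eq 27 28) R1"
    obtain i g where i: "B + 1 \<le> i" "i \<le> j" "k = j - i" "cregs R1" "R1 27 = i" "R1 28 = j"
     "inv g m2 None (KMr g)" "gC g = {B+1..<i}" "gP g = {B+1..<i}" "gT g = {B+1..<j}" "gK g = cellKey m1"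
     "ce g = j" "\<forall>f. f \<noteq> 2 \<longrightarrow> f \<noteq> 3 \<longrightarrow> m2 0 f = m 0 f" "t1 + C * (j - i) \<le> t + 30 + C * j"
      using I unfolding I_def by blast
    have ij: "i < j" using i nb by auto
    have cI: "cellI g m2" using i(7) by (simp add: inv_def)
    have iT: "i \<in> gT g" "i \<notin> gP g" using i ij by auto
    have mi: "m2 i 0 = gK g i mod B ^ H" "m2 i 2 = Suc (gK g i div B ^ H)" "gK g i < 2 * B ^ H"
      using cI iT(1) i(1,12) ij unfolding cellI_def by auto
    have r: "R1 4 = 0" "R1 5 = 1" using i(4) by (auto simp: cregs_def)
    have rg: "roomy g" using room i(12) by (simp add: roomy_def)
    have "gK g i div B ^ H < 2" using mi(3) by (simp add: less_mult_imp_div_less mult.commute)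
    moreover have w4: "(4::nat) < 2 ^ w" using small(1) L1 B2 by linarith
    ultimately have b: "i < L" "i < 2 ^ w" "Suc i < 2 ^ w" "Suc (gK g i div B ^ H) < 2 ^ w"
      using ij room(2) small(1) by auto
    define R2 where "R2 = R1(20 := i, 9 := gK g i mod B ^ H, 8 := gK g i div B ^ H)"
    have lk: "wp w L link_com (wp w L (Bin Add 27 27 5) (\<lambda>t R m. \<exists>n'<k. I n' (t + 1) R m)) (13 + t1) R2 m2"
    proof (rule wp_link[OF i(7) iT refl _ _ _ _ rg])
      show "cregs R2" "R2 20 = i" "R2 8 = gK g i div B ^ H" "R2 9 = gK g i mod B ^ H"
        using i(4) by (auto simp: R2_def cregs_def)
    next
      fix t3 R3 m3 g3
      assume 3: "t3 \<le> 13 + t1 + 600 * (H + B + 1)" "same_regs {7..26} R2 R3" "inv g3 m3 None (KMr g3)"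
        "linked g g3 i" "\<forall>f. f \<noteq> 3 \<longrightarrow> m3 0 f = m2 0 f"
      have r3: "R3 27 = i" "R3 28 = j" "cregs R3" "R3 5 = 1"
        using 3(2) i(4-6) by (auto simp: same_regs_def R2_def cregs_def)
      have e: "insert i {B+1..<i} = {B+1..<Suc i}" using i(1) by auto
      have "j - i = Suc (j - Suc i)" using ij by simp
      then have Cs: "C * (j - i) = C + C * (j - Suc i)" by simp
      have "I (j - Suc i) (t3 + 1 + 1) (R3(27 := Suc i)) m3"
        unfolding I_def
      proof (intro exI[of _ "Suc i"] exI[of _ g3] conjI)
        show "t3 + 1 + 1 + C * (j - Suc i) \<le> t + 30 + C * j"
          using 3(1) i(14) Cs by (simp add: C_def)
      qed (use 3 r3 i ij e in \<open>auto simp: linked_def cregs_def\<close>)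
      moreover have "j - Suc i < k" using i(3) ij by simp
      ultimately have "\<exists>n'<k. I n' (t3 + 1 + 1) (R3(27 := Suc i)) m3" by blast
      then show "wp w L (Bin Add 27 27 5) (\<lambda>t R m. \<exists>n'<k. I n' (t + 1) R m) t3 R3 m3"
        using r3 b(3) by simp
    qed
    show "wp w L ?body (\<lambda>t R m. \<exists>n'<k. I n' (t + 1) R m) (t1 + 1) R1 m2"
      using lk b mi(1,2) r unfolding R2_def by (simp add: i(5) del: wp_Seq add: wp_Seq_fun)
  next
    fix k t1 R1 m2
    assume I: "I k t1 R1 m2" and nb: "bval (Eq 27 28) R1"
    obtain i g where i: "R1 27 = i" "R1 28 = j"
     "inv g m2 None (KMr g)" "gC g = {B+1..<i}" "gT g = {B+1..<j}" "gK g = cellKey m1"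
     "ce g = j" "\<forall>f. f \<noteq> 2 \<longrightarrow> f \<noteq> 3 \<longrightarrow> m2 0 f = m 0 f" "t1 + C * (j - i) \<le> t + 30 + C * j"
      using I unfolding I_def by blast
    have "i = j" using i nb by simp
    moreover have Cle: "C * j \<le> (600 * (H + B + 1) + 40) * j"
      unfolding C_def by (intro mult_right_mono) auto
    moreover have "\<forall>u\<in>{B+1..<j}. gK g u = cellKey m u"
      unfolding i(6) by (auto simp: cellKey_def m1_def)
    moreover have tm: "t1 + 1 \<le> t + 40 + (600 * (H + B + 1) + 40) * j"
    proof -
      have "t1 \<le> t + 30 + C * j" using i(9) by (rule le_trans[OF le_add1])
      then show ?thesis using Cle by linarith
    qed
    ultimately show "Q (t1 + 1) R1 m2" by (intro Q[OF tm i(3)]) (simp_all add: i)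
  qed
  moreover have "m 0 5 = Suc B" using tab by (simp add: table_def)
  ultimately show ?thesis
    unfolding relink_com_def using c' c(2) jw L1 by (simp add: m1_def mult_2)
qed


lemma sum_singletons: "finite T \<Longrightarrow> (\<Sum>u\<in>T. {#f u#}) = image_mset f (mset_set T)"
  by (induction T rule: finite_induct) auto

text \<open>The time is stated in terms of all cells, live or dead; the caller converts it into
  potential, as the dead ones are then in the majority.\<close>

lemma wp_rebuild:
  assumes inv: "inv g m None (KMr g)" and CT: "gC g = gT g" and c: "cregs R" and room: "roomy g"
    and cl: "\<forall>u f. 11 \<le> f \<longrightarrow> m u f = 0"
    and Q: "\<And>t' R' m' g'. t' \<le> t + 100 + 60 * ne g + (700 * (H + B + 1)) * ce g \<Longrightarrow>
      inv g' m' None (KMr g') \<Longrightarrow> gC g' = gT g' \<Longrightarrow> keys g' = keys g \<Longrightarrow> ce g' = B + 1 + card (gC g) \<Longrightarrow>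
      \<forall>f. f \<noteq> 2 \<longrightarrow> f \<noteq> 3 \<longrightarrow> m' 0 f = m 0 f \<Longrightarrow> Q t' R' m'"
  shows "wp w L rebuild_com Q t R m"
proof -
  have I: "memI g m" "nodeI g m" "listI g m None" "cellI g m" "countI g m (KMr g)"
    using inv by (auto simp: inv_def)
  note rm = roomyD[OF room I(2,4)]
  have tab: "table m" "m 0 2 = ce g" "m 0 3 = ne g" using I(1) by (auto simp: memI_def)
  have z: "\<forall>u f. ne g \<le> u \<longrightarrow> 3 \<le> f \<longrightarrow> m u f = 0" using I(2) unfolding nodeI_def by blast
  have nb: "B + 1 \<le> ne g"
  proof -
    have "nd g H 0 = B + 1" using I(2) unfolding nodeI_def by blast
    then show ?thesis using nodeD(3)[OF I(2), of H 0] by simp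
  qed
  have cb: "B + 1 \<le> ce g" and T: "gT g \<subseteq> {B+1..<ce g}" using I(4) unfolding cellI_def by blast+
  have live: "m u 2 \<noteq> 0 \<longleftrightarrow> u \<in> gT g" if "u \<in> {B+1..<ce g}" for u
    using I(4) that unfolding cellI_def by simp
  have key: "(m u 2 = 1 \<or> m u 2 = 2) \<and> m u 0 < 2 ^ w \<and> cellKey m u = gK g u" if "u \<in> gT g" for u
  proof -
    have 1: "m u 0 = gK g u mod B ^ H" "gK g u < 2 * B ^ H" "gK g u mod B ^ H < 2 ^ w"
      using I(4) that unfolding cellI_def by blast+
    have 2: "m u 2 = 1 + gK g u div B ^ H" using I(4) that T unfolding cellI_def by (metis subsetD)
    have "gK g u div B ^ H < 2" using 1(2) by (simp add: less_mult_imp_div_less mult.commute)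
    then have "m u 2 = 1 \<or> m u 2 = 2" using 2 by linarith
    moreover have "cellKey m u = gK g u" unfolding cellKey_def 1(1) 2 add_diff_cancel_left' by (rule div_mult_mod_eq)
    moreover have "m u 0 < 2 ^ w" using 1 by simp
    ultimately show ?thesis by blast
  qed
  have fT: "finite (gT g)" using T finite_subset by blast
  have sumT: "(\<Sum>u\<in>{B+1..<ce g}. if m u 2 = 0 then {#} else {#cellKey m u#}) = keys g"
  proof -
    have "(\<Sum>u\<in>{B+1..<ce g}. if m u 2 = 0 then {#} else {#cellKey m u#}) =
        (\<Sum>u\<in>{B+1..<ce g}. if u \<in> gT g then {#gK g u#} else {#})"
    proof (rule sum.cong[OF refl])
      fix u assume u: "u \<in> {B+1..<ce g}"
      show "(if m u 2 = 0 then {#} else {#cellKey m u#}) = (if u \<in> gT g then {#gK g u#} else {#})"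
      proof (cases "u \<in> gT g")
        case True
        then have "m u 2 \<noteq> 0" using live[OF u] by blast
        then show ?thesis using True key[OF True] by simp
      next
        case False
        then have "m u 2 = 0" using live[OF u] by blast
        then show ?thesis using False by simp
      qed
    qed
    also have "\<dots> = (\<Sum>u\<in>{B+1..<ce g} \<inter> gT g. {#gK g u#})"
      by (rule sum.inter_restrict[symmetric]) simp
    also have "{B+1..<ce g} \<inter> gT g = gT g" using T by blast
    also have "(\<Sum>u\<in>gT g. {#gK g u#}) = keys g" unfolding keys_def CT by (rule sum_singletons[OF fT])
    finally show ?thesis .
  qed
  show ?thesis
    unfolding rebuild_com_def wp_Seq
  proof (rule wp_clear[OF c tab(1,3) nb rm(1) z cl])
    fix t1 R1 m1
    assume 1: "t1 \<le> t + 60 * ne g" "same_regs {7..26} R R1" "\<forall>u f. B < u \<longrightarrow> 3 \<le> f \<longrightarrow> m1 u f = 0"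
      "\<forall>u f. u \<le> B \<or> f < 3 \<longrightarrow> m1 u f = m u f"
    have c1: "cregs R1" using c 1(2) by (auto simp: cregs_def same_regs_def)
    have tab1: "table m1" "m1 0 2 = ce g" using tab 1(4) by (auto simp: table_def)
    have ck1: "cellKey m1 u = cellKey m u" for u using 1(4) by (simp add: cellKey_def)
    have val: "\<forall>u\<in>{B+1..<ce g}. m1 u 2 \<noteq> 0 \<longrightarrow> (m1 u 2 = 1 \<or> m1 u 2 = 2) \<and> m1 u 0 < 2 ^ w"
    proof (intro ballI impI)
      fix u assume u: "u \<in> {B+1..<ce g}" "m1 u 2 \<noteq> 0"
      then have "u \<in> gT g" using live 1(4) by simp
      then show "(m1 u 2 = 1 \<or> m1 u 2 = 2) \<and> m1 u 0 < 2 ^ w" using key 1(4) by simp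
    qed
    show "wp w L compact_com (wp w L relink_com Q) t1 R1 m1"
    proof (rule wp_compact[OF c1 tab1 cb rm(2) val])
      fix t2 R2 m2 j
      assume 2: "t2 \<le> t1 + 60 * ce g" "same_regs {7..26} R1 R2" "R2 9 = j" "B + 1 \<le> j" "j \<le> ce g"
        "\<forall>u\<in>{B+1..<j}. (m2 u 2 = 1 \<or> m2 u 2 = 2) \<and> m2 u 0 < 2 ^ w"
        "\<forall>u f. j \<le> u \<longrightarrow> u < ce g \<longrightarrow> f < 3 \<longrightarrow> m2 u f = 0"
        "\<forall>u f. u \<le> B \<or> ce g \<le> u \<or> 3 \<le> f \<longrightarrow> m2 u f = m1 u f"
        "(\<Sum>u\<in>{B+1..<j}. {#cellKey m2 u#}) = (\<Sum>u\<in>{B+1..<ce g}. if m1 u 2 = 0 then {#} else {#cellKey m1 u#})"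
      have c2: "cregs R2" using c1 2(2) by (auto simp: cregs_def same_regs_def)
      have tab2: "table m2" using tab1 2(8) by (auto simp: table_def)
      have "j - (B + 1) \<le> ce g - (B + 1)" using 2(5) by simp
      then have rj: "3 * (B + 1) + 2 * (j - (B + 1)) \<le> L" "j \<le> L"
        using room 2(5) unfolding roomy_def by linarith+
      have z2: "\<forall>u f. B < u \<longrightarrow> 3 \<le> f \<longrightarrow> m2 u f = 0" using 2(8) 1(3) by simp
      have zc2: "\<forall>u f. j \<le> u \<longrightarrow> f < 3 \<longrightarrow> m2 u f = 0"
      proof (intro allI impI)
        fix u f assume u: "j \<le> u" "f < (3::nat)"
        show "m2 u f = 0"
        proof (cases "u < ce g")
          case True
          then show ?thesis using 2(7) u by simp
        next
          case False
          then have "m2 u f = m u f" using 2(8) 1(4) u by simp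
          then show ?thesis using I(4) False u unfolding cellI_def by simp
        qed
      qed
      show "wp w L relink_com Q t2 R2 m2"
      proof (rule wp_relink[OF c2 2(3) tab2 2(4) rj z2 2(6) zc2])
        fix t3 R3 m3 g3
        assume 3: "t3 \<le> t2 + 40 + (600 * (H + B + 1) + 40) * j" "inv g3 m3 None (KMr g3)"
          "gC g3 = {B+1..<j}" "gT g3 = {B+1..<j}" "\<forall>u\<in>{B+1..<j}. gK g3 u = cellKey m2 u" "ce g3 = j"
          "\<forall>f. f \<noteq> 2 \<longrightarrow> f \<noteq> 3 \<longrightarrow> m3 0 f = m2 0 f"
        have "keys g3 = (\<Sum>u\<in>{B+1..<j}. {#gK g3 u#})"
          unfolding keys_def 3(3) by (rule sum_singletons[symmetric]) simp
        also have "\<dots> = (\<Sum>u\<in>{B+1..<j}. {#cellKey m2 u#})" using 3(5) by (intro sum.cong) auto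
        also have "\<dots> = (\<Sum>u\<in>{B+1..<ce g}. if m u 2 = 0 then {#} else {#cellKey m u#})"
          unfolding 2(9) using 1(4) ck1 by (intro sum.cong[OF refl]) simp
        finally have keys: "keys g3 = keys g" using sumT by simp
        \<comment> \<open>Equality of the key multisets also fixes the number of cells, hence the
          new \<open>ce\<close>.\<close>
        have "card (gC g3) = size (keys g3)" by (simp add: keys_def)
        also have "\<dots> = card (gC g)" unfolding keys by (simp add: keys_def)
        finally have "j - (B + 1) = card (gC g)" using 3(3) by simp
        then have cj: "ce g3 = B + 1 + card (gC g)" using 3(6) 2(4) by simp
        show "Q t3 R3 m3"
        proof (rule Q[OF _ 3(2) _ keys cj])
          have "(600 * (H + B + 1) + 40) * j \<le> (600 * (H + B + 1) + 40) * ce g"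
            using 2(5) by (intro mult_left_mono) auto
          moreover have "(600 * (H + B + 1) + 40) * ce g + 60 * ce g = (600 * (H + B + 1) + 100) * ce g"
            by (simp add: algebra_simps)
          moreover have "(600 * (H + B + 1) + 100) * ce g \<le> (700 * (H + B + 1)) * ce g"
            by (intro mult_right_mono) auto
          ultimately show "t3 \<le> t + 100 + 60 * ne g + (700 * (H + B + 1)) * ce g"
            using 3(1) 2(1) 1(1) by linarith
          show "gC g3 = gT g3" using 3 by simp
          show "\<forall>f. f \<noteq> 2 \<longrightarrow> f \<noteq> 3 \<longrightarrow> m3 0 f = m 0 f" using 3(7) 2(8) 1(4) by simp
        qed
      qed
    qed
  qed
qed

end

section \<open>The operations\<close>

text \<open>A syntactic guarantee that the fields from 11 on keep their contents; it spares the
  lemmas on single commands a frame condition for them.\<close>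

fun low_stores :: "com \<Rightarrow> bool" where
  "low_stores (St x f r) \<longleftrightarrow> f < 11"
| "low_stores (c1 ;; c2) \<longleftrightarrow> low_stores c1 \<and> low_stores c2"
| "low_stores (If b c1 c2) \<longleftrightarrow> low_stores c1 \<and> low_stores c2"
| "low_stores (Until b c) \<longleftrightarrow> low_stores c"
| "low_stores _ \<longleftrightarrow> True"

lemma ex_low_stores:
  "ex w L c s s' \<Longrightarrow> low_stores c \<Longrightarrow> 11 \<le> f \<Longrightarrow> snd (snd s') u f = snd (snd s) u f"
  by (induction rule: ex.induct) auto

lemma wp_low_stores:
  assumes "wp w L c Q t R m" "low_stores c"
  shows "wp w L c (\<lambda>t R m'. Q t R m' \<and> (\<forall>u f. 11 \<le> f \<longrightarrow> m' u f = m u f)) t R m"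
  using assms ex_low_stores unfolding wp_def by fastforce

context trie begin

definition width_loop :: com where
  "width_loop = Until (Eq 31 4) (Bin Div 31 31 33 ;; Bin Add 32 32 5)"

text \<open>Register 6 lags one behind register 34, so it ends as the largest \<open>b\<close> with
  \<open>b * b \<le> w\<close>.\<close>

definition base_loop :: com where
  "base_loop = Until (Lt 32 35) (Bin Add 6 34 4 ;; Bin Add 34 34 5 ;; Bin Mul 35 34 34)"

text \<open>Register 37 holds the largest word divided by \<open>B\<close>, so a multiplication
  takes place only if its result fits into a word.\<close>

definition power_loop :: com where
  "power_loop = Until (Lt 37 36) (Bin Mul 36 36 6)"

definition powers_loop :: com where
  "powers_loop = Until (Eq 31 6) (Bin Add 31 31 5 ;; St 31 1 38 ;; Bin Mul 38 38 34)"

text \<open>The mask of \<open>j\<close> is the sum of the powers with exponents above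
  \<open>j\<close>. Running downwards, each power is added right after the mask of its own digit has
  been stored.\<close>

definition masks_loop :: com where
  "masks_loop = Until (Eq 31 4) (St 31 0 38 ;; Ld 39 31 1 ;; Bin Add 38 38 39 ;; Bin Sub 31 31 5)"

definition init_com :: com where
  "init_com = MaxW 30 ;; Bin Add 31 30 4 ;; Imm 32 0 ;; Imm 33 2 ;;
     width_loop ;;
     Imm 6 1 ;; Imm 34 2 ;; Imm 35 4 ;;
     base_loop ;;
     Imm 36 1 ;; Bin Div 37 30 6 ;; power_loop ;;
     St 4 0 6 ;; St 4 1 36 ;; Bin Add 34 6 5 ;; St 4 5 34 ;; St 4 2 34 ;; Bin Add 35 34 34 ;; St 4 3 35 ;;
     Imm 31 0 ;; Imm 38 1 ;;
     powers_loop ;;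
     Imm 38 0 ;;
     masks_loop"

definition pro_com :: com where
  "pro_com = Imm 4 0 ;; Imm 5 1 ;; Ld 6 4 0"

definition cell_com :: com where
  "cell_com = Ld 20 4 2 ;; St 20 0 9 ;; Bin Add 12 8 5 ;; St 20 2 12 ;; Bin Add 12 20 5 ;; St 4 2 12"

definition add_com :: com where
  "add_com = cell_com ;; link_com"

text \<open>Memory starts as 0 while \<open>B\<close> is positive, so a zero in the field of
  \<open>B\<close> identifies the very first insertion.\<close>

definition insert_com :: com where
  "insert_com = pro_com ;; If (Eq 6 4) init_com Skip ;;
     MaxW 30 ;; Bin Sub 9 30 0 ;; Imm 8 0 ;; add_com ;; Bin Add 9 1 4 ;; Imm 8 1 ;; add_com ;; Ld 30 4 4 ;; Bin Add 30 30 5 ;; St 4 4 30"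

text \<open>Register 31 becomes \<open>4 * n\<close> and register 32 the number of cells in use. As
  \<open>2 * n\<close> of them are live, the test asks whether the dead ones are in the
  majority.\<close>

definition delete_com :: com where
  "delete_com = pro_com ;; MaxW 30 ;; Bin Sub 9 30 0 ;; Imm 8 0 ;; unlink_com ;;
     Bin Add 9 1 4 ;; Imm 8 1 ;; unlink_com ;; Ld 30 4 4 ;; Bin Sub 30 30 5 ;; St 4 4 30 ;;
     Bin Add 31 30 30 ;; Bin Add 31 31 31 ;; Ld 32 4 2 ;; Ld 33 4 5 ;; Bin Sub 32 32 33 ;;
     If (Lt 31 32) rebuild_com Skip"

text \<open>Register 26 accumulates both ranks. The second one includes all \<open>n\<close> left
  endpoints, which precede the right endpoints; hence the subtraction from
  \<open>2 * n\<close>.\<close>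

definition query_com :: com where
  "query_com = pro_com ;; MaxW 30 ;; Bin Sub 9 30 0 ;; Imm 8 0 ;; Imm 26 0 ;; rank_com ;;
     Bin Add 9 0 4 ;; Imm 8 1 ;; rank_com ;; Ld 30 4 4 ;; Bin Add 30 30 30 ;; Bin Sub 0 30 26"

lemmas com_defs = add_com_def insert_com_def delete_com_def query_com_def init_com_def pro_com_def cell_com_def
  link_com_def unlink_com_def rebuild_com_def rank_com_def start_com_def walk_com_def find_com_def
  ins_com_def over_com_def push_com_def pop_com_def alloc_com_def seek_com_def rem_com_def
  clear_com_def compact_com_def relink_com_def scan_com_def pre_com_def visit_def descend_def
  count_com_def norm_com_def width_loop_def base_loop_def power_loop_def powers_loop_def masks_loop_def

lemma com_ok:
  "wf insert_com" "wf delete_com" "wf query_com"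
  "low_stores insert_com" "low_stores delete_com" "low_stores query_com" "low_stores unlink_com"
  by (simp_all add: com_defs)

text \<open>The new cell is live but unlinked, so lists and counts are unaffected. Renaming the key
  of a unit outside \<open>gC\<close> and \<open>gP\<close> is invisible to the invariant.\<close>

lemma inv_new_cell:
  assumes inv: "inv g m None (KMr g)" and k: "k < 2 * B ^ H" "k mod B ^ H < 2 ^ w" and c: "c = ce g"
    and m': "m' = upd (upd (upd m c 0 (k mod B ^ H)) c 2 (Suc (k div B ^ H))) 0 2 (Suc c)"
    and g': "g' = g\<lparr>gT := insert c (gT g), gK := (gK g)(c := k), ce := Suc c\<rparr>"
  shows "inv g' m' None (KMr g')" "c \<in> gT g'" "c \<notin> gP g'" "gC g' = gC g" "gK g' c = k" "keys g' = keys g"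
proof -
  have I: "memI g m" "nodeI g m" "listI g m None" "cellI g m" "countI g m (KMr g)"
    using inv by (auto simp: inv_def)
  have sub: "gC g \<subseteq> gT g" "gC g \<subseteq> gP g" "gT g \<subseteq> {B+1..<c}" "gP g \<subseteq> {B+1..<c}" "B + 1 \<le> c"
    using I(4) unfolding cellI_def c by blast+
  have cn: "c \<notin> gP g" "c \<notin> gC g" using sub by auto
  show "c \<in> gT g'" "c \<notin> gP g'" "gC g' = gC g" "gK g' c = k" using cn by (simp_all add: g')
  have same: "nd g' = nd g" "ls g' = ls g" "ne g' = ne g" "gP g' = gP g" "gh g' = gh g" "gC g' = gC g"
    by (simp_all add: g')
  have K: "gK g' x = gK g x" if "x \<noteq> c" for x using that by (simp add: g')
  have su: "su g' h P = su g h P" for h P by (simp add: su_def same)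
  show kk: "keys g' = keys g"
  proof -
    have "image_mset (gK g') (mset_set (gC g)) = image_mset (gK g) (mset_set (gC g))"
    proof (rule image_mset_cong)
      fix x assume "x \<in># mset_set (gC g)"
      then have "x \<in> gC g" using finite_cells[OF I(4)] by simp
      then show "gK g' x = gK g x" using cn K by metis
    qed
    then show ?thesis by (simp add: keys_def same)
  qed
  have KM: "KMr g' h = KMr g h" for h
  proof -
    have "image_mset (gK g') (mset_set {c \<in> gC g. gh g c \<le> h}) = image_mset (gK g) (mset_set {c \<in> gC g. gh g c \<le> h})"
    proof (rule image_mset_cong)
      fix x assume "x \<in># mset_set {c \<in> gC g. gh g c \<le> h}"
      then have "x \<in> gC g" using finite_cells[OF I(4)] by simp
      then show "gK g' x = gK g x" using cn K by metis
    qed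
    then show ?thesis by (simp add: KMr_def same)
  qed
  have f3: "m' u f = m u f" if "f \<noteq> 0" "f \<noteq> 2" for u f using that by (simp add: m')
  have mem': "memI g' m'" using I(1) sub(5) unfolding memI_def table_def by (auto simp: m' g')
  have n2: "nodeI g m'" by (rule nodeI_cong[OF I(2)]) (simp_all add: f3)
  have node': "nodeI g' m'"
  proof (rule nodeI_ghost[OF n2 same(1,3)], intro allI impI)
    fix h p assume "nd g h p \<noteq> 0" "h < H"
    then have "B \<le> card {c \<in> gP g. gh g c = Suc h \<and> gK g c div B ^ Suc h = p}"
      using I(2) unfolding nodeI_def by blast
    moreover have "{c \<in> gP g'. gh g' c = Suc h \<and> gK g' c div B ^ Suc h = p} =
        {c \<in> gP g. gh g c = Suc h \<and> gK g c div B ^ Suc h = p}"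
      using K cn(1) unfolding same by (intro Collect_cong) metis
    ultimately show "B \<le> card {c \<in> gP g'. gh g' c = Suc h \<and> gK g' c div B ^ Suc h = p}" by simp
  qed
  have l2: "listI g m' None" by (rule listI_cong[OF I(3)]) (auto simp: f3)
  have list': "listI g' m' None"
    unfolding listI_def
  proof (intro conjI allI impI ballI)
    fix h P assume n: "nd g' h (P div B) \<noteq> 0"
    note d = listD[OF l2 n[unfolded same]]
    show "lst m' (su g' h P) (ls g' h P)" "distinct (ls g' h P)" unfolding su same using d by blast+
    show "set (ls g' h P) = {c \<in> gC g'. gh g' c = h \<and> gK g' c div B ^ h = P}"
      unfolding same d(2) using K cn(2) by (intro Collect_cong) metis
    have "c \<notin> set (ls g h P)" using d(2) cn(2) by blast
    then show "sorted_wrt (\<lambda>a b. gK g' b \<le> gK g' a) (ls g' h P)"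
      unfolding same
    proof (intro sorted_wrt_mono_rel[OF _ d(4)])
      fix a b assume "a \<in> set (ls g h P)" "b \<in> set (ls g h P)" "gK g b \<le> gK g a" "c \<notin> set (ls g h P)"
      then have "a \<noteq> c" "b \<noteq> c" by auto
      then show "gK g' b \<le> gK g' a" using K \<open>gK g b \<le> gK g a\<close> by simp
    qed
  next
    fix h P assume "0 < h" "nd g' h (P div B) \<noteq> 0"
    then show "length (ls g' h P) \<le> B + (if None = Some (h, P) then 1 else 0)"
      using listI_length[OF l2] unfolding same by blast
  next
    fix x assume "x \<in> gC g'"
    then show "gh g' x \<le> H" using l2 unfolding listI_def same by blast
  next
    fix x h assume x: "x \<in> gC g'" "gh g' x \<le> h" "h \<le> H"
    then have "x \<noteq> c" using cn(2) same by auto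
    then show "nd g' h (gK g' x div B ^ Suc h) \<noteq> 0"
      using listI_path[OF l2, of x h] x K unfolding same by simp
  next
    fix x x' assume x: "x \<in> gC g'" "x' \<in> gC g'" "gh g' x' < gh g' x"
      "gK g' x div B ^ gh g' x = gK g' x' div B ^ gh g' x"
    then have "x \<noteq> c" "x' \<noteq> c" using cn(2) same by auto
    then show "gK g' x \<le> gK g' x'" using listI_order[OF l2, of x x'] x K unfolding same by simp
  qed
  have cell': "cellI g' m'"
    unfolding cellI_def
  proof (intro conjI allI impI ballI)
    fix x assume "x \<in> gT g'"
    then have x: "x = c \<or> x \<in> gT g" by (auto simp: g')
    have "x \<in> gT g \<Longrightarrow> x \<noteq> c \<and> x \<noteq> 0" using sub(3) by auto
    then show "m' x 0 = gK g' x mod B ^ H" "gK g' x < 2 * B ^ H" "gK g' x mod B ^ H < 2 ^ w"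
      using x k I(4) unfolding cellI_def by (auto simp: m' g')
  next
    fix x assume x: "x \<in> {B + 1..<ce g'}"
    show "m' x 2 = (if x \<in> gT g' then 1 + gK g' x div B ^ H else 0)"
    proof (cases "x = c")
      case True
      then show ?thesis using sub(5) by (simp add: m' g')
    next
      case False
      then have "x \<in> {B+1..<ce g}" using x by (auto simp: g' c)
      then have "m x 2 = (if x \<in> gT g then 1 + gK g x div B ^ H else 0)" using I(4) unfolding cellI_def by blast
      then show ?thesis using False x by (simp add: m' g')
    qed
  next
    fix u f assume "ce g' \<le> u" "f < (3::nat)"
    then show "m' u f = 0" using I(4) sub(5) unfolding cellI_def by (simp add: m' g' c)
  qed (use sub in \<open>auto simp: g'\<close>)
  have "countI g' m' (KMr g)" using countI_cong[OF I(5), of m' g'] f3 same(1) by simp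
  then have "countI g' m' (KMr g')" using KM by (simp add: countI_def)
  then show "inv g' m' None (KMr g')" using mem' node' list' cell' by (simp add: inv_def)
qed

section \<open>Initialisation: the word length, the base, the height and the tables\<close>

lemma enc_single: "j < B \<Longrightarrow> enc B (\<lambda>x. if x = j then 1 else 0) = Suc B ^ j"
  by (simp add: enc_def if_distrib[of "\<lambda>a. a * _"] cong: if_cong)

lemma init_width:
  assumes R: "R 4 = 0" "R 5 = 1" "R 31 = 2 ^ w - 1" "R 32 = 0" "R 33 = 2"
    and Q: "\<And>t' R'. t' \<le> t + 10 * w + 1 \<Longrightarrow> same_regs {31, 32} R R' \<Longrightarrow> R' 32 = w \<Longrightarrow> Q t' R' m"
  shows "wp w L width_loop Q t R m"
proof -
  define I where "I = (\<lambda>n t' R' m'. m' = m \<and> same_regs {31, 32} R R' \<and> (\<exists>i\<le>w. n = w - i \<and>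
     R' 31 = (2 ^ w - 1) div 2 ^ i \<and> R' 32 = i \<and> t' \<le> t + 10 * i))"
  show ?thesis
    unfolding width_loop_def
  proof (rule wp_Until[where I = I and n = w])
    show "I w t R m" unfolding I_def using R by (auto simp: same_regs_def intro!: exI[of _ 0])
  next
    fix n t1 R1 m1 assume I: "I n t1 R1 m1" and nb: "\<not> bval (Eq 31 4) R1"
    obtain i where i: "i \<le> w" "n = w - i" "R1 31 = (2 ^ w - 1) div 2 ^ i" "R1 32 = i" "t1 \<le> t + 10 * i"
      and s: "m1 = m" "same_regs {31, 32} R R1" using I unfolding I_def by blast
    have r: "R1 4 = 0" "R1 5 = 1" "R1 33 = 2" using s R by (auto simp: same_regs_def)
    have "i \<noteq> w"
    proof
      assume "i = w"
      then have "R1 31 = 0" using i(3) by simp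
      then show False using nb r by simp
    qed
    then have iw: "i < w" using i by simp
    have "\<exists>n'<n. I n' t' R' m1" if "t' \<le> t1 + 10" "same_regs {31, 32} R1 R'"
      "R' 31 = (2 ^ w - 1) div 2 ^ i div 2" "R' 32 = Suc i" for t' R'
    proof (intro exI[of _ "w - Suc i"] conjI)
      have "(2 ^ w - 1 :: nat) div 2 ^ i div 2 = (2 ^ w - 1) div 2 ^ Suc i"
        by (simp only: power_Suc2 div_mult2_eq)
      then show "I (w - Suc i) t' R' m1"
        unfolding I_def using that i s iw
        by (intro conjI exI[of _ "Suc i"]) (auto simp: same_regs_def)
    qed (use i iw in auto)
    moreover have "Suc i < 2 ^ w" using iw less_exp[of w] by linarith
    ultimately show "wp w L (Bin Div 31 31 33 ;; Bin Add 32 32 5) (\<lambda>t R m. \<exists>n'<n. I n' (t + 1) R m) (t1 + 1) R1 m1"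
      using r i(3,4) by (simp add: same_regs_def)
  next
    fix n t1 R1 m1 assume I: "I n t1 R1 m1" and nb: "bval (Eq 31 4) R1"
    obtain i where i: "i \<le> w" "R1 31 = (2 ^ w - 1) div 2 ^ i" "R1 32 = i" "t1 \<le> t + 10 * i"
      and s: "m1 = m" "same_regs {31, 32} R R1" using I unfolding I_def by blast
    have "R1 31 = 0" using nb s R by (auto simp: same_regs_def)
    then have lt: "(2::nat) ^ w - 1 < 2 ^ i" using i(2) by (simp add: div_eq_0_iff)
    \<comment> \<open>The largest word has exactly \<open>w\<close> bits, so it reaches 0 after
      \<open>w\<close> halvings and not earlier.\<close>
    have "i = w"
    proof (rule ccontr)
      assume "i \<noteq> w"
      then have "Suc i \<le> w" using i(1) by simp
      then have "(2::nat) ^ Suc i \<le> 2 ^ w" by (intro power_increasing) auto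
      moreover have "(1::nat) \<le> 2 ^ i" by simp
      ultimately show False using lt by simp
    qed
    then show "Q (t1 + 1) R1 m1" unfolding s(1) using i s by (intro Q) auto
  qed
qed

lemma init_base:
  assumes w2: "w < (B + 1) * (B + 1)" and R: "R 4 = 0" "R 5 = 1" "R 32 = w" "R 6 = 1" "R 34 = 2" "R 35 = 4"
    and Q: "\<And>t' R'. t' \<le> t + 10 * B + 1 \<Longrightarrow> same_regs {6, 34, 35} R R' \<Longrightarrow> R' 6 = B \<Longrightarrow> Q t' R' m"
  shows "wp w L base_loop Q t R m"
proof -
  define I where "I = (\<lambda>n t' R' m'. m' = m \<and> same_regs {6, 34, 35} R R' \<and> (\<exists>b\<le>B. 1 \<le> b \<and> n = B - b \<and>
     R' 6 = b \<and> R' 34 = b + 1 \<and> R' 35 = (b + 1) * (b + 1) \<and> t' \<le> t + 10 * b))"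
  show ?thesis
    unfolding base_loop_def
  proof (rule wp_Until[where I = I and n = "B - 1"])
    show "I (B - 1) t R m" unfolding I_def using R B2 by (auto simp: same_regs_def intro!: exI[of _ 1])
  next
    fix n t1 R1 m1 assume I: "I n t1 R1 m1" and nb: "\<not> bval (Lt 32 35) R1"
    obtain b where b: "b \<le> B" "1 \<le> b" "n = B - b" "R1 6 = b" "R1 34 = b + 1" "R1 35 = (b + 1) * (b + 1)" "t1 \<le> t + 10 * b"
      and s: "m1 = m" "same_regs {6, 34, 35} R R1" using I unfolding I_def by blast
    have r: "R1 4 = 0" "R1 5 = 1" "R1 32 = w" using s R by (auto simp: same_regs_def)
    have le: "(b + 1) * (b + 1) \<le> w" using nb r b(6) by (simp add: not_less)
    have "b \<noteq> B" using le w2 by auto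
    then have bB: "b < B" using b by simp
    \<comment> \<open>Even the first square beyond \<open>w\<close> has to fit into a word. It is at
      most \<open>4 * w\<close>, and \<open>4 * w < 2 ^ w\<close> from \<open>w = 5\<close>
      on.\<close>
    have "(b + 2) * (b + 2) \<le> (B + 1) * (B + 1)" using bB by (intro mult_mono) auto
    also have "\<dots> \<le> (2 * B) * (2 * B)" using B2 by (intro mult_mono) auto
    also have "\<dots> = 4 * (B * B)" by simp
    also have "\<dots> \<le> 4 * w" using BB by simp
    also have "\<dots> < 2 ^ w"
    proof -
      have "(5::nat) \<le> w \<or> w = 4" using BB B2 mult_le_mono[OF B2 B2] by linarith
      moreover have "4 * n < 2 ^ n" if "5 \<le> n" for n :: nat using that by (induction n rule: dec_induct) auto
      \<comment> \<open>For \<open>w = 4\<close> the bound \<open>L2\<close> would leave at most one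
        unit, contradicting \<open>L1\<close>.\<close>
      moreover have "w \<noteq> 4"
      proof
        assume "w = 4"
        then have "(b + 1) * (b + 1) \<le> 4" using le by simp
        then have "b = 1" using b(2) by (cases b; cases "b - 1") (auto simp: algebra_simps)
        moreover have "B = 2" using \<open>w = 4\<close> BB B2
        proof -
          have "B < 3" using \<open>w = 4\<close> BB mult_le_mono[of 3 B 3 B] by (cases "3 \<le> B") auto
          then show ?thesis using B2 by simp
        qed
        ultimately show False using L1 L2 \<open>w = 4\<close> by simp
      qed
      ultimately show ?thesis by blast
    qed
    finally have b2: "(b + 2) * (b + 2) < 2 ^ w" .
    have "b + 2 \<le> (b + 2) * (b + 2)" by simp
    then have b3: "b + 2 < 2 ^ w" using b2 by linarith
    have "\<exists>n'<n. I n' t' R' m1" if "t' \<le> t1 + 10" "same_regs {6, 34, 35} R1 R'"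
      "R' 6 = Suc b" "R' 34 = b + 2" "R' 35 = (b + 2) * (b + 2)" for t' R'
    proof (intro exI[of _ "B - Suc b"] conjI)
      show "I (B - Suc b) t' R' m1"
        unfolding I_def using that b s bB
        by (intro conjI exI[of _ "Suc b"]) (auto simp: same_regs_def)
    qed (use b bB in auto)
    moreover have "R1 34 + R1 4 < 2 ^ w" "R1 34 + R1 5 = b + 2" using b3 b r by auto
    ultimately show "wp w L (Bin Add 6 34 4 ;; Bin Add 34 34 5 ;; Bin Mul 35 34 34)
      (\<lambda>t R m. \<exists>n'<n. I n' (t + 1) R m) (t1 + 1) R1 m1"
      using b2 b3 r b(5) by (simp add: same_regs_def)
  next
    fix n t1 R1 m1 assume I: "I n t1 R1 m1" and nb: "bval (Lt 32 35) R1"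
    obtain b where b: "b \<le> B" "R1 6 = b" "R1 35 = (b + 1) * (b + 1)" "t1 \<le> t + 10 * b"
      and s: "m1 = m" "same_regs {6, 34, 35} R R1" using I unfolding I_def by blast
    have "R1 32 = w" using s R by (auto simp: same_regs_def)
    then have lt: "w < (b + 1) * (b + 1)" using nb b(3) by simp
    have "b = B"
    proof (rule ccontr)
      assume "b \<noteq> B"
      then have "(b + 1) * (b + 1) \<le> B * B" using b(1) by (intro mult_mono) auto
      then show False using lt BB by simp
    qed
    then show "Q (t1 + 1) R1 m1" unfolding s(1) using b s by (intro Q) auto
  qed
qed

lemma init_power:
  assumes R: "R 6 = B" "R 36 = 1" "R 37 = (2 ^ w - 1) div B"
    and Q: "\<And>t' R'. t' \<le> t + 10 * H + 1 \<Longrightarrow> same_regs {36} R R' \<Longrightarrow> R' 36 = B ^ (H - 1) \<Longrightarrow> Q t' R' m"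
  shows "wp w L power_loop Q t R m"
proof -
  define I where "I = (\<lambda>n t' R' m'. m' = m \<and> same_regs {36} R R' \<and> (\<exists>e<H. n = H - e \<and>
     R' 36 = B ^ e \<and> t' \<le> t + 10 * e))"
  have le_iff: "B ^ e \<le> (2 ^ w - 1) div B \<longleftrightarrow> B ^ Suc e < 2 ^ w" for e
  proof -
    have "B ^ e \<le> (2 ^ w - 1) div B \<longleftrightarrow> B ^ e * B \<le> 2 ^ w - 1"
      by (rule less_eq_div_iff_mult_less_eq[OF B_pos])
    also have "\<dots> \<longleftrightarrow> B ^ Suc e < 2 ^ w" by (simp add: mult.commute Suc_le_eq flip: less_eq_Suc_le)
      (metis One_nat_def Suc_pred le_imp_less_Suc less_Suc_eq_le pos2 zero_less_power)
    finally show ?thesis .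
  qed
  have lt_iff: "B ^ Suc e < 2 ^ w \<longleftrightarrow> Suc e < H" if "e < H" for e
  proof
    assume a: "B ^ Suc e < 2 ^ w"
    show "Suc e < H"
    proof (rule ccontr)
      assume "\<not> Suc e < H"
      then have "Suc e = H" using that by simp
      then show False using a BH by simp
    qed
  next
    assume "Suc e < H"
    then have "B ^ Suc e \<le> B ^ (H - 1)" using B_pos by (intro power_increasing) auto
    then show "B ^ Suc e < 2 ^ w" using BH1 by simp
  qed
  show ?thesis
    unfolding power_loop_def
  proof (rule wp_Until[where I = I and n = H])
    show "I H t R m" unfolding I_def using R H1 by (auto simp: same_regs_def intro!: exI[of _ 0])
  next
    fix n t1 R1 m1 assume I: "I n t1 R1 m1" and nb: "\<not> bval (Lt 37 36) R1"
    obtain e where e: "e < H" "n = H - e" "R1 36 = B ^ e" "t1 \<le> t + 10 * e"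
      and s: "m1 = m" "same_regs {36} R R1" using I unfolding I_def by blast
    have r: "R1 6 = B" "R1 37 = (2 ^ w - 1) div B" using s R by (auto simp: same_regs_def)
    have lt: "B ^ Suc e < 2 ^ w" using nb e(3) r le_iff by (simp add: not_less)
    then have eH: "Suc e < H" using lt_iff e(1) by blast
    have "\<exists>n'<n. I n' t' R' m1" if "t' \<le> t1 + 10" "same_regs {36} R1 R'" "R' 36 = B ^ Suc e" for t' R'
    proof (intro exI[of _ "H - Suc e"] conjI)
      show "I (H - Suc e) t' R' m1"
        unfolding I_def using that e s eH
        by (intro conjI exI[of _ "Suc e"]) (auto simp: same_regs_def)
    qed (use e in auto)
    then show "wp w L (Bin Mul 36 36 6) (\<lambda>t R m. \<exists>n'<n. I n' (t + 1) R m) (t1 + 1) R1 m1"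
      using lt r e(3) by (simp add: same_regs_def mult.commute)
  next
    fix n t1 R1 m1 assume I: "I n t1 R1 m1" and nb: "bval (Lt 37 36) R1"
    obtain e where e: "e < H" "R1 36 = B ^ e" "t1 \<le> t + 10 * e"
      and s: "m1 = m" "same_regs {36} R R1" using I unfolding I_def by blast
    have "R1 37 = (2 ^ w - 1) div B" using s R by (auto simp: same_regs_def)
    then have "\<not> B ^ Suc e < 2 ^ w" using nb e(2) le_iff[of e] by (simp add: not_le[symmetric])
    then have "Suc e = H" using lt_iff e(1) by auto
    then have "e = H - 1" by simp
    then show "Q (t1 + 1) R1 m1" unfolding s(1) using e s by (intro Q) auto
  qed
qed

lemma G_power_less: "j \<le> B \<Longrightarrow> Suc B ^ j < 2 ^ w"
  using small(2) power_increasing[of j B "Suc B"] by simp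

lemma init_powers:
  assumes R: "R 5 = 1" "R 6 = B" "R 34 = Suc B" "R 31 = 0" "R 38 = 1"
    and Q: "\<And>t' R' m'. t' \<le> t + 10 * B + 1 \<Longrightarrow> same_regs {31, 38} R R' \<Longrightarrow> R' 31 = B \<Longrightarrow>
      m' = (\<lambda>u f. if 0 < u \<and> u \<le> B \<and> f = 1 then Suc B ^ (u - 1) else m u f) \<Longrightarrow> Q t' R' m'"
  shows "wp w L powers_loop Q t R m"
proof -
  define I where "I = (\<lambda>n t' R' m'. same_regs {31, 38} R R' \<and> (\<exists>i\<le>B. n = B - i \<and> R' 31 = i \<and>
     R' 38 = Suc B ^ i \<and> t' \<le> t + 10 * i \<and> m' = (\<lambda>u f. if 0 < u \<and> u \<le> i \<and> f = 1 then Suc B ^ (u - 1) else m u f)))"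
  show ?thesis
    unfolding powers_loop_def
  proof (rule wp_Until[where I = I and n = B])
    show "I B t R m" unfolding I_def using R by (auto simp: same_regs_def fun_eq_iff intro!: exI[of _ 0])
  next
    fix n t1 R1 m1 assume I: "I n t1 R1 m1" and nb: "\<not> bval (Eq 31 6) R1"
    obtain i where i: "i \<le> B" "n = B - i" "R1 31 = i" "R1 38 = Suc B ^ i" "t1 \<le> t + 10 * i"
      "m1 = (\<lambda>u f. if 0 < u \<and> u \<le> i \<and> f = 1 then Suc B ^ (u - 1) else m u f)"
      and s: "same_regs {31, 38} R R1" using I unfolding I_def by blast
    have r: "R1 5 = 1" "R1 6 = B" "R1 34 = Suc B" using s R by (auto simp: same_regs_def)
    have iB: "i < B" using nb i r by auto
    have goal: "\<exists>n'<n. I n' t' R' mm" if "mm = upd m1 (Suc i) (Suc 0) (Suc B ^ i)" "t' \<le> t1 + 10"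
      "same_regs {31, 38} R1 R'" "R' 31 = Suc i" "R' 38 = Suc B ^ Suc i" for t' R' mm
    proof (intro exI[of _ "B - Suc i"] conjI)
      have "mm = (\<lambda>u f. if 0 < u \<and> u \<le> Suc i \<and> f = 1 then Suc B ^ (u - 1) else m u f)"
        unfolding that(1) i(6) by (auto simp: fun_eq_iff le_Suc_eq)
      then show "I (B - Suc i) t' R' mm"
        unfolding I_def using that(2-5) i(1-5) s iB
        by (intro conjI exI[of _ "Suc i"]) (auto simp: same_regs_def)
    qed (use i iB in auto)
    have b: "Suc i < L" "Suc i < 2 ^ w" "Suc B ^ i * Suc B < 2 ^ w"
      using iB L1 small(1) G_power_less[of "Suc i"] by (auto simp: mult.commute)
    show "wp w L (Bin Add 31 31 5 ;; St 31 1 38 ;; Bin Mul 38 38 34)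
      (\<lambda>t R m. \<exists>n'<n. I n' (t + 1) R m) (t1 + 1) R1 m1"
      using b by (simp add: r i(3,4) del: mult_Suc_right mult_Suc) (rule goal; simp add: same_regs_def mult.commute)
  next
    fix n t1 R1 m1 assume I: "I n t1 R1 m1" and nb: "bval (Eq 31 6) R1"
    obtain i where i: "R1 31 = i" "t1 \<le> t + 10 * i"
      "m1 = (\<lambda>u f. if 0 < u \<and> u \<le> i \<and> f = 1 then Suc B ^ (u - 1) else m u f)"
      and s: "same_regs {31, 38} R R1" using I unfolding I_def by blast
    have "i = B" using nb i s R by (auto simp: same_regs_def)
    then show "Q (t1 + 1) R1 m1" using i s by (intro Q) auto
  qed
qed

lemma init_masks:
  assumes R: "R 4 = 0" "R 5 = 1" "R 31 = B" "R 38 = 0" and m: "\<forall>j<B. m (Suc j) 1 = Suc B ^ j"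
    and Q: "\<And>t' R' m'. t' \<le> t + 20 * B + 1 \<Longrightarrow> same_regs {31, 38, 39} R R' \<Longrightarrow>
      m' = (\<lambda>u f. if 0 < u \<and> u \<le> B \<and> f = 0 then enc B (above (u - 1)) else m u f) \<Longrightarrow> Q t' R' m'"
  shows "wp w L masks_loop Q t R m"
proof -
  \<comment> \<open>The sum of the powers from exponent \<open>i\<close> on; the mask of digit
    \<open>j\<close> is \<open>E (Suc j)\<close>.\<close>
  define E where "E = (\<lambda>i. enc B (\<lambda>x. if i \<le> x then 1 else 0))"
  have Es: "E (Suc j) = enc B (above j)" for j unfolding E_def by (simp add: Suc_le_eq)
  have EB: "E B = 0" by (simp add: E_def enc_def)
  have E_step: "E (Suc j) + Suc B ^ j = E j" if "j < B" for j
  proof -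
    have "E (Suc j) + enc B (\<lambda>x. if x = j then 1 else 0) = E j"
      unfolding E_def enc_add by (rule arg_cong[of _ _ "enc B"]) auto
    then show ?thesis using enc_single[OF that] by simp
  qed
  have El: "E j < 2 ^ w" for j
  proof -
    have "\<forall>i<B. (if j \<le> i then 1 else 0) \<le> B" using B2 by auto
    from enc_less[OF this] show ?thesis unfolding E_def using small(2) by linarith
  qed
  define I where "I = (\<lambda>n t' R' m'. same_regs {31, 38, 39} R R' \<and> (n \<le> B \<and> R' 31 = n \<and> R' 38 = E n \<and>
     t' + 20 * n \<le> t + 20 * B \<and> m' = (\<lambda>u f. if n < u \<and> u \<le> B \<and> f = 0 then enc B (above (u - 1)) else m u f)))"
  show ?thesis
    unfolding masks_loop_def
  proof (rule wp_Until[where I = I and n = B])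
    show "I B t R m" unfolding I_def using R EB by (auto simp: same_regs_def fun_eq_iff)
  next
    fix n t1 R1 m1 assume I: "I n t1 R1 m1" and nb: "\<not> bval (Eq 31 4) R1"
    have i: "n \<le> B" "R1 31 = n" "R1 38 = E n" "t1 + 20 * n \<le> t + 20 * B"
      "m1 = (\<lambda>u f. if n < u \<and> u \<le> B \<and> f = 0 then enc B (above (u - 1)) else m u f)"
      and s: "same_regs {31, 38, 39} R R1" using I unfolding I_def by blast+
    have r: "R1 4 = 0" "R1 5 = 1" using s R by (auto simp: same_regs_def)
    obtain j where j: "n = Suc j" using nb i r by (cases n) auto
    have jB: "j < B" using i j by simp
    have mj: "m1 (Suc j) (Suc 0) = Suc B ^ j" using m jB unfolding i(5) by simp
    have goal: "\<exists>n'<Suc j. I n' t' R' mm" if "mm = upd m1 (Suc j) 0 (E (Suc j))" "t' \<le> t1 + 20"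
      "same_regs {31, 38, 39} R1 R'" "R' 31 = j" "R' 38 = E j" for t' R' mm
    proof (intro exI[of _ j] conjI)
      have "mm = (\<lambda>u f. if j < u \<and> u \<le> B \<and> f = 0 then enc B (above (u - 1)) else m u f)"
        unfolding that(1) i(5) j Es using jB by (auto simp: fun_eq_iff)
      then show "I j t' R' mm"
        unfolding I_def using that(2-5) i(1-4) s j by (auto simp: same_regs_def)
    qed (use j in auto)
    have b: "Suc j < L" "Suc j < 2 ^ w" "E j < 2 ^ w" "E (Suc j) + Suc B ^ j = E j"
      using jB L1 small(1) El E_step by auto
    show "wp w L (St 31 0 38 ;; Ld 39 31 1 ;; Bin Add 38 38 39 ;; Bin Sub 31 31 5)
      (\<lambda>t R m. \<exists>n'<n. I n' (t + 1) R m) (t1 + 1) R1 m1"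
      using b by (simp add: r i(2,3) j mj) (rule goal; simp add: same_regs_def)
  next
    fix n t1 R1 m1 assume I: "I n t1 R1 m1" and nb: "bval (Eq 31 4) R1"
    have i: "R1 31 = n" "t1 + 20 * n \<le> t + 20 * B"
      "m1 = (\<lambda>u f. if n < u \<and> u \<le> B \<and> f = 0 then enc B (above (u - 1)) else m u f)"
      and s: "same_regs {31, 38, 39} R R1" using I unfolding I_def by blast+
    have "n = 0" using nb i s R by (auto simp: same_regs_def)
    then show "Q (t1 + 1) R1 m1" using i s by (intro Q) auto
  qed
qed

text \<open>This crude bound suffices for updates, whose amortised cost is only required to be
  linear in \<open>w\<close>.\<close>

lemma H_le: "H \<le> w"
proof -
  have "(2::nat) ^ (H - 1) \<le> B ^ (H - 1)" using B2 by (intro power_mono) auto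
  also have "\<dots> < 2 ^ w" by (rule BH1)
  finally show ?thesis by simp
qed

lemma wp_init:
  assumes w2: "w < (B + 1) * (B + 1)" and R: "R 4 = 0" "R 5 = 1" and m: "m = (\<lambda>_ _. 0)"
    and L: "3 * (B + 1) \<le> L"
    and Q: "\<And>t' R' m'. t' \<le> t + 200 * w \<Longrightarrow> same_regs ({6} \<union> {30..39}) R R' \<Longrightarrow> cregs R' \<Longrightarrow>
      inv (empty_g m' (B + 1)) m' None (KMr (empty_g m' (B + 1))) \<Longrightarrow> m' 0 4 = 0 \<Longrightarrow>
      \<forall>u f. 11 \<le> f \<longrightarrow> m' u f = 0 \<Longrightarrow> Q t' R' m'"
  shows "wp w L init_com Q t R m"
proof -
  have w1: "(1::nat) < 2 ^ w" using small(1) L1 by linarith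
  have w4: "(4::nat) < 2 ^ w" using small(1) L1 B2 by linarith
  have b: "0 < L" "Suc B < 2 ^ w" "Suc (Suc (B + B)) < 2 ^ w" "B < 2 ^ w"
    using L small(1) by auto
  define mp where "mp = upd (upd (upd (upd (upd m 0 0 B) 0 (Suc 0) (B ^ (H - 1))) 0 5 (Suc B)) 0 2 (Suc B)) 0 3 (Suc (Suc (B + B)))"
  define mq where "mq = (\<lambda>u f. if 0 < u \<and> u \<le> B \<and> f = 1 then Suc B ^ (u - 1) else mp u f)"
  \<comment> \<open>The program is verified from its end: each block consumes one loop and hands
    over to the block proved before it.\<close>
  have A5: "wp w L (Imm 38 0 ;; masks_loop) Q t5 R5 mq"
    if "t5 \<le> t + 100 * w + 100" "same_regs ({6} \<union> {30..39}) R R5" "R5 6 = B" "R5 31 = B" for t5 R5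
  proof -
    have r: "R5 4 = 0" "R5 5 = 1" using that(2) R by (auto simp: same_regs_def)
    have "wp w L masks_loop Q (t5 + 1) (R5(38 := 0)) mq"
    proof (rule init_masks)
      show "\<forall>j<B. mq (Suc j) 1 = Suc B ^ j" by (simp add: mq_def)
      fix t6 R6 m6
      assume 6: "t6 \<le> t5 + 1 + 20 * B + 1" "same_regs {31, 38, 39} (R5(38 := 0)) R6"
        "m6 = (\<lambda>u f. if 0 < u \<and> u \<le> B \<and> f = 0 then enc B (above (u - 1)) else mq u f)"
      have tab: "table m6" "m6 0 2 = B + 1" "m6 0 3 = 2 * (B + 1)" "m6 0 4 = 0"
        using m by (auto simp: table_def 6(3) mq_def mp_def)
      have zz: "\<forall>u f. B < u \<longrightarrow> m6 u f = 0" "\<forall>u f. 11 \<le> f \<longrightarrow> m6 u f = 0"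
        using m by (auto simp: 6(3) mq_def mp_def)
      have iv: "inv (empty_g m6 (B + 1)) m6 None (KMr (empty_g m6 (B + 1)))"
        by (rule inv_empty[OF tab(1-3)]) (use zz in auto)
      have "B + 11 \<le> 5 * w" using small(3) BB B2 mult_le_mono[OF B2 B2] by linarith
      show "Q t6 R6 m6"
      proof (rule Q[OF _ _ _ iv tab(4) zz(2)])
        show "t6 \<le> t + 200 * w" using 6(1) that(1) \<open>B + 11 \<le> 5 * w\<close> small(3) BB B2 mult_le_mono[OF B2 B2] by linarith
        show "same_regs ({6} \<union> {30..39}) R R6" using that(2) 6(2) by (auto simp: same_regs_def)
        show "cregs R6" using r that(3) 6(2) by (simp add: cregs_def same_regs_def)
      qed
    qed (use r that in simp_all)
    then show ?thesis by simp
  qed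
  have A4: "wp w L (St 4 0 6 ;; St 4 1 36 ;; Bin Add 34 6 5 ;; St 4 5 34 ;; St 4 2 34 ;; Bin Add 35 34 34 ;; St 4 3 35 ;;
     Imm 31 0 ;; Imm 38 1 ;; powers_loop ;; Imm 38 0 ;; masks_loop) Q t4 R4 m"
    if "t4 \<le> t + 80 * w + 50" "same_regs ({6} \<union> {30..39}) R R4" "R4 6 = B" "R4 36 = B ^ (H - 1)" for t4 R4
  proof -
    have r: "R4 4 = 0" "R4 5 = 1" using that(2) R by (auto simp: same_regs_def)
    let ?R = "R4(34 := Suc B, 35 := Suc (Suc (B + B)), 31 := 0, 38 := Suc 0)"
    have "wp w L powers_loop (wp w L (Imm 38 0 ;; masks_loop) Q) (29 + t4) ?R mp"
    proof (rule init_powers)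
      fix t5 R5 m5
      assume 5: "t5 \<le> 29 + t4 + 10 * B + 1" "same_regs {31, 38} ?R R5" "R5 31 = B"
        "m5 = (\<lambda>u f. if 0 < u \<and> u \<le> B \<and> f = 1 then Suc B ^ (u - 1) else mp u f)"
      have "m5 = mq" unfolding 5(4) mq_def ..
      moreover have "wp w L (Imm 38 0 ;; masks_loop) Q t5 R5 mq"
        by (rule A5) (use 5 that small(3) r in \<open>auto simp: same_regs_def\<close>)
      ultimately show "wp w L (Imm 38 0 ;; masks_loop) Q t5 R5 m5" by simp
    qed (use r that in simp_all)
    then show ?thesis using b w1 by (simp add: r that(3,4) mp_def)
  qed
  define rest4 where "rest4 = St 4 0 6 ;; St 4 1 36 ;; Bin Add 34 6 5 ;; St 4 5 34 ;; St 4 2 34 ;; Bin Add 35 34 34 ;; St 4 3 35 ;;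
     Imm 31 0 ;; Imm 38 1 ;; powers_loop ;; Imm 38 0 ;; masks_loop"
  have A3: "wp w L (Imm 36 1 ;; Bin Div 37 30 6 ;; power_loop ;; rest4) Q t3 R3 m"
    if "t3 \<le> t + 60 * w + 40" "same_regs ({6} \<union> {30..39}) R R3" "R3 6 = B" "R3 30 = 2 ^ w - 1" for t3 R3
  proof -
    let ?R = "R3(36 := Suc 0, 37 := (2 ^ w - 1) div B)"
    have "wp w L power_loop (wp w L rest4 Q) (2 + t3) ?R m"
    proof (rule init_power)
      fix t4 R4
      assume 4: "t4 \<le> 2 + t3 + 10 * H + 1" "same_regs {36} ?R R4" "R4 36 = B ^ (H - 1)"
      show "wp w L rest4 Q t4 R4 m"
        unfolding rest4_def by (rule A4) (use 4 that H_le in \<open>auto simp: same_regs_def\<close>)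
    qed (use that in simp_all)
    then show ?thesis using w1 by (simp add: that(3,4))
  qed
  define rest3 where "rest3 = Imm 36 1 ;; Bin Div 37 30 6 ;; power_loop ;; rest4"
  have A2: "wp w L (Imm 6 1 ;; Imm 34 2 ;; Imm 35 4 ;; base_loop ;; rest3) Q t2 R2 m"
    if "t2 \<le> t + 20 * w + 30" "same_regs ({6} \<union> {30..39}) R R2" "R2 32 = w" "R2 30 = 2 ^ w - 1" for t2 R2
  proof -
    let ?R = "R2(6 := Suc 0, 34 := 2, 35 := 4)"
    have r: "R2 4 = 0" "R2 5 = 1" using that(2) R by (auto simp: same_regs_def)
    have "wp w L base_loop (wp w L rest3 Q) (Suc (Suc (Suc t2))) ?R m"
    proof (rule init_base[OF w2])
      fix t3 R3
      assume 3: "t3 \<le> Suc (Suc (Suc t2)) + 10 * B + 1" "same_regs {6, 34, 35} ?R R3" "R3 6 = B"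
      show "wp w L rest3 Q t3 R3 m"
        unfolding rest3_def by (rule A3) (use 3 that small(3) in \<open>auto simp: same_regs_def\<close>)
    qed (use that r in simp_all)
    then show ?thesis using w1 w4 by simp
  qed
  define rest2 where "rest2 = Imm 6 1 ;; Imm 34 2 ;; Imm 35 4 ;; base_loop ;; rest3"
  let ?R = "R(30 := 2 ^ w - 1, 31 := 2 ^ w - 1, 32 := 0, 33 := 2)"
  have A1: "wp w L width_loop (wp w L rest2 Q) (6 + t) ?R m"
  proof (rule init_width)
    fix t2 R2
    assume 2: "t2 \<le> 6 + t + 10 * w + 1" "same_regs {31, 32} ?R R2" "R2 32 = w"
    show "wp w L rest2 Q t2 R2 m"
      unfolding rest2_def by (rule A2) (use 2 in \<open>auto simp: same_regs_def\<close>)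
  qed (use R in simp_all)
  have E: "init_com = MaxW 30 ;; Bin Add 31 30 4 ;; Imm 32 0 ;; Imm 33 2 ;; width_loop ;; rest2"
    by (simp add: init_com_def rest2_def rest3_def rest4_def)
  show ?thesis unfolding E using A1 w4 by (simp add: R)
qed

section \<open>Representation of interval sets\<close>

lemma wp_add:
  assumes inv: "inv g m None (KMr g)" and CT: "gC g = gT g" and R: "cregs R" "R 8 = k div B ^ H" "R 9 = k mod B ^ H"
    and k: "k < 2 * B ^ H" "k mod B ^ H < 2 ^ w"
    and room: "3 * (B + 1) + 2 * (Suc (ce g) - (B + 1)) \<le> L" "Suc (ce g) \<le> L"
    and Q: "\<And>t' R' m' g'. t' \<le> t + 630 * (H + B + 1) \<Longrightarrow> same_regs {7..26} R R' \<Longrightarrow>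
      inv g' m' None (KMr g') \<Longrightarrow> gC g' = gT g' \<Longrightarrow> keys g' = add_mset k (keys g) \<Longrightarrow> ce g' = Suc (ce g) \<Longrightarrow>
      \<forall>f. f \<noteq> 2 \<longrightarrow> f \<noteq> 3 \<longrightarrow> m' 0 f = m 0 f \<Longrightarrow> Q t' R' m'"
  shows "wp w L add_com Q t R m"
proof -
  define c where "c = ce g"
  define m1 where "m1 = upd (upd (upd m c 0 (k mod B ^ H)) c 2 (Suc (k div B ^ H))) 0 2 (Suc c)"
  define g1 where "g1 = g\<lparr>gT := insert c (gT g), gK := (gK g)(c := k), ce := Suc c\<rparr>"
  note nc = inv_new_cell[OF inv k c_def m1_def g1_def]
  have cb: "B + 1 \<le> c" using inv unfolding inv_def cellI_def c_def by blast
  have r: "R 4 = 0" "R 5 = 1" using R by (auto simp: cregs_def)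
  have ce: "m 0 2 = c" using inv by (simp add: inv_def memI_def c_def)
  have "k div B ^ H < 2" using k(1) by (simp add: less_mult_imp_div_less mult.commute)
  moreover have "(4::nat) < 2 ^ w" using small(1) L1 B2 by linarith
  ultimately have b: "c < L" "Suc c < 2 ^ w" "Suc (k div B ^ H) < 2 ^ w" "0 < L"
    using room(2) small(1) by (auto simp: c_def)
  let ?R = "R(20 := c, 12 := Suc c)"
  have rg: "roomy g1" using room by (simp add: roomy_def g1_def c_def)
  have "wp w L link_com Q (22 + t) ?R m1"
  proof (rule wp_link[OF nc(1-3) nc(5)[symmetric] _ _ _ _ rg])
    show "cregs ?R" "?R 20 = c" "?R 8 = k div B ^ H" "?R 9 = k mod B ^ H" using R by (auto simp: cregs_def)
  next
    fix t' R' m' g'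
    assume 1: "t' \<le> 22 + t + 600 * (H + B + 1)" "same_regs {7..26} ?R R'" "inv g' m' None (KMr g')"
      "linked g1 g' c" "\<forall>f. f \<noteq> 3 \<longrightarrow> m' 0 f = m1 0 f"
    have fin: "finite (gC g)" using inv finite_cells by (auto simp: inv_def)
    have cC: "c \<notin> gC g" using nc(3) inv cb by (auto simp: inv_def cellI_def g1_def)
    show "Q t' R' m'"
    proof (rule Q[OF _ _ 1(3)])
      show "t' \<le> t + 630 * (H + B + 1)" using 1(1) by simp
      show "same_regs {7..26} R R'" using 1(2) by (auto simp: same_regs_def)
      show "gC g' = gT g'" using 1(4) nc(4) CT by (simp add: linked_def g1_def)
      have "keys g' = image_mset (gK g1) (mset_set (insert c (gC g)))"
        using 1(4) nc(4) by (simp add: keys_def linked_def)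
      also have "\<dots> = add_mset k (keys g1)" using fin cC nc(4,5) by (simp add: keys_def)
      finally show "keys g' = add_mset k (keys g)" using nc(6) by simp
      show "ce g' = Suc (ce g)" using 1(4) by (simp add: linked_def g1_def c_def)
      show "\<forall>f. f \<noteq> 2 \<longrightarrow> f \<noteq> 3 \<longrightarrow> m' 0 f = m 0 f" using 1(5) cb by (auto simp: m1_def)
    qed
  qed
  then show ?thesis
    unfolding add_com_def wp_Seq cell_com_def using b by (simp add: r ce R(2,3) m1_def)
qed

text \<open>Keys of left endpoints are below \<open>2 ^ w \<le> B ^ H\<close>, so they have tag
  digit 0 and precede all keys of right endpoints. Multisets are needed because distinct intervals
  may share an endpoint.\<close>

definition keysOf :: "intervals \<Rightarrow> nat multiset" where
  "keysOf S = image_mset (\<lambda>(l, r). 2 ^ w - 1 - l) (mset_set S) + image_mset (\<lambda>(l, r). B ^ H + r) (mset_set S)"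

text \<open>The bound on \<open>ce\<close> is the negation of the test for rebuilding: two live
  cells per interval and at most as many dead ones. Between operations every live cell is linked,
  hence \<open>gC g = gT g\<close>.\<close>

definition represents :: "umem \<Rightarrow> intervals \<Rightarrow> bool" where
  "represents m S \<longleftrightarrow> (\<exists>g. inv g m None (KMr g) \<and> gC g = gT g \<and> keys g = keysOf S \<and> ce g \<le> B + 1 + 4 * card S) \<and>
     finite S \<and> m 0 4 = card S"

text \<open>The number of dead cells pays for rebuilding.\<close>

definition pot :: "umem \<Rightarrow> nat" where
  "pot m = m 0 2 - (B + 1) - 2 * m 0 4"

lemma rest_room:
  assumes "inv g m None (KMr g)" "gC g = gT g" "keys g = keysOf S"
  shows "card (gC g) = 2 * card S" "B + 1 + 2 * card S \<le> ce g" "m 0 2 = ce g"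
proof -
  have "card (gC g) = size (keys g)" by (simp add: keys_def)
  then show 1: "card (gC g) = 2 * card S" using assms(3) by (simp add: keysOf_def)
  have "gC g \<subseteq> {B+1..<ce g}" "B + 1 \<le> ce g" using assms(1) unfolding inv_def cellI_def by blast+
  moreover then have "card (gC g) \<le> ce g - (B + 1)" using card_mono[of "{B+1..<ce g}" "gC g"] by simp
  ultimately show "B + 1 + 2 * card S \<le> ce g" using 1 by linarith
  show "m 0 2 = ce g" using assms(1) by (simp add: inv_def memI_def)
qed

lemma word_key: "x < 2 ^ w \<Longrightarrow> x div B ^ H = 0 \<and> x mod B ^ H = x \<and> x < 2 * B ^ H \<and>
    (B ^ H + x) div B ^ H = 1 \<and> (B ^ H + x) mod B ^ H = x \<and> B ^ H + x < 2 * B ^ H"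
  using BH B_pos by (auto simp: div_add_self1)


text \<open>Hands the invariance of the fields from 11 on to the continuation, where rebuilding
  needs it.\<close>

lemma wp_clean:
  assumes "wp w L c (\<lambda>t R m'. (\<forall>u f. 11 \<le> f \<longrightarrow> m' u f = m u f) \<longrightarrow> Q t R m') t R m" "low_stores c"
  shows "wp w L c Q t R m"
  by (rule wp_mono[OF wp_low_stores[OF assms]]) blast

lemma keysOf_insert:
  assumes "finite S" "(l, r) \<notin> S"
  shows "keysOf (insert (l, r) S) = add_mset (2 ^ w - 1 - l) (add_mset (B ^ H + r) (keysOf S))"
  using assms by (simp add: keysOf_def)

lemma inv_set_n:
  assumes "inv g m None (KMr g)"
  shows "inv g (upd m 0 4 v) None (KMr g)"
proof -
  define m' where "m' = upd m 0 4 v"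
  have "memI g m'" using assms unfolding inv_def memI_def table_def by (auto simp: m'_def)
  moreover have "nodeI g m'"
    using assms nodeI_cong[of g m m'] nodeD(3)[of g m H 0] unfolding inv_def
    by (auto simp: m'_def nodeI_def)
  moreover have I3: "listI g m None" "cellI g m" "countI g m (KMr g)" "nodeI g m" using assms by (auto simp: inv_def)
  have "listI g m' None"
    unfolding listI_def
  proof (intro conjI allI impI)
    fix h P assume n: "nd g h (P div B) \<noteq> 0"
    have "lst m' (su g h P) (ls g h P) = lst m (su g h P) (ls g h P)"
      using su_range(1)[OF I3(4) n] by (intro lst_cong) (auto simp: m'_def)
    then show "lst m' (su g h P) (ls g h P)" using listD(1)[OF I3(1) n] by simp
    show "set (ls g h P) = {c \<in> gC g. gh g c = h \<and> gK g c div B ^ h = P}"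
      "distinct (ls g h P)" "sorted_wrt (\<lambda>a b. gK g b \<le> gK g a) (ls g h P)"
      using listD(2-4)[OF I3(1) n] by blast+
  next
    fix h P assume "0 < h" "nd g h (P div B) \<noteq> 0"
    then show "length (ls g h P) \<le> B + (if None = Some (h, P) then 1 else 0)"
      by (rule listI_length[OF I3(1)])
  qed (use I3(1) in \<open>unfold listI_def, blast+\<close>)
  moreover have "cellI g m'" by (rule cellI_cong[OF I3(2)]) (simp add: m'_def)
  moreover have "countI g m' (KMr g)" by (rule countI_cong[OF I3(3)]) (simp_all add: m'_def)
  ultimately have "inv g m' None (KMr g)" by (simp add: inv_def)
  then show ?thesis by (simp add: m'_def)
qed

section \<open>Correctness and cost of insertion, query and deletion\<close>

lemma wp_insert_rest:
  assumes rep: "represents m S" and new: "(l, r) \<notin> S" "l < 2 ^ w" "r < 2 ^ w"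
    and R: "cregs R" "R 0 = l" "R 1 = r"
    and room: "3 * (B + 1) + 8 * card S + 4 \<le> L"
    and Q: "\<And>t' R' m'. t' \<le> t + 1300 * (H + B + 1) \<Longrightarrow> represents m' (insert (l, r) S) \<Longrightarrow> pot m' = pot m \<Longrightarrow> Q t' R' m'"
  shows "wp w L (MaxW 30 ;; Bin Sub 9 30 0 ;; Imm 8 0 ;; add_com ;; Bin Add 9 1 4 ;; Imm 8 1 ;; add_com ;;
    Ld 30 4 4 ;; Bin Add 30 30 5 ;; St 4 4 30) Q t R m"
proof -
  obtain g where g: "inv g m None (KMr g)" "gC g = gT g" "keys g = keysOf S" "ce g \<le> B + 1 + 4 * card S"
    and S: "finite S" "m 0 4 = card S" using rep unfolding represents_def by blast
  note rr = rest_room[OF g(1-3)]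
  have w1: "(1::nat) < 2 ^ w" using small(1) L1 by linarith
  let ?k1 = "2 ^ w - 1 - l" and ?k2 = "B ^ H + r"
  have k1: "?k1 < 2 ^ w" by (simp add: less_imp_diff_less)
  note K1 = word_key[OF k1] and K2 = word_key[OF new(3)]
  have lr: "l \<le> 2 ^ w - 1" using new(2) by linarith
  let ?tail = "Ld 30 4 4 ;; Bin Add 30 30 5 ;; St 4 4 30"
  have T2: "wp w L (Bin Add 9 1 4 ;; Imm 8 1 ;; add_com ;; ?tail) Q t2 R2 m2"
    if "t2 \<le> t + 5 + 630 * (H + B + 1)" "same_regs {7..26} (R(30 := 2 ^ w - 1, 9 := ?k1, 8 := 0)) R2"
      and g2: "inv g2 m2 None (KMr g2)" "gC g2 = gT g2" "keys g2 = add_mset ?k1 (keys g)" "ce g2 = Suc (ce g)"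
      and m2: "\<forall>f. f \<noteq> 2 \<longrightarrow> f \<noteq> 3 \<longrightarrow> m2 0 f = m 0 f" for t2 R2 m2 g2
  proof -
    have r: "R2 4 = 0" "R2 5 = 1" "R2 (Suc 0) = r" "cregs R2" using that(2) R by (auto simp: same_regs_def cregs_def)
    let ?R = "R2(9 := r, 8 := Suc 0)"
    have "wp w L add_com (wp w L ?tail Q) (Suc (Suc t2)) ?R m2"
    proof (rule wp_add[where k = ?k2, OF g2(1,2)])
      show "cregs ?R" "?R 8 = ?k2 div B ^ H" "?R 9 = ?k2 mod B ^ H" "?k2 < 2 * B ^ H" "?k2 mod B ^ H < 2 ^ w"
        using r K2 new(3) by (auto simp: cregs_def)
      show "3 * (B + 1) + 2 * (Suc (ce g2) - (B + 1)) \<le> L" "Suc (ce g2) \<le> L" using room g(4) g2(4) by simp_all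
    next
      fix t3 R3 m3 g3
      assume 3: "t3 \<le> Suc (Suc t2) + 630 * (H + B + 1)" "same_regs {7..26} ?R R3" "inv g3 m3 None (KMr g3)"
        "gC g3 = gT g3" "keys g3 = add_mset ?k2 (keys g2)" "ce g3 = Suc (ce g2)"
        "\<forall>f. f \<noteq> 2 \<longrightarrow> f \<noteq> 3 \<longrightarrow> m3 0 f = m2 0 f"
      have r3: "R3 4 = 0" "R3 5 = 1" using 3(2) r by (auto simp: same_regs_def)
      have m34: "m3 0 4 = card S" using 3(7) m2 S(2) by simp
      define m4 where "m4 = upd m3 0 4 (Suc (card S))"
      have inv4: "inv g3 m4 None (KMr g3)" unfolding m4_def by (rule inv_set_n[OF 3(3)])
      have keys4: "keys g3 = keysOf (insert (l, r) S)"
        using 3(5) g2(3) g(3) keysOf_insert[OF S(1) new(1)] by (simp add: add_mset_commute)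
      have card: "card (insert (l, r) S) = Suc (card S)" using S(1) new(1) by simp
      have rep4: "represents m4 (insert (l, r) S)"
        unfolding represents_def using inv4 3(4,6) keys4 g(4) g2(4) S(1) card
        by (auto simp: m4_def intro!: exI[of _ g3])
      have "m3 0 2 = ce g3" using 3(3) by (simp add: inv_def memI_def)
      \<comment> \<open>The cells in use and twice the number of intervals both grow by 2.\<close>
      then have pot4: "pot m4 = pot m"
        using 3(6) g2(4) rr(2,3) S(2) by (simp add: pot_def m4_def)
      have fin: "Q t' R' mm" if "mm = m4" "t' \<le> t3 + 20" for t' R' mm
        unfolding that(1) by (rule Q[OF _ rep4 pot4]) (use that(2) 3(1) \<open>t2 \<le> _\<close> in simp)
      have b: "0 < L" "Suc (card S) < 2 ^ w" using room small(1) by auto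
      show "wp w L ?tail Q t3 R3 m3"
        using b by (simp add: r3 m34) (rule fin; simp add: m4_def)
    qed
    then show ?thesis using w1 new(3) by (simp add: r)
  qed
  let ?R = "R(30 := 2 ^ w - 1, 9 := ?k1, 8 := 0)"
  have "wp w L add_com (wp w L (Bin Add 9 1 4 ;; Imm 8 1 ;; add_com ;; ?tail) Q) (5 + t) ?R m"
  proof (rule wp_add[where k = ?k1, OF g(1,2)])
    show "cregs ?R" "?R 8 = ?k1 div B ^ H" "?R 9 = ?k1 mod B ^ H" "?k1 < 2 * B ^ H" "?k1 mod B ^ H < 2 ^ w"
      using R K1 k1 by (auto simp: cregs_def)
    show "3 * (B + 1) + 2 * (Suc (ce g) - (B + 1)) \<le> L" "Suc (ce g) \<le> L" using room g(4) by simp_all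
  next
    fix t2 R2 m2 g2
    assume 2: "t2 \<le> 5 + t + 630 * (H + B + 1)" "same_regs {7..26} ?R R2" "inv g2 m2 None (KMr g2)"
      "gC g2 = gT g2" "keys g2 = add_mset ?k1 (keys g)" "ce g2 = Suc (ce g)"
      "\<forall>f. f \<noteq> 2 \<longrightarrow> f \<noteq> 3 \<longrightarrow> m2 0 f = m 0 f"
    show "wp w L (Bin Add 9 1 4 ;; Imm 8 1 ;; add_com ;; ?tail) Q t2 R2 m2"
      by (rule T2[OF _ 2(2-7)]) (use 2(1) in simp)
  qed
  then show ?thesis using lr by (simp add: R(2))
qed

text \<open>The bound is in terms of \<open>w\<close> rather than \<open>H + B\<close>, because the
  first insertion also pays for the initialisation.\<close>

lemma wp_insert:
  assumes rep: "represents m S \<or> S = {} \<and> m = (\<lambda>_ _. 0)"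
    and new: "(l, r) \<notin> S" "l < 2 ^ w" "r < 2 ^ w" and w2: "w < (B + 1) * (B + 1)"
    and R: "R 0 = l" "R 1 = r" and room: "3 * (B + 1) + 8 * card S + 4 \<le> L"
    and Q: "\<And>t' R' m'. t' \<le> t + 5000 * w \<Longrightarrow> represents m' (insert (l, r) S) \<Longrightarrow> pot m' \<le> pot m \<Longrightarrow> Q t' R' m'"
  shows "wp w L insert_com Q t R m"
proof -
  have X: "H + B + 1 \<le> 3 * w" "10 \<le> 100 * w" using H_le small(3) B2 by auto
  have w1: "(1::nat) < 2 ^ w" using small(1) L1 by linarith
  let ?rest = "MaxW 30 ;; Bin Sub 9 30 0 ;; Imm 8 0 ;; add_com ;; Bin Add 9 1 4 ;; Imm 8 1 ;; add_com ;;
    Ld 30 4 4 ;; Bin Add 30 30 5 ;; St 4 4 30"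
  have rest: "wp w L ?rest Q t1 R1 m1"
    if "t1 \<le> t + 300 * w" "represents m1 S" "pot m1 \<le> pot m" "cregs R1" "R1 0 = l" "R1 1 = r" for t1 R1 m1
  proof (rule wp_insert_rest[OF that(2) new that(4-6) room])
    fix t' R' m'
    assume "t' \<le> t1 + 1300 * (H + B + 1)" "represents m' (insert (l, r) S)" "pot m' = pot m1"
    then show "Q t' R' m'" using that X by (intro Q) auto
  qed
  define rest where "rest = ?rest"
  let ?R = "R(4 := 0, 5 := Suc 0, 6 := m 0 0)"
  have "wp w L (If (Eq 6 4) init_com Skip) (wp w L rest Q) (7 + t) ?R m"
  proof (cases "represents m S")
    case True
    then have m0: "m 0 0 = B" unfolding represents_def inv_def memI_def table_def by blast
    have "wp w L rest Q (7 + t + 1 + 1) ?R m"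
      unfolding rest_def by (rule rest) (use True m0 R X in \<open>auto simp: cregs_def\<close>)
    then show ?thesis using m0 B2 by simp
  next
    case False
    then have z: "S = {}" "m = (\<lambda>_ _. 0)" using rep by auto
    have "wp w L init_com (wp w L rest Q) (7 + t + 1) ?R m"
    proof (rule wp_init[OF w2 _ _ z(2)])
      show "3 * (B + 1) \<le> L" using room by simp
      fix t1 R1 m1
      assume 1: "t1 \<le> 7 + t + 1 + 200 * w" "same_regs ({6} \<union> {30..39}) ?R R1" "cregs R1"
        "inv (empty_g m1 (B + 1)) m1 None (KMr (empty_g m1 (B + 1)))" "m1 0 4 = 0"
      have "represents m1 S"
        unfolding represents_def z(1) using 1(4,5)
        by (auto simp: empty_g_def keys_def keysOf_def intro!: exI[of _ "empty_g m1 (B + 1)"])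
      moreover have "m1 0 2 = B + 1" using 1(4) by (simp add: inv_def memI_def empty_g_def)
      then have "pot m1 \<le> pot m" by (simp add: pot_def)
      ultimately show "wp w L rest Q t1 R1 m1"
        unfolding rest_def by (intro rest) (use 1 R X in \<open>auto simp: same_regs_def\<close>)
    qed simp_all
    then show ?thesis using z(2) by simp
  qed
  moreover have E: "insert_com = pro_com ;; If (Eq 6 4) init_com Skip ;; rest"
    by (simp add: insert_com_def rest_def)
  ultimately show ?thesis
    unfolding E pro_com_def using L1 w1 by (simp del: wp_If)
qed

lemma wp_query:
  assumes rep: "represents m S" and SS: "\<forall>(l, r)\<in>S. l \<le> r \<and> l < 2 ^ w \<and> r < 2 ^ w" and q: "q < 2 ^ w"
    and R: "R 0 = q" and room: "3 * (B + 1) + 8 * card S + 4 \<le> L"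
    and Q: "\<And>t' R' m'. t' \<le> t + 500 * (H + B + 1) \<Longrightarrow> R' 0 = stabbing_sum S q \<Longrightarrow> m' = m \<Longrightarrow> Q t' R' m'"
  shows "wp w L query_com Q t R m"
proof -
  obtain g where g: "inv g m None (KMr g)" "gC g = gT g" "keys g = keysOf S" "ce g \<le> B + 1 + 4 * card S"
    and S: "finite S" "m 0 4 = card S" using rep unfolding represents_def by blast
  have rg: "roomy g" using room g(4) by (simp add: roomy_def)
  have I: "nodeI g m" "cellI g m" using g(1) by (auto simp: inv_def)
  note rm = roomyD[OF rg I]
  have m0: "m 0 0 = B" using g(1) by (simp add: inv_def memI_def table_def)
  have w1: "(1::nat) < 2 ^ w" using small(1) L1 by linarith
  let ?k1 = "2 ^ w - 1 - q" and ?k2 = "B ^ H + q"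
  have k1: "?k1 < 2 ^ w" by (simp add: less_imp_diff_less)
  note K1 = word_key[OF k1] and K2 = word_key[OF q]
  have qr: "q \<le> 2 ^ w - 1" using q by linarith
  have cnt: "size {#v \<in># keysOf S. v < x#} =
      card {p \<in> S. 2 ^ w - 1 - fst p < x} + card {p \<in> S. B ^ H + snd p < x}" for x
    using S(1) by (simp add: keysOf_def size_filter_image case_prod_beta)
  have SSp: "fst p \<le> snd p" "fst p < 2 ^ w" "snd p < 2 ^ w" if "p \<in> S" for p using SS that by auto
  have e1: "{p \<in> S. 2 ^ w - 1 - fst p < ?k1} = {p \<in> S. q < fst p}"
  proof -
    have "2 ^ w - 1 - fst p < ?k1 \<longleftrightarrow> q < fst p" if "p \<in> S" for p using SSp(2)[OF that] q by linarith
    then show ?thesis by blast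
  qed
  \<comment> \<open>Keys of right endpoints are at least \<open>B ^ H\<close>, hence above every key
    with tag digit 0.\<close>
  have e2: "{p \<in> S. B ^ H + snd p < ?k1} = {}"
  proof -
    have "\<not> B ^ H + x < ?k1" for x using k1 BH by linarith
    then show ?thesis by blast
  qed
  have e3: "{p \<in> S. 2 ^ w - 1 - fst p < ?k2} = S"
  proof -
    have "2 ^ w - 1 - x < ?k2" for x :: nat
    proof -
      have "2 ^ w - 1 - x < 2 ^ w" by (simp add: less_imp_diff_less)
      then show ?thesis using BH by linarith
    qed
    then show ?thesis by blast
  qed
  have e4: "{p \<in> S. B ^ H + snd p < ?k2} = {p \<in> S. snd p < q}" by auto
  have r1: "size {#v \<in># keysOf S. v < ?k1#} = card {p \<in> S. q < fst p}" unfolding cnt e1 e2 by simp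
  have r2: "size {#v \<in># keysOf S. v < ?k2#} = card S + card {p \<in> S. snd p < q}" unfolding cnt e3 e4 by simp
  \<comment> \<open>An interval that misses \<open>q\<close> begins after \<open>q\<close> or ends
    before it, and not both, because \<open>l \<le> r\<close>.\<close>
  have st: "card {p \<in> S. q < fst p} + card {p \<in> S. snd p < q} + stabbing_sum S q = card S"
  proof -
    have e: "{(l, r) \<in> S. l \<le> q \<and> q \<le> r} = {p \<in> S. fst p \<le> q \<and> q \<le> snd p}" by auto
    have "card S = card ({p \<in> S. q < fst p} \<union> {p \<in> S. snd p < q} \<union> {p \<in> S. fst p \<le> q \<and> q \<le> snd p})"
      by (rule arg_cong[of _ _ card]) auto
    also have "\<dots> = card {p \<in> S. q < fst p} + card {p \<in> S. snd p < q} + card {p \<in> S. fst p \<le> q \<and> q \<le> snd p}"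
      using S(1) SSp(1) by (subst card_Un_disjoint, simp, simp, fastforce)+ simp
    finally show ?thesis unfolding stabbing_sum_def e by simp
  qed
  have nL: "card S < L" "card S + card S < 2 ^ w" using room small(1) by auto
  let ?tail = "Ld 30 4 4 ;; Bin Add 30 30 30 ;; Bin Sub 0 30 26"
  have T2: "wp w L (Bin Add 9 0 4 ;; Imm 8 1 ;; rank_com ;; ?tail) Q t2 R2 m"
    if "t2 \<le> t + 20 + 200 * (H + B + 1)" "R2 0 = q" "cregs R2" "R2 26 = card {p \<in> S. q < fst p}" for t2 R2
  proof -
    have r: "R2 4 = 0" "R2 5 = 1" using that(3) by (auto simp: cregs_def)
    let ?R = "R2(9 := q, 8 := Suc 0)"
    have c: "card {p \<in> S. q < fst p} \<le> card S" using S(1) by (intro card_mono) auto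
    have "wp w L rank_com (wp w L ?tail Q) (Suc (Suc t2)) ?R m"
    proof (rule wp_rank[where k = ?k2, OF g(1)])
      show "cregs ?R" "?R 8 = ?k2 div B ^ H" "?R 9 = ?k2 mod B ^ H" "?k2 < 2 * B ^ H"
        using that K2 by (auto simp: cregs_def)
      show "?R 26 + 2 * L < 2 ^ w" using that(4) c nL L1 L2 by simp
      fix t3 R3
      assume 3: "t3 \<le> Suc (Suc t2) + 200 * (H + B + 1)" "same_regs {7..26} ?R R3"
        "R3 26 = ?R 26 + size {#v \<in># keys g. v < ?k2#}"
      have acc: "R3 26 = card {p \<in> S. q < fst p} + card S + card {p \<in> S. snd p < q}"
        using 3(3) that(4) r2 g(3) by simp
      have r3: "R3 4 = 0" using 3(2) r by (simp add: same_regs_def)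
      have fin: "Q t' R' m" if "t' \<le> t3 + 20" "R' 0 = card S + card S - R3 26" for t' R'
        by (rule Q) (use that 3(1) \<open>t2 \<le> _\<close> acc st in auto)
      have "0 < L" "R3 26 \<le> card S + card S" using L1 acc st by auto
      then show "wp w L ?tail Q t3 R3 m"
        using nL by (simp add: r3 S(2)) (rule fin; simp)
    qed (use rm in auto)
    then show ?thesis using w1 q that(2) by (simp add: r)
  qed
  let ?R = "R(4 := 0, 5 := Suc 0, 6 := B, 30 := 2 ^ w - 1, 9 := ?k1, 8 := 0, 26 := 0)"
  have "wp w L rank_com (wp w L (Bin Add 9 0 4 ;; Imm 8 1 ;; rank_com ;; ?tail) Q) (13 + t) ?R m"
  proof (rule wp_rank[where k = ?k1, OF g(1)])
    show "cregs ?R" "?R 8 = ?k1 div B ^ H" "?R 9 = ?k1 mod B ^ H" "?k1 < 2 * B ^ H"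
      using K1 by (auto simp: cregs_def)
    show "?R 26 + 2 * L < 2 ^ w" using L1 L2 by simp
    fix t2 R2
    assume 2: "t2 \<le> 13 + t + 200 * (H + B + 1)" "same_regs {7..26} ?R R2"
      "R2 26 = ?R 26 + size {#v \<in># keys g. v < ?k1#}"
    show "wp w L (Bin Add 9 0 4 ;; Imm 8 1 ;; rank_com ;; ?tail) Q t2 R2 m"
      by (rule T2) (use 2 R r1 g(3) in \<open>auto simp: same_regs_def cregs_def\<close>)
  qed (use rm in auto)
  then show ?thesis
    unfolding query_com_def pro_com_def using w1 L1 qr m0 by (simp add: R)
qed

lemma keys_unlinked:
  assumes "unlinked g g' y" "y \<in> gC g" "finite (gC g)"
  shows "keys g = add_mset (gK g y) (keys g')"
  using assms by (simp add: keys_def unlinked_def mset_set.remove)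

text \<open>An amortised bound: each dead cell carries \<open>4000 * (H + B + 1)\<close> units. A
  deletion without rebuilding adds two dead cells; one with rebuilding resets the potential to 0,
  which pays for the linear work.\<close>

lemma wp_delete:
  assumes rep: "represents m S" and mem: "(l, r) \<in> S" "l < 2 ^ w" "r < 2 ^ w"
    and cl: "\<forall>u f. 11 \<le> f \<longrightarrow> m u f = 0" and R: "R 0 = l" "R 1 = r"
    and room: "3 * (B + 1) + 8 * card S + 4 \<le> L" and big: "B + 2 \<le> card S"
    and Q: "\<And>t' R' m'. t' + 4000 * (H + B + 1) * pot m' \<le> t + 4000 * (H + B + 1) * pot m + 20000 * (H + B + 1) \<Longrightarrow>
      represents m' (S - {(l, r)}) \<Longrightarrow> Q t' R' m'"
  shows "wp w L delete_com Q t R m"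
proof -
  obtain g where g: "inv g m None (KMr g)" "gC g = gT g" "keys g = keysOf S" "ce g \<le> B + 1 + 4 * card S"
    and S: "finite S" "m 0 4 = card S" using rep unfolding represents_def by blast
  note rr = rest_room[OF g(1-3)]
  define X where "X = H + B + 1"
  have X4: "4 \<le> X" using H1 B2 by (simp add: X_def)
  have w1: "(1::nat) < 2 ^ w" using small(1) L1 by linarith
  let ?S = "S - {(l, r)}" and ?k1 = "2 ^ w - 1 - l" and ?k2 = "B ^ H + r"
  define n where "n = card ?S"
  have n: "card S = Suc n" using card_Suc_Diff1[OF S(1) mem(1)] by (simp add: n_def)
  have n': "card S - Suc 0 = n" using n by simp
  have KS: "keysOf S = add_mset ?k1 (add_mset ?k2 (keysOf ?S))"
    using keysOf_insert[of ?S l r] S(1) mem(1) by (simp add: insert_absorb)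
  have k1: "?k1 < 2 ^ w" by (simp add: less_imp_diff_less)
  note K1 = word_key[OF k1] and K2 = word_key[OF mem(3)]
  have lr: "l \<le> 2 ^ w - 1" using mem(2) by linarith
  have rg: "roomy g" using room g(4) by (simp add: roomy_def)
  have tab: "m 0 5 = B + 1" "m 0 0 = B" using g(1) by (simp_all add: inv_def memI_def table_def)
  have ex: "\<exists>c\<in>gC h. gK h c = k" if "k \<in># keys h" "inv h mm None (KMr h)" for h mm k
    using that finite_cells[of h mm] by (auto simp: keys_def inv_def)
  have fin: "finite (gC h)" if "inv h mm None (KMr h)" for h mm
    using that finite_cells[of h mm] by (auto simp: inv_def)
  define tail where "tail = Ld 30 4 4 ;; Bin Sub 30 30 5 ;; St 4 4 30 ;;
     Bin Add 31 30 30 ;; Bin Add 31 31 31 ;; Ld 32 4 2 ;; Ld 33 4 5 ;; Bin Sub 32 32 33 ;; If (Lt 31 32) rebuild_com Skip"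
  have T3: "wp w L tail Q t3 R3 m3"
    if t3: "t3 \<le> t + 20 + 1200 * X" and R3: "cregs R3" and g3: "inv g3 m3 None (KMr g3)" "gC g3 = gT g3"
      "keys g3 = keysOf ?S" "ce g3 = ce g" and m3: "m3 0 = m 0" "\<forall>u f. 11 \<le> f \<longrightarrow> m3 u f = 0" for t3 R3 m3 g3
  proof -
    have r3: "R3 4 = 0" "R3 5 = 1" using R3 by (auto simp: cregs_def)
    define m4 where "m4 = upd m3 0 4 n"
    have inv4: "inv g3 m4 None (KMr g3)" unfolding m4_def by (rule inv_set_n[OF g3(1)])
    have rg3: "roomy g3" using rg g3(4) by (simp add: roomy_def)
    \<comment> \<open>\<open>N\<close> cells are in use, of which \<open>2 * n\<close> remain live
      after the deletion.\<close>
    define N where "N = ce g - (B + 1)"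
    have N: "ce g = N + B + 1" "2 * n + 2 \<le> N" "pot m = N - 2 * n - 2"
      using rr n S(2) by (simp_all add: N_def pot_def)
    have m4: "m4 0 4 = n" "m4 0 2 = ce g" using m3(1) rr(3) by (simp_all add: m4_def)
    have cl4: "\<forall>u f. 11 \<le> f \<longrightarrow> m4 u f = 0" using m3(2) by (simp add: m4_def)
    let ?R = "R3(30 := n, 31 := n + n + (n + n), 32 := N, 33 := Suc B)"
    have A: "wp w L (If (Lt 31 32) rebuild_com Skip) Q t4 ?R m4" if t4: "t4 \<le> t3 + 30" for t4
    proof (cases "4 * n < N")
      case False
      have c: "ce g3 \<le> B + 1 + 4 * card ?S" using False N g3(4) by (simp add: n_def)
      have rep4: "represents m4 ?S"
        unfolding represents_def using inv4 g3(2,3) c S(1) m4 by (auto simp: n_def)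
      have "pot m4 = pot m + 2" using N m4 by (simp add: pot_def)
      then have "4000 * X * pot m4 = 4000 * X * pot m + 8000 * X" by (simp add: algebra_simps)
      then have "Q (t4 + 2) ?R m4"
        by (intro Q[OF _ rep4]) (use t4 t3 X4 in \<open>unfold X_def[symmetric], linarith\<close>)
      then show ?thesis using False by simp
    next
      case True
      have "wp w L rebuild_com Q (Suc t4) ?R m4"
      proof (rule wp_rebuild[OF inv4 g3(2) _ rg3 cl4])
        show "cregs ?R" using R3 by (auto simp: cregs_def)
        fix t5 R5 m5 g5
        assume 5: "t5 \<le> Suc t4 + 100 + 60 * ne g3 + 700 * (H + B + 1) * ce g3" "inv g5 m5 None (KMr g5)"
          "gC g5 = gT g5" "keys g5 = keys g3" "ce g5 = B + 1 + card (gC g3)"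
          "\<forall>f. f \<noteq> 2 \<longrightarrow> f \<noteq> 3 \<longrightarrow> m5 0 f = m4 0 f"
        have c3: "card (gC g3) = 2 * n" using rest_room(1)[OF g3(1-3)] by (simp add: n_def)
        have rep5: "represents m5 ?S"
          unfolding represents_def using 5 g3(3) c3 S(1) m4(1) by (auto simp: n_def intro!: exI[of _ g5])
        have "m5 0 2 = ce g5" using 5(2) by (simp add: inv_def memI_def)
        then have p0: "pot m5 = 0" using 5(5,6) m4(1) c3 by (simp add: pot_def)
        have "nodeI g3 m4" "cellI g3 m4" using inv4 by (auto simp: inv_def)
        then have "ne g3 \<le> 2 * (B + 1) + 2 * N" using nodes_bound[of g3 m4] N(1) g3(4) by simp
        \<comment> \<open>From \<open>4 * n < N\<close> and \<open>pot m = N - 2 * n - 2\<close>.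
          The assumption \<open>big\<close> keeps the reserved units proportional to the cells, so
          that \<open>ne\<close> and \<open>ce\<close> become linear in the potential.\<close>
        moreover have "N \<le> 2 * pot m + 3" "4 * (B + 1) \<le> N" using N True big n by simp_all
        ultimately have ne: "ne g3 \<le> 6 * pot m + 9" and ce: "ce g3 \<le> 4 * pot m + 6" using N(1) g3(4) by simp_all
        \<comment> \<open>Relinking takes 2800 of the weight 4000; clearing the node fields fits
          into the rest because \<open>4 \<le> X\<close>.\<close>
        have "700 * X * ce g3 \<le> 700 * X * (4 * pot m + 6)" using ce by (intro mult_left_mono) auto
        moreover have "700 * X * (4 * pot m + 6) = 2800 * (X * pot m) + 4200 * X" by (simp add: algebra_simps)
        moreover have "4 * pot m \<le> X * pot m" using X4 by simp
        ultimately have "t5 \<le> t + 4000 * (X * pot m) + 20000 * X"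
          using 5(1)[folded X_def] t4 t3 ne X4 by linarith
        then have le: "t5 + 4000 * X * pot m5 \<le> t + 4000 * X * pot m + 20000 * X"
          by (simp add: p0 mult.assoc)
        show "Q t5 R5 m5" by (rule Q[OF le[unfolded X_def] rep5])
      qed
      then show ?thesis using True by simp
    qed
    have b: "0 < L" "n < 2 ^ w" "n + n < 2 ^ w" "n + n + (n + n) < 2 ^ w" "Suc B \<le> ce g" "ce g - Suc B = N"
      "Suc n < 2 ^ w" "ce g < 2 ^ w"
      using room n small(1) N(1) g(4) by auto
    have A': "wp w L (If (Lt 31 32) rebuild_com Skip) Q t4 R4 mm" if "t4 \<le> t3 + 30" "R4 = ?R" "mm = m4" for t4 R4 mm
      using A[OF that(1)] that(2,3) by simp
    show ?thesis
      unfolding tail_def using b S(2) rr(3) tab(1)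
      by (simp add: r3 m3(1) n n' del: wp_If) (rule A'; simp add: m4_def fun_eq_iff)
  qed
  have T2: "wp w L (Bin Add 9 1 4 ;; Imm 8 1 ;; unlink_com ;; tail) Q t2 R2 m2"
    if t2: "t2 \<le> t + 12 + 600 * X" "same_regs {7..26} (R(4 := 0, 5 := Suc 0, 6 := B, 30 := 2 ^ w - 1, 9 := ?k1, 8 := 0)) R2"
      and g2: "inv g2 m2 None (KMr g2)" "gC g2 = gT g2" "keys g = add_mset ?k1 (keys g2)" "ce g2 = ce g"
      and m2: "m2 0 = m 0" "\<forall>u f. 11 \<le> f \<longrightarrow> m2 u f = 0" for t2 R2 m2 g2
  proof -
    have r: "R2 4 = 0" "R2 5 = 1" "R2 (Suc 0) = r" "cregs R2" using that(2) R by (auto simp: same_regs_def cregs_def)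
    have k2: "keys g2 = add_mset ?k2 (keysOf ?S)" using g2(3) g(3) KS by simp
    let ?R = "R2(9 := r, 8 := Suc 0)"
    have "wp w L unlink_com (wp w L tail Q) (Suc (Suc t2)) ?R m2"
    proof (rule wp_clean[OF _ com_ok(7)], rule wp_unlink[where k = ?k2, OF g2(1)], goal_cases)
      case 1 show ?case by (rule ex[OF _ g2(1)]) (simp add: k2)
      case 2 show ?case using r by (auto simp: cregs_def)
      case 3 show ?case using K2 by simp
      case 4 show ?case using K2 by simp
      case 5 show ?case using rg g2(4) by (simp add: roomy_def)
      case (6 t3 R3 m3 g3 y)
      have kk: "keys g3 = keysOf ?S" using keys_unlinked[OF 6(6,4) fin[OF g2(1)]] k2 6(5) by simp
      show ?case
      proof
        assume "\<forall>u f. 11 \<le> f \<longrightarrow> m3 u f = m2 u f"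
        then show "wp w L tail Q t3 R3 m3"
          using 6(1,2,6,7) t2(1) m2 g2(2,4) r(4)
          by (intro T3[OF _ _ 6(3) _ kk]) (auto simp: X_def unlinked_def cregs_def same_regs_def)
      qed
    qed
    then show ?thesis using w1 mem(3) by (simp add: r)
  qed
  let ?R = "R(4 := 0, 5 := Suc 0, 6 := B, 30 := 2 ^ w - 1, 9 := ?k1, 8 := 0)"
  define rest where "rest = Bin Add 9 1 4 ;; Imm 8 1 ;; unlink_com ;; tail"
  have T1: "wp w L unlink_com (wp w L rest Q) (12 + t) ?R m"
  proof (rule wp_clean[OF _ com_ok(7)], rule wp_unlink[where k = ?k1, OF g(1)], goal_cases)
    case 1 show ?case by (rule ex[OF _ g(1)]) (simp add: g(3) KS)
    case 2 show ?case by (auto simp: cregs_def)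
    case 3 show ?case using K1 by simp
    case 4 show ?case using K1 by simp
    case 5 show ?case by (rule rg)
    case (6 t2 R2 m2 g2 y)
    have kk: "keys g = add_mset ?k1 (keys g2)" using keys_unlinked[OF 6(6,4) fin[OF g(1)]] 6(5) by simp
    show ?case
    proof
      assume c: "\<forall>u f. 11 \<le> f \<longrightarrow> m2 u f = m u f"
      show "wp w L rest Q t2 R2 m2"
        unfolding rest_def
        by (rule T2[OF _ 6(2,3) _ kk _ 6(7)]) (use 6 c cl g(2) in \<open>auto simp: X_def unlinked_def\<close>)
    qed
  qed
  have E: "delete_com = pro_com ;; MaxW 30 ;; Bin Sub 9 30 0 ;; Imm 8 0 ;; unlink_com ;; rest"
    by (simp add: delete_com_def rest_def tail_def)
  show ?thesis unfolding E pro_com_def using T1 w1 lr L1 by (simp add: R(1) tab(2))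
qed

end

section \<open>Histories\<close>

text \<open>The commands do not mention the parameters of the locale: one fixed program serves every
  word length.\<close>

definition stabbing_structure :: data_structure where
  "stabbing_structure = \<lparr>insert_prog = comp 0 trie.insert_com, delete_prog = comp 0 trie.delete_com,
     query_prog = comp 0 trie.query_com\<rparr>"

context trie begin

text \<open>With everything from unit \<open>L\<close> on being 0, the frame property of the
  compiler turns into a space bound.\<close>

lemma represents_zero:
  assumes rep: "represents m S" and room: "3 * (B + 1) + 8 * card S + 4 \<le> L" and u: "L \<le> u"
  shows "m u f = 0"
proof -
  obtain g where g: "inv g m None (KMr g)" "ce g \<le> B + 1 + 4 * card S"
    using rep unfolding represents_def by blast
  have rg: "roomy g" using room g(2) by (simp add: roomy_def)
  have I: "nodeI g m" "cellI g m" using g(1) by (auto simp: inv_def)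
  note rm = roomyD[OF rg I]
  have "\<forall>u f. ne g \<le> u \<longrightarrow> 3 \<le> f \<longrightarrow> m u f = 0" using I(1) unfolding nodeI_def by blast
  moreover have "\<forall>u f. ce g \<le> u \<longrightarrow> f < 3 \<longrightarrow> m u f = 0" using I(2) unfolding cellI_def by blast
  ultimately show ?thesis using rm u by (cases "f < 3") auto
qed

lemma run:
  assumes wp: "wp w L c Q 0 ((\<lambda>_. 0)(0 := fst args, 1 := snd args)) m" and c: "wf c" "low_stores c"
    and cl: "\<forall>u f. 11 \<le> f \<longrightarrow> m u f = 0" and z: "\<And>u f. L \<le> u \<Longrightarrow> m u f = 0"
  shows "\<exists>R m'. halts w (comp 0 c) args (flat m) \<and> Q (run_time w (comp 0 c) args (flat m)) R m' \<and>
    (\<forall>u f. 11 \<le> f \<longrightarrow> m' u f = 0) \<and> regs (final w (comp 0 c) args (flat m)) 0 = R 0 \<and>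
    mem (final w (comp 0 c) args (flat m)) = flat m' \<and>
    (\<forall>t a. mem (config_at w (comp 0 c) args (flat m) t) a \<noteq> 0 \<longrightarrow> a < 16 * L)"
proof -
  have L: "2 \<le> L" using L1 B2 by simp
  obtain R m' where 1: "halts w (comp 0 c) args (flat m)"
    "Q (run_time w (comp 0 c) args (flat m)) R m' \<and> (\<forall>u f. 11 \<le> f \<longrightarrow> m' u f = m u f)"
    "regs (final w (comp 0 c) args (flat m)) 0 = R 0" "mem (final w (comp 0 c) args (flat m)) = flat m'"
    "\<forall>t. \<forall>a\<ge>16 * L. mem (config_at w (comp 0 c) args (flat m) t) a = flat m a"
    using wp_run[OF wp_low_stores[OF wp c(2)] c(1) L2 L] by blast
  have "flat m a = 0" if "16 * L \<le> a" for a
  proof -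
    have "L \<le> a div 16" using that by linarith
    then show ?thesis unfolding flat_def by (rule z)
  qed
  then have "\<forall>t a. mem (config_at w (comp 0 c) args (flat m) t) a \<noteq> 0 \<longrightarrow> a < 16 * L"
    using 1(5) by (metis not_le)
  moreover have "\<forall>u f. 11 \<le> f \<longrightarrow> m' u f = 0" using 1(2) cl by simp
  ultimately show ?thesis using 1 by blast
qed

text \<open>A common format for the three operations. \<open>big\<close> is demanded only of
  deletions and queries, because the insertions of the initial phase also meet small sets.\<close>

lemma op_run:
  assumes st: "represents m S \<or> S = {} \<and> m = (\<lambda>_ _. 0)" and cl: "\<forall>u f. 11 \<le> f \<longrightarrow> m u f = 0"
    and SS: "\<forall>(l, r)\<in>S. l \<le> r \<and> r < 2 ^ w" and legal: "legal w S p"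
    and big: "(\<forall>l r. p \<noteq> Insert l r) \<Longrightarrow> B + 2 \<le> card S"
    and w2: "w < (B + 1) * (B + 1)" and room: "3 * (B + 1) + 8 * card S + 4 \<le> L"
  defines "P \<equiv> op_prog stabbing_structure p"
  defines "time \<equiv> run_time w P (op_args p) (flat m)"
  shows "\<exists>m'. halts w P (op_args p) (flat m) \<and>
    mem (op_final w stabbing_structure p (flat m)) = flat m' \<and> (\<forall>u f. 11 \<le> f \<longrightarrow> m' u f = 0) \<and>
    represents m' (apply_op p S) \<and>
    (\<forall>t a. mem (config_at w P (op_args p) (flat m) t) a \<noteq> 0 \<longrightarrow> a < 16 * L) \<and>
    (case p of
       Query q \<Rightarrow> m' = m \<and> regs (op_final w stabbing_structure p (flat m)) 0 = stabbing_sum S q \<and>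
         time \<le> 500 * (H + B + 1)
     | _ \<Rightarrow> time + 4000 * (H + B + 1) * pot m' \<le> 4000 * (H + B + 1) * pot m + 60000 * w)"
proof -
  have X: "H + B + 1 \<le> 3 * w" using H_le small(3) B2 by simp
  have z: "m u f = 0" if "L \<le> u" for u f using st represents_zero[OF _ room that] by auto
  show ?thesis
  proof (cases p)
    case p: (Insert l r)
    have "wp w L insert_com (\<lambda>t R m'. t \<le> 5000 * w \<and> represents m' (insert (l, r) S) \<and> pot m' \<le> pot m)
        0 ((\<lambda>_. 0)(0 := fst (l, r), 1 := snd (l, r))) m"
      by (rule wp_insert[OF st _ _ _ w2 _ _ room, where l = l and r = r]) (use legal p in auto)
    from run[OF this com_ok(1,4) cl z] obtain R m' where 1: "halts w P (l, r) (flat m)" "time \<le> 5000 * w"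
      "represents m' (insert (l, r) S)" "pot m' \<le> pot m" "\<forall>u f. 11 \<le> f \<longrightarrow> m' u f = 0"
      "mem (op_final w stabbing_structure p (flat m)) = flat m'"
      "\<forall>t a. mem (config_at w P (l, r) (flat m) t) a \<noteq> 0 \<longrightarrow> a < 16 * L"
      unfolding P_def time_def op_final_def p by (auto simp: stabbing_structure_def)
    have "4000 * (H + B + 1) * pot m' \<le> 4000 * (H + B + 1) * pot m" using 1(4) by (rule mult_left_mono) simp
    then have "time + 4000 * (H + B + 1) * pot m' \<le> 4000 * (H + B + 1) * pot m + 60000 * w" using 1(2) by linarith
    then show ?thesis using 1(1,3,5-7) p by (intro exI[of _ m']) simp
  next
    case p: (Delete l r)
    have c: "B + 2 \<le> card S" using big p by simp
    then have rep: "represents m S" using st by auto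
    have lr: "(l, r) \<in> S" "l < 2 ^ w" "r < 2 ^ w" using legal p SS by auto
    let ?pot = "\<lambda>m. 4000 * (H + B + 1) * pot m"
    have run0: "wp w L delete_com (\<lambda>t R m'. t + ?pot m' \<le> 0 + ?pot m + 20000 * (H + B + 1) \<and> represents m' (S - {(l, r)}))
        0 ((\<lambda>_. 0)(0 := fst (l, r), 1 := snd (l, r))) m"
      by (rule wp_delete[OF rep lr cl _ _ room c]) auto
    have e: "P = comp 0 delete_com" "op_args p = (l, r)" "time = run_time w (comp 0 delete_com) (l, r) (flat m)"
      "op_final w stabbing_structure p (flat m) = final w (comp 0 delete_com) (l, r) (flat m)"
      by (simp_all add: P_def time_def op_final_def p stabbing_structure_def)
    from run[OF run0 com_ok(2,5) cl z, folded e(1,3,4)] obtain R m' where 1: "halts w P (l, r) (flat m)"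
      "time + ?pot m' \<le> 0 + ?pot m + 20000 * (H + B + 1)"
      "represents m' (S - {(l, r)})" "\<forall>u f. 11 \<le> f \<longrightarrow> m' u f = 0"
      "mem (op_final w stabbing_structure p (flat m)) = flat m'"
      "\<forall>t a. mem (config_at w P (l, r) (flat m) t) a \<noteq> 0 \<longrightarrow> a < 16 * L"
      by blast
    have X': "20000 * (H + B + 1) \<le> 60000 * w" using X by simp
    \<comment> \<open>Stated for variables, to keep the arithmetic away from the large
      products.\<close>
    have "a + x \<le> y + v" if "a + x \<le> 0 + y + z" "z \<le> v" for a x y z v :: nat using that by simp
    note this[OF 1(2) X']
    then show ?thesis using 1(1,3-6) p by (intro exI[of _ m']) simp
  next
    case p: (Query q)
    have c: "B + 2 \<le> card S" using big p by simp
    then have rep: "represents m S" using st by auto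
    have q: "q < 2 ^ w" using legal p by simp
    have SS': "\<forall>(l, r)\<in>S. l \<le> r \<and> l < 2 ^ w \<and> r < 2 ^ w" using SS by auto
    have "wp w L query_com (\<lambda>t R m'. t \<le> 500 * (H + B + 1) \<and> R 0 = stabbing_sum S q \<and> m' = m)
        0 ((\<lambda>_. 0)(0 := fst (q, 0), 1 := snd (q, 0))) m"
      by (rule wp_query[OF rep SS' q _ room]) auto
    from run[OF this com_ok(3,6) cl z] have "halts w P (q, 0) (flat m)" "time \<le> 500 * (H + B + 1)"
      "regs (op_final w stabbing_structure p (flat m)) 0 = stabbing_sum S q"
      "mem (op_final w stabbing_structure p (flat m)) = flat m"
      "\<forall>t a. mem (config_at w P (q, 0) (flat m) t) a \<noteq> 0 \<longrightarrow> a < 16 * L"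
      unfolding P_def time_def op_final_def p by (auto simp: stabbing_structure_def)
    then show ?thesis using rep cl p by (intro exI[of _ m]) simp
  qed
qed

end

lemma before_Suc:
  assumes "i < length ops"
  shows "set_before ops (Suc i) = apply_op (ops ! i) (set_before ops i)"
    "memory_before w D ops (Suc i) = mem (op_final w D (ops ! i) (memory_before w D ops i))"
  using assms by (simp_all add: set_before_def memory_before_def take_Suc_conv_app_nth)

lemma set_before_legal:
  assumes "legal_history w ops" "i \<le> length ops"
  shows "finite (set_before ops i) \<and> (\<forall>(l, r)\<in>set_before ops i. l \<le> r \<and> r < 2 ^ w)"
  using assms(2)
proof (induction i)
  case 0 then show ?case by (simp add: set_before_def)
next
  case (Suc i)
  then have "legal w (set_before ops i) (ops ! i)" using assms(1) by (simp add: legal_history_def)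
  then show ?case using Suc before_Suc(1)[of i ops] by (cases "ops ! i") auto
qed

lemma size_before_prefix:
  assumes "legal_history w ops" "\<forall>i<k. \<exists>l r. ops ! i = Insert l r" "k \<le> length ops" "i \<le> k"
  shows "size_before ops i = i"
  using assms(4)
proof (induction i)
  case 0 then show ?case by (simp add: size_before_def set_before_def)
next
  case (Suc i)
  then have i: "i < length ops" "i < k" using assms(3) by auto
  then have "legal w (set_before ops i) (ops ! i)" using assms(1) by (simp add: legal_history_def)
  moreover obtain l r where "ops ! i = Insert l r" using assms(2) i by blast
  moreover have "finite (set_before ops i)" using set_before_legal[OF assms(1)] i by simp
  ultimately show ?case using Suc before_Suc(1)[OF i(1)] by (simp add: size_before_def)
qed

definition updates :: "operation list \<Rightarrow> nat \<Rightarrow> nat" where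
  "updates ops i = (\<Sum>j<i. case ops ! j of Query q \<Rightarrow> 0 | _ \<Rightarrow> 1)"

definition inserts :: "operation list \<Rightarrow> nat \<Rightarrow> nat" where
  "inserts ops i = (\<Sum>j<i. case ops ! j of Insert l r \<Rightarrow> 1 | _ \<Rightarrow> 0)"

text \<open>Insertions minus deletions give the current size, insertions plus deletions the number
  of updates. So updates are at most twice the insertions, which lets insertions pay for all
  deletions.\<close>

lemma updates_inserts:
  assumes "legal_history w ops" "i \<le> length ops"
  shows "updates ops i + size_before ops i = 2 * inserts ops i"
  using assms(2)
proof (induction i)
  case 0 then show ?case by (simp add: size_before_def set_before_def updates_def inserts_def)
next
  case (Suc i)
  then have i: "i < length ops" by simp
  then have "legal w (set_before ops i) (ops ! i)" using assms(1) by (simp add: legal_history_def)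
  note lg = this
  have f: "finite (set_before ops i)" using set_before_legal[OF assms(1), of i] i by simp
  have IH: "updates ops i + size_before ops i = 2 * inserts ops i" using Suc by simp
  show ?case
  proof (cases "ops ! i")
    case (Insert l r)
    then have "size_before ops (Suc i) = Suc (size_before ops i)"
      using lg f by (simp add: size_before_def before_Suc(1)[OF i])
    then show ?thesis using IH Insert by (simp add: updates_def inserts_def)
  next
    case (Delete l r)
    then have "(l, r) \<in> set_before ops i" using lg by simp
    from card_Suc_Diff1[OF f this] have "Suc (size_before ops (Suc i)) = size_before ops i"
      by (simp only: size_before_def before_Suc(1)[OF i] Delete apply_op.simps)
    then show ?thesis using IH Delete by (simp add: updates_def inserts_def)
  next
    case (Query q)
    then have "size_before ops (Suc i) = size_before ops i" by (simp add: size_before_def before_Suc(1)[OF i])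
    then show ?thesis using IH Query by (simp add: updates_def inserts_def)
  qed
qed

text \<open>The two conditions on the size are what a logarithmic word length is good for: tables of
  size \<open>B\<close> are negligible next to the set, and 256 cells per interval can be
  addressed.\<close>

locale history =
  fixes w B H k :: nat and ops :: "operation list"
  assumes num: "2 \<le> B" "B * B \<le> w" "w < (B + 1) * (B + 1)" "1 \<le> H" "2 ^ w \<le> B ^ H" "B ^ (H - 1) < 2 ^ w"
    and leg: "legal_history w ops" and k: "k \<le> length ops" "\<forall>i<k. \<exists>l r. ops ! i = Insert l r"
    and size: "\<And>i. k \<le> i \<Longrightarrow> i \<le> length ops \<Longrightarrow> w + 3 \<le> size_before ops i \<and> 256 * size_before ops i \<le> 2 ^ w"
begin

text \<open>At most 4 cells per interval, counted twice because nodes may take two units per cell;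
  the \<open>+ 4\<close> serves the two cells of an insertion in progress. In the initial phase the
  size after \<open>k\<close> insertions is used.\<close>

definition room :: "nat \<Rightarrow> nat" where
  "room i = 3 * (B + 1) + 8 * size_before ops (max i k) + 4"

lemma B_w: "B < w"
proof -
  have "B < B * B" using num(1) by simp
  then show ?thesis using num(2) by (rule less_le_trans)
qed

text \<open>\<open>16 * 8 = 128\<close> words per interval, and 48 more absorb the reserved units,
  because \<open>B < w\<close> and \<open>w + 3\<close> is at most the size.\<close>

lemma room_le: "i \<le> length ops \<Longrightarrow> 16 * room i \<le> 176 * size_before ops (max i k)"
  using size[of "max i k"] k(1) B_w by (simp add: room_def)

lemma trie_room:
  assumes "i \<le> length ops"
  shows "trie w B H (room i)"
proof
  show "16 * room i \<le> 2 ^ w" using room_le[OF assms] size[of "max i k"] k(1) assms by simp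
qed (use num in \<open>auto simp: room_def\<close>)

text \<open>\<open>represents\<close> does not refer to \<open>L\<close>, so a state carries over
  from one operation to the next although each has its own \<open>room\<close>.\<close>

definition state :: "nat \<Rightarrow> umem \<Rightarrow> bool" where
  "state i m \<longleftrightarrow> memory_before w stabbing_structure ops i = flat m \<and> (\<forall>u f. 11 \<le> f \<longrightarrow> m u f = 0) \<and>
     (trie.represents w B H m (set_before ops i) \<or> set_before ops i = {} \<and> m = (\<lambda>_ _. 0))"

lemma op_at:
  assumes i: "i < length ops" and st: "state i m"
  shows "\<exists>m'. state (Suc i) m' \<and> op_halts w stabbing_structure ops i \<and>
    op_space_le w stabbing_structure ops i (176 * real (size_before ops (max i k))) \<and>
    (case ops ! i of
       Query q \<Rightarrow> m' = m \<and> op_result w stabbing_structure ops i = stabbing_sum (set_before ops i) q \<and>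
         op_time w stabbing_structure ops i \<le> 500 * (H + B + 1)
     | _ \<Rightarrow> op_time w stabbing_structure ops i + 4000 * (H + B + 1) * trie.pot B m' \<le>
         4000 * (H + B + 1) * trie.pot B m + 60000 * w)"
proof -
  let ?S = "set_before ops i" and ?p = "ops ! i"
  interpret trie w B H "room i" using trie_room i by simp
  have M: "memory_before w stabbing_structure ops i = flat m" and cl: "\<forall>u f. 11 \<le> f \<longrightarrow> m u f = 0"
    and rp: "represents m ?S \<or> ?S = {} \<and> m = (\<lambda>_ _. 0)" using st by (auto simp: state_def)
  have SS: "\<forall>(l, r)\<in>?S. l \<le> r \<and> r < 2 ^ w" using set_before_legal[OF leg, of i] i by simp
  have lg: "legal w ?S ?p" using leg i by (simp add: legal_history_def)
  \<comment> \<open>An operation other than an insertion lies beyond the initial phase, where the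
    set is large.\<close>
  have big: "B + 2 \<le> card ?S" if "\<forall>l r. ?p \<noteq> Insert l r"
  proof -
    have "k \<le> i" using k(2) that not_le by blast
    then show ?thesis using size[of i] i B_w by (simp add: size_before_def)
  qed
  have sz: "card ?S \<le> size_before ops (max i k)"
    using size_before_prefix[OF leg k(2,1), of i] size_before_prefix[OF leg k(2,1), of k]
    by (cases "i \<le> k") (auto simp: size_before_def max_def)
  then have rm: "3 * (B + 1) + 8 * card ?S + 4 \<le> room i" by (simp add: room_def)
  obtain m' where 1: "halts w (op_prog stabbing_structure ?p) (op_args ?p) (flat m)"
    "mem (op_final w stabbing_structure ?p (flat m)) = flat m'" "\<forall>u f. 11 \<le> f \<longrightarrow> m' u f = 0"
    "represents m' (apply_op ?p ?S)"
    "\<forall>t a. mem (config_at w (op_prog stabbing_structure ?p) (op_args ?p) (flat m) t) a \<noteq> 0 \<longrightarrow> a < 16 * room i"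
    "case ?p of
       Query q \<Rightarrow> m' = m \<and> regs (op_final w stabbing_structure ?p (flat m)) 0 = stabbing_sum ?S q \<and>
         run_time w (op_prog stabbing_structure ?p) (op_args ?p) (flat m) \<le> 500 * (H + B + 1)
     | _ \<Rightarrow> run_time w (op_prog stabbing_structure ?p) (op_args ?p) (flat m) + 4000 * (H + B + 1) * pot m' \<le>
         4000 * (H + B + 1) * pot m + 60000 * w"
    using op_run[OF rp cl SS lg big num(3) rm] by blast
  have "real a < 176 * real (size_before ops (max i k))" if "a < 16 * room i" for a
  proof -
    have "a < 176 * size_before ops (max i k)" using that room_le[of i] i by simp
    then show ?thesis by linarith
  qed
  then have "op_space_le w stabbing_structure ops i (176 * real (size_before ops (max i k)))"
    using 1(5) unfolding op_space_le_def M by blast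
  moreover have "state (Suc i) m'"
    using 1(2-4) before_Suc[OF i] by (simp add: state_def M)
  ultimately show ?thesis
    using 1(1,6) unfolding op_halts_def op_result_def op_time_def M by blast
qed

text \<open>The amortised bounds telescope; a query leaves the memory and with it the potential
  unchanged.\<close>

lemma state_exists:
  assumes "i \<le> length ops"
  shows "\<exists>m. state i m \<and>
    (\<Sum>j<i. case ops ! j of Query q \<Rightarrow> 0 | _ \<Rightarrow> op_time w stabbing_structure ops j) +
      4000 * (H + B + 1) * trie.pot B m \<le> 60000 * w * updates ops i"
  using assms
proof (induction i)
  case 0
  interpret trie w B H "room 0" using trie_room by simp
  have "state 0 (\<lambda>_ _. 0)" by (simp add: state_def memory_before_def set_before_def flat_def fun_eq_iff)
  moreover have "pot (\<lambda>_ _. 0) = 0" by (simp add: pot_def)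
  ultimately show ?case by (intro exI[of _ "\<lambda>_ _. 0"]) simp
next
  case (Suc i)
  let ?T = "\<Sum>j<i. case ops ! j of Query q \<Rightarrow> 0 | _ \<Rightarrow> op_time w stabbing_structure ops j"
  obtain m where m: "state i m" "?T + 4000 * (H + B + 1) * trie.pot B m \<le> 60000 * w * updates ops i"
    using Suc by auto
  have i: "i < length ops" using Suc.prems by simp
  define time where "time = op_time w stabbing_structure ops i"
  obtain m' where m': "state (Suc i) m'" "case ops ! i of
       Query q \<Rightarrow> m' = m \<and> op_result w stabbing_structure ops i = stabbing_sum (set_before ops i) q \<and>
         time \<le> 500 * (H + B + 1)
     | _ \<Rightarrow> time + 4000 * (H + B + 1) * trie.pot B m' \<le> 4000 * (H + B + 1) * trie.pot B m + 60000 * w"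
    using op_at[OF i m(1), folded time_def] by blast
  define a a' v where "a = 4000 * (H + B + 1) * trie.pot B m" and "a' = 4000 * (H + B + 1) * trie.pot B m'"
    and "v = 60000 * w"
  have T: "?T + a \<le> v * updates ops i" using m(2) unfolding a_def v_def .
  have "(\<Sum>j<Suc i. case ops ! j of Query q \<Rightarrow> 0 | _ \<Rightarrow> op_time w stabbing_structure ops j) + a' \<le>
      v * updates ops (Suc i)"
  proof (cases "ops ! i")
    case (Insert l r)
    have "time + a' \<le> a + v" using m'(2) unfolding Insert operation.case a_def a'_def v_def .
    then show ?thesis using T Insert by (simp add: updates_def time_def)
  next
    case (Delete l r)
    have "time + a' \<le> a + v" using m'(2) unfolding Delete operation.case a_def a'_def v_def .
    then show ?thesis using T Delete by (simp add: updates_def time_def)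
  next
    case (Query q)
    have "m' = m" using m'(2) unfolding Query operation.case by blast
    then show ?thesis using T Query by (simp add: updates_def a_def a'_def)
  qed
  then show ?case using m'(1) unfolding a'_def v_def by blast
qed

lemma query_at:
  assumes "i < length ops" "state i m" and q: "ops ! i = Query q"
  shows "op_result w stabbing_structure ops i = stabbing_sum (set_before ops i) q \<and>
    op_time w stabbing_structure ops i \<le> 500 * (H + B + 1)"
  using op_at[OF assms(1,2)] unfolding q operation.case
  by (elim exE conjE) (intro conjI)

lemma update_time_le: "update_time w stabbing_structure ops \<le> 120000 * w * inserts ops (length ops)"
proof -
  have "update_time w stabbing_structure ops \<le> 60000 * w * updates ops (length ops)"
  proof -
    obtain m where "update_time w stabbing_structure ops + 4000 * (H + B + 1) * trie.pot B m \<le>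
        60000 * w * updates ops (length ops)"
      using state_exists[of "length ops"] unfolding update_time_def by blast
    then show ?thesis by (rule add_leD1)
  qed
  also have "\<dots> \<le> 60000 * w * (2 * inserts ops (length ops))"
    using updates_inserts[OF leg, of "length ops"] by (intro mult_left_mono) auto
  finally show ?thesis by simp
qed

end

section \<open>Choice of the parameters and asymptotic estimates\<close>

text \<open>\<open>B\<close> is the integer square root of \<open>w\<close>, and \<open>H\<close>
  the least exponent for which \<open>B ^ H\<close> covers all words.\<close>

lemma trie_parameters:
  fixes w :: nat
  assumes "4 \<le> w"
  obtains B H :: nat where "2 \<le> B" "B * B \<le> w" "w < (B + 1) * (B + 1)" "1 \<le> H" "2 ^ w \<le> B ^ H" "B ^ (H - 1) < 2 ^ w"
proof -
  define B where "B = (LEAST b. w < (b + 1) * (b + 1))"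
  have "w < (w + 1) * (w + 1)" by simp
  then have B1: "w < (B + 1) * (B + 1)" unfolding B_def by (rule LeastI)
  have "B * B \<le> w"
  proof (cases B)
    case (Suc b)
    then have "\<not> w < (b + 1) * (b + 1)" unfolding B_def by (intro not_less_Least) simp
    then show ?thesis using Suc by simp
  qed simp
  note B = this B1
  have B2: "2 \<le> B"
  proof (rule ccontr)
    assume "\<not> 2 \<le> B"
    then have "(B + 1) * (B + 1) \<le> 2 * 2" by (intro mult_mono) auto
    then show False using B(2) assms by simp
  qed
  define H where "H = (LEAST h. (2::nat) ^ w \<le> B ^ h)"
  have "(2::nat) ^ w \<le> B ^ w" using B2 by (intro power_mono) auto
  then have H: "2 ^ w \<le> B ^ H" unfolding H_def by (rule LeastI)
  have "H \<noteq> 0"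
  proof
    assume "H = 0"
    then have "(2::nat) ^ w \<le> 1" using H by simp
    moreover have "w < 2 ^ w" by (rule less_exp)
    ultimately show False using assms by linarith
  qed
  moreover then have "\<not> 2 ^ w \<le> B ^ (H - 1)" unfolding H_def by (intro not_less_Least) (simp add: H_def[symmetric])
  ultimately show ?thesis using that[OF B2 B _ H] by simp
qed

text \<open>The height is at most \<open>1 + w / log 2 B\<close>, and \<open>B\<close> is about the square root of \<open>w\<close>.\<close>

lemma trie_depth:
  fixes w B H :: nat
  assumes "2 \<le> B" "B * B \<le> w" "w < (B + 1) * (B + 1)" "1 \<le> H" "B ^ (H - 1) < 2 ^ w"
  shows "real (H + B + 1) \<le> 8 * (real w / log 2 (real w))"
proof -
  have B0: "0 < real B" "1 < real B" using assms(1) by auto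
  have w4: "4 \<le> w" using mult_le_mono[OF assms(1,1)] assms(2) by simp
  have lw: "0 < log 2 (real w)" using w4 by simp
  \<comment> \<open>Then \<open>log 2 B\<close> is at least a quarter of \<open>log 2 w\<close>,
    which bounds the height.\<close>
  have "w < B * B * (B * B)"
  proof -
    have "B + 1 \<le> B * B" using assms(1) mult_le_mono1[OF assms(1), of B] by linarith
    then have "(B + 1) * (B + 1) \<le> B * B * (B * B)" by (intro mult_le_mono)
    then show ?thesis using assms(3) by simp
  qed
  then have "real w \<le> real (B ^ 4)" by (simp add: power4_eq_xxxx mult.assoc flip: of_nat_mult)
  then have "log 2 (real w) \<le> log 2 (real (B ^ 4))" using w4 B0 by (subst log_le_cancel_iff) auto
  also have "\<dots> = 4 * log 2 (real B)" using B0 by (simp add: log_nat_power)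
  finally have lB: "log 2 (real w) \<le> 4 * log 2 (real B)" .
  have "real B ^ (H - 1) \<le> 2 ^ w" using assms(5) by (metis less_imp_le of_nat_le_iff of_nat_numeral of_nat_power)
  then have "log 2 (real B ^ (H - 1)) \<le> log 2 (2 ^ w)" using B0 by (subst log_le_cancel_iff) auto
  then have "real (H - 1) * log 2 (real B) \<le> real w" using B0 by (simp add: log_nat_power)
  moreover have "real (H - 1) * log 2 (real w) \<le> real (H - 1) * (4 * log 2 (real B))"
    using lB by (intro mult_left_mono) auto
  ultimately have h: "real (H - 1) * log 2 (real w) \<le> 4 * real w" by linarith
  \<comment> \<open>\<open>B\<close> is at most the square root of \<open>w\<close>, and the
    logarithm of \<open>w\<close> is at most twice that root.\<close>
  have "real B * log 2 (real w) \<le> 2 * real w"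
  proof -
    have sq: "0 < sqrt (real w)" using w4 by simp
    have "sqrt (real w) \<le> 2 powr sqrt (real w)"
    proof -
      \<comment> \<open>With \<open>x = sqrt w\<close>: \<open>(1 + x / 4)\<^sup>2 - x\<close> is
        the square of \<open>1 - x / 4\<close>, and
        \<open>1 + x / 4 \<le> 2 powr (x / 2)\<close>.\<close>
      have "(sqrt (real w) / 2) * 2 \<le> (2 powr (sqrt (real w) / 2)) ^ 2"
      proof -
        have "1 + sqrt (real w) / 2 * ln 2 \<le> exp (sqrt (real w) / 2 * ln 2)" by (rule exp_ge_add_one_self)
        then have a: "1 + sqrt (real w) / 2 * ln 2 \<le> 2 powr (sqrt (real w) / 2)" by (simp add: powr_def)
        have "(1 / 2 :: real) \<le> ln 2" using exp_half_le2 by (subst ln_ge_iff) auto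
        then have "sqrt (real w) / 4 \<le> sqrt (real w) / 2 * ln 2"
          using mult_left_mono[of "1 / 2" "ln 2" "sqrt (real w) / 2"] sq by simp
        then have b: "1 + sqrt (real w) / 4 \<le> 2 powr (sqrt (real w) / 2)" using a by linarith
        then have A: "(1 + sqrt (real w) / 4) ^ 2 \<le> (2 powr (sqrt (real w) / 2)) ^ 2" using sq by (intro power_mono) auto
        have B: "sqrt (real w) \<le> (1 + sqrt (real w) / 4) ^ 2"
          using zero_le_power2[of "1 - sqrt (real w) / 4"] by (simp add: power2_eq_square algebra_simps)
        have E: "sqrt (real w) / 2 * 2 = sqrt (real w)" by simp
        show ?thesis unfolding E by (rule order_trans[OF B A])
      qed
      then show ?thesis by (simp add: powr_power)
    qed
    then have "log 2 (sqrt (real w)) \<le> log 2 (2 powr sqrt (real w))" using sq by (subst log_le_cancel_iff) auto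
    then have "log 2 (sqrt (real w)) \<le> sqrt (real w)" by simp
    moreover have "log 2 (real w) = 2 * log 2 (sqrt (real w))"
      using log_nat_power[of "sqrt (real w)" 2 2] sq by simp
    ultimately have l: "log 2 (real w) \<le> 2 * sqrt (real w)" by simp
    have "real B * real B \<le> real w" using assms(2) by (simp flip: of_nat_mult)
    then have "real B \<le> sqrt (real w)" by (intro real_le_rsqrt) (simp add: power2_eq_square)
    then have "real B * log 2 (real w) \<le> sqrt (real w) * (2 * sqrt (real w))"
      using l lw by (intro mult_mono) auto
    also have "\<dots> = 2 * real w" by simp
    finally show ?thesis .
  qed
  \<comment> \<open>As \<open>2 \<le> B\<close>. The factor 8 consists of 4 for \<open>H - 1\<close>
    and of 2 for each of the two copies of \<open>B\<close>.\<close>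
  moreover have "real (H + B + 1) \<le> real (H - 1) + 2 * real B" using assms(1,4) by simp
  then have "real (H + B + 1) * log 2 (real w) \<le> (real (H - 1) + 2 * real B) * log 2 (real w)"
    using lw by (intro mult_right_mono) auto
  ultimately have "real (H + B + 1) * log 2 (real w) \<le> 8 * real w" using h by (simp add: algebra_simps)
  then show ?thesis using lw by (simp add: field_simps)
qed

text \<open>Pair \<open>i\<close> with \<open>k - 1 - i\<close>: the product of the two arguments of
  the logarithm is at least \<open>k\<close>.\<close>

lemma sum_log_ge:
  fixes k :: nat
  assumes "0 < k"
  shows "real k * log 2 (real k) \<le> 2 * (\<Sum>i<k. log 2 (real i + 2))"
proof -
  have "(\<Sum>i<k. log 2 (real i + 2)) = (\<Sum>i<k. log 2 (real (k - Suc i) + 2))"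
    by (rule sum.nat_diff_reindex[symmetric])
  then have "2 * (\<Sum>i<k. log 2 (real i + 2)) = (\<Sum>i<k. log 2 (real i + 2) + log 2 (real (k - Suc i) + 2))"
    by (simp add: sum.distrib)
  moreover have "(\<Sum>i<k. log 2 (real k)) \<le> (\<Sum>i<k. log 2 (real i + 2) + log 2 (real (k - Suc i) + 2))"
  proof (rule sum_mono)
    fix i assume "i \<in> {..<k}"
    then have k: "real k = real i + real (k - Suc i) + 1" by simp
    have "log 2 (real k) \<le> log 2 ((real i + 2) * (real (k - Suc i) + 2))"
      using assms unfolding k by (subst log_le_cancel_iff) (auto simp: algebra_simps intro: add_pos_nonneg)
    also have "\<dots> = log 2 (real i + 2) + log 2 (real (k - Suc i) + 2)"
      by (intro log_mult_pos) auto
    finally show "log 2 (real k) \<le> log 2 (real i + 2) + log 2 (real (k - Suc i) + 2)" .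
  qed
  ultimately show ?thesis by simp
qed

text \<open>In the initial phase an insertion may cost about \<open>w\<close> while its budget is
  the logarithm of a small size. Summed over the phase, the budgets still reach half of
  \<open>k * log 2 k\<close>; afterwards each insertion covers \<open>w\<close> by itself.\<close>

lemma budget_ge:
  fixes c :: real and w :: nat
  assumes c: "0 < c" and leg: "legal_history w ops" and k: "k \<le> length ops" "\<forall>i<k. \<exists>l r. ops ! i = Insert l r" "0 < k"
    and wc: "\<And>i. k \<le> i \<Longrightarrow> i \<le> length ops \<Longrightarrow> 0 < size_before ops i \<and> real w \<le> c * log 2 (real (size_before ops i))"
  shows "real w * real (inserts ops (length ops)) \<le>
    2 * c * (\<Sum>i<length ops. case ops ! i of Insert l r \<Rightarrow> log 2 (real (size_before ops i) + 2) | _ \<Rightarrow> 0)"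
proof -
  let ?F = "\<lambda>i. case ops ! i of Insert l r \<Rightarrow> log 2 (real (size_before ops i) + 2) | _ \<Rightarrow> 0"
  let ?G = "\<lambda>i. case ops ! i of Insert l r \<Rightarrow> 1 | _ \<Rightarrow> (0::real)"
  have un: "{..<length ops} = {..<k} \<union> {k..<length ops}" using k(1) by auto
  have split: "(\<Sum>i<length ops. f i) = (\<Sum>i<k. f i) + (\<Sum>i\<in>{k..<length ops}. f i)" for f :: "nat \<Rightarrow> real"
    unfolding un by (rule sum.union_disjoint) auto
  have s: "size_before ops i = i" if "i \<le> k" for i by (rule size_before_prefix[OF leg k(2,1) that])
  have F1: "(\<Sum>i<k. ?F i) = (\<Sum>i<k. log 2 (real i + 2))"
  proof (rule sum.cong)
    fix i assume "i \<in> {..<k}"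
    moreover then obtain l r where "ops ! i = Insert l r" using k(2) by auto
    ultimately show "?F i = log 2 (real i + 2)" using s[of i] by simp
  qed simp
  have G1: "(\<Sum>i<k. ?G i) = real k"
  proof -
    have "(\<Sum>i<k. ?G i) = (\<Sum>i<k. 1)"
    proof (rule sum.cong)
      fix i assume "i \<in> {..<k}"
      then obtain l r where "ops ! i = Insert l r" using k(2) by auto
      then show "?G i = 1" by simp
    qed simp
    then show ?thesis by simp
  qed
  have "real w \<le> c * log 2 (real k)" using wc[of k] s[of k] k(1) by simp
  then have "real w * real k \<le> c * log 2 (real k) * real k" by (intro mult_right_mono) auto
  also have "\<dots> = c * (real k * log 2 (real k))" by (simp add: algebra_simps)
  also have "\<dots> \<le> c * (2 * (\<Sum>i<k. ?F i))"
    unfolding F1 using c by (intro mult_left_mono sum_log_ge k(3)) auto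
  finally have A: "real w * (\<Sum>i<k. ?G i) \<le> 2 * c * (\<Sum>i<k. ?F i)" unfolding G1 by (simp add: algebra_simps)
  have "(\<Sum>i\<in>{k..<length ops}. real w * ?G i) \<le> (\<Sum>i\<in>{k..<length ops}. 2 * c * ?F i)"
  proof (rule sum_mono)
    fix i assume i: "i \<in> {k..<length ops}"
    then have p: "0 < size_before ops i" "real w \<le> c * log 2 (real (size_before ops i))" using wc[of i] by auto
    have "log 2 (real (size_before ops i)) \<le> log 2 (real (size_before ops i) + 2)" using p(1) by simp
    moreover have "0 \<le> log 2 (real (size_before ops i))" using p(1) by simp
    ultimately have "log 2 (real (size_before ops i)) \<le> 2 * log 2 (real (size_before ops i) + 2)" by linarith
    then have "c * log 2 (real (size_before ops i)) \<le> c * (2 * log 2 (real (size_before ops i) + 2))"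
      using c by (intro mult_left_mono) auto
    then show "real w * ?G i \<le> 2 * c * ?F i" using p(2) by (simp add: algebra_simps split: operation.split)
  qed
  then have "real w * (\<Sum>i\<in>{k..<length ops}. ?G i) \<le> 2 * c * (\<Sum>i\<in>{k..<length ops}. ?F i)"
    by (simp only: sum_distrib_left)
  moreover have "real (inserts ops (length ops)) = (\<Sum>i<length ops. ?G i)"
    unfolding inserts_def of_nat_sum by (rule sum.cong) (auto split: operation.split)
  ultimately show ?thesis using A unfolding split by (simp add: distrib_left)
qed

text \<open>\<open>w \<le> c * log 2 n\<close> means \<open>n \<ge> 2 powr (w / c)\<close>, which is
  at least \<open>w + 3\<close> by the choice of \<open>b\<close>; and \<open>8 \<le> b\<close>
  yields the factor \<open>256 = 2 ^ 8\<close>.\<close>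

lemma log_word_length_bounds:
  fixes b c :: real
  assumes b: "8 \<le> b" "\<forall>x\<ge>b. x + 3 \<le> 2 powr (x / c)" and c: "0 < c" and lw: "log_word_length b c n w"
  shows "b \<le> real w" "w + 3 \<le> n" "256 * n \<le> 2 ^ w" "log 2 (real n) \<le> real w" "real w \<le> c * log 2 (real n)"
proof -
  have lw': "log 2 (real n) + b \<le> real w" "real w \<le> c * log 2 (real n)"
    using lw by (auto simp: log_word_length_def)
  \<comment> \<open>For \<open>n = 0\<close> the logarithm is 0 by convention, so \<open>w\<close>
    would be at least \<open>b\<close> and at most 0.\<close>
  have n: "0 < n"
  proof (rule ccontr)
    assume "\<not> 0 < n"
    then have "log 2 (real n) = 0" by (simp add: log_def)
    then show False using lw' b(1) by simp
  qed
  then have l0: "0 \<le> log 2 (real n)" by simp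
  then show bw: "b \<le> real w" "log 2 (real n) \<le> real w" "real w \<le> c * log 2 (real n)" using lw' b(1) by auto
  have "real w / c \<le> log 2 (real n)" using lw'(2) c by (simp add: field_simps)
  then have "2 powr (real w / c) \<le> 2 powr (log 2 (real n))" by simp
  then have "real w + 3 \<le> real n" using b(2)[rule_format, OF bw(1)] n by simp
  then show "w + 3 \<le> n" by linarith
  have "2 powr (log 2 (real n) + 8) \<le> 2 powr real w" using lw'(1) b(1) by simp
  moreover have "2 powr (log 2 (real n) + 8) = real (256 * n)" using n by (simp add: powr_add)
  moreover have "2 powr real w = real (2 ^ w)" by (simp add: powr_realpow)
  ultimately have "real (256 * n) \<le> real (2 ^ w)" by argo
  then show "256 * n \<le> 2 ^ w" by (simp only: of_nat_le_iff)
qed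

text \<open>The upper bound on \<open>w\<close> serves the numerator, the lower bound the
  denominator; \<open>3 \<le> n\<close> makes the iterated logarithm positive.\<close>

lemma query_bound:
  fixes n w :: nat and c :: real
  assumes c: "0 < c" and n: "3 \<le> n" and w: "log 2 (real n) \<le> real w" "real w \<le> c * log 2 (real n)"
  shows "real w / log 2 (real w) \<le> c * (log 2 (real n) / log 2 (log 2 (real n)))"
proof -
  define l where "l = log 2 (real n)"
  have "log 2 2 < log 2 (real n)" using n by (subst log_less_cancel_iff) auto
  then have l: "1 < l" by (simp add: l_def)
  then have "0 < log 2 l" "log 2 l \<le> log 2 (real w)" using w(1) by (auto simp: l_def)
  then have "real w / log 2 (real w) \<le> (c * l) / log 2 l"
    using w(2) l by (intro frac_le) (auto simp: l_def)
  then show ?thesis by (simp add: l_def)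
qed

theorem theorem3:
  fixes c :: real
  assumes "c > 0"
  shows "\<exists>(D :: data_structure) (b :: real)
      (space :: nat \<Rightarrow> real) (tq :: nat \<Rightarrow> real) (ti :: nat \<Rightarrow> real) (td :: nat \<Rightarrow> real).
    space \<in> O(\<lambda>n. real n) \<and>
    tq \<in> O(\<lambda>n. log 2 (real n) / log 2 (log 2 (real n))) \<and>
    ti \<in> O(\<lambda>n. log 2 (real n)) \<and>
    td \<in> O(\<lambda>n. log 2 (real n) / log 2 (log 2 (real n))) \<and>
    (\<forall>w k ops. admissible b c w k ops \<longrightarrow>
       (\<forall>i < length ops. op_halts w D ops i \<and>
          op_space_le w D ops i (space (size_before ops (max i k)))) \<and>
       (\<forall>i q. i < length ops \<longrightarrow> ops ! i = Query q \<longrightarrow>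
          op_result w D ops i = stabbing_sum (set_before ops i) q \<and>
          real (op_time w D ops i) \<le> tq (size_before ops i)) \<and>
       real (update_time w D ops) \<le> update_budget ti td ops)"
proof -
  \<comment> \<open>The threshold \<open>b\<close> depends on \<open>c\<close>: beyond it, a set
    whose logarithm is proportional to \<open>w\<close> is larger than \<open>w\<close>
    itself.\<close>
  have "eventually (\<lambda>x::real. x + 3 \<le> 2 powr (x / c)) at_top" using assms by real_asymp
  then obtain b0 where b0: "\<And>x. b0 \<le> x \<Longrightarrow> x + 3 \<le> 2 powr (x / c)" unfolding eventually_at_top_linorder by blast
  define b where "b = max b0 8"
  have b: "8 \<le> b" "\<forall>x\<ge>b. x + 3 \<le> 2 powr (x / c)" using b0 by (auto simp: b_def)
  \<comment> \<open>\<open>120000 * 2 * c\<close>, from \<open>update_time_le\<close> and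
    \<open>budget_ge\<close>. The summand 2 keeps the budget positive for the empty set.\<close>
  define ti where "ti = (\<lambda>n::nat. 240000 * c * log 2 (real n + 2))"
  \<comment> \<open>\<open>500 * 8 * c\<close>, from the cost of a query, \<open>trie_depth\<close>
    and \<open>query_bound\<close>.\<close>
  define tq where "tq = (\<lambda>n::nat. 4000 * c * (log 2 (real n) / log 2 (log 2 (real n))))"
  \<comment> \<open>Deletions receive the budget 0: their entire cost is charged to
    insertions.\<close>
  have main: "(\<forall>i < length ops. op_halts w stabbing_structure ops i \<and>
          op_space_le w stabbing_structure ops i (176 * real (size_before ops (max i k)))) \<and>
       (\<forall>i q. i < length ops \<longrightarrow> ops ! i = Query q \<longrightarrow>
          op_result w stabbing_structure ops i = stabbing_sum (set_before ops i) q \<and>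
          real (op_time w stabbing_structure ops i) \<le> tq (size_before ops i)) \<and>
       real (update_time w stabbing_structure ops) \<le> update_budget ti (\<lambda>_. 0) ops"
    if adm: "admissible b c w k ops" for w k ops
  proof -
    note leg = adm[unfolded admissible_def, THEN conjunct1]
    have k: "k \<le> length ops" "\<forall>i<k. \<exists>l r. ops ! i = Insert l r" using adm by (auto simp: admissible_def)
    have lw: "log_word_length b c (size_before ops i) w" if "k \<le> i" "i \<le> length ops" for i
      using adm that by (auto simp: admissible_def)
    note bd = log_word_length_bounds[OF b assms lw]
    have "4 \<le> w" using bd(1)[of k] b(1) k(1) by simp
    then obtain B H where num: "2 \<le> B" "B * B \<le> w" "w < (B + 1) * (B + 1)" "1 \<le> H" "2 ^ w \<le> B ^ H" "B ^ (H - 1) < 2 ^ w"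
      by (rule trie_parameters)
    interpret history w B H k ops
      by unfold_locales (use num leg k bd(2,3) in auto)
    have 1: "op_halts w stabbing_structure ops i \<and>
          op_space_le w stabbing_structure ops i (176 * real (size_before ops (max i k)))"
      if i: "i < length ops" for i
    proof -
      obtain m where "state i m" using state_exists[of i] i by auto
      from op_at[OF i this] show ?thesis by blast
    qed
    have 2: "op_result w stabbing_structure ops i = stabbing_sum (set_before ops i) q \<and>
          real (op_time w stabbing_structure ops i) \<le> tq (size_before ops i)"
      if i: "i < length ops" "ops ! i = Query q" for i q
    proof -
      obtain m where "state i m" using state_exists[of i] i by auto
      note r = query_at[OF i(1) this i(2), THEN conjunct1] query_at[OF i(1) this i(2), THEN conjunct2]
      have ki: "k \<le> i"
      proof (rule ccontr)
        assume "\<not> k \<le> i"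
        then have "i < k" by simp
        then obtain l r where "ops ! i = Insert l r" using k(2) by blast
        then show False using i(2) by simp
      qed
      note bi = bd(2,4,5)[OF ki less_imp_le[OF i(1)]]
      have "real (op_time w stabbing_structure ops i) \<le> 500 * real (H + B + 1)" using r(2) by linarith
      also have "\<dots> \<le> 500 * (8 * (real w / log 2 (real w)))"
        by (intro mult_left_mono trie_depth num) auto
      also have "\<dots> \<le> 500 * (8 * (c * (log 2 (real (size_before ops i)) / log 2 (log 2 (real (size_before ops i))))))"
        by (intro mult_left_mono query_bound[OF assms]) (use bi in auto)
      also have "\<dots> = tq (size_before ops i)" by (simp add: tq_def mult.assoc)
      finally show ?thesis using r(1) by simp
    qed
    have s: "size_before ops k = k" by (rule size_before_prefix[OF leg k(2,1)]) simp
    have k0: "0 < k" using bd(2)[of k] k(1) s by simp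
    have "real (update_time w stabbing_structure ops) \<le> real (120000 * w * inserts ops (length ops))"
      using update_time_le of_nat_le_iff by blast
    also have "\<dots> = 120000 * (real w * real (inserts ops (length ops)))" by simp
    also have "\<dots> \<le> 120000 * (2 * c * (\<Sum>i<length ops. case ops ! i of Insert l r \<Rightarrow>
        log 2 (real (size_before ops i) + 2) | _ \<Rightarrow> 0))"
    proof (intro mult_left_mono budget_ge[OF assms leg k k0])
      fix i assume "k \<le> i" "i \<le> length ops"
      then show "0 < size_before ops i \<and> real w \<le> c * log 2 (real (size_before ops i))"
        using bd(2,5)[of i] by auto
    qed auto
    also have "\<dots> = update_budget ti (\<lambda>_. 0) ops"
      unfolding update_budget_def sum_distrib_left
      by (rule sum.cong) (auto simp: ti_def mult.assoc split: operation.split)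
    finally show ?thesis using 1 2 by blast
  qed
  have "ti \<in> O(\<lambda>n. log 2 (real n))" unfolding ti_def using assms by real_asymp
  moreover have "tq \<in> O(\<lambda>n. log 2 (real n) / log 2 (log 2 (real n)))" unfolding tq_def
    by (intro bigoI[where c = "\<bar>4000 * c\<bar>"] always_eventually allI) (simp only: real_norm_def abs_mult order_refl)
  moreover have "(\<lambda>n. 176 * real n) \<in> O(\<lambda>n. real n)" by (rule bigoI[where c = 176]) simp
  moreover have "(\<lambda>_. 0) \<in> O(\<lambda>n. log 2 (real n) / log 2 (log 2 (real n)))" by (rule bigoI[where c = 0]) simp
  ultimately show ?thesis using main by blast
qed

end
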